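(* Let $1\leq l\leq n-1$, $\lambda\in I_l$, $\lambda'\in I_n$, and let $N=V(l,\lambda)\otimes V(n,\lambda')$, a $D(H_{\mathcal D})$-module. (1) If $\lambda'\in I_n'$, then $N\cong\bigoplus_{s=0}^{l-1}V(n,\phi^s\lambda\lambda')$. (2) If $\lambda'\in I_n''$, then $N\cong\bigoplus_{s=c(l-1)}^{l-1}P(n+l-1-2s,\phi^s\lambda\lambda')$.
   Context: Let $\Bbbk$ be an algebraically closed field of characteristic $0$; all modules are finite-dimensional left modules. $\mathcal D=(G,\chi,a,\alpha)$ is a group datum with $G$ abelian: $G$ is a finite abelian group, $\chi\in\Gamma:=\mathrm{Hom}(G,\Bbbk^\times)$, $a\in G$, $\alpha\in\Bbbk$, and, with $\rho=\chi(a)$ of order $n\geq 2$, either $\chi^n=1$ or $\alpha(a^n-1)=0$. $\mathcal D$ is of nilpotent type if $\alpha(a^n-1)=0$, and of non-nilpotent type if $\alpha(a^n-1)\neq0$ and $\chi^n=1$ (then $\alpha=1$ is assumed). Put $(i)_\rho=1+\rho+\cdots+\rho^{i-1}$, $(i)!_\rho=(i)_\rho\cdots(1)_\rho$, $(0)!_\rho=1$. The Drinfeld double $D(H_{\mathcal D})$ is the Hopf algebra generated as an algebra by the groups $G,\Gamma$ and elements $x,\xi$, with the group relations of $G$ and $\Gamma$ and: $x^n=\alpha(a^n-1)$, $xg=\chi(g)gx$, $\xi^n=0$, $\xi\gamma=\gamma(a)\gamma\xi$, $g\gamma=\gamma g$, $\xi g=\chi^{-1}(g)g\xi$, $x\xi-\xi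 x=a-\chi$, and $\gamma(a)x\gamma=\gamma x$ in the nilpotent case, $\gamma(a)x\gamma=\gamma x+\frac{\gamma^n(a)-1}{(n-1)!_\rho}\gamma(\rho a-\chi)\xi^{n-1}$ in the non-nilpotent case ($g\in G,\gamma\in\Gamma$). Comultiplication: $\Delta(g)=g\otimes g$, $\Delta(x)=x\otimes a+1\otimes x$, $\Delta(\xi)=\xi\otimes1+\chi\otimes\xi$, and $\Delta(\gamma)=\gamma\otimes\gamma$ in the nilpotent case, $\Delta(\gamma)=\gamma\otimes\gamma+(\gamma^n(a)-1)\sum_{p+r=n,\,p,r\geq1}\frac{1}{(p)!_\rho(r)!_\rho}\gamma\chi^p\xi^r\otimes\gamma\xi^p$ in the non-nilpotent case. Tensor products of modules are over $\Bbbk$ with action via $\Delta$. $\Lambda$ is the group of characters $G\times\Gamma\to\Bbbk^\times$; $\phi\in\Lambda$ is $\phi(g\gamma)=\chi^{-1}(g)\gamma(a)$. For $1\leq l\leq n-1$, $I_l=\{\lambda\in\Lambda:\lambda(a\chi^{-1})=\rho^{l-1}\}$; $I_n''=\{\lambda\in\Lambda:\lambda(a\chi^{-1})=\rho^{n-1}\}$; $I_n'=\{\lambda\in\Lambda:\lambda(a\chi^{-1})\neq\rho^k\text{ for all }0\leq k\leq n-1\}$; $I_n=I_n'\cup I_n''$. For $1\leq l\leq n$, $\lambda\in I_l$, let $\alpha_i(l,\lambda)=(i)_\rho(\lambda(\chi)-\lambda(a)\rho^{1-i})$. $V(l,\lambda)$ is the simple module with basis $v_0,\dots,v_{l-1}$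 and $(g\gamma)v_i=(\phi^i\lambda)(g\gamma)v_i$; $xv_i=v_{i+1}$ for $i\leq l-2$; $\xi v_0=0$, $\xi v_i=\alpha_i(l,\lambda)v_{i-1}$ for $i\geq1$; $xv_{l-1}=0$ if $l<n$ or $\mathcal D$ is nilpotent, and $xv_{n-1}=(\lambda(a)^n-1)v_0$ if $l=n$ and $\mathcal D$ is non-nilpotent. These form a complete set of representatives of simple modules. For $1\leq l\leq n-1$, $P(l,\lambda)$ is the projective cover of $V(l,\lambda)$ (of dimension $2n$); $V(n,\lambda)$ is projective and $P(n,\lambda):=V(n,\lambda)$ for $\lambda\in I_n$. For an integer $t$, $c(t)=\lfloor (t+1)/2\rfloor$. *)

theory Defs
  imports
    "Jordan_Normal_Form.Matrix_Kernel"
    "HOL-Algebra.QuotRing"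
    "HOL-Algebra.Multiplicative_Group"
    "HOL-Library.Poly_Mapping"
    "HOL-Library.Product_Plus"
begin

section \<open>Finite-dimensional modules over an algebra\<close>

text \<open>
  An algebra over the field \<open>'k\<close> is a ring together with a scalar multiplication, packaged in the
  HOL-Algebra record \<^type>\<open>module\<close>.  A finite-dimensional left module is given in coordinates: its
  underlying space is the space of column vectors \<^term>\<open>carrier_vec d\<close>, and an element of the
  algebra acts by a \<open>d \<times> d\<close> matrix.  Every finite-dimensional module is isomorphic to one of
  this form, and a linear map between two of them is a matrix.
\<close>

record ('a, 'k) fdmod =
  mdim :: nat
  mact :: "'a \<Rightarrow> 'k mat"

definition fd_module :: "('k::field, 'a, 'm) module_scheme \<Rightarrow> ('a, 'k) fdmod \<Rightarrow> bool" where
  "fd_module A M \<longleftrightarrow>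
     mact M \<in> Ring.ring_hom A (ring_mat TYPE('k) (mdim M) ()) \<and>
     (\<forall>c. \<forall>x\<in>carrier A. mact M (c \<odot>\<^bsub>A\<^esub> x) = c \<cdot>\<^sub>m mact M x)"

definition fd_hom ::
  "('k::field, 'a, 'm) module_scheme \<Rightarrow> ('a, 'k) fdmod \<Rightarrow> ('a, 'k) fdmod \<Rightarrow> 'k mat set" where
  "fd_hom A M N =
     {T \<in> carrier_mat (mdim N) (mdim M). \<forall>x\<in>carrier A. T * mact M x = mact N x * T}"

definition surj_mat :: "'k::field mat \<Rightarrow> bool" where
  "surj_mat T \<longleftrightarrow> (\<lambda>v. T *\<^sub>v v) ` carrier_vec (dim_col T) = carrier_vec (dim_row T)"

definition fd_iso ::
  "('k::field, 'a, 'm) module_scheme \<Rightarrow> ('a, 'k) fdmod \<Rightarrow> ('a, 'k) fdmod \<Rightarrow> bool" where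
  "fd_iso A M N \<longleftrightarrow>
     fd_module A M \<and> fd_module A N \<and> (\<exists>T \<in> fd_hom A M N. invertible_mat T)"

definition fd_direct_sum :: "('a, 'k::field) fdmod list \<Rightarrow> ('a, 'k) fdmod" where
  "fd_direct_sum Ms =
     \<lparr>mdim = (\<Sum>M\<leftarrow>Ms. mdim M), mact = (\<lambda>x. diag_block_mat (map (\<lambda>M. mact M x) Ms))\<rparr>"

definition fd_submodule ::
  "('k::field, 'a, 'm) module_scheme \<Rightarrow> ('a, 'k) fdmod \<Rightarrow> 'k vec set \<Rightarrow> bool" where
  "fd_submodule A M U \<longleftrightarrow>
     U \<subseteq> carrier_vec (mdim M) \<and> 0\<^sub>v (mdim M) \<in> U \<and>
     (\<forall>u\<in>U. \<forall>v\<in>U. u + v \<in> U) \<and> (\<forall>c. \<forall>u\<in>U. c \<cdot>\<^sub>v u \<in> U) \<and>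
     (\<forall>x\<in>carrier A. \<forall>u\<in>U. mact M x *\<^sub>v u \<in> U)"

definition fd_projective ::
  "('k::field, 'a, 'm) module_scheme \<Rightarrow> ('a, 'k) fdmod \<Rightarrow> bool" where
  "fd_projective A P \<longleftrightarrow>
     fd_module A P \<and>
     (\<forall>M N f g. fd_module A M \<and> fd_module A N \<and> f \<in> fd_hom A M N \<and> surj_mat f \<and> g \<in> fd_hom A P N
        \<longrightarrow> (\<exists>h \<in> fd_hom A P M. f * h = g))"

text \<open>A projective cover is a projective module with a surjection whose kernel is superfluous.\<close>

definition projective_cover ::
  "('k::field, 'a, 'm) module_scheme \<Rightarrow> ('a, 'k) fdmod \<Rightarrow> ('a, 'k) fdmod \<Rightarrow> bool" where
  "projective_cover A P M \<longleftrightarrow>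
     fd_projective A P \<and> fd_module A M \<and>
     (\<exists>f \<in> fd_hom A P M. surj_mat f \<and>
        (\<forall>U. fd_submodule A P U \<and> {u + z | u z. u \<in> U \<and> z \<in> mat_kernel f} = carrier_vec (mdim P)
           \<longrightarrow> U = carrier_vec (mdim P)))"


section \<open>Free algebras\<close>

text \<open>
  Words are written additively, so that the convolution product which makes finitely supported
  functions \<open>'s word \<Rightarrow>\<^sub>0 'k\<close> a ring is the product of the free algebra.  In the same way
  \<open>('s word \<times> 's word) \<Rightarrow>\<^sub>0 'k\<close> is the tensor square of the free algebra.
\<close>

datatype 's word = Word (letters: "'s list")

instantiation word :: (type) monoid_add
begin

definition "0 = Word []"
definition "u + v = Word (letters u @ letters v)"

instance
  by standard (simp_all add: zero_word_def plus_word_def)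

end

text \<open>Scalars, in the free algebra or in its tensor square.\<close>

abbreviation const :: "'k \<Rightarrow> ('w::monoid_add \<Rightarrow>\<^sub>0 'k::field)" where
  "const c \<equiv> Poly_Mapping.single 0 c"

definition gen :: "'s \<Rightarrow> ('s word \<Rightarrow>\<^sub>0 'k::field)" where
  "gen s = Poly_Mapping.single (Word [s]) 1"

definition free_algebra :: "'s set \<Rightarrow> ('s word \<Rightarrow>\<^sub>0 'k::field) ring" where
  "free_algebra S =
     \<lparr>carrier = {p. \<forall>w \<in> Poly_Mapping.keys p. set (letters w) \<subseteq> S},
      mult = (*), one = 1, zero = 0, add = (+)\<rparr>"

definition tens :: "('s word \<Rightarrow>\<^sub>0 'k::field) \<Rightarrow> ('s word \<Rightarrow>\<^sub>0 'k) \<Rightarrow> (('s word \<times> 's word) \<Rightarrow>\<^sub>0 'k)"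
    (infixl "\<otimes>\<^sub>F" 68) where
  "p \<otimes>\<^sub>F q = (\<Sum>u \<in> Poly_Mapping.keys p. \<Sum>w \<in> Poly_Mapping.keys q.
     Poly_Mapping.single (u, w) (Poly_Mapping.lookup p u * Poly_Mapping.lookup q w))"

text \<open>The quotient by the two-sided ideal generated by \<open>R\<close>: generators \<open>S\<close>, relations \<open>r = 0\<close>.\<close>

definition presented_algebra ::
  "'s set \<Rightarrow> ('s word \<Rightarrow>\<^sub>0 'k) set \<Rightarrow> ('k::field, ('s word \<Rightarrow>\<^sub>0 'k) set) module" where
  "presented_algebra S R =
     (let F = free_algebra S; I = Idl\<^bsub>F\<^esub> R; Q = F Quot I in
      \<lparr>carrier = carrier Q, mult = mult Q, one = one Q, zero = zero Q, add = add Q,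
       smult = (\<lambda>c X. (I +>\<^bsub>F\<^esub> const c) \<otimes>\<^bsub>Q\<^esub> X)\<rparr>)"

definition presented_class ::
  "'s set \<Rightarrow> ('s word \<Rightarrow>\<^sub>0 'k::field) set \<Rightarrow> ('s word \<Rightarrow>\<^sub>0 'k) \<Rightarrow> ('s word \<Rightarrow>\<^sub>0 'k) set" where
  "presented_class S R p = (let F = free_algebra S in (Idl\<^bsub>F\<^esub> R) +>\<^bsub>F\<^esub> p)"

text \<open>The linear extension of \<open>f\<close>, with values in the \<open>d \<times> d\<close> matrices.\<close>

definition lin_ext :: "nat \<Rightarrow> ('w \<Rightarrow> 'k mat) \<Rightarrow> ('w \<Rightarrow>\<^sub>0 'k::field) \<Rightarrow> 'k mat" where
  "lin_ext d f p = mat d d (\<lambda>ij. \<Sum>w \<in> Poly_Mapping.keys p. Poly_Mapping.lookup p w * f w $$ ij)"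

definition word_mat :: "nat \<Rightarrow> ('s \<Rightarrow> 'k::field mat) \<Rightarrow> 's word \<Rightarrow> 'k mat" where
  "word_mat d r w = foldr (\<lambda>s A. r s * A) (letters w) (1\<^sub>m d)"

text \<open>
  The module of dimension \<open>d\<close> on which each generator \<open>s\<close> acts by \<open>r s\<close>.  An element of the
  presented algebra is a coset; when the matrices \<open>r s\<close> satisfy the relations, the choice of a
  representative is immaterial.
\<close>

definition module_of_gens ::
  "nat \<Rightarrow> ('s \<Rightarrow> 'k::field mat) \<Rightarrow> (('s word \<Rightarrow>\<^sub>0 'k) set, 'k) fdmod" where
  "module_of_gens d r = \<lparr>mdim = d, mact = (\<lambda>X. lin_ext d (word_mat d r) (SOME p. p \<in> X))\<rparr>"

text \<open>
  The matrix of \<open>A \<otimes> B\<close> in the basis \<open>v\<^sub>i \<otimes> w\<^sub>j\<close>, which is numbered by \<open>i * dim B + j\<close>.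
\<close>

definition kron :: "'k::field mat \<Rightarrow> 'k mat \<Rightarrow> 'k mat" where
  "kron A B = mat (dim_row A * dim_row B) (dim_col A * dim_col B)
     (\<lambda>(i, j). A $$ (i div dim_row B, j div dim_col B) * B $$ (i mod dim_row B, j mod dim_col B))"


section \<open>Group data and characters\<close>

definition kunits :: "'k::field monoid" where
  "kunits = \<lparr>carrier = {c. c \<noteq> 0}, mult = (*), one = 1\<rparr>"

text \<open>Extensionality makes a character determined by its values on the group.\<close>

definition characters :: "('g, 'm) monoid_scheme \<Rightarrow> ('g \<Rightarrow> 'k::field) monoid" where
  "characters G =
     \<lparr>carrier = hom G kunits \<inter> extensional (carrier G),
      mult = (\<lambda>\<psi> \<theta>. \<lambda>g\<in>carrier G. \<psi> g * \<theta> g),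
      one = (\<lambda>g\<in>carrier G. 1)\<rparr>"

record ('g, 'k) datum =
  grp :: "'g monoid"
  chi :: "'g \<Rightarrow> 'k"
  elt :: 'g
  scal :: 'k

abbreviation Gam :: "('g, 'k::field) datum \<Rightarrow> ('g \<Rightarrow> 'k) monoid" where
  "Gam D \<equiv> characters (grp D)"

abbreviation Lam :: "('g, 'k::field) datum \<Rightarrow> ('g \<times> ('g \<Rightarrow> 'k) \<Rightarrow> 'k) monoid" where
  "Lam D \<equiv> characters (grp D \<times>\<times> Gam D)"

definition rho :: "('g, 'k::field) datum \<Rightarrow> 'k" where
  "rho D = chi D (elt D)"

definition ordn :: "('g, 'k::field) datum \<Rightarrow> nat" where
  "ordn D = group.ord kunits (rho D)"

text \<open>Being nilpotent is the equation \<open>\<alpha>(a\<^sup>n - 1) = 0\<close> in the group algebra of \<open>G\<close>.\<close>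

definition nilpotent_type :: "('g, 'k::field) datum \<Rightarrow> bool" where
  "nilpotent_type D \<longleftrightarrow> scal D = 0 \<or> elt D [^]\<^bsub>grp D\<^esub> ordn D = \<one>\<^bsub>grp D\<^esub>"

definition group_datum :: "('g, 'k::field) datum \<Rightarrow> bool" where
  "group_datum D \<longleftrightarrow>
     comm_group (grp D) \<and> finite (carrier (grp D)) \<and>
     chi D \<in> carrier (Gam D) \<and> elt D \<in> carrier (grp D) \<and> ordn D \<ge> 2 \<and>
     (chi D [^]\<^bsub>Gam D\<^esub> ordn D = \<one>\<^bsub>Gam D\<^esub> \<or> nilpotent_type D) \<and>
     (\<not> nilpotent_type D \<longrightarrow> scal D = 1)"

definition qint :: "'k::field \<Rightarrow> nat \<Rightarrow> 'k" where
  "qint q i = (\<Sum>j<i. q ^ j)"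

definition qfact :: "'k::field \<Rightarrow> nat \<Rightarrow> 'k" where
  "qfact q i = (\<Prod>j=1..i. qint q j)"


section \<open>The Drinfeld double\<close>

datatype ('g, 'k) dgen = GrpGen 'g | ChrGen "'g \<Rightarrow> 'k" | XGen | XiGen

type_synonym ('g, 'k) dfree = "('g, 'k) dgen word \<Rightarrow>\<^sub>0 'k"

definition dgens :: "('g, 'k::field) datum \<Rightarrow> ('g, 'k) dgen set" where
  "dgens D = GrpGen ` carrier (grp D) \<union> ChrGen ` carrier (Gam D) \<union> {XGen, XiGen}"

definition drels :: "('g, 'k::field) datum \<Rightarrow> ('g, 'k) dfree set" where
  "drels D = (let
       G = grp D; \<Gamma> = Gam D; \<chi> = chi D; a = elt D; \<rho> = rho D; n = ordn D;
       g' = (\<lambda>g. gen (GrpGen g)); c' = (\<lambda>\<gamma>. gen (ChrGen \<gamma>)); x = gen XGen; \<xi> = gen XiGen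
     in
       {g' (g \<otimes>\<^bsub>G\<^esub> h) - g' g * g' h | g h. g \<in> carrier G \<and> h \<in> carrier G}
     \<union> {g' \<one>\<^bsub>G\<^esub> - 1}
     \<union> {c' (\<gamma> \<otimes>\<^bsub>\<Gamma>\<^esub> \<delta>) - c' \<gamma> * c' \<delta> | \<gamma> \<delta>. \<gamma> \<in> carrier \<Gamma> \<and> \<delta> \<in> carrier \<Gamma>}
     \<union> {c' \<one>\<^bsub>\<Gamma>\<^esub> - 1}
     \<union> {x ^ n - const (scal D) * (g' a ^ n - 1)}
     \<union> {x * g' g - const (\<chi> g) * g' g * x | g. g \<in> carrier G}
     \<union> {\<xi> ^ n}
     \<union> {\<xi> * c' \<gamma> - const (\<gamma> a) * c' \<gamma> * \<xi> | \<gamma>. \<gamma> \<in> carrier \<Gamma>}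
     \<union> {g' g * c' \<gamma> - c' \<gamma> * g' g | g \<gamma>. g \<in> carrier G \<and> \<gamma> \<in> carrier \<Gamma>}
     \<union> {\<xi> * g' g - const ((inv\<^bsub>\<Gamma>\<^esub> \<chi>) g) * g' g * \<xi> | g. g \<in> carrier G}
     \<union> {x * \<xi> - \<xi> * x - (g' a - c' \<chi>)}
     \<union> {const (\<gamma> a) * x * c' \<gamma> -
          (c' \<gamma> * x +
            (if nilpotent_type D then 0
             else const (((\<gamma> [^]\<^bsub>\<Gamma>\<^esub> n) a - 1) / qfact \<rho> (n - 1))
                    * c' \<gamma> * (const \<rho> * g' a - c' \<chi>) * \<xi> ^ (n - 1)))
        | \<gamma>. \<gamma> \<in> carrier \<Gamma>})"

abbreviation double ::
  "('g, 'k::field) datum \<Rightarrow> ('k, ('g, 'k) dfree set) module" where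
  "double D \<equiv> presented_algebra (dgens D) (drels D)"

fun comult_gen ::
  "('g, 'k::field) datum \<Rightarrow> ('g, 'k) dgen \<Rightarrow> (('g, 'k) dgen word \<times> ('g, 'k) dgen word \<Rightarrow>\<^sub>0 'k)" where
  "comult_gen D (GrpGen g) = gen (GrpGen g) \<otimes>\<^sub>F gen (GrpGen g)"
| "comult_gen D XGen = gen XGen \<otimes>\<^sub>F gen (GrpGen (elt D)) + 1 \<otimes>\<^sub>F gen XGen"
| "comult_gen D XiGen = gen XiGen \<otimes>\<^sub>F 1 + gen (ChrGen (chi D)) \<otimes>\<^sub>F gen XiGen"
| "comult_gen D (ChrGen \<gamma>) =
     gen (ChrGen \<gamma>) \<otimes>\<^sub>F gen (ChrGen \<gamma>) +
     (if nilpotent_type D then 0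
      else const ((\<gamma> [^]\<^bsub>Gam D\<^esub> ordn D) (elt D) - 1) *
        (\<Sum>(p, r) \<in> {(p, r). p + r = ordn D \<and> p \<ge> 1 \<and> r \<ge> 1}.
           const (1 / (qfact (rho D) p * qfact (rho D) r)) *
           ((gen (ChrGen \<gamma>) * gen (ChrGen (chi D)) ^ p * gen XiGen ^ r) \<otimes>\<^sub>F
            (gen (ChrGen \<gamma>) * gen XiGen ^ p))))"

text \<open>
  The extension of \<open>comult_gen\<close> to an algebra map from the free algebra to its tensor square; it
  induces the comultiplication of the double.
\<close>

definition comult ::
  "('g, 'k::field) datum \<Rightarrow> ('g, 'k) dfree \<Rightarrow> (('g, 'k) dgen word \<times> ('g, 'k) dgen word \<Rightarrow>\<^sub>0 'k)" where
  "comult D p = (\<Sum>w \<in> Poly_Mapping.keys p.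
     const (Poly_Mapping.lookup p w) * prod_list (map (comult_gen D) (letters w)))"

text \<open>
  The tensor product, with action through the comultiplication.  As above, the choice of a
  representative \<open>p\<close> of the coset \<open>X\<close> is immaterial, since \<open>comult\<close> is compatible with the relations.
\<close>

definition tensor_module ::
  "('g, 'k::field) datum \<Rightarrow> (('g, 'k) dfree set, 'k) fdmod \<Rightarrow> (('g, 'k) dfree set, 'k) fdmod
    \<Rightarrow> (('g, 'k) dfree set, 'k) fdmod" where
  "tensor_module D M N = (let
       cl = (\<lambda>w. presented_class (dgens D) (drels D) (Poly_Mapping.single w 1))
     in
       \<lparr>mdim = mdim M * mdim N,
        mact = (\<lambda>X. lin_ext (mdim M * mdim N) (\<lambda>(u, w). kron (mact M (cl u)) (mact N (cl w)))
                      (comult D (SOME p. p \<in> X)))\<rparr>)"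


section \<open>Weights, simple modules and their projective covers\<close>

definition phi :: "('g, 'k::field) datum \<Rightarrow> 'g \<times> ('g \<Rightarrow> 'k) \<Rightarrow> 'k" where
  "phi D = (\<lambda>(g, \<gamma>) \<in> carrier (grp D \<times>\<times> Gam D). (inv\<^bsub>Gam D\<^esub> (chi D)) g * \<gamma> (elt D))"

text \<open>\<open>In' D\<close> and \<open>In'' D\<close> are the two parts of \<open>In D\<close>; the sets \<open>Il D l\<close> are meant for \<open>1 \<le> l < n\<close>.\<close>

definition Il :: "('g, 'k::field) datum \<Rightarrow> nat \<Rightarrow> ('g \<times> ('g \<Rightarrow> 'k) \<Rightarrow> 'k) set" where
  "Il D l = {\<mu> \<in> carrier (Lam D). \<mu> (elt D, inv\<^bsub>Gam D\<^esub> (chi D)) = rho D ^ (l - 1)}"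

definition In'' :: "('g, 'k::field) datum \<Rightarrow> ('g \<times> ('g \<Rightarrow> 'k) \<Rightarrow> 'k) set" where
  "In'' D = {\<mu> \<in> carrier (Lam D). \<mu> (elt D, inv\<^bsub>Gam D\<^esub> (chi D)) = rho D ^ (ordn D - 1)}"

definition In' :: "('g, 'k::field) datum \<Rightarrow> ('g \<times> ('g \<Rightarrow> 'k) \<Rightarrow> 'k) set" where
  "In' D = {\<mu> \<in> carrier (Lam D).
     \<forall>k \<le> ordn D - 1. \<mu> (elt D, inv\<^bsub>Gam D\<^esub> (chi D)) \<noteq> rho D ^ k}"

definition In :: "('g, 'k::field) datum \<Rightarrow> ('g \<times> ('g \<Rightarrow> 'k) \<Rightarrow> 'k) set" where
  "In D = In' D \<union> In'' D"

definition alph :: "('g, 'k::field) datum \<Rightarrow> ('g \<times> ('g \<Rightarrow> 'k) \<Rightarrow> 'k) \<Rightarrow> nat \<Rightarrow> 'k" where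
  "alph D \<mu> i = qint (rho D) i *
     (\<mu> (\<one>\<^bsub>grp D\<^esub>, chi D) - \<mu> (elt D, \<one>\<^bsub>Gam D\<^esub>) * rho D powi (1 - int i))"

text \<open>Column \<open>j\<close> of each matrix is the image of the basis vector \<open>v\<^sub>j\<close>.\<close>

fun simple_gen ::
  "('g, 'k::field) datum \<Rightarrow> nat \<Rightarrow> ('g \<times> ('g \<Rightarrow> 'k) \<Rightarrow> 'k) \<Rightarrow> ('g, 'k) dgen \<Rightarrow> 'k mat" where
  "simple_gen D l \<mu> (GrpGen g) = mat l l (\<lambda>(i, j).
     if i = j then (phi D [^]\<^bsub>Lam D\<^esub> j \<otimes>\<^bsub>Lam D\<^esub> \<mu>) (g, \<one>\<^bsub>Gam D\<^esub>) else 0)"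
| "simple_gen D l \<mu> (ChrGen \<gamma>) = mat l l (\<lambda>(i, j).
     if i = j then (phi D [^]\<^bsub>Lam D\<^esub> j \<otimes>\<^bsub>Lam D\<^esub> \<mu>) (\<one>\<^bsub>grp D\<^esub>, \<gamma>) else 0)"
| "simple_gen D l \<mu> XGen = mat l l (\<lambda>(i, j).
     if i = j + 1 then 1
     else if l = ordn D \<and> \<not> nilpotent_type D \<and> i = 0 \<and> j = l - 1
     then \<mu> (elt D, \<one>\<^bsub>Gam D\<^esub>) ^ ordn D - 1
     else 0)"
| "simple_gen D l \<mu> XiGen = mat l l (\<lambda>(i, j). if j = i + 1 then alph D \<mu> j else 0)"

definition simple_module ::
  "('g, 'k::field) datum \<Rightarrow> nat \<Rightarrow> ('g \<times> ('g \<Rightarrow> 'k) \<Rightarrow> 'k) \<Rightarrow> (('g, 'k) dfree set, 'k) fdmod" where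
  "simple_module D l \<mu> = module_of_gens l (simple_gen D l \<mu>)"

text \<open>Projective covers are unique up to isomorphism; we choose one.\<close>

definition proj_module ::
  "('g, 'k::field) datum \<Rightarrow> nat \<Rightarrow> ('g \<times> ('g \<Rightarrow> 'k) \<Rightarrow> 'k) \<Rightarrow> (('g, 'k) dfree set, 'k) fdmod" where
  "proj_module D l \<mu> =
     (if l = ordn D then simple_module D l \<mu>
      else (SOME P. projective_cover (double D) P (simple_module D l \<mu>)))"

definition ceil_half :: "int \<Rightarrow> int" where
  "ceil_half t = (t + 1) div 2"

end

theory Submission
  imports Defs
begin

text \<open>
  A tensor product \<open>V(l, \<lambda>) \<otimes> V(n, \<lambda>')\<close> is generated by \<open>p = v\<^sub>l\<^sub>-\<^sub>1 \<otimes> w\<^sub>0\<close>, a vector of weight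
  \<open>\<nu> = \<phi>\<^sup>l\<^sup>-\<^sup>1\<lambda>\<lambda>'\<close> with \<open>\<xi>\<^sup>l p = 0\<close>, and the vectors \<open>x\<^sup>i \<xi>\<^sup>j p\<close> with \<open>i < n\<close>, \<open>j < l\<close> form a basis. It is
  therefore the universal module on such a generator, and depends on \<open>l\<close> and \<open>\<nu>\<close> only. In the first
  case \<open>\<xi> p\<close> generates a direct summand of the same kind for \<open>l - 1\<close>, with complement \<open>V(n, \<nu>)\<close>. In
  the second case a vector killed by \<open>\<xi>\<^sup>l\<close> of weight \<open>\<nu>\<close> lies in the image of \<open>\<xi>\<^sup>n\<^sup>-\<^sup>l\<close>, so that the
  module is projective; a correction of \<open>\<xi> p\<close> generates a summand for \<open>l - 2\<close>, and its complement is
  the projective cover of \<open>V(n - l + 1, \<nu>)\<close>.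
\<close>


text \<open>In the non-nilpotent type an element \<gamma> of \<Gamma> commutes with x only up to a
  correction containing \<xi>^(n-1), so x^i \<xi>^j p is in general an eigenvector only of G and of
  \<chi>. The eigenvalues s of a and t of \<chi> therefore carry most computations: they fix the
  scalars met when \<xi> moves past x^i, while full weights are demanded of generators only.
  Universality is a dimension count, nl spanning vectors in dimension nl; the work lies in checking
  that the resulting map respects \<Gamma>. Vectors of prescribed weight come from averaging over G
  and \<Gamma>. The induction on l needs a universal module for each smaller length and shifted
  weight, and takes it to be another tensor product with a convenient first factor. The complement
  in the second case is a projective cover because the a-eigenspace of p in it is spanned by p and
  x^(l-1) \<xi>^(l-1) p: a submodule that maps onto V(n - l + 1, \<nu>) contains p plus a multiple
  of the second vector, then \<xi>^(l-1) p, and hence p. The relation t = s \<rho>^l decides which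
  of the scalars involved vanish.\<close>

datatype 'k fvec = Fvec (ent: "nat \<Rightarrow> 'k")

lemma fvec_eqI: "(\<And>i. ent u i = ent v i) \<Longrightarrow> u = v"
  by (cases u; cases v) (simp add: fun_eq_iff)

lemma fvec_eq_iff: "u = v \<longleftrightarrow> (\<forall>i. ent u i = ent v i)"
  by (auto intro: fvec_eqI)

instantiation fvec :: (field) ab_group_add
begin

definition "0 = Fvec (\<lambda>i. 0)"
definition "u + v = Fvec (\<lambda>i. ent u i + ent v i)"
definition "u - v = Fvec (\<lambda>i. ent u i - ent v i)"
definition "- v = Fvec (\<lambda>i. - ent v i)"

lemma ent_ops [simp]:
  "ent 0 i = 0" "ent (u + v) i = ent u i + ent v i" "ent (u - v) i = ent u i - ent v i"
  "ent (- v) i = - ent v i"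
  by (simp_all add: zero_fvec_def plus_fvec_def minus_fvec_def uminus_fvec_def)

instance
  by standard (simp_all add: fvec_eq_iff)

end

definition sc :: "'k::field \<Rightarrow> 'k fvec \<Rightarrow> 'k fvec" (infixr "*\<^sub>F" 75)
  where "c *\<^sub>F v = Fvec (\<lambda>i. c * ent v i)"

lemma sc_apply [simp]: "ent (c *\<^sub>F v) i = c * ent v i"
  by (simp add: sc_def)

lemma sc_simps [simp]:
  "c *\<^sub>F (u + v) = c *\<^sub>F u + c *\<^sub>F v" "c *\<^sub>F (u - v) = c *\<^sub>F u - c *\<^sub>F v"
  "c *\<^sub>F (- v) = - (c *\<^sub>F v)"
  "c *\<^sub>F (0 :: 'k::field fvec) = 0" "1 *\<^sub>F v = v" "0 *\<^sub>F v = 0" "a *\<^sub>F b *\<^sub>F v = (a * b) *\<^sub>F v"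
  by (simp_all add: fvec_eq_iff algebra_simps)

lemma sc_add_left: "(a + b) *\<^sub>F v = a *\<^sub>F v + b *\<^sub>F v"
  and sc_diff_left: "(a - b) *\<^sub>F v = a *\<^sub>F v - b *\<^sub>F v"
  and sc_minus_left: "(- a) *\<^sub>F v = - (a *\<^sub>F v)"
  by (simp_all add: fvec_eq_iff algebra_simps)

lemma sc_sum: "c *\<^sub>F (\<Sum>i\<in>I. f i) = (\<Sum>i\<in>I. c *\<^sub>F f i)"
  by (induction I rule: infinite_finite_induct) simp_all

lemma sc_sum_left: "(\<Sum>i\<in>I. c i) *\<^sub>F v = (\<Sum>i\<in>I. c i *\<^sub>F v)"
  by (induction I rule: infinite_finite_induct) (simp_all add: sc_add_left)

lemma ent_sum: "ent (\<Sum>i\<in>I. f i) x = (\<Sum>i\<in>I. ent (f i) x)"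
  by (induction I rule: infinite_finite_induct) simp_all

section \<open>The ring of linear endomorphisms of one common space\<close>

definition islin :: "('k::field fvec \<Rightarrow> 'k fvec) \<Rightarrow> bool" where
  "islin t \<longleftrightarrow> (\<forall>u v. t (u + v) = t u + t v) \<and> (\<forall>c v. t (c *\<^sub>F v) = c *\<^sub>F t v)"

lemma islinI: "(\<And>u v. t (u + v) = t u + t v) \<Longrightarrow> (\<And>c v. t (c *\<^sub>F v) = c *\<^sub>F t v) \<Longrightarrow> islin t"
  by (simp add: islin_def)

lemma islin_add: "islin t \<Longrightarrow> t (u + v) = t u + t v"
  and islin_sc: "islin t \<Longrightarrow> t (c *\<^sub>F v) = c *\<^sub>F t v"
  by (simp_all add: islin_def)

lemma islin_0: "islin t \<Longrightarrow> t 0 = 0"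
  using islin_sc[of t 0 0] by simp

lemma islin_minus: "islin t \<Longrightarrow> t (- v) = - t v"
  using islin_sc[of t "-1" v] by (simp add: sc_minus_left)

lemma islin_diff: "islin t \<Longrightarrow> t (u - v) = t u - t v"
  using islin_add[of t u "- v"] by (simp add: islin_minus)

lemma islin_sum: "islin t \<Longrightarrow> t (\<Sum>i\<in>I. f i) = (\<Sum>i\<in>I. t (f i))"
  by (induction I rule: infinite_finite_induct) (simp_all add: islin_0 islin_add)

lemmas islin_simps = islin_add islin_sc islin_0 islin_minus islin_diff islin_sum

text \<open>Endomorphisms of a single space form a type, so powers, sums and the ring laws come from
  the class \<open>ring_1\<close>; square matrices of a given size are only a carrier set inside a
  type.\<close>

typedef (overloaded) ('k::field) endo = "{t :: 'k fvec \<Rightarrow> 'k fvec. islin t}"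
  morphisms app Endo
  by (rule exI[of _ "\<lambda>v. v"]) (simp add: islin_def)

lemma islin_app [simp]: "islin (app F)"
  using app[of F] by simp

lemmas app_simps [simp] = islin_add[OF islin_app] islin_sc[OF islin_app] islin_0[OF islin_app]
  islin_minus[OF islin_app] islin_diff[OF islin_app]

lemmas app_sum = islin_sum[OF islin_app]

lemma app_Endo: "islin t \<Longrightarrow> app (Endo t) = t"
  by (simp add: Endo_inverse)

lemma endo_eqI: "(\<And>v. app F v = app H v) \<Longrightarrow> F = H"
  by (metis app_inject ext)

instantiation endo :: (field) ring_1
begin

definition "0 = Endo (\<lambda>v. 0)"
definition "1 = Endo (\<lambda>v. v)"
definition "F + H = Endo (\<lambda>v. app F v + app H v)"
definition "F - H = Endo (\<lambda>v. app F v - app H v)"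
definition "- F = Endo (\<lambda>v. - app F v)"
definition "F * H = Endo (\<lambda>v. app F (app H v))"

lemma app_ops [simp]:
  "app 0 v = 0" "app 1 v = v" "app (F + H) v = app F v + app H v"
  "app (F - H) v = app F v - app H v" "app (- F) v = - app F v"
  "app (F * H) v = app F (app H v)"
  unfolding zero_endo_def one_endo_def plus_endo_def minus_endo_def uminus_endo_def times_endo_def
  by (subst app_Endo; simp add: islin_def algebra_simps)+

instance
proof
  show "(0::'a endo) \<noteq> 1"
  proof
    assume "(0::'a endo) = 1"
    then have "app (0::'a endo) (Fvec (\<lambda>_. 1)) = app 1 (Fvec (\<lambda>_. 1))" by simp
    then show False by (simp add: fvec_eq_iff)
  qed
qed (rule endo_eqI; simp add: algebra_simps)+

end

definition sm :: "'k::field \<Rightarrow> 'k endo \<Rightarrow> 'k endo" (infixr "*\<^sub>E" 72)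
  where "c *\<^sub>E F = Endo (\<lambda>v. c *\<^sub>F app F v)"

lemma app_sm [simp]: "app (c *\<^sub>E F) v = c *\<^sub>F app F v"
  unfolding sm_def by (subst app_Endo) (simp_all add: islin_def mult.commute)

lemma sm_simps [simp]:
  "a *\<^sub>E F * H = a *\<^sub>E (F * H)" "F * (a *\<^sub>E H) = a *\<^sub>E (F * H)" "a *\<^sub>E b *\<^sub>E F = (a * b) *\<^sub>E F"
  "1 *\<^sub>E F = F" "0 *\<^sub>E F = 0" "a *\<^sub>E 0 = 0" "a *\<^sub>E (- F) = - (a *\<^sub>E F)"
  by (rule endo_eqI; simp add: fvec_eq_iff)+

lemma sm_add: "a *\<^sub>E (F + H) = a *\<^sub>E F + a *\<^sub>E H"
  and sm_diff: "a *\<^sub>E (F - H) = a *\<^sub>E F - a *\<^sub>E H"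
  and sm_add_left: "(a + b) *\<^sub>E F = a *\<^sub>E F + b *\<^sub>E F"
  and sm_diff_left: "(a - b) *\<^sub>E F = a *\<^sub>E F - b *\<^sub>E F"
  and sm_minus_left: "(- a) *\<^sub>E F = - (a *\<^sub>E F)"
  by (rule endo_eqI; simp add: fvec_eq_iff algebra_simps)+

lemma sm_sum: "a *\<^sub>E (\<Sum>i\<in>I. f i) = (\<Sum>i\<in>I. a *\<^sub>E f i)"
  by (induction I rule: infinite_finite_induct) (simp_all add: sm_add)

lemma app_esum: "app (\<Sum>i\<in>I. F i) v = (\<Sum>i\<in>I. app (F i) v)"
  by (induction I rule: infinite_finite_induct) simp_all

lemma app_pow_Suc: "app (F ^ Suc i) v = app F (app (F ^ i) v)"
  by simp

lemma app_pow_add: "app (F ^ (i + j)) v = app (F ^ i) (app (F ^ j) v)"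
  by (simp add: power_add)

lemma app_pow_Suc2: "app (F ^ Suc i) v = app (F ^ i) (app F v)"
  by (simp add: power_Suc2 del: power_Suc)


section \<open>Column spaces as coordinate subspaces, and matrices acting on them\<close>

definition W :: "nat \<Rightarrow> 'k::field fvec set" where
  "W d = {v. \<forall>i\<ge>d. ent v i = 0}"

lemma W_closed [simp]:
  "0 \<in> W d" "u \<in> W d \<Longrightarrow> v \<in> W d \<Longrightarrow> u + v \<in> W d" "u \<in> W d \<Longrightarrow> v \<in> W d \<Longrightarrow> u - v \<in> W d"
  "v \<in> W d \<Longrightarrow> c *\<^sub>F v \<in> W d" "v \<in> W d \<Longrightarrow> - v \<in> W d"
  by (simp_all add: W_def)

lemma W_sum: "(\<And>i. i \<in> I \<Longrightarrow> f i \<in> W d) \<Longrightarrow> (\<Sum>i\<in>I. f i) \<in> W d"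
  by (induction I rule: infinite_finite_induct) simp_all

definition bv :: "nat \<Rightarrow> 'k::field fvec" where
  "bv j = Fvec (\<lambda>i. if i = j then 1 else 0)"

lemma bv_in_W [simp]: "j < d \<Longrightarrow> bv j \<in> W d"
  by (auto simp: W_def bv_def)

lemma W_expand: "v \<in> W d \<Longrightarrow> v = (\<Sum>j<d. ent v j *\<^sub>F bv j)"
  by (rule fvec_eqI) (auto simp: ent_sum bv_def W_def if_distrib cong: if_cong)

text \<open>The linear map of a matrix, and the action of a square matrix on infinitely many copies of
  its column space. The latter is unital, so that identities between square matrices become
  identities in the ring \<open>'k endo\<close>.\<close>

definition lin :: "'k::field mat \<Rightarrow> 'k fvec \<Rightarrow> 'k fvec" where
  "lin T v = Fvec (\<lambda>i. if i < dim_row T then \<Sum>j<dim_col T. T $$ (i, j) * ent v j else 0)"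

definition emb :: "nat \<Rightarrow> 'k::field mat \<Rightarrow> 'k endo" where
  "emb d A = Endo (\<lambda>v. Fvec (\<lambda>i. \<Sum>j<d. A $$ (i mod d, j) * ent v (d * (i div d) + j)))"

lemma app_emb: "ent (app (emb d A) v) i = (\<Sum>j<d. A $$ (i mod d, j) * ent v (d * (i div d) + j))"
  unfolding emb_def
  by (subst app_Endo)
    (auto simp: islin_def fvec_eq_iff sum.distrib sum_distrib_left algebra_simps)

lemma islin_lin [simp]: "islin (lin T)"
  by (auto simp: islin_def lin_def fvec_eq_iff sum.distrib sum_distrib_left algebra_simps)

lemma lin_in_W [simp]: "dim_row T = d \<Longrightarrow> lin T v \<in> W d"
  by (auto simp: lin_def W_def)

lemma lin_bv: "i < dim_row T \<Longrightarrow> j < dim_col T \<Longrightarrow> ent (lin T (bv j)) i = T $$ (i, j)"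
  by (simp add: lin_def bv_def if_distrib cong: if_cong)

text \<open>The first of the infinitely many copies is \<open>W d\<close> itself: a vector there has
  no coordinates in the later blocks, so the block action reduces to the matrix.\<close>

lemma app_emb_W:
  assumes "v \<in> W d" "A \<in> carrier_mat d d"
  shows "app (emb d A) v = lin A v"
proof (rule fvec_eqI)
  fix i
  show "ent (app (emb d A) v) i = ent (lin A v) i"
  proof (cases "i < d")
    case True
    with assms show ?thesis by (simp add: app_emb lin_def)
  next
    case False
    have "ent v (d * (i div d) + j) = 0" if "j < d" for j
    proof -
      have "d * (i div d) \<ge> d" using False that
        by (metis div_greater_zero_iff leI le_zero_eq less_le_trans mult.right_neutral
            mult_le_mono2 not_less_zero One_nat_def Suc_leI)
      then show ?thesis using assms by (simp add: W_def trans_le_add1)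
    qed
    with False assms show ?thesis by (auto simp: app_emb lin_def)
  qed
qed

lemma lin_mult:
  assumes "dim_col A = dim_row B"
  shows "lin (A * B) v = lin A (lin B v)"
proof (rule fvec_eqI)
  fix i
  show "ent (lin (A * B) v) i = ent (lin A (lin B v)) i"
  proof (cases "i < dim_row A")
    case True
    have "ent (lin (A * B) v) i = (\<Sum>j<dim_col B. \<Sum>k<dim_row B. A $$ (i, k) * B $$ (k, j) * ent v j)"
      using True assms by (simp add: lin_def scalar_prod_def sum_distrib_right atLeast0LessThan)
    also have "\<dots> = (\<Sum>k<dim_row B. \<Sum>j<dim_col B. A $$ (i, k) * B $$ (k, j) * ent v j)"
      by (rule sum.swap)
    also have "\<dots> = ent (lin A (lin B v)) i"
      using True assms by (simp add: lin_def sum_distrib_left mult.assoc)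
    finally show ?thesis .
  qed (use assms in \<open>auto simp: lin_def\<close>)
qed

lemma lin_inject:
  assumes "A \<in> carrier_mat m k" "B \<in> carrier_mat m k" "\<And>j. j < k \<Longrightarrow> lin A (bv j) = lin B (bv j)"
  shows "A = B"
proof (rule eq_matI)
  fix i j assume "i < dim_row B" "j < dim_col B"
  then show "A $$ (i, j) = B $$ (i, j)"
    using assms lin_bv[of i A j] lin_bv[of i B j] by auto
qed (use assms in auto)

lemma lin_one: "v \<in> W d \<Longrightarrow> lin (1\<^sub>m d) v = v"
  by (rule fvec_eqI) (auto simp: lin_def W_def if_distrib if_distribR cong: if_cong)

lemma lin_zero [simp]: "lin (0\<^sub>m m k) v = 0"
  by (rule fvec_eqI) (auto simp: lin_def)

definition mat_of :: "nat \<Rightarrow> nat \<Rightarrow> ('k::field fvec \<Rightarrow> 'k fvec) \<Rightarrow> 'k mat" where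
  "mat_of m k t = mat m k (\<lambda>(i, j). ent (t (bv j)) i)"

lemma mat_of_carrier [simp]: "mat_of m k t \<in> carrier_mat m k"
  by (simp add: mat_of_def)

lemma lin_mat_of:
  assumes "islin t" "\<And>v. v \<in> W k \<Longrightarrow> t v \<in> W m" "v \<in> W k"
  shows "lin (mat_of m k t) v = t v"
proof (rule fvec_eqI)
  fix i
  have v: "t v = (\<Sum>j<k. ent v j *\<^sub>F t (bv j))"
    by (subst W_expand[OF assms(3)]) (simp add: islin_simps[OF assms(1)])
  show "ent (lin (mat_of m k t) v) i = ent (t v) i"
  proof (cases "i < m")
    case True
    then show ?thesis by (simp add: v lin_def mat_of_def ent_sum mult.commute)
  next
    case False
    then show ?thesis using assms(2)[OF assms(3)] by (auto simp: lin_def mat_of_def W_def)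
  qed
qed

text \<open>Bridge from vectors with a dimension to vectors of the common space; it serves to
  restate surjectivity, submodules and kernels.\<close>

definition fv :: "'k::field vec \<Rightarrow> 'k fvec" where
  "fv v = Fvec (\<lambda>i. if i < dim_vec v then v $ i else 0)"

lemma fv_in_W [simp]: "v \<in> carrier_vec d \<Longrightarrow> fv v \<in> W d"
  by (auto simp: fv_def W_def)

lemma fv_vec: "v \<in> W d \<Longrightarrow> fv (vec d (ent v)) = v"
  by (rule fvec_eqI) (auto simp: fv_def W_def)

lemma fv_inject: "u \<in> carrier_vec d \<Longrightarrow> v \<in> carrier_vec d \<Longrightarrow> fv u = fv v \<Longrightarrow> u = v"
  by (rule eq_vecI) (auto simp: fv_def fvec_eq_iff, metis)

lemma fv_add: "u \<in> carrier_vec d \<Longrightarrow> v \<in> carrier_vec d \<Longrightarrow> fv (u + v) = fv u + fv v"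
  by (rule fvec_eqI) (auto simp: fv_def)

lemma fv_smult: "fv (c \<cdot>\<^sub>v v) = c *\<^sub>F fv v"
  by (rule fvec_eqI) (auto simp: fv_def)

lemma fv_zero: "fv (0\<^sub>v d) = 0"
  by (rule fvec_eqI) (auto simp: fv_def)

lemma fv_mult: "v \<in> carrier_vec (dim_col T) \<Longrightarrow> fv (T *\<^sub>v v) = lin T (fv v)"
  by (rule fvec_eqI) (auto simp: fv_def lin_def scalar_prod_def atLeast0LessThan)

lemma fv_image: "fv ` carrier_vec d = W d"
proof -
  have "v \<in> fv ` carrier_vec d" if "v \<in> W d" for v :: "'a fvec"
    using fv_vec[OF that] by (intro image_eqI[of _ _ "vec d (ent v)"]) auto
  then show ?thesis by auto
qed

context
  fixes d :: nat
  assumes d: "d > 0"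
begin

lemma emb_mult:
  fixes A B :: "'k::field mat"
  assumes "A \<in> carrier_mat d d" "B \<in> carrier_mat d d"
  shows "emb d (A * B) = emb d A * emb d B"
proof (rule endo_eqI, rule fvec_eqI)
  fix v :: "'k fvec" and i
  let ?w = "\<lambda>j. ent v (d * (i div d) + j)"
  have m: "i mod d < d" using d by simp
  have "ent (app (emb d (A * B)) v) i = (\<Sum>j<d. \<Sum>k<d. A $$ (i mod d, k) * B $$ (k, j) * ?w j)"
    using m assms by (simp add: app_emb scalar_prod_def sum_distrib_right atLeast0LessThan)
  also have "\<dots> = (\<Sum>k<d. \<Sum>j<d. A $$ (i mod d, k) * B $$ (k, j) * ?w j)"
    by (rule sum.swap)
  also have "\<dots> = ent (app (emb d A * emb d B) v) i"
    using d by (auto simp: app_emb sum_distrib_left mult.assoc intro!: sum.cong)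
  finally show "ent (app (emb d (A * B)) v) i = ent (app (emb d A * emb d B) v) i" .
qed

lemma emb_one: "emb d (1\<^sub>m d) = 1"
  by (rule endo_eqI, rule fvec_eqI)
    (use d in \<open>simp add: app_emb if_distrib if_distribR cong: if_cong\<close>)

lemma emb_add:
  assumes "A \<in> carrier_mat d d" "B \<in> carrier_mat d d"
  shows "emb d (A + B) = emb d A + emb d B"
  by (rule endo_eqI, rule fvec_eqI) (use assms d in \<open>simp add: app_emb sum.distrib algebra_simps\<close>)

lemma emb_smult:
  assumes "A \<in> carrier_mat d d"
  shows "emb d (c \<cdot>\<^sub>m A) = c *\<^sub>E emb d A"
  by (rule endo_eqI, rule fvec_eqI) (use assms d in \<open>simp add: app_emb sum_distrib_left algebra_simps\<close>)

lemma emb_zero: "emb d (0\<^sub>m d d) = 0"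
  by (rule endo_eqI, rule fvec_eqI) (use d in \<open>simp add: app_emb\<close>)

text \<open>All copies carry the same matrix, so the first one decides.\<close>

lemma emb_inject:
  assumes "A \<in> carrier_mat d d" "B \<in> carrier_mat d d"
    and "\<And>j. j < d \<Longrightarrow> app (emb d A) (bv j) = app (emb d B) (bv j)"
  shows "A = B"
  by (rule lin_inject[OF assms(1,2)]) (metis assms app_emb_W bv_in_W)

end


section \<open>Evaluating elements of free algebras as operators\<close>

definition wev :: "('s \<Rightarrow> 'k::field endo) \<Rightarrow> 's word \<Rightarrow> 'k endo" where
  "wev r w = prod_list (map r (letters w))"

text \<open>For \<open>f = wev r\<close> this is the algebra map on the free algebra that extends
  \<open>r\<close>; for the function \<open>wev2\<close> below it evaluates the tensor
  square.\<close>

definition Ev :: "('w \<Rightarrow> 'k::field endo) \<Rightarrow> ('w \<Rightarrow>\<^sub>0 'k) \<Rightarrow> 'k endo" where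
  "Ev f p = (\<Sum>w\<in>Poly_Mapping.keys p. Poly_Mapping.lookup p w *\<^sub>E f w)"

definition multiplicative :: "('w::monoid_add \<Rightarrow> 'k::field endo) \<Rightarrow> bool" where
  "multiplicative f \<longleftrightarrow> f 0 = 1 \<and> (\<forall>u w. f (u + w) = f u * f w)"

lemma multiplicative_wev [simp]: "multiplicative (wev r)"
  by (simp add: multiplicative_def wev_def zero_word_def plus_word_def)

lemma wev_single [simp]: "wev r (Word [s]) = r s"
  by (simp add: wev_def)

lemma wev_zero [simp]: "wev r 0 = 1"
  by (simp add: wev_def zero_word_def)

lemma Ev_superset:
  assumes "finite K" "Poly_Mapping.keys p \<subseteq> K"
  shows "Ev f p = (\<Sum>w\<in>K. Poly_Mapping.lookup p w *\<^sub>E f w)"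
  unfolding Ev_def by (rule sum.mono_neutral_left) (use assms in \<open>auto simp: in_keys_iff\<close>)

lemma Ev_add: "Ev f (p + q) = Ev f p + Ev f q"
proof -
  let ?K = "Poly_Mapping.keys p \<union> Poly_Mapping.keys q"
  have "Poly_Mapping.keys (p + q) \<subseteq> ?K" by (rule keys_add)
  then show ?thesis
    by (simp add: Ev_superset[of ?K] lookup_add sm_add_left sum.distrib)
qed

lemma Ev_zero [simp]: "Ev f 0 = 0"
  by (simp add: Ev_def)

lemma Ev_uminus: "Ev f (- p) = - Ev f p"
  using Ev_add[of f p "- p"] by (simp add: eq_neg_iff_add_eq_0 add.commute)

lemma Ev_diff: "Ev f (p - q) = Ev f p - Ev f q"
  using Ev_add[of f p "- q"] by (simp add: Ev_uminus)

lemma Ev_sum: "Ev f (\<Sum>i\<in>I. p i) = (\<Sum>i\<in>I. Ev f (p i))"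
  by (induction I rule: infinite_finite_induct) (simp_all add: Ev_add)

lemma Ev_single [simp]: "Ev f (Poly_Mapping.single w c) = c *\<^sub>E f w"
  by (cases "c = 0") (simp_all add: Ev_def)

lemma sum_singles: "p = (\<Sum>w\<in>Poly_Mapping.keys p. Poly_Mapping.single w (Poly_Mapping.lookup p w))"
  by (rule poly_mapping_eqI)
    (auto simp: lookup_sum lookup_single when_def in_keys_iff if_distrib cong: if_cong)

lemma Ev_mult:
  assumes "multiplicative f"
  shows "Ev f (p * q) = Ev f p * Ev f q"
proof -
  have "Ev f (p * q) = Ev f ((\<Sum>w\<in>Poly_Mapping.keys p. Poly_Mapping.single w (Poly_Mapping.lookup p w))
      * (\<Sum>w\<in>Poly_Mapping.keys q. Poly_Mapping.single w (Poly_Mapping.lookup q w)))"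
    using sum_singles[of p] sum_singles[of q] by simp
  also have "\<dots> = (\<Sum>u\<in>Poly_Mapping.keys p. \<Sum>w\<in>Poly_Mapping.keys q.
      (Poly_Mapping.lookup p u * Poly_Mapping.lookup q w) *\<^sub>E (f u * f w))"
    using assms by (simp add: sum_product Ev_sum mult_single multiplicative_def)
  also have "\<dots> = Ev f p * Ev f q"
    by (simp add: Ev_def sum_product mult.commute)
  finally show ?thesis .
qed

lemma Ev_one: "multiplicative f \<Longrightarrow> Ev f 1 = 1"
  using Ev_single[of f 0 1] by (simp add: multiplicative_def)

lemma Ev_const: "multiplicative f \<Longrightarrow> Ev f (const c) = c *\<^sub>E 1"
  by (simp add: multiplicative_def)

lemma Ev_power: "multiplicative f \<Longrightarrow> Ev f (p ^ i) = Ev f p ^ i"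
  by (induction i) (simp_all add: Ev_one Ev_mult)

lemma Ev_gen [simp]: "Ev (wev r) (gen s) = r s"
  by (simp add: gen_def)

lemmas Ev_simps = Ev_add Ev_uminus Ev_diff Ev_mult Ev_one Ev_power Ev_const

lemma free_algebra_simps [simp]:
  "mult (free_algebra S) = (*)" "one (free_algebra S) = 1" "zero (free_algebra S) = 0"
  "add (free_algebra S) = (+)"
  by (simp_all add: free_algebra_def)

abbreviation FA :: "'s set \<Rightarrow> ('s word \<Rightarrow>\<^sub>0 'k::field) set" where
  "FA S \<equiv> carrier (free_algebra S)"

lemma FA_iff: "p \<in> FA S \<longleftrightarrow> (\<forall>w \<in> Poly_Mapping.keys p. set (letters w) \<subseteq> S)"
  by (simp add: free_algebra_def)

lemma FA_zero [simp]: "0 \<in> FA S" and FA_const [simp]: "const c \<in> FA S"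
  and FA_one [simp]: "1 \<in> FA S"
  by (auto simp: FA_iff zero_word_def split: if_splits)

lemma FA_gen [simp]: "gen s \<in> FA S \<longleftrightarrow> s \<in> S"
  by (simp add: FA_iff gen_def)

lemma FA_add [simp]: "p \<in> FA S \<Longrightarrow> q \<in> FA S \<Longrightarrow> p + q \<in> FA S"
  unfolding FA_iff using keys_add[of p q] by blast

lemma FA_uminus [simp]: "p \<in> FA S \<Longrightarrow> - p \<in> FA S"
  by (simp add: FA_iff in_keys_iff)

lemma FA_diff [simp]: "p \<in> FA S \<Longrightarrow> q \<in> FA S \<Longrightarrow> p - q \<in> FA S"
  using FA_add[of p S "- q"] by simp

lemma FA_mult [simp]: "p \<in> FA S \<Longrightarrow> q \<in> FA S \<Longrightarrow> p * q \<in> FA S"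
  unfolding FA_iff using keys_mult[of p q] by (fastforce simp: plus_word_def)

lemma FA_power [simp]: "p \<in> FA S \<Longrightarrow> p ^ i \<in> FA S"
  by (induction i) simp_all

lemma ring_free_algebra: "ring (free_algebra S :: ('s word \<Rightarrow>\<^sub>0 'k::field) ring)" (is "ring ?F")
proof (rule ringI)
  show "abelian_group ?F"
  proof (rule abelian_groupI)
    fix p :: "'s word \<Rightarrow>\<^sub>0 'k" assume "p \<in> FA S"
    then show "\<exists>q\<in>carrier ?F. q \<oplus>\<^bsub>?F\<^esub> p = \<zero>\<^bsub>?F\<^esub>"
      by (intro bexI[of _ "- p"]) simp_all
  qed (simp_all add: add_ac)
  show "monoid ?F"
    by (rule monoidI) (simp_all add: mult.assoc)
qed (simp_all add: distrib_left distrib_right)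

text \<open>A word is a product of generators and an element is a sum of scaled words. The rule
  reduces statements about the action of the whole algebra to its generators.\<close>

lemma free_algebra_induct [consumes 1, case_names const gen add mult]:
  fixes p :: "'s word \<Rightarrow>\<^sub>0 'k::field"
  assumes "p \<in> FA S"
    and const: "\<And>c. P (const c)" and gen: "\<And>s. s \<in> S \<Longrightarrow> P (gen s)"
    and add: "\<And>p q. p \<in> FA S \<Longrightarrow> q \<in> FA S \<Longrightarrow> P p \<Longrightarrow> P q \<Longrightarrow> P (p + q)"
    and mult: "\<And>p q. p \<in> FA S \<Longrightarrow> q \<in> FA S \<Longrightarrow> P p \<Longrightarrow> P q \<Longrightarrow> P (p * q)"
  shows "P p"
proof -
  have word: "P (Poly_Mapping.single (Word xs) c) \<and> Poly_Mapping.single (Word xs) c \<in> FA S"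
    if "set xs \<subseteq> S" for xs and c :: 'k
    using that
  proof (induction xs)
    case Nil
    show ?case using const[of c] FA_const[of c S] by (simp add: zero_word_def)
  next
    case (Cons x xs)
    have "Poly_Mapping.single (Word (x # xs)) c = gen x * Poly_Mapping.single (Word xs) c"
      by (simp add: gen_def mult_single plus_word_def)
    then show ?case using Cons gen[of x] mult[of "gen x"] by simp
  qed
  have "P (\<Sum>w\<in>K. Poly_Mapping.single w (Poly_Mapping.lookup p w)) \<and>
      (\<Sum>w\<in>K. Poly_Mapping.single w (Poly_Mapping.lookup p w)) \<in> FA S"
    if "finite K" "K \<subseteq> Poly_Mapping.keys p" for K
    using that
  proof (induction K rule: finite_induct)
    case empty
    show ?case using const[of 0] by simp
  next
    case (insert w K)
    have "set (letters w) \<subseteq> S" using insert.prems assms(1) by (simp add: FA_iff)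
    from word[OF this, of "Poly_Mapping.lookup p w"] insert show ?case by (simp add: add)
  qed
  from this[of "Poly_Mapping.keys p"] sum_singles[of p] show ?thesis by simp
qed

text \<open>Algebra maps from matrices to operators. Three of them occur: \<open>emb\<close>, and
  the embeddings \<open>kl\<close> and \<open>kr\<close> of the two factors of a tensor
  product.\<close>

definition mhom :: "nat \<Rightarrow> ('k::field mat \<Rightarrow> 'k endo) \<Rightarrow> bool" where
  "mhom d \<psi> \<longleftrightarrow> \<psi> (1\<^sub>m d) = 1 \<and>
    (\<forall>A\<in>carrier_mat d d. (\<forall>B\<in>carrier_mat d d. \<psi> (A * B) = \<psi> A * \<psi> B \<and> \<psi> (A + B) = \<psi> A + \<psi> B) \<and>
       (\<forall>c. \<psi> (c \<cdot>\<^sub>m A) = c *\<^sub>E \<psi> A))"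

lemma mhom_emb: "d > 0 \<Longrightarrow> mhom d (emb d)"
  by (simp add: mhom_def emb_mult emb_add emb_one emb_smult)

lemma emb_inj:
  assumes "d > 0" "A \<in> carrier_mat d d" "B \<in> carrier_mat d d" "emb d A = emb d B"
  shows "A = B"
  using assms emb_inject by metis

section \<open>Algebras given by generators and relations, and their modules\<close>

locale presentation =
  fixes S :: "'s set" and R :: "('s word \<Rightarrow>\<^sub>0 'k::field) set"
  assumes R_sub: "R \<subseteq> FA S"
begin

abbreviation Fr :: "('s word \<Rightarrow>\<^sub>0 'k) ring" where "Fr \<equiv> free_algebra S"
abbreviation Rel :: "('s word \<Rightarrow>\<^sub>0 'k) set" where "Rel \<equiv> Idl\<^bsub>Fr\<^esub> R"
abbreviation Alg :: "('k, ('s word \<Rightarrow>\<^sub>0 'k) set) module" where "Alg \<equiv> presented_algebra S R"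
abbreviation cl :: "('s word \<Rightarrow>\<^sub>0 'k) \<Rightarrow> ('s word \<Rightarrow>\<^sub>0 'k) set" where "cl \<equiv> presented_class S R"

sublocale Fr: ring Fr by (rule ring_free_algebra)

sublocale Idl: ideal Rel Fr by (rule Fr.genideal_ideal[OF R_sub])

lemma cl_eq: "cl p = Rel +>\<^bsub>Fr\<^esub> p"
  by (simp add: presented_class_def Let_def)

lemma algebra_simps':
  "carrier Alg = carrier (Fr Quot Rel)" "mult Alg = mult (Fr Quot Rel)" "one Alg = one (Fr Quot Rel)"
  "zero Alg = zero (Fr Quot Rel)" "add Alg = add (Fr Quot Rel)" "c \<odot>\<^bsub>Alg\<^esub> X = cl (const c) \<otimes>\<^bsub>Fr Quot Rel\<^esub> X"
  by (simp_all add: presented_algebra_def Let_def cl_eq)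

lemma carrier_A: "carrier Alg = cl ` FA S"
  by (auto simp: algebra_simps' FactRing_def A_RCOSETS_def' cl_eq)

lemma cl_hom: "cl \<in> Ring.ring_hom Fr (Fr Quot Rel)"
  using Idl.rcos_ring_hom by (simp add: cl_eq[abs_def])

lemma cl_ops:
  assumes "p \<in> FA S" "q \<in> FA S"
  shows "cl p \<otimes>\<^bsub>Alg\<^esub> cl q = cl (p * q)" "cl p \<oplus>\<^bsub>Alg\<^esub> cl q = cl (p + q)" "\<one>\<^bsub>Alg\<^esub> = cl 1"
    "c \<odot>\<^bsub>Alg\<^esub> cl p = cl (const c * p)"
  using assms ring_hom_mult[OF cl_hom] ring_hom_add[OF cl_hom] ring_hom_one[OF cl_hom]
  by (simp_all add: algebra_simps')

lemma minus_F: "p \<in> FA S \<Longrightarrow> q \<in> FA S \<Longrightarrow> p \<ominus>\<^bsub>Fr\<^esub> q = p - q"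
  using Fr.minus_equality[of "- q" q] by (simp add: a_minus_def)

lemma cl_eq_iff: "p \<in> FA S \<Longrightarrow> q \<in> FA S \<Longrightarrow> cl p = cl q \<longleftrightarrow> p - q \<in> Rel"
  using Fr.quotient_eq_iff_same_a_r_cos[OF Idl.is_ideal, of p q] by (simp add: cl_eq minus_F)

lemma cl_rel: "r \<in> R \<Longrightarrow> cl r = cl 0"
  using cl_eq_iff[of r 0] R_sub Fr.genideal_self[OF R_sub] by auto

text \<open>The modules built from generators and the tensor products act through a chosen element
  of a coset; this makes the choice harmless.\<close>

lemma some_rep:
  assumes "X \<in> carrier Alg"
  shows "(SOME p. p \<in> X) \<in> FA S" "cl (SOME p. p \<in> X) = X"
proof -
  from assms obtain p where p: "p \<in> FA S" "X = cl p" by (auto simp: carrier_A)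
  then have "p \<in> X" by (simp add: cl_eq Idl.a_rcos_self)
  then have q: "(SOME p. p \<in> X) \<in> X" by (rule someI)
  with p have "X \<subseteq> FA S"
    using Fr.a_r_coset_subset_G[OF Idl.a_subset] by (simp add: cl_eq)
  with q show "(SOME p. p \<in> X) \<in> FA S" by blast
  from q p show "cl (SOME p. p \<in> X) = X"
    using Fr.a_repr_independence[OF _ _ Idl.a_subgroup] by (simp add: cl_eq)
qed

lemma rep_hom:
  assumes M: "fd_module Alg M" and p: "p \<in> FA S" and q: "q \<in> FA S"
  shows "mact M (cl p) \<in> carrier_mat (mdim M) (mdim M)"
    "mact M (cl (p * q)) = mact M (cl p) * mact M (cl q)"
    "mact M (cl (p + q)) = mact M (cl p) + mact M (cl q)"
    "mact M (cl 1) = 1\<^sub>m (mdim M)"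
    "mact M (cl (const c * p)) = c \<cdot>\<^sub>m mact M (cl p)"
proof -
  from M have h: "mact M \<in> Ring.ring_hom Alg (ring_mat TYPE('k) (mdim M) ())"
    and s: "X \<in> carrier Alg \<Longrightarrow> mact M (c \<odot>\<^bsub>Alg\<^esub> X) = c \<cdot>\<^sub>m mact M X" for X c
    by (simp_all add: fd_module_def)
  have X: "cl p \<in> carrier Alg" "cl q \<in> carrier Alg" using p q by (auto simp: carrier_A)
  show "mact M (cl p) \<in> carrier_mat (mdim M) (mdim M)"
    using ring_hom_closed[OF h X(1)] by (simp add: ring_mat_simps)
  show "mact M (cl (p * q)) = mact M (cl p) * mact M (cl q)"
    "mact M (cl (p + q)) = mact M (cl p) + mact M (cl q)"
    "mact M (cl 1) = 1\<^sub>m (mdim M)"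
    using ring_hom_mult[OF h X] ring_hom_add[OF h X] ring_hom_one[OF h]
    by (simp_all add: ring_mat_simps cl_ops[OF p q])
  show "mact M (cl (const c * p)) = c \<cdot>\<^sub>m mact M (cl p)"
    using s[OF X(1), of c] by (simp add: cl_ops[OF p q])
qed

lemma rep_const: "fd_module Alg M \<Longrightarrow> mact M (cl (const c)) = c \<cdot>\<^sub>m 1\<^sub>m (mdim M)"
  using rep_hom(5)[of M 1 1 c] rep_hom(4)[of M 1 1] by simp

text \<open>Composing the class map, the module action and \<psi> gives an algebra map on the free
  algebra, which its values on generators determine.\<close>

lemma mhom_rep:
  assumes M: "fd_module Alg M" and \<psi>: "mhom (mdim M) \<psi>" and p: "p \<in> FA S"
  shows "\<psi> (mact M (cl p)) = Ev (wev (\<lambda>s. \<psi> (mact M (cl (gen s))))) p"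
  using p
proof (induction rule: free_algebra_induct)
  case (const c)
  show ?case using \<psi> by (simp add: rep_const[OF M] mhom_def Ev_const)
next
  case (add p q)
  note c = rep_hom(1)[OF M add(1) add(2)] rep_hom(1)[OF M add(2) add(2)]
  have "\<psi> (mact M (cl p) + mact M (cl q)) = \<psi> (mact M (cl p)) + \<psi> (mact M (cl q))"
    using \<psi> c unfolding mhom_def by blast
  then show ?case using add(3,4) by (simp add: rep_hom(3)[OF M add(1,2)] Ev_add)
next
  case (mult p q)
  note c = rep_hom(1)[OF M mult(1) mult(2)] rep_hom(1)[OF M mult(2) mult(2)]
  have "\<psi> (mact M (cl p) * mact M (cl q)) = \<psi> (mact M (cl p)) * \<psi> (mact M (cl q))"
    using \<psi> c unfolding mhom_def by blast
  then show ?case using mult(3,4) by (simp add: rep_hom(2)[OF M mult(1,2)] Ev_mult)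
qed simp

lemma mhom_rel:
  assumes M: "fd_module Alg M" and \<psi>: "mhom (mdim M) \<psi>" and r: "r \<in> R"
  shows "Ev (wev (\<lambda>s. \<psi> (mact M (cl (gen s))))) r = 0"
proof -
  have "Ev (wev (\<lambda>s. \<psi> (mact M (cl (gen s))))) r = \<psi> (mact M (cl 0))"
    using mhom_rep[OF M \<psi>, of r] r R_sub cl_rel[OF r] by auto
  also have "\<dots> = 0" by (simp add: mhom_rep[OF M \<psi>])
  finally show ?thesis .
qed

text \<open>The kernel of the evaluation is an ideal containing \<open>R\<close>, hence contains the
  ideal generated by \<open>R\<close>.\<close>

lemma Ev_Idl:
  assumes "\<And>r. r \<in> R \<Longrightarrow> Ev (wev op) r = 0" and "p \<in> Rel"
  shows "Ev (wev op) p = 0"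
proof -
  let ?K = "{p \<in> FA S. Ev (wev op) p = 0}"
  have m: "inv\<^bsub>\<lparr>carrier = FA S, mult = (+), one = 0\<rparr>\<^esub> p = - p"
    if "p \<in> FA S" for p :: "'s word \<Rightarrow>\<^sub>0 'k"
    using minus_F[of 0 p] that by (simp add: a_minus_def a_inv_def)
  have "ideal ?K Fr"
    by (rule idealI[OF Fr.ring_axioms], rule group.subgroupI[OF Fr.a_group])
      (auto simp: Ev_simps m)
  moreover have "R \<subseteq> ?K" using assms(1) R_sub by auto
  ultimately have "Rel \<subseteq> ?K" by (rule Fr.genideal_minimal)
  with assms(2) show ?thesis by auto
qed

text \<open>By \<open>Ev_Idl\<close> the evaluation does not depend on the representative, so the
  action of a class is the evaluation of any of its elements. The module laws then hold among
  operators and pass back to matrices because \<open>emb\<close> is injective on them.\<close>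

lemma fd_module_of_operators:
  assumes d: "mdim M > 0"
    and rel: "\<And>r. r \<in> R \<Longrightarrow> Ev (wev op) r = 0"
    and car: "\<And>p. p \<in> FA S \<Longrightarrow> mact M (cl p) \<in> carrier_mat (mdim M) (mdim M)"
    and act: "\<And>X. X \<in> carrier Alg \<Longrightarrow> emb (mdim M) (mact M X) = Ev (wev op) (SOME p. p \<in> X)"
  shows "fd_module Alg M" "p \<in> FA S \<Longrightarrow> emb (mdim M) (mact M (cl p)) = Ev (wev op) p"
proof -
  have ev: "emb (mdim M) (mact M (cl p)) = Ev (wev op) p" if p: "p \<in> FA S" for p
  proof -
    have X: "cl p \<in> carrier Alg" using p by (auto simp: carrier_A)
    from some_rep[OF X] p have "p - (SOME q. q \<in> cl p) \<in> Rel"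
      using cl_eq_iff by metis
    from Ev_Idl[OF rel this] act[OF X] show ?thesis by (simp add: Ev_diff)
  qed
  show "p \<in> FA S \<Longrightarrow> emb (mdim M) (mact M (cl p)) = Ev (wev op) p" by (rule ev)
  have "mact M (cl (p * q)) = mact M (cl p) * mact M (cl q)" if "p \<in> FA S" "q \<in> FA S" for p q
    by (rule emb_inj[OF d])
      (simp_all add: ev emb_mult[OF d] Ev_simps car that mult_carrier_mat[OF car car])
  moreover have "mact M (cl (p + q)) = mact M (cl p) + mact M (cl q)"
    if "p \<in> FA S" "q \<in> FA S" for p q
    by (rule emb_inj[OF d]) (use that car in \<open>simp_all add: ev emb_add[OF d] Ev_simps\<close>)
  moreover have "mact M (cl 1) = 1\<^sub>m (mdim M)"
    by (rule emb_inj[OF d]) (use car in \<open>simp_all add: ev emb_one[OF d] Ev_simps\<close>)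
  moreover have "mact M (cl (const c * p)) = c \<cdot>\<^sub>m mact M (cl p)" if "p \<in> FA S" for p c
    by (rule emb_inj[OF d]) (use car that in \<open>simp_all add: ev emb_smult[OF d] Ev_mult Ev_const\<close>)
  ultimately show "fd_module Alg M"
    unfolding fd_module_def
    by (auto intro!: ring_hom_memI simp: ring_mat_simps carrier_A cl_ops cl_ops(3)[OF FA_zero FA_zero] car)
qed

lemma fd_hom_gens:
  assumes M: "fd_module Alg M" and N: "fd_module Alg N" and T: "T \<in> carrier_mat (mdim N) (mdim M)"
    and gens: "\<And>s. s \<in> S \<Longrightarrow> T * mact M (cl (gen s)) = mact N (cl (gen s)) * T"
  shows "T \<in> fd_hom Alg M N"
proof -
  have "T * mact M (cl p) = mact N (cl p) * T" if "p \<in> FA S" for p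
    using that
  proof (induction rule: free_algebra_induct)
    case (const c)
    show ?case using mult_smult_distrib[OF T one_carrier_mat, of c]
      mult_smult_assoc_mat[OF one_carrier_mat T, of c] T
      by (simp add: rep_const[OF M] rep_const[OF N])
  next
    case (add p q)
    note c = rep_hom(1)[OF M add(1) add(2)] rep_hom(1)[OF M add(2) add(2)]
      rep_hom(1)[OF N add(1) add(2)] rep_hom(1)[OF N add(2) add(2)]
    show ?case
      using add(3,4) mult_add_distrib_mat[OF T c(1,2)] add_mult_distrib_mat[OF c(3,4) T]
      by (simp add: rep_hom(3)[OF M add(1,2)] rep_hom(3)[OF N add(1,2)])
  next
    case (mult p q)
    note c = rep_hom(1)[OF M mult(1) mult(2)] rep_hom(1)[OF M mult(2) mult(2)]
      rep_hom(1)[OF N mult(1) mult(2)] rep_hom(1)[OF N mult(2) mult(2)]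
    have "T * (mact M (cl p) * mact M (cl q)) = mact N (cl p) * (T * mact M (cl q))"
      using assoc_mult_mat[OF T c(1,2)] assoc_mult_mat[OF c(3) T c(2)] mult(3) by simp
    also have "\<dots> = mact N (cl p) * mact N (cl q) * T"
      using assoc_mult_mat[OF c(3,4) T] mult(4) by simp
    finally show ?case by (simp add: rep_hom(2)[OF M mult(1,2)] rep_hom(2)[OF N mult(1,2)])
  qed (rule gens)
  with T show ?thesis by (auto simp: fd_hom_def carrier_A)
qed

end


section \<open>Character groups and q-integers\<close>

lemma group_kunits: "group (kunits :: 'k::field monoid)"
proof (rule groupI)
  fix x :: 'k assume "x \<in> carrier kunits"
  then show "\<exists>y\<in>carrier kunits. y \<otimes>\<^bsub>kunits\<^esub> x = \<one>\<^bsub>kunits\<^esub>"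
    by (intro bexI[of _ "inverse x"]) (simp_all add: kunits_def)
qed (simp_all add: kunits_def)

lemma kunits_simps [simp]:
  "carrier kunits = {c::'k::field. c \<noteq> 0}" "mult kunits = ((*) :: 'k \<Rightarrow> _)" "one kunits = (1::'k)"
  by (simp_all add: kunits_def)

lemma kunits_pow [simp]: "(c::'k::field) [^]\<^bsub>kunits\<^esub> (i::nat) = c ^ i"
  by (induction i) (simp_all add: nat_pow_def mult.commute)

lemma characters_simps [simp]:
  "mult (characters G) = (\<lambda>\<psi> \<theta>. \<lambda>g\<in>carrier G. \<psi> g * \<theta> g)"
  "one (characters G) = (\<lambda>g\<in>carrier G. 1)"
  by (simp_all add: characters_def)

lemma characters_iff: "\<psi> \<in> carrier (characters G) \<longleftrightarrow> \<psi> \<in> hom G kunits \<and> \<psi> \<in> extensional (carrier G)"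
  by (simp add: characters_def)

lemma characters_mult:
  "\<psi> \<in> carrier (characters G) \<Longrightarrow> g \<in> carrier G \<Longrightarrow> h \<in> carrier G \<Longrightarrow> \<psi> (g \<otimes>\<^bsub>G\<^esub> h) = \<psi> g * \<psi> h"
  and characters_nonzero: "\<psi> \<in> carrier (characters G) \<Longrightarrow> g \<in> carrier G \<Longrightarrow> \<psi> g \<noteq> 0"
  by (auto simp: characters_iff hom_def Pi_def)

lemma characters_one:
  assumes "group G" "\<psi> \<in> carrier (characters G)"
  shows "\<psi> \<one>\<^bsub>G\<^esub> = 1"
proof -
  interpret group G by fact
  have "\<psi> \<one>\<^bsub>G\<^esub> * \<psi> \<one>\<^bsub>G\<^esub> = \<psi> \<one>\<^bsub>G\<^esub>" "\<psi> \<one>\<^bsub>G\<^esub> \<noteq> 0"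
    using characters_mult[OF assms(2), of "\<one>\<^bsub>G\<^esub>" "\<one>\<^bsub>G\<^esub>"] characters_nonzero[OF assms(2)] by auto
  then show ?thesis by simp
qed

lemma characters_memI:
  assumes "\<And>g. g \<in> carrier G \<Longrightarrow> \<psi> g \<noteq> 0"
    and "\<And>g h. g \<in> carrier G \<Longrightarrow> h \<in> carrier G \<Longrightarrow> \<psi> (g \<otimes>\<^bsub>G\<^esub> h) = \<psi> g * \<psi> h"
    and "\<psi> \<in> extensional (carrier G)"
  shows "\<psi> \<in> carrier (characters G)"
  using assms by (auto simp: characters_iff hom_def)

lemma comm_group_characters:
  assumes "group G"
  shows "comm_group (characters G :: ('a \<Rightarrow> 'b::field) monoid)"
proof (rule comm_groupI)
  interpret group G by fact
  fix \<psi> \<theta> :: "'a \<Rightarrow> 'b"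
  assume p: "\<psi> \<in> carrier (characters G)"
  {
    assume q: "\<theta> \<in> carrier (characters G)"
    show "\<psi> \<otimes>\<^bsub>characters G\<^esub> \<theta> \<in> carrier (characters G)"
      by (rule characters_memI) (use p q in \<open>auto simp: characters_mult characters_nonzero\<close>)
    show "\<psi> \<otimes>\<^bsub>characters G\<^esub> \<theta> = \<theta> \<otimes>\<^bsub>characters G\<^esub> \<psi>"
      by (auto simp: fun_eq_iff mult.commute)
    fix \<eta> :: "'a \<Rightarrow> 'b"
    show "\<psi> \<otimes>\<^bsub>characters G\<^esub> \<theta> \<otimes>\<^bsub>characters G\<^esub> \<eta> = \<psi> \<otimes>\<^bsub>characters G\<^esub> (\<theta> \<otimes>\<^bsub>characters G\<^esub> \<eta>)"
      by (auto simp: fun_eq_iff mult.assoc)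
  }
  show "\<one>\<^bsub>characters G\<^esub> \<otimes>\<^bsub>characters G\<^esub> \<psi> = \<psi>"
    using p by (auto simp: fun_eq_iff characters_iff extensional_def)
  have "(\<lambda>g\<in>carrier G. inverse (\<psi> g)) \<in> carrier (characters G)"
    by (rule characters_memI) (use p in \<open>auto simp: characters_mult characters_nonzero\<close>)
  then show "\<exists>\<theta>\<in>carrier (characters G). \<theta> \<otimes>\<^bsub>characters G\<^esub> \<psi> = \<one>\<^bsub>characters G\<^esub>"
    by (rule bexI[rotated]) (use p in \<open>auto simp: fun_eq_iff characters_nonzero\<close>)
next
  interpret group G by fact
  show "\<one>\<^bsub>characters G\<^esub> \<in> carrier (characters G :: ('a \<Rightarrow> 'b::field) monoid)"
    by (rule characters_memI) auto
qed

lemma characters_inv: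
  assumes "group G" "\<psi> \<in> carrier (characters G)" "g \<in> carrier G"
  shows "(inv\<^bsub>characters G\<^esub> \<psi>) g = inverse (\<psi> g)"
proof -
  interpret C: comm_group "characters G" by (rule comm_group_characters) fact
  have "(inv\<^bsub>characters G\<^esub> \<psi> \<otimes>\<^bsub>characters G\<^esub> \<psi>) g = 1"
    using C.l_inv[OF assms(2)] assms(3) by simp
  then show ?thesis
    using characters_nonzero[OF assms(2,3)] assms(3) by (simp add: field_simps)
qed

lemma characters_pow:
  assumes "g \<in> carrier G"
  shows "(\<psi> [^]\<^bsub>characters G\<^esub> (i::nat)) g = \<psi> g ^ i"
  using assms by (induction i) (simp_all add: nat_pow_def mult.commute)

text \<open>The values are roots of unity of exponent |G|, of which a field has finitely many.
  Finiteness of \<Gamma> makes averaging over it possible.\<close>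

lemma finite_characters:
  assumes "group G" "finite (carrier G)"
  shows "finite (carrier (characters G :: ('a \<Rightarrow> 'k::field) monoid))"
proof -
  interpret group G by fact
  let ?m = "card (carrier G)"
  have m: "?m > 0" using assms(2) by (simp add: card_gt_0_iff) blast
  let ?U = "{c::'k. c ^ ?m = 1}"
  have U: "finite ?U"
  proof (rule finite_subset)
    show "?U \<subseteq> {c. poly (Polynomial.monom 1 ?m - 1 :: 'k poly) c = 0}" by (auto simp: Polynomial.poly_monom)
    have "Polynomial.coeff (Polynomial.monom 1 ?m - 1 :: 'k poly) ?m = 1" using m by simp
    then show "finite {c. poly (Polynomial.monom 1 ?m - 1 :: 'k poly) c = 0}"
      by (intro poly_roots_finite) (metis Polynomial.coeff_0 zero_neq_one)
  qed
  have "carrier (characters G) \<subseteq> (carrier G \<rightarrow>\<^sub>E ?U)"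
  proof
    fix \<psi> :: "'a \<Rightarrow> 'k" assume p: "\<psi> \<in> carrier (characters G)"
    have pw: "\<psi> (g [^]\<^bsub>G\<^esub> (i::nat)) = \<psi> g ^ i" if "g \<in> carrier G" for g i
      using that
      by (induction i) (simp_all add: characters_one[OF assms(1) p] characters_mult[OF p] mult.commute)
    have "\<psi> g ^ ?m = 1" if "g \<in> carrier G" for g
      using pw[OF that, of ?m] pow_order_eq_1[OF that] characters_one[OF assms(1) p]
      by (simp add: Coset.order_def)
    then show "\<psi> \<in> carrier G \<rightarrow>\<^sub>E ?U"
      using p by (auto simp: characters_iff extensional_def)
  qed
  then show ?thesis
    by (rule finite_subset) (rule finite_PiE[OF assms(2) U])
qed

lemma qint_0 [simp]: "qint q 0 = 0" and qint_Suc: "qint q (Suc i) = qint q i + q ^ i"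
  by (simp_all add: qint_def)

lemma qint_1 [simp]: "qint q (Suc 0) = 1"
  by (simp add: qint_Suc)

lemma qint_Suc': "qint q (Suc i) = 1 + q * qint q i"
  unfolding qint_def by (subst sum.lessThan_Suc_shift) (simp add: sum_distrib_left)

lemma qint_add: "qint q (i + j) = qint q i + q ^ i * qint q j"
  by (induction j) (simp_all add: qint_Suc algebra_simps power_add)

lemma qint_geometric: "(q - 1) * qint q i = q ^ i - 1"
  by (induction i) (simp_all add: qint_Suc algebra_simps)

lemma qfact_0 [simp]: "qfact q 0 = 1" and qfact_Suc: "qfact q (Suc i) = qfact q i * qint q (Suc i)"
  by (simp_all add: qfact_def mult.commute)

section \<open>Group data and the root of unity \<rho>\<close>

locale gdatum =
  fixes D :: "('g, 'k::{field_char_0}) datum"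
  assumes gd: "group_datum D"
begin

abbreviation G where "G \<equiv> grp D"
abbreviation a where "a \<equiv> elt D"
abbreviation \<rho> where "\<rho> \<equiv> rho D"
abbreviation n where "n \<equiv> ordn D"
abbreviation \<chi> where "\<chi> \<equiv> chi D"
abbreviation nilp where "nilp \<equiv> nilpotent_type D"

sublocale G: comm_group G using gd by (simp add: group_datum_def)
sublocale \<Gamma>: comm_group "Gam D" by (rule comm_group_characters) (rule G.is_group)
sublocale GG: comm_group "G \<times>\<times> Gam D"
  by (rule group.group_comm_groupI[OF DirProd_group])
    (auto intro: G.is_group \<Gamma>.is_group simp: G.m_comm \<Gamma>.m_comm simp del: characters_simps)
sublocale \<Lambda>: comm_group "Lam D" by (rule comm_group_characters) (rule GG.is_group)

lemma finite_G: "finite (carrier G)" and \<chi>_in [simp]: "\<chi> \<in> carrier (Gam D)"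
  and a_in [simp]: "a \<in> carrier G" and n_ge2: "n \<ge> 2"
  and nonnilp_scal: "\<not> nilp \<Longrightarrow> scal D = 1"
  using gd by (simp_all add: group_datum_def)

lemma finite_\<Gamma>: "finite (carrier (Gam D))"
  by (rule finite_characters[OF G.is_group finite_G])

lemma char_nz: "\<gamma> \<in> carrier (Gam D) \<Longrightarrow> g \<in> carrier G \<Longrightarrow> \<gamma> g \<noteq> 0"
  by (rule characters_nonzero)

lemma char_mult: "\<gamma> \<in> carrier (Gam D) \<Longrightarrow> g \<in> carrier G \<Longrightarrow> h \<in> carrier G \<Longrightarrow> \<gamma> (g \<otimes>\<^bsub>G\<^esub> h) = \<gamma> g * \<gamma> h"
  by (rule characters_mult)

lemma char_one: "\<gamma> \<in> carrier (Gam D) \<Longrightarrow> \<gamma> \<one>\<^bsub>G\<^esub> = 1"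
  by (rule characters_one[OF G.is_group])

lemma inv_chi: "g \<in> carrier G \<Longrightarrow> (inv\<^bsub>Gam D\<^esub> \<chi>) g = inverse (\<chi> g)"
  by (rule characters_inv[OF G.is_group \<chi>_in])

lemma char_pow: "g \<in> carrier G \<Longrightarrow> (\<gamma> [^]\<^bsub>Gam D\<^esub> (i::nat)) g = \<gamma> g ^ i"
  by (rule characters_pow)

lemma rho_eq: "\<chi> a = \<rho>"
  by (simp add: rho_def)

lemma rho_nz [simp]: "\<rho> \<noteq> 0"
  by (metis rho_eq char_nz \<chi>_in a_in)

lemma rho_pow_eq_1: "\<rho> ^ k = 1 \<longleftrightarrow> n dvd k"
  using group.pow_eq_id[OF group_kunits, of "\<rho>" k] by (simp add: ordn_def)

lemma rho_n [simp]: "\<rho> ^ n = 1"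
  by (simp add: rho_pow_eq_1)

lemma rho_pow_neq: "0 < k \<Longrightarrow> k < n \<Longrightarrow> \<rho> ^ k \<noteq> 1"
  by (auto simp: rho_pow_eq_1 dest: dvd_imp_le)

lemma rho_ne_1: "\<rho> \<noteq> 1"
  using rho_pow_neq[of 1] n_ge2 by simp

lemma qint_n [simp]: "qint \<rho> n = 0"
  using qint_geometric[of \<rho> n] rho_ne_1 by simp

lemma qint_nz: "0 < k \<Longrightarrow> k < n \<Longrightarrow> qint \<rho> k \<noteq> 0"
  using qint_geometric[of \<rho> k] rho_pow_neq[of k] by auto

lemma qfact_nz: "k < n \<Longrightarrow> qfact \<rho> k \<noteq> 0"
  by (induction k) (simp_all add: qfact_Suc qint_nz)

lemma nonnilp_chi: "\<not> nilp \<Longrightarrow> g \<in> carrier G \<Longrightarrow> \<chi> g ^ n = 1"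
  using gd char_pow[of g \<chi> n] by (simp add: group_datum_def)

lemma nonnilp_chi_pow: "\<not> nilp \<Longrightarrow> \<chi> [^]\<^bsub>Gam D\<^esub> n = \<one>\<^bsub>Gam D\<^esub>"
  using gd by (simp add: group_datum_def)

end

text \<open>Operators satisfying the relations of the double.\<close>

locale double_ops = gdatum D for D :: "('g, 'k::field_char_0) datum" +
  fixes go :: "'g \<Rightarrow> 'k endo" and co :: "('g \<Rightarrow> 'k) \<Rightarrow> 'k endo" and X Y :: "'k endo"
  assumes go_mult: "\<And>g h. g \<in> carrier G \<Longrightarrow> h \<in> carrier G \<Longrightarrow> go (g \<otimes>\<^bsub>G\<^esub> h) = go g * go h"
    and go_one: "go \<one>\<^bsub>G\<^esub> = 1"
    and co_mult: "\<And>\<gamma> \<delta>. \<gamma> \<in> carrier (Gam D) \<Longrightarrow> \<delta> \<in> carrier (Gam D) \<Longrightarrow>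
        co (\<gamma> \<otimes>\<^bsub>Gam D\<^esub> \<delta>) = co \<gamma> * co \<delta>"
    and co_one: "co \<one>\<^bsub>Gam D\<^esub> = 1"
    and X_pow: "X ^ n = scal D *\<^sub>E (go a ^ n - 1)"
    and X_go: "\<And>g. g \<in> carrier G \<Longrightarrow> X * go g = \<chi> g *\<^sub>E (go g * X)"
    and Y_pow: "Y ^ n = 0"
    and Y_co: "\<And>\<gamma>. \<gamma> \<in> carrier (Gam D) \<Longrightarrow> Y * co \<gamma> = \<gamma> a *\<^sub>E (co \<gamma> * Y)"
    and go_co: "\<And>g \<gamma>. g \<in> carrier G \<Longrightarrow> \<gamma> \<in> carrier (Gam D) \<Longrightarrow> go g * co \<gamma> = co \<gamma> * go g"
    and Y_go: "\<And>g. g \<in> carrier G \<Longrightarrow> Y * go g = inverse (\<chi> g) *\<^sub>E (go g * Y)"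
    and XY: "X * Y - Y * X = go a - co \<chi>"
    and X_co: "\<And>\<gamma>. \<gamma> \<in> carrier (Gam D) \<Longrightarrow> \<gamma> a *\<^sub>E (X * co \<gamma>) = co \<gamma> * X +
        (if nilp then 0 else ((\<gamma> a ^ n - 1) / qfact \<rho> (n - 1)) *\<^sub>E
           (co \<gamma> * (\<rho> *\<^sub>E go a - co \<chi>) * Y ^ (n - 1)))"

context gdatum
begin

abbreviation ops :: "(('g, 'k) dgen \<Rightarrow> 'k endo) \<Rightarrow> bool" where
  "ops r \<equiv> double_ops D (\<lambda>g. r (GrpGen g)) (\<lambda>\<gamma>. r (ChrGen \<gamma>)) (r XGen) (r XiGen)"

lemma dgens_simps [simp]:
  "GrpGen g \<in> dgens D \<longleftrightarrow> g \<in> carrier G" "ChrGen \<gamma> \<in> dgens D \<longleftrightarrow> \<gamma> \<in> carrier (Gam D)"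
  "XGen \<in> dgens D" "XiGen \<in> dgens D"
  by (auto simp: dgens_def)

lemma drels_sub: "drels D \<subseteq> FA (dgens D)"
proof -
  have c: "\<And>g h. g \<in> carrier G \<Longrightarrow> h \<in> carrier G \<Longrightarrow> g \<otimes>\<^bsub>G\<^esub> h \<in> carrier G" by simp
  have c': "\<And>g h. g \<in> carrier (Gam D) \<Longrightarrow> h \<in> carrier (Gam D) \<Longrightarrow> g \<otimes>\<^bsub>Gam D\<^esub> h \<in> carrier (Gam D)"
    by (rule \<Gamma>.m_closed)
  show ?thesis
    unfolding drels_def Let_def
    using \<Gamma>.one_closed by (auto simp: c c' simp del: characters_simps)
qed

sublocale presentation "dgens D" "drels D"
  by unfold_locales (rule drels_sub)

text \<open>Each family of relations evaluates to one axiom of \<open>double_ops\<close>. Hence both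
  the proof that a construction is a module and the use of a given module take place inside that
  locale.\<close>

lemma rels_iff: "(\<forall>r\<in>drels D. Ev (wev op) r = 0) \<longleftrightarrow> ops op"
proof
  assume r: "\<forall>r\<in>drels D. Ev (wev op) r = 0"
  have m: "multiplicative (wev op)" by simp
  note e = Ev_add Ev_uminus Ev_diff Ev_mult[OF m] Ev_one[OF m] Ev_power[OF m] Ev_const[OF m]
  show "ops op"
  proof
    fix g h assume "g \<in> carrier G" "h \<in> carrier G"
    then have "gen (GrpGen (g \<otimes>\<^bsub>G\<^esub> h)) - gen (GrpGen g) * gen (GrpGen h) \<in> drels D"
      unfolding drels_def Let_def by blast
    then show "op (GrpGen (g \<otimes>\<^bsub>G\<^esub> h)) = op (GrpGen g) * op (GrpGen h)"
      using bspec[OF r] by (force simp: e)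
  next
    have "gen (GrpGen \<one>\<^bsub>G\<^esub>) - 1 \<in> drels D" unfolding drels_def Let_def by blast
    from bspec[OF r this] show "op (GrpGen \<one>\<^bsub>G\<^esub>) = 1" by (simp add: e)
  next
    fix \<gamma> \<delta> assume "\<gamma> \<in> carrier (Gam D)" "\<delta> \<in> carrier (Gam D)"
    then have "gen (ChrGen (\<gamma> \<otimes>\<^bsub>Gam D\<^esub> \<delta>)) - gen (ChrGen \<gamma>) * gen (ChrGen \<delta>) \<in> drels D"
      unfolding drels_def Let_def by blast
    from bspec[OF r this] show "op (ChrGen (\<gamma> \<otimes>\<^bsub>Gam D\<^esub> \<delta>)) = op (ChrGen \<gamma>) * op (ChrGen \<delta>)"
      by (simp add: e del: characters_simps)
  next
    have "gen (ChrGen \<one>\<^bsub>Gam D\<^esub>) - 1 \<in> drels D" unfolding drels_def Let_def by blast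
    from bspec[OF r this] show "op (ChrGen \<one>\<^bsub>Gam D\<^esub>) = 1" by (simp add: e del: characters_simps)
  next
    have "gen XGen ^ n - const (scal D) * (gen (GrpGen a) ^ n - 1) \<in> drels D"
      unfolding drels_def Let_def by blast
    from bspec[OF r this] show "op XGen ^ n = scal D *\<^sub>E (op (GrpGen a) ^ n - 1)" by (simp add: e)
  next
    fix g assume "g \<in> carrier G"
    then have "gen XGen * gen (GrpGen g) - const (\<chi> g) * gen (GrpGen g) * gen XGen \<in> drels D"
      unfolding drels_def Let_def by blast
    from bspec[OF r this] show "op XGen * op (GrpGen g) = \<chi> g *\<^sub>E (op (GrpGen g) * op XGen)"
      by (simp add: e)
  next
    have "gen XiGen ^ n \<in> drels D" unfolding drels_def Let_def by blast
    from bspec[OF r this] show "op XiGen ^ n = 0" by (simp add: e)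
  next
    fix \<gamma> assume "\<gamma> \<in> carrier (Gam D)"
    then have "gen XiGen * gen (ChrGen \<gamma>) - const (\<gamma> a) * gen (ChrGen \<gamma>) * gen XiGen \<in> drels D"
      unfolding drels_def Let_def by blast
    from bspec[OF r this] show "op XiGen * op (ChrGen \<gamma>) = \<gamma> a *\<^sub>E (op (ChrGen \<gamma>) * op XiGen)"
      by (simp add: e)
  next
    fix g \<gamma> assume "g \<in> carrier G" "\<gamma> \<in> carrier (Gam D)"
    then have "gen (GrpGen g) * gen (ChrGen \<gamma>) - gen (ChrGen \<gamma>) * gen (GrpGen g) \<in> drels D"
      unfolding drels_def Let_def by blast
    from bspec[OF r this] show "op (GrpGen g) * op (ChrGen \<gamma>) = op (ChrGen \<gamma>) * op (GrpGen g)"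
      by (simp add: e)
  next
    fix g assume g: "g \<in> carrier G"
    then have "gen XiGen * gen (GrpGen g) - const ((inv\<^bsub>Gam D\<^esub> \<chi>) g) * gen (GrpGen g) * gen XiGen \<in> drels D"
      unfolding drels_def Let_def by blast
    from bspec[OF r this] g show "op XiGen * op (GrpGen g) = inverse (\<chi> g) *\<^sub>E (op (GrpGen g) * op XiGen)"
      by (simp add: e inv_chi)
  next
    have "gen XGen * gen XiGen - gen XiGen * gen XGen - (gen (GrpGen a) - gen (ChrGen \<chi>)) \<in> drels D"
      unfolding drels_def Let_def by blast
    from bspec[OF r this]
    show "op XGen * op XiGen - op XiGen * op XGen = op (GrpGen a) - op (ChrGen \<chi>)"
      by (simp add: e)
  next
    fix \<gamma> assume g: "\<gamma> \<in> carrier (Gam D)"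
    have "const (\<gamma> a) * gen XGen * gen (ChrGen \<gamma>) -
          (gen (ChrGen \<gamma>) * gen XGen +
            (if nilpotent_type D then 0
             else const (((\<gamma> [^]\<^bsub>Gam D\<^esub> n) a - 1) / qfact \<rho> (n - 1))
                    * gen (ChrGen \<gamma>) * (const \<rho> * gen (GrpGen a) - gen (ChrGen \<chi>)) * gen XiGen ^ (n - 1)))
        \<in> drels D"
      using g unfolding drels_def Let_def by blast
    from bspec[OF r this]
    show "\<gamma> a *\<^sub>E (op XGen * op (ChrGen \<gamma>)) = op (ChrGen \<gamma>) * op XGen +
        (if nilp then 0 else ((\<gamma> a ^ n - 1) / qfact \<rho> (n - 1)) *\<^sub>E
           (op (ChrGen \<gamma>) * (\<rho> *\<^sub>E op (GrpGen a) - op (ChrGen \<chi>)) * op XiGen ^ (n - 1)))"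
      by (simp add: e char_pow mult.assoc split: if_splits)
  qed
next
  assume "ops op"
  then interpret O: double_ops D "\<lambda>g. op (GrpGen g)" "\<lambda>\<gamma>. op (ChrGen \<gamma>)" "op XGen" "op XiGen" .
  have m: "multiplicative (wev op)" by simp
  note e = Ev_add Ev_uminus Ev_diff Ev_mult[OF m] Ev_one[OF m] Ev_power[OF m] Ev_const[OF m]
  note o = O.go_mult O.go_one O.co_mult O.co_one O.X_pow O.X_go O.Y_pow O.Y_co O.go_co O.Y_go O.XY
  show "\<forall>r\<in>drels D. Ev (wev op) r = 0"
    unfolding drels_def Let_def
    by (cases nilp) (auto simp: e o O.X_co inv_chi char_pow mult.assoc simp del: characters_simps)
qed

end


section \<open>Operators that commute up to a scalar, and the q-binomial theorem\<close>

lemma comm3: "F * H = c *\<^sub>E (H * F) \<Longrightarrow> F * (H * Z) = c *\<^sub>E (H * (F * Z))"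
  by (metis mult.assoc sm_simps(1))

lemma comm3': "F * H = H * F \<Longrightarrow> F * (H * Z) = H * (F * (Z :: 'k::field endo))"
  by (metis mult.assoc)

lemma comm_pow: "F * H = c *\<^sub>E (H * F) \<Longrightarrow> F * H ^ i = c ^ i *\<^sub>E (H ^ i * F)"
proof (induction i)
  case (Suc i)
  have "F * H ^ Suc i = c *\<^sub>E (H * (F * H ^ i))"
    using comm3[OF Suc.prems, of "H ^ i"] by simp
  then show ?case using Suc by (simp add: mult.assoc)
qed simp

lemma comm_pow2: "F * H = c *\<^sub>E (H * F) \<Longrightarrow> F ^ i * H = c ^ i *\<^sub>E (H * F ^ i)"
  by (induction i) (simp_all add: mult.assoc comm3 mult.commute)

lemma comm_pow': "F * H = H * F \<Longrightarrow> F ^ i * H ^ j = H ^ j * F ^ i" for F :: "'k::field endo"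
  using comm_pow[of "F ^ i" H 1] comm_pow2[of F H 1] by simp

lemma pow_mult_comm: "F * H = H * F \<Longrightarrow> (F * H) ^ i = F ^ i * H ^ i" for F :: "'k::field endo"
proof (induction i)
  case (Suc i)
  have "(F * H) ^ Suc i = F * (H * F ^ i) * H ^ i" using Suc.IH[OF Suc.prems] by (simp add: mult.assoc)
  also have "H * F ^ i = F ^ i * H" using comm_pow'[OF Suc.prems, of i 1] by simp
  finally show ?case by (simp add: mult.assoc)
qed simp

text \<open>The two sums arise from A (A + B)^m and B (A + B)^m. The extreme terms stay apart
  because they need separate treatment at the exponent n.\<close>

lemma sum_shift_merge:
  fixes f g :: "nat \<Rightarrow> 'a::ab_group_add"
  shows "(\<Sum>k\<le>m. f (Suc k)) + (\<Sum>k\<le>m. g k) = f (Suc m) + g 0 + (\<Sum>k=1..m. f k + g k)"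
  by (induction m) (simp_all add: algebra_simps)

context gdatum
begin

abbreviation qbin :: "nat \<Rightarrow> nat \<Rightarrow> 'k" where
  "qbin m k \<equiv> qfact \<rho> m / (qfact \<rho> k * qfact \<rho> (m - k))"

text \<open>The step includes \<open>Suc m = n\<close>. There the extreme coefficients, written as
  quotients of q-factorials, would be 0/0, so the extreme terms are listed without coefficient; the
  inner quotients still have nonzero denominators.\<close>

lemma q_binomial_step:
  assumes BA: "B * A = \<rho> *\<^sub>E (A * B)" and m: "m < n"
    and IH: "(A + B) ^ m = (\<Sum>k\<le>m. qbin m k *\<^sub>E (A ^ k * B ^ (m - k)))"
  shows "(A + B) ^ Suc m = A ^ Suc m + B ^ Suc m +
    (\<Sum>k=1..m. qbin (Suc m) k *\<^sub>E (A ^ k * B ^ (Suc m - k)))"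
proof -
  define f where "f k = qbin m (k - 1) *\<^sub>E (A ^ k * B ^ (m - (k - 1)))" for k
  define g where "g k = (qbin m k * \<rho> ^ k) *\<^sub>E (A ^ k * B ^ (Suc m - k))" for k
  have "A * (A + B) ^ m = (\<Sum>k\<le>m. f (Suc k))"
    by (simp add: IH f_def sum_distrib_left mult.assoc)
  moreover have "B * (A + B) ^ m = (\<Sum>k\<le>m. g k)"
    unfolding IH g_def sum_distrib_left
  proof (rule sum.cong)
    fix k assume "k \<in> {..m}"
    then have "Suc m - k = Suc (m - k)" by auto
    then show "B * qbin m k *\<^sub>E (A ^ k * B ^ (m - k)) = (qbin m k * \<rho> ^ k) *\<^sub>E (A ^ k * B ^ (Suc m - k))"
      using comm3[OF comm_pow[OF BA, of k], of "B ^ (m - k)"] by simp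
  qed simp
  ultimately have "(A + B) ^ Suc m = f (Suc m) + g 0 + (\<Sum>k=1..m. f k + g k)"
    by (simp add: distrib_right sum_shift_merge)
  moreover have "f (Suc m) = A ^ Suc m" "g 0 = B ^ Suc m"
    using qfact_nz[OF m] by (simp_all add: f_def g_def)
  moreover have "(\<Sum>k=1..m. f k + g k) = (\<Sum>k=1..m. qbin (Suc m) k *\<^sub>E (A ^ k * B ^ (Suc m - k)))"
  proof (rule sum.cong)
    fix k assume "k \<in> {1..m}"
    then obtain j i where kj: "k = Suc j" and mi: "m = Suc j + i"
      by (metis Suc_le_D atLeastAtMost_iff One_nat_def le_Suc_ex)
    have nz: "qint \<rho> (Suc j) \<noteq> 0" "qint \<rho> (Suc i) \<noteq> 0" "qfact \<rho> j \<noteq> 0" "qfact \<rho> i \<noteq> 0"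
      using m mi qint_nz[of "Suc j"] qint_nz[of "Suc i"] qfact_nz[of j] qfact_nz[of i] by auto
    have e: "qint \<rho> (Suc j) + \<rho> ^ Suc j * qint \<rho> (Suc i) = qint \<rho> (Suc m)"
      using qint_add[of \<rho> "Suc j" "Suc i"] mi by simp
    \<comment> \<open>The q-Pascal rule; once denominators are cleared it is the addition formula
      \<open>e\<close> for q-integers.\<close>
    have "qbin m j + qbin m (Suc j) * \<rho> ^ Suc j = qbin (Suc m) (Suc j)"
      unfolding qfact_Suc[of \<rho> m] e[symmetric] using nz
      by (simp add: mi qfact_Suc Suc_diff_le field_simps)
    then show "f k + g k = qbin (Suc m) k *\<^sub>E (A ^ k * B ^ (Suc m - k))"
      unfolding f_def g_def kj by (simp add: mi flip: sm_add_left)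
  qed simp
  ultimately show ?thesis by simp
qed

lemma q_binomial:
  assumes BA: "B * A = \<rho> *\<^sub>E (A * B)" and m: "m < n"
  shows "(A + B) ^ m = (\<Sum>k\<le>m. qbin m k *\<^sub>E (A ^ k * B ^ (m - k)))"
  using m
proof (induction m)
  case (Suc m)
  have s: "(\<Sum>k\<le>Suc m. h k) = h 0 + (\<Sum>k=1..m. h k) + h (Suc m)" for h :: "nat \<Rightarrow> 'k endo"
    by (simp add: sum.atMost_Suc atMost_atLeast0 sum.atLeast_Suc_atMost)
  have "qfact \<rho> (Suc m) \<noteq> 0" using Suc.prems by (rule qfact_nz)
  with q_binomial_step[OF BA _ Suc.IH] Suc.prems show ?case
    by (simp only: s) (simp add: add_ac)
qed simp

text \<open>As \<open>qint \<rho> n = 0\<close>, the q-factorial of n vanishes and with it every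
  inner coefficient. This yields the relations for x^n and \<xi>^n in tensor products.\<close>

lemma q_binomial_n:
  assumes BA: "B * A = \<rho> *\<^sub>E (A * B)"
  shows "(A + B) ^ n = A ^ n + B ^ n"
proof -
  have n: "Suc (n - 1) = n" "n - 1 < n" using n_ge2 by auto
  have "qfact \<rho> n = 0" using qfact_Suc[of \<rho> "n - 1"] n by simp
  with q_binomial_step[OF BA n(2) q_binomial[OF BA n(2)], unfolded n(1)] show ?thesis
    by simp
qed

end

section \<open>Commutation rules in the double\<close>

context double_ops
begin

lemma co_pow: "\<gamma> \<in> carrier (Gam D) \<Longrightarrow> co (\<gamma> [^]\<^bsub>Gam D\<^esub> (i::nat)) = co \<gamma> ^ i"
  by (induction i) (simp_all add: co_one co_mult power_commutes del: characters_simps)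

text \<open>The correction carries the factor \<chi>(a)^n - 1, which is 0. So \<chi>, unlike a
  general \<gamma>, commutes with x up to a scalar in both types.\<close>

lemma X_cochi: "X * co \<chi> = inverse \<rho> *\<^sub>E (co \<chi> * X)"
proof -
  have "\<chi> a *\<^sub>E (X * co \<chi>) = co \<chi> * X"
    using X_co[OF \<chi>_in] nonnilp_chi[OF _ a_in] by auto
  then have "inverse \<rho> *\<^sub>E \<rho> *\<^sub>E (X * co \<chi>) = inverse \<rho> *\<^sub>E (co \<chi> * X)" by (simp add: rho_eq)
  then show ?thesis by simp
qed

lemma X_goa: "X * go a = \<rho> *\<^sub>E (go a * X)"
  using X_go[OF a_in] by (simp add: rho_eq)

lemma Y_goa: "Y * go a = inverse \<rho> *\<^sub>E (go a * Y)"
  using Y_go[OF a_in] by (simp add: rho_eq)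

lemma Y_cochi: "Y * co \<chi> = \<rho> *\<^sub>E (co \<chi> * Y)"
  using Y_co[OF \<chi>_in] by (simp add: rho_eq)

lemma goa_cochi: "go a * co \<chi> = co \<chi> * go a"
  by (rule go_co) auto

text \<open>Each factor \<xi> contributes one copy of a - \<chi>; collecting these on the left
  multiplies them by powers of \<rho>, which add up to q-integers.\<close>

lemma X_Ypow: "X * Y ^ Suc r - Y ^ Suc r * X =
   qint \<rho> (Suc r) *\<^sub>E (inverse \<rho> ^ r *\<^sub>E go a - co \<chi>) * Y ^ r"
proof (induction r)
  case 0
  show ?case using XY by simp
next
  case (Suc r)
  have "X * Y ^ Suc (Suc r) - Y ^ Suc (Suc r) * X =
    (X * Y ^ Suc r - Y ^ Suc r * X) * Y + Y ^ Suc r * (X * Y - Y * X)"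
    by (simp only: power_Suc2[of Y "Suc r"]) (simp add: algebra_simps del: power_Suc)
  also have "\<dots> = qint \<rho> (Suc r) *\<^sub>E (inverse \<rho> ^ r *\<^sub>E go a - co \<chi>) * Y ^ Suc r +
      Y ^ Suc r * (go a - co \<chi>)"
    unfolding Suc XY by (simp only: mult.assoc power_Suc2)
  also have "Y ^ Suc r * (go a - co \<chi>) =
      (inverse \<rho> ^ Suc r *\<^sub>E go a - \<rho> ^ Suc r *\<^sub>E co \<chi>) * Y ^ Suc r"
    using comm_pow2[OF Y_goa, of "Suc r"] comm_pow2[OF Y_cochi, of "Suc r"]
    by (simp add: right_diff_distrib left_diff_distrib del: power_Suc)
  also have "qint \<rho> (Suc r) *\<^sub>E (inverse \<rho> ^ r *\<^sub>E go a - co \<chi>) * Y ^ Suc r +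
      (inverse \<rho> ^ Suc r *\<^sub>E go a - \<rho> ^ Suc r *\<^sub>E co \<chi>) * Y ^ Suc r =
     ((qint \<rho> (Suc r) * inverse \<rho> ^ r + inverse \<rho> ^ Suc r) *\<^sub>E go a
        - (qint \<rho> (Suc r) + \<rho> ^ Suc r) *\<^sub>E co \<chi>) * Y ^ Suc r"
    by (simp add: algebra_simps sm_diff sm_add_left del: power_Suc)
  also have "qint \<rho> (Suc r) * inverse \<rho> ^ r + inverse \<rho> ^ Suc r = qint \<rho> (Suc (Suc r)) * inverse \<rho> ^ Suc r"
    by (simp add: qint_Suc'[of _ "Suc r"] field_simps)
  also have "qint \<rho> (Suc r) + \<rho> ^ Suc r = qint \<rho> (Suc (Suc r))"
    by (simp add: qint_Suc[of _ "Suc r"])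
  finally show ?case by (simp add: sm_diff)
qed

text \<open>The part of the correction that does not depend on \<gamma>, so that x \<gamma> is
  governed by x + (\<gamma>(a)^n - 1) z.\<close>

definition z :: "'k endo" where
  "z = (1 / qfact \<rho> (n - 1)) *\<^sub>E ((\<rho> *\<^sub>E go a - co \<chi>) * Y ^ (n - 1))"

lemma X_co_z:
  assumes "\<gamma> \<in> carrier (Gam D)" "\<not> nilp"
  shows "\<gamma> a *\<^sub>E (X * co \<gamma>) = co \<gamma> * (X + (\<gamma> a ^ n - 1) *\<^sub>E z)"
  using X_co[OF assms(1)] assms(2) by (simp add: z_def distrib_left mult.assoc)

lemma X_co_nilp: "\<gamma> \<in> carrier (Gam D) \<Longrightarrow> nilp \<Longrightarrow> \<gamma> a *\<^sub>E (X * co \<gamma>) = co \<gamma> * X"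
  using X_co[of \<gamma>] by simp

lemma Y_pow_ge: "n \<le> i \<Longrightarrow> Y ^ i = 0"
  by (metis Y_pow le_Suc_ex power_add mult_zero_left)

end


context double_ops
begin

lemma co_comm: "\<gamma> \<in> carrier (Gam D) \<Longrightarrow> \<delta> \<in> carrier (Gam D) \<Longrightarrow> co \<gamma> * co \<delta> = co \<delta> * co \<gamma>"
  by (metis co_mult \<Gamma>.m_comm)

lemma go_comm: "g \<in> carrier G \<Longrightarrow> h \<in> carrier G \<Longrightarrow> go g * go h = go h * go g"
  by (metis go_mult G.m_comm)

lemma Ypow_chipow: "Y ^ i * co \<chi> ^ j = \<rho> ^ (i * j) *\<^sub>E (co \<chi> ^ j * Y ^ i)"
  using comm_pow[OF comm_pow2[OF Y_cochi], of i j] by (simp add: power_mult)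

lemma cochi_n: "\<not> nilp \<Longrightarrow> co \<chi> ^ n = 1"
  using co_pow[OF \<chi>_in, of n] by (simp add: nonnilp_chi_pow co_one del: characters_simps)

end

section \<open>The comultiplication respects the relations\<close>

locale tensor_ops = L: double_ops D g1 c1 X1 Y1 + R: double_ops D g2 c2 X2 Y2
  for D :: "('g, 'k::field_char_0) datum" and g1 c1 X1 Y1 g2 c2 X2 Y2 +
  assumes comm: "\<And>F H. F \<in> g1 ` carrier (grp D) \<union> c1 ` carrier (Gam D) \<union> {X1, Y1} \<Longrightarrow>
      H \<in> g2 ` carrier (grp D) \<union> c2 ` carrier (Gam D) \<union> {X2, Y2} \<Longrightarrow> F * H = H * F"
begin

text \<open>\<open>A2\<close> is the commutant of the left generators and \<open>A1\<close> the
  commutant of \<open>A2\<close>. They contain the left and right algebras, commute elementwise, and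
  are closed under the ring operations.\<close>

definition "A2 = {H :: 'k endo. \<forall>F \<in> g1 ` carrier (grp D) \<union> c1 ` carrier (Gam D) \<union> {X1, Y1}. F * H = H * F}"
definition "A1 = {F :: 'k endo. \<forall>H \<in> A2. F * H = H * F}"

lemma A12_gens [simp]:
  "g \<in> carrier L.G \<Longrightarrow> g1 g \<in> A1" "\<gamma> \<in> carrier (Gam D) \<Longrightarrow> c1 \<gamma> \<in> A1" "X1 \<in> A1" "Y1 \<in> A1" "1 \<in> A1"
  "g \<in> carrier L.G \<Longrightarrow> g2 g \<in> A2" "\<gamma> \<in> carrier (Gam D) \<Longrightarrow> c2 \<gamma> \<in> A2" "X2 \<in> A2" "Y2 \<in> A2" "1 \<in> A2"
  using comm by (auto simp: A1_def A2_def)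

lemma A1_ops [simp]:
  assumes "F \<in> A1" "F' \<in> A1"
  shows "F * F' \<in> A1" "F + F' \<in> A1" "F - F' \<in> A1"
  using assms by (auto simp: A1_def algebra_simps) (metis mult.assoc)

lemma A1_ops' [simp]: "F \<in> A1 \<Longrightarrow> c *\<^sub>E F \<in> A1" "F \<in> A1 \<Longrightarrow> F ^ i \<in> A1"
proof -
  show "F \<in> A1 \<Longrightarrow> c *\<^sub>E F \<in> A1" by (simp add: A1_def)
  show "F \<in> A1 \<Longrightarrow> F ^ i \<in> A1" by (induction i) simp_all
qed

lemma A2_ops [simp]:
  assumes "F \<in> A2" "F' \<in> A2"
  shows "F * F' \<in> A2" "F + F' \<in> A2" "F - F' \<in> A2"
proof -
  show "F * F' \<in> A2" using assms unfolding A2_def mem_Collect_eq by (metis mult.assoc)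
qed (use assms in \<open>simp_all add: A2_def algebra_simps\<close>)

lemma A2_ops' [simp]: "F \<in> A2 \<Longrightarrow> c *\<^sub>E F \<in> A2" "F \<in> A2 \<Longrightarrow> F ^ i \<in> A2"
proof -
  show "F \<in> A2 \<Longrightarrow> c *\<^sub>E F \<in> A2" by (simp add: A2_def)
  show "F \<in> A2 \<Longrightarrow> F ^ i \<in> A2" by (induction i) simp_all
qed

lemma swap: "F \<in> A1 \<Longrightarrow> H \<in> A2 \<Longrightarrow> H * F = F * H"
  by (simp add: A1_def)

lemma mult12: "F' \<in> A1 \<Longrightarrow> H \<in> A2 \<Longrightarrow> (F * H) * (F' * H') = (F * F') * (H * H')"
  by (metis swap mult.assoc)

abbreviation "u \<equiv> c1 L.\<chi>"
abbreviation "v \<equiv> c2 L.\<chi>"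
abbreviation "p1 \<equiv> g1 L.a"
abbreviation "p2 \<equiv> g2 L.a"
abbreviation "n \<equiv> L.n"
abbreviation "\<rho> \<equiv> L.\<rho>"

definition "XX = X1 * p2 + X2"
definition "YY = Y1 + u * Y2"
text \<open>The elements \<chi>^p \<xi>^(n-p) \<otimes> \<xi>^p of the correction in
  \<Delta>(\<gamma>). With \<gamma> \<otimes> \<gamma> taken out in front, what remains is 1 +
  (\<gamma>(a)^n - 1) \<open>EE\<close>, where \<open>EE\<close> is the same for all
  \<gamma>.\<close>

definition K where "K p = (u ^ p * Y1 ^ (n - p)) * Y2 ^ p"
definition e where "e p = 1 / (qfact \<rho> p * qfact \<rho> (n - p))"
text \<open>Up to the factor \<open>qfact \<rho> (n - 1)\<close> these are the q-binomial
  coefficients in the expansion of \<open>YY ^ (n - 1)\<close>.\<close>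

definition h where "h p = 1 / (qfact \<rho> p * qfact \<rho> (n - 1 - p))"
definition EE where "EE = (if L.nilp then 0 else \<Sum>p\<in>{1..<n}. e p *\<^sub>E K p)"
definition gg where "gg g = g1 g * g2 g"
definition cc where "cc \<gamma> = c1 \<gamma> * c2 \<gamma> * (1 + (\<gamma> L.a ^ n - 1) *\<^sub>E EE)"

text \<open>Lowering either member of the pair (p, n - p) leads to the same family \<open>h\<close>.
  This lets the commutator of \<open>EE\<close> with \<open>YY\<close> telescope and the one with
  \<open>XX\<close> combine into a single power.\<close>

lemma e_h:
  assumes "p \<in> {1..<n}"
  shows "e p * qint \<rho> p = h (p - 1)" "e p * qint \<rho> (n - p) = h p"
proof -
  obtain j where j: "p = Suc j" using assms by (cases p) auto
  have nz: "qfact \<rho> p \<noteq> 0" "qfact \<rho> (n - p) \<noteq> 0"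
    using assms by (auto intro!: L.qfact_nz)
  from nz(1) show "e p * qint \<rho> p = h (p - 1)"
    by (simp add: e_def h_def j qfact_Suc)
  have "n - p = Suc (n - 1 - p)" using assms by auto
  with nz show "e p * qint \<rho> (n - p) = h p"
    by (simp add: e_def h_def qfact_Suc)
qed

text \<open>The total degree of \<open>K p\<close> in \<xi> is n: the left factor contributes
  s^(n-p), the right one s^p.\<close>

lemma K_scal_comm:
  assumes F: "F \<in> A1" and H: "H \<in> A2"
    and "u * F = F * u" "Y1 * F = s *\<^sub>E (F * Y1)" "Y2 * H = s *\<^sub>E (H * Y2)" "p \<le> n"
  shows "K p * (F * H) = s ^ n *\<^sub>E (F * H * K p)"
proof -
  have "K p * (F * H) = (u ^ p * Y1 ^ (n - p) * F) * (Y2 ^ p * H)"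
    unfolding K_def by (rule mult12) (use F in simp_all)
  also have "u ^ p * Y1 ^ (n - p) * F = s ^ (n - p) *\<^sub>E (F * (u ^ p * Y1 ^ (n - p)))"
    using comm_pow2[OF assms(4), of "n - p"] comm_pow'[OF assms(3), of p 1]
    by (simp add: mult.assoc) (metis mult.assoc)
  also have "Y2 ^ p * H = s ^ p *\<^sub>E (H * Y2 ^ p)"
    by (rule comm_pow2) fact
  also have "s ^ (n - p) *\<^sub>E (F * (u ^ p * Y1 ^ (n - p))) * s ^ p *\<^sub>E (H * Y2 ^ p)
      = s ^ n *\<^sub>E ((F * (u ^ p * Y1 ^ (n - p))) * (H * Y2 ^ p))"
    using assms(6) by (simp add: mult.commute flip: power_add)
  also have "(F * (u ^ p * Y1 ^ (n - p))) * (H * Y2 ^ p) = F * H * K p"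
    unfolding K_def by (rule mult12[symmetric]) (use H in simp_all)
  finally show ?thesis .
qed

lemma EE_scal_comm:
  assumes F: "F \<in> A1" and H: "H \<in> A2"
    and "u * F = F * u" "Y1 * F = s *\<^sub>E (F * Y1)" "Y2 * H = s *\<^sub>E (H * Y2)"
  shows "EE * (F * H) = s ^ n *\<^sub>E (F * H * EE)"
  unfolding EE_def
  by (auto simp: sum_distrib_left sum_distrib_right sm_sum K_scal_comm[OF assms] mult.commute[of "s ^ n"]
      intro!: sum.cong)

text \<open>The product has degree p + q in the right \<xi> and 2n - p - q in the left one, and one
  of these is at least n.\<close>

lemma K_K: "p \<in> {1..<n} \<Longrightarrow> q \<in> {1..<n} \<Longrightarrow> K p * K q = 0"
proof -
  assume pq: "p \<in> {1..<n}" "q \<in> {1..<n}"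
  have "K p * K q = (u ^ p * Y1 ^ (n - p) * (u ^ q * Y1 ^ (n - q))) * Y2 ^ (p + q)"
    unfolding K_def power_add by (rule mult12) simp_all
  also have "u ^ p * Y1 ^ (n - p) * (u ^ q * Y1 ^ (n - q)) =
      \<rho> ^ ((n - p) * q) *\<^sub>E (u ^ p * (u ^ q * Y1 ^ (n - p + (n - q))))"
    using comm3[OF L.Ypow_chipow[of "n - p" q]] by (simp add: mult.assoc power_add)
  finally have *: "K p * K q =
      \<rho> ^ ((n - p) * q) *\<^sub>E (u ^ p * (u ^ q * Y1 ^ (n - p + (n - q)))) * Y2 ^ (p + q)" .
  show "K p * K q = 0"
  proof (cases "n \<le> p + q")
    case True
    then show ?thesis by (simp add: * R.Y_pow_ge)
  next
    case False
    then have "n \<le> n - p + (n - q)" by auto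
    then show ?thesis by (simp add: * L.Y_pow_ge)
  qed
qed

lemma EE_EE: "EE * EE = 0"
  unfolding EE_def by (simp add: sum_product K_K)

lemma YY_K:
  assumes "p \<in> {1..<n}"
  defines "M \<equiv> \<lambda>p. (u ^ p * Y1 ^ (n + 1 - p)) * Y2 ^ p"
  shows "YY * K p = \<rho> ^ p *\<^sub>E M p + M (Suc p)" "K p * YY = M p + \<rho> ^ (n - p) *\<^sub>E M (Suc p)"
proof -
  have n: "n + 1 - p = Suc (n - p)" "n + 1 - Suc p = n - p" using assms by auto
  have "Y1 * K p = (Y1 * u ^ p * Y1 ^ (n - p)) * Y2 ^ p" by (simp add: K_def mult.assoc)
  also have "Y1 * u ^ p = \<rho> ^ p *\<^sub>E (u ^ p * Y1)" by (rule comm_pow) (rule L.Y_cochi)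
  finally have a: "Y1 * K p = \<rho> ^ p *\<^sub>E M p" by (simp only: M_def n power_Suc sm_simps mult.assoc)
  have b: "u * Y2 * K p = M (Suc p)"
    unfolding K_def M_def n by (subst mult12) (simp_all add: mult.assoc)
  show "YY * K p = \<rho> ^ p *\<^sub>E M p + M (Suc p)"
    by (simp add: YY_def distrib_right a b)
  have "K p * (Y1 * 1) = (u ^ p * Y1 ^ (n - p) * Y1) * (Y2 ^ p * 1)"
    unfolding K_def by (rule mult12) simp_all
  then have c: "K p * Y1 = M p" by (simp only: M_def n power_Suc2 mult_1_right mult.assoc)
  have "K p * (u * Y2) = (u ^ p * (Y1 ^ (n - p) * u)) * (Y2 ^ p * Y2)"
    unfolding K_def by (subst mult12) (simp_all add: mult.assoc)
  also have "Y1 ^ (n - p) * u = \<rho> ^ (n - p) *\<^sub>E (u * Y1 ^ (n - p))"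
    by (rule comm_pow2) (rule L.Y_cochi)
  finally have d: "K p * (u * Y2) = \<rho> ^ (n - p) *\<^sub>E M (Suc p)"
    by (simp add: M_def n flip: mult.assoc power_Suc2)
  show "K p * YY = M p + \<rho> ^ (n - p) *\<^sub>E M (Suc p)"
    by (simp add: YY_def distrib_left c d)
qed

lemma sum_telescope_int: "(\<Sum>p\<in>{1..<Suc m}. f p - f (Suc p)) = f 1 - f (Suc m)" for f :: "nat \<Rightarrow> 'k endo"
  by (induction m) simp_all

text \<open>With the coefficients rewritten by \<open>e_h\<close> the commutator telescopes. Its two
  boundary terms contain \<open>Y1 ^ n\<close> and \<open>Y2 ^ n\<close>, which vanish.\<close>

lemma YY_EE: "YY * EE = EE * YY"
proof (cases L.nilp)
  case False
  define M where "M p = (u ^ p * Y1 ^ (n + 1 - p)) * Y2 ^ p" for p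
  define f where "f p = ((\<rho> - 1) * h (p - 1)) *\<^sub>E M p" for p
  have t: "e p *\<^sub>E (YY * K p) - e p *\<^sub>E (K p * YY) = f p - f (Suc p)" if p: "p \<in> {1..<n}" for p
  proof -
    have "(\<rho> - 1) * h (p - 1) = e p * ((\<rho> - 1) * qint \<rho> p)"
      unfolding e_h(1)[OF p, symmetric] by simp
    then have c1: "(\<rho> - 1) * h (p - 1) = e p * \<rho> ^ p - e p"
      by (simp only: qint_geometric right_diff_distrib mult_1_right)
    have "(\<rho> - 1) * h p = e p * ((\<rho> - 1) * qint \<rho> (n - p))"
      unfolding e_h(2)[OF p, symmetric] by simp
    then have c2: "(\<rho> - 1) * h p = e p * \<rho> ^ (n - p) - e p"
      by (simp only: qint_geometric right_diff_distrib mult_1_right)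
    show ?thesis
      unfolding YY_K[OF p, folded M_def] f_def c1 by (simp add: c2 sm_add sm_diff_left)
  qed
  have n: "Suc (n - 1) = n" using L.n_ge2 by auto
  have "YY * EE - EE * YY = (\<Sum>p\<in>{1..<n}. f p - f (Suc p))"
    using False by (simp add: EE_def sum_distrib_left sum_distrib_right t flip: sum_subtractf)
  also have "\<dots> = f 1 - f n"
    using sum_telescope_int[of f "n - 1"] n by simp
  also have "\<dots> = 0"
    by (simp add: f_def M_def L.Y_pow R.Y_pow)
  finally show ?thesis by simp
qed (simp add: EE_def)

text \<open>\<open>X_Ypow\<close> is applied in each tensor factor; the q-integers it produces turn
  \<open>e\<close> into \<open>h\<close>. The two summands are of neighbouring index, which prepares
  the recombination in \<open>XX_EE\<close>.\<close>

lemma XX_K: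
  assumes p: "p \<in> {1..<n}"
  shows "e p *\<^sub>E (XX * K p - K p * XX) =
    h p *\<^sub>E ((u ^ p * (\<rho> *\<^sub>E p1 - inverse \<rho> ^ p *\<^sub>E u) * Y1 ^ (n - 1 - p)) * (p2 * Y2 ^ p)) +
    h (p - 1) *\<^sub>E ((u ^ p * Y1 ^ (n - p)) * ((inverse \<rho> ^ (p - 1) *\<^sub>E p2 - v) * Y2 ^ (p - 1)))"
proof -
  define \<iota> where "\<iota> = inverse \<rho>"
  define r where "r = n - 1 - p"
  obtain j where j: "p = Suc j" using p by (cases p) auto
  have n: "n - p = Suc r" using p by (auto simp: r_def)
  \<comment> \<open>As \<rho>^(-(n-1)) = \<rho>, the powers collected from both factors become the
    coefficient \<rho> of \<open>p1\<close>.\<close>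
  have "\<iota> ^ p * \<iota> ^ r = \<iota> ^ (n - 1)" using p by (simp add: r_def flip: power_add)
  also have "\<dots> = \<rho>"
  proof -
    have "\<rho> * \<rho> ^ (n - 1) = 1" using L.rho_n L.n_ge2 by (metis power_Suc Suc_diff_1 less_le_trans pos2)
    then show ?thesis by (simp add: \<iota>_def power_inverse field_simps)
  qed
  finally have \<iota>: "\<iota> ^ p * \<iota> ^ r = \<rho>" .
  have "X1 * p2 * K p = (X1 * u ^ p * Y1 ^ (n - p)) * (p2 * Y2 ^ p)"
    unfolding K_def by (subst mult12) (simp_all add: mult.assoc)
  also have "X1 * u ^ p = \<iota> ^ p *\<^sub>E (u ^ p * X1)"
    unfolding \<iota>_def by (rule comm_pow) (rule L.X_cochi)
  finally have a: "X1 * p2 * K p = \<iota> ^ p *\<^sub>E (u ^ p * (X1 * Y1 ^ (n - p))) * (p2 * Y2 ^ p)"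
    by (simp add: mult.assoc)
  have "K p * (X1 * p2) = (u ^ p * Y1 ^ (n - p) * X1) * (Y2 ^ p * p2)"
    unfolding K_def by (rule mult12) simp_all
  also have "Y2 ^ p * p2 = \<iota> ^ p *\<^sub>E (p2 * Y2 ^ p)"
    unfolding \<iota>_def by (rule comm_pow2) (rule R.Y_goa)
  finally have b: "K p * (X1 * p2) = \<iota> ^ p *\<^sub>E (u ^ p * (Y1 ^ (n - p) * X1)) * (p2 * Y2 ^ p)"
    by (simp add: mult.assoc)
  have "X1 * p2 * K p - K p * (X1 * p2) =
      \<iota> ^ p *\<^sub>E (u ^ p * (X1 * Y1 ^ (n - p) - Y1 ^ (n - p) * X1)) * (p2 * Y2 ^ p)"
    by (simp only: a b left_diff_distrib right_diff_distrib sm_diff)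
  also have "\<dots> = (qint \<rho> (n - p)) *\<^sub>E ((u ^ p * (\<rho> *\<^sub>E p1 - \<iota> ^ p *\<^sub>E u) * Y1 ^ r) * (p2 * Y2 ^ p))"
    unfolding n L.X_Ypow[folded \<iota>_def] \<iota>[symmetric]
    by (simp add: sm_diff right_diff_distrib left_diff_distrib mult.assoc mult.left_commute mult.commute)
  finally have c: "X1 * p2 * K p - K p * (X1 * p2) =
      (qint \<rho> (n - p)) *\<^sub>E ((u ^ p * (\<rho> *\<^sub>E p1 - \<iota> ^ p *\<^sub>E u) * Y1 ^ r) * (p2 * Y2 ^ p))" .
  have "X2 * K p = (u ^ p * Y1 ^ (n - p)) * (X2 * Y2 ^ p)"
    using mult12[of "u ^ p * Y1 ^ (n - p)" X2 1 "Y2 ^ p"] by (simp add: K_def)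
  moreover have "K p * X2 = (u ^ p * Y1 ^ (n - p)) * (Y2 ^ p * X2)" by (simp add: K_def mult.assoc)
  ultimately have "X2 * K p - K p * X2 = (u ^ p * Y1 ^ (n - p)) * (X2 * Y2 ^ p - Y2 ^ p * X2)"
    by (simp add: right_diff_distrib)
  also have "X2 * Y2 ^ p - Y2 ^ p * X2 = qint \<rho> p *\<^sub>E ((\<iota> ^ (p - 1) *\<^sub>E p2 - v) * Y2 ^ (p - 1))"
    unfolding j R.X_Ypow[folded \<iota>_def] by simp
  finally have d: "X2 * K p - K p * X2 =
      qint \<rho> p *\<^sub>E ((u ^ p * Y1 ^ (n - p)) * ((\<iota> ^ (p - 1) *\<^sub>E p2 - v) * Y2 ^ (p - 1)))" by simp
  have "XX * K p - K p * XX = (X1 * p2 * K p - K p * (X1 * p2)) + (X2 * K p - K p * X2)"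
    by (simp add: XX_def algebra_simps)
  then show ?thesis
    unfolding c d by (simp add: sm_add e_h[OF p] \<iota>_def r_def del: sm_simps(1,2))
qed

lemma YY_pow: "m < n \<Longrightarrow> YY ^ m = (\<Sum>k\<le>m. L.qbin m k *\<^sub>E ((u ^ k * Y1 ^ (m - k)) * Y2 ^ k))"
proof -
  assume m: "m < n"
  have ba: "Y1 * (u * Y2) = \<rho> *\<^sub>E ((u * Y2) * Y1)"
    using comm3[OF L.Y_cochi, of Y2] swap[of Y1 Y2] by (simp add: mult.assoc)
  have "(u * Y2) ^ k * Y1 ^ i = (u ^ k * Y1 ^ i) * Y2 ^ k" for k i
    using swap[of u Y2] swap[of "Y1 ^ i" "Y2 ^ k"] pow_mult_comm[of u Y2 k] by (simp add: mult.assoc)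
  then show ?thesis
    using L.q_binomial[OF ba m] by (simp add: YY_def add.commute)
qed

lemma YY_n: "YY ^ n = 0"
proof -
  have ba: "Y1 * (u * Y2) = \<rho> *\<^sub>E ((u * Y2) * Y1)"
    using comm3[OF L.Y_cochi, of Y2] swap[of Y1 Y2] by (simp add: mult.assoc)
  have "(u * Y2) ^ n = u ^ n * Y2 ^ n"
    using swap[of u Y2] by (intro pow_mult_comm) simp
  then show ?thesis
    using L.q_binomial_n[OF ba] by (simp add: YY_def add.commute L.Y_pow R.Y_pow)
qed

text \<open>\<open>Z'\<close> is the correction that \<open>XX\<close> acquires in passing \<gamma>
  \<otimes> \<gamma>; \<open>ZZ\<close> is the element \<open>z\<close> formed from the tensor
  operators. They differ by a commutator with \<open>EE\<close>.\<close>

definition "Z' = L.z * p2 + R.z"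
definition "ZZ = (1 / qfact \<rho> (n - 1)) *\<^sub>E ((\<rho> *\<^sub>E (p1 * p2) - u * v) * YY ^ (n - 1))"

text \<open>The commutator supplies all but two terms of two sums over p < n. The missing terms, p =
  0 in the first and p = n - 1 in the second, are the two parts of \<open>Z'\<close>; the second
  uses \<chi>^n = 1. The completed sums are the q-binomial expansion of
  \<open>YY ^ (n - 1)\<close>.\<close>

lemma XX_EE:
  assumes nn: "\<not> L.nilp"
  shows "XX * EE - EE * XX + Z' = ZZ"
proof -
  define \<iota> where "\<iota> = inverse \<rho>"
  define T1 where "T1 p = h p *\<^sub>E ((u ^ p * (\<rho> *\<^sub>E p1 - \<iota> ^ p *\<^sub>E u) * Y1 ^ (n - 1 - p)) * (p2 * Y2 ^ p))" for p
  define T2 where "T2 p = h p *\<^sub>E ((u ^ Suc p * Y1 ^ (n - 1 - p)) * ((\<iota> ^ p *\<^sub>E p2 - v) * Y2 ^ p))" for p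
  have n: "Suc (n - 1) = n" using L.n_ge2 by auto
  have \<iota>: "\<iota> ^ (n - 1) = \<rho>"
  proof -
    have "\<rho> * \<rho> ^ (n - 1) = 1" using L.rho_n L.n_ge2 by (metis power_Suc Suc_diff_1 less_le_trans pos2)
    then show ?thesis by (simp add: \<iota>_def power_inverse field_simps)
  qed
  have "XX * EE - EE * XX = (\<Sum>p\<in>{1..<n}. e p *\<^sub>E (XX * K p - K p * XX))"
    using nn by (simp add: EE_def sum_distrib_left sum_distrib_right sm_diff flip: sum_subtractf)
  also have "\<dots> = (\<Sum>p\<in>{1..<n}. T1 p + T2 (p - 1))"
  proof (rule sum.cong)
    fix p assume p: "p \<in> {1..<n}"
    then have "n - 1 - (p - 1) = n - p" "Suc (p - 1) = p" by auto
    then show "e p *\<^sub>E (XX * K p - K p * XX) = T1 p + T2 (p - 1)"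
      unfolding XX_K[OF p] T1_def T2_def \<iota>_def by simp
  qed simp
  also have "\<dots> = (\<Sum>p\<in>{1..<n}. T1 p) + (\<Sum>p<n - 1. T2 p)"
  proof -
    have "(\<Sum>p\<in>{1..<n}. T2 (p - 1)) = (\<Sum>p<n - 1. T2 p)"
      by (rule sum.reindex_bij_witness[of _ Suc "\<lambda>p. p - 1"]) auto
    then show ?thesis by (simp add: sum.distrib)
  qed
  finally have 1: "XX * EE - EE * XX = (\<Sum>p\<in>{1..<n}. T1 p) + (\<Sum>p<n - 1. T2 p)" .
  have "T1 0 = L.z * p2" by (simp add: T1_def L.z_def h_def mult.assoc)
  moreover have "T2 (n - 1) = R.z"
    unfolding T2_def \<iota> n L.cochi_n[OF nn] by (simp add: R.z_def h_def)
  moreover have "(\<Sum>p<n. T1 p) = T1 0 + (\<Sum>p\<in>{1..<n}. T1 p)"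
    using L.n_ge2 by (simp add: lessThan_atLeast0 sum.atLeast_Suc_lessThan)
  moreover have "(\<Sum>p<n. T2 p) = (\<Sum>p<n - 1. T2 p) + T2 (n - 1)"
    using sum.lessThan_Suc[of T2 "n - 1"] n by simp
  ultimately have "XX * EE - EE * XX + Z' = (\<Sum>p<n. T1 p + T2 p)"
    unfolding 1 Z'_def sum.distrib by (simp add: algebra_simps)
  also have "\<dots> = (\<Sum>p<n. h p *\<^sub>E ((\<rho> *\<^sub>E (p1 * p2) - u * v) * ((u ^ p * Y1 ^ (n - 1 - p)) * Y2 ^ p)))"
  proof (rule sum.cong)
    fix p
    let ?U = "u ^ p" and ?Y = "Y1 ^ (n - 1 - p)"
    have up: "?U * p1 = p1 * ?U"
      using comm_pow'[of u p1 p 1] L.goa_cochi by simp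
    \<comment> \<open>The terms with an extra \<open>u\<close> on the left and \<open>p2\<close> on
      the right occur with opposite signs and cancel.\<close>
    have "T1 p + T2 p = h p *\<^sub>E (\<rho> *\<^sub>E ((p1 * (?U * ?Y)) * (p2 * Y2 ^ p)) - ((u * (?U * ?Y)) * (v * Y2 ^ p)))"
      unfolding T1_def T2_def
      by (simp add: right_diff_distrib left_diff_distrib sm_diff mult.assoc comm3'[OF up]
          power_commutes power_Suc2[of u] del: power_Suc)
    also have "(p1 * (?U * ?Y)) * (p2 * Y2 ^ p) = (p1 * p2) * ((?U * ?Y) * Y2 ^ p)"
      by (rule mult12[symmetric]) simp_all
    also have "(u * (?U * ?Y)) * (v * Y2 ^ p) = (u * v) * ((?U * ?Y) * Y2 ^ p)"
      by (rule mult12[symmetric]) simp_all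
    finally show "T1 p + T2 p = h p *\<^sub>E ((\<rho> *\<^sub>E (p1 * p2) - u * v) * ((?U * ?Y) * Y2 ^ p))"
      by (simp add: left_diff_distrib)
  qed simp
  also have "\<dots> = ZZ"
  proof -
    have "{..n - 1} = {..<n}" using n by (metis lessThan_Suc_atMost)
    moreover have "qfact \<rho> (n - 1) \<noteq> 0" by (rule L.qfact_nz) (use n in simp)
    moreover have "n - 1 < n" using n by simp
    ultimately show ?thesis
      by (simp add: ZZ_def YY_pow sum_distrib_left sm_sum h_def)
  qed
  finally show ?thesis .
qed

text \<open>Each part of \<open>Z'\<close> has degree n - 1 in one of the two \<xi>, and every
  \<open>K p\<close> with 0 < p < n has positive degree in both.\<close>

lemma Z'_EE: "Z' * EE = 0"
proof (cases L.nilp)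
  case False
  have "Z' * K p = 0" if p: "p \<in> {1..<n}" for p
  proof -
    have a: "L.z * p2 * K p = (L.z * (u ^ p * Y1 ^ (n - p))) * (p2 * Y2 ^ p)"
      unfolding K_def by (rule mult12) simp_all
    have "Y1 ^ (n - 1) * (u ^ p * Y1 ^ (n - p)) = \<rho> ^ ((n - 1) * p) *\<^sub>E (u ^ p * Y1 ^ (n - 1 + (n - p)))"
      using comm3[OF L.Ypow_chipow[of "n - 1" p]] by (simp add: power_add)
    moreover have "n \<le> n - 1 + (n - p)" using p by auto
    ultimately have "L.z * (u ^ p * Y1 ^ (n - p)) = 0"
      by (simp add: L.z_def mult.assoc L.Y_pow_ge)
    moreover have "R.z * K p = (u ^ p * Y1 ^ (n - p)) * (R.z * Y2 ^ p)"
      using mult12[of "u ^ p * Y1 ^ (n - p)" R.z 1 "Y2 ^ p"] by (simp add: K_def R.z_def)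
    moreover have "Y2 ^ (n - 1) * Y2 ^ p = 0"
    proof -
      have "n \<le> n - 1 + p" using p by auto
      from R.Y_pow_ge[OF this] show ?thesis by (simp add: power_add)
    qed
    then have "R.z * Y2 ^ p = 0"
      by (simp add: R.z_def mult.assoc)
    ultimately show ?thesis by (simp add: Z'_def distrib_right a)
  qed
  with False show ?thesis by (simp add: EE_def sum_distrib_left)
qed (simp add: EE_def)

text \<open>Terms of \<open>K p * YY ^ (n - 1)\<close> have total degree 2n - 1 in the two \<xi>, so
  one of the degrees reaches n.\<close>

lemma EE_ZZ: "EE * ZZ = 0"
proof (cases L.nilp)
  case False
  have n: "n - 1 < n" using L.n_ge2 by simp
  have "K p * YY ^ (n - 1) = 0" if p: "p \<in> {1..<n}" for p
  proof -
    have "K p * ((u ^ k * Y1 ^ (n - 1 - k)) * Y2 ^ k) = 0" if k: "k \<le> n - 1" for k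
    proof -
      have "K p * ((u ^ k * Y1 ^ (n - 1 - k)) * Y2 ^ k) =
          (u ^ p * (Y1 ^ (n - p) * (u ^ k * Y1 ^ (n - 1 - k)))) * Y2 ^ (p + k)"
        unfolding K_def power_add by (subst mult12) (simp_all add: mult.assoc)
      also have "Y1 ^ (n - p) * (u ^ k * Y1 ^ (n - 1 - k)) =
          \<rho> ^ ((n - p) * k) *\<^sub>E (u ^ k * Y1 ^ (n - p + (n - 1 - k)))"
        using comm3[OF L.Ypow_chipow[of "n - p" k]] by (simp add: power_add)
      also have "(u ^ p * \<rho> ^ ((n - p) * k) *\<^sub>E (u ^ k * Y1 ^ (n - p + (n - 1 - k)))) * Y2 ^ (p + k) = 0"
      proof (cases "n \<le> p + k")
        case True
        then show ?thesis by (simp add: R.Y_pow_ge)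
      next
        case False
        then have "n \<le> n - p + (n - 1 - k)" using p by auto
        then show ?thesis by (simp add: L.Y_pow_ge)
      qed
      finally show ?thesis .
    qed
    then show ?thesis unfolding YY_pow[OF n] sum_distrib_left by (intro sum.neutral) auto
  qed
  then have "EE * YY ^ (n - 1) = 0" by (simp add: EE_def sum_distrib_right)
  moreover have "EE * (p1 * p2) = p1 * p2 * EE"
    using EE_scal_comm[of p1 p2 "inverse \<rho>"] L.goa_cochi L.Y_goa R.Y_goa by (simp add: power_inverse)
  moreover have "EE * (u * v) = u * v * EE"
    using EE_scal_comm[of u v \<rho>] L.Y_cochi R.Y_cochi by simp
  ultimately show ?thesis
    unfolding ZZ_def by (simp add: right_diff_distrib left_diff_distrib flip: mult.assoc)
      (simp add: mult.assoc)
qed (simp add: EE_def)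

lemma T_EE:
  assumes "\<gamma> \<in> carrier (Gam D)"
  shows "EE * (c1 \<gamma> * c2 \<gamma>) = \<gamma> L.a ^ n *\<^sub>E (c1 \<gamma> * c2 \<gamma> * EE)"
  by (rule EE_scal_comm) (use assms in \<open>simp_all add: L.co_comm L.Y_co R.Y_co\<close>)

lemma cc_chi: "cc L.\<chi> = u * v"
  by (simp add: cc_def L.rho_eq)

lemma YY_T:
  assumes "\<gamma> \<in> carrier (Gam D)"
  shows "YY * (c1 \<gamma> * c2 \<gamma>) = \<gamma> L.a *\<^sub>E (c1 \<gamma> * c2 \<gamma> * YY)"
proof -
  have "Y1 * (c1 \<gamma> * c2 \<gamma>) = \<gamma> L.a *\<^sub>E (c1 \<gamma> * c2 \<gamma> * Y1)"
    using comm3[OF L.Y_co[OF assms], of "c2 \<gamma>"] swap[of Y1 "c2 \<gamma>"] assms by (simp add: mult.assoc)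
  moreover have "u * Y2 * (c1 \<gamma> * c2 \<gamma>) = \<gamma> L.a *\<^sub>E (c1 \<gamma> * c2 \<gamma> * (u * Y2))"
    using mult12[of "c1 \<gamma>" Y2 u "c2 \<gamma>"] mult12[of u "c2 \<gamma>" "c1 \<gamma>" Y2] L.co_comm[OF _ assms, of L.\<chi>]
    by (simp add: assms R.Y_co)
  ultimately show ?thesis by (simp add: YY_def distrib_left distrib_right sm_add)
qed

lemma XX_T:
  assumes g: "\<gamma> \<in> carrier (Gam D)" and nn: "\<not> L.nilp"
  shows "\<gamma> L.a *\<^sub>E (XX * (c1 \<gamma> * c2 \<gamma>)) = c1 \<gamma> * c2 \<gamma> * (XX + (\<gamma> L.a ^ n - 1) *\<^sub>E Z')"
proof -
  let ?k = "\<gamma> L.a ^ n - 1"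
  have z1: "L.z \<in> A1" by (simp add: L.z_def)
  have "\<gamma> L.a *\<^sub>E (X1 * p2 * (c1 \<gamma> * c2 \<gamma>)) = (\<gamma> L.a *\<^sub>E (X1 * c1 \<gamma>)) * (p2 * c2 \<gamma>)"
    using mult12[of "c1 \<gamma>" p2 X1 "c2 \<gamma>"] g by simp
  also have "\<dots> = (c1 \<gamma> * (X1 + ?k *\<^sub>E L.z)) * (c2 \<gamma> * p2)"
    using L.X_co_z[OF g nn] R.go_co[OF L.a_in g] by simp
  also have "\<dots> = c1 \<gamma> * c2 \<gamma> * ((X1 + ?k *\<^sub>E L.z) * p2)"
    by (rule mult12[symmetric]) (use z1 g in simp_all)
  finally have 1: "\<gamma> L.a *\<^sub>E (X1 * p2 * (c1 \<gamma> * c2 \<gamma>)) = c1 \<gamma> * c2 \<gamma> * ((X1 + ?k *\<^sub>E L.z) * p2)" .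
  have "\<gamma> L.a *\<^sub>E (X2 * (c1 \<gamma> * c2 \<gamma>)) = c1 \<gamma> * (\<gamma> L.a *\<^sub>E (X2 * c2 \<gamma>))"
    using mult12[of "c1 \<gamma>" X2 1 "c2 \<gamma>"] g by simp
  also have "\<dots> = c1 \<gamma> * c2 \<gamma> * (X2 + ?k *\<^sub>E R.z)"
    using R.X_co_z[OF g nn] by (simp add: mult.assoc)
  finally have 2: "\<gamma> L.a *\<^sub>E (X2 * (c1 \<gamma> * c2 \<gamma>)) = c1 \<gamma> * c2 \<gamma> * (X2 + ?k *\<^sub>E R.z)" .
  have "\<gamma> L.a *\<^sub>E (XX * (c1 \<gamma> * c2 \<gamma>)) =
      c1 \<gamma> * c2 \<gamma> * ((X1 + ?k *\<^sub>E L.z) * p2) + c1 \<gamma> * c2 \<gamma> * (X2 + ?k *\<^sub>E R.z)"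
    by (simp only: XX_def distrib_right sm_add 1 2)
  also have "\<dots> = c1 \<gamma> * c2 \<gamma> * (XX + ?k *\<^sub>E Z')"
    by (simp add: XX_def Z'_def algebra_simps sm_add)
  finally show ?thesis .
qed

lemma XX_T_nilp:
  assumes g: "\<gamma> \<in> carrier (Gam D)" and nn: "L.nilp"
  shows "\<gamma> L.a *\<^sub>E (XX * (c1 \<gamma> * c2 \<gamma>)) = c1 \<gamma> * c2 \<gamma> * XX"
proof -
  have "\<gamma> L.a *\<^sub>E (X1 * p2 * (c1 \<gamma> * c2 \<gamma>)) = (\<gamma> L.a *\<^sub>E (X1 * c1 \<gamma>)) * (p2 * c2 \<gamma>)"
    using mult12[of "c1 \<gamma>" p2 X1 "c2 \<gamma>"] g by simp
  also have "\<dots> = (c1 \<gamma> * X1) * (c2 \<gamma> * p2)"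
    using L.X_co_nilp[OF g nn] R.go_co[OF L.a_in g] by simp
  also have "\<dots> = c1 \<gamma> * c2 \<gamma> * (X1 * p2)"
    by (rule mult12[symmetric]) (use g in simp_all)
  finally have 1: "\<gamma> L.a *\<^sub>E (X1 * p2 * (c1 \<gamma> * c2 \<gamma>)) = c1 \<gamma> * c2 \<gamma> * (X1 * p2)" .
  have "\<gamma> L.a *\<^sub>E (X2 * (c1 \<gamma> * c2 \<gamma>)) = c1 \<gamma> * (\<gamma> L.a *\<^sub>E (X2 * c2 \<gamma>))"
    using mult12[of "c1 \<gamma>" X2 1 "c2 \<gamma>"] g by simp
  also have "\<dots> = c1 \<gamma> * c2 \<gamma> * X2"
    using R.X_co_nilp[OF g nn] by (simp add: mult.assoc)
  finally have 2: "\<gamma> L.a *\<^sub>E (X2 * (c1 \<gamma> * c2 \<gamma>)) = c1 \<gamma> * c2 \<gamma> * X2" .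
  show ?thesis
    by (simp only: XX_def distrib_right distrib_left sm_add 1 2)
qed

text \<open>Multiplicativity on \<Gamma> rests on \<open>EE * EE = 0\<close> and on the degree n of
  \<open>EE\<close>, the powers of x and \<xi> on the q-binomial theorem. For the relation between x
  and \<gamma>, \<open>XX_EE\<close> turns \<open>Z'\<close> into \<open>ZZ\<close>, while
  \<open>Z'_EE\<close> and \<open>EE_ZZ\<close> remove the quadratic terms.\<close>

lemma double_ops_tensor: "double_ops D gg cc XX YY"
proof
  fix g h assume "g \<in> carrier L.G" "h \<in> carrier L.G"
  then show "gg (g \<otimes>\<^bsub>L.G\<^esub> h) = gg g * gg h"
    using mult12[of "g1 h" "g2 g" "g1 g" "g2 h"] by (simp add: gg_def L.go_mult R.go_mult)
next
  show "gg \<one>\<^bsub>L.G\<^esub> = 1" by (simp add: gg_def L.go_one R.go_one)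
next
  fix \<gamma> \<delta> assume g: "\<gamma> \<in> carrier (Gam D)" and d: "\<delta> \<in> carrier (Gam D)"
  let ?T = "\<lambda>\<gamma>. c1 \<gamma> * c2 \<gamma>" and ?k = "\<lambda>\<gamma>. \<gamma> L.a ^ n - 1"
  have T: "?T (\<gamma> \<otimes>\<^bsub>Gam D\<^esub> \<delta>) = ?T \<gamma> * ?T \<delta>"
    using mult12[of "c1 \<delta>" "c2 \<gamma>" "c1 \<gamma>" "c2 \<delta>"] g d
    by (simp add: L.co_mult R.co_mult del: characters_simps)
  have k: "?k (\<gamma> \<otimes>\<^bsub>Gam D\<^esub> \<delta>) = ?k \<gamma> * \<delta> L.a ^ n + ?k \<delta>"
    by (simp add: power_mult_distrib algebra_simps)
  have "cc \<gamma> * cc \<delta> = ?T \<gamma> * (?T \<delta> + ?k \<gamma> *\<^sub>E (EE * ?T \<delta>)) * (1 + ?k \<delta> *\<^sub>E EE)"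
    by (simp add: cc_def algebra_simps)
  also have "EE * ?T \<delta> = \<delta> L.a ^ n *\<^sub>E (?T \<delta> * EE)" by (rule T_EE[OF d])
  also have "?T \<gamma> * (?T \<delta> + ?k \<gamma> *\<^sub>E (\<delta> L.a ^ n *\<^sub>E (?T \<delta> * EE))) * (1 + ?k \<delta> *\<^sub>E EE) =
      ?T \<gamma> * ?T \<delta> * (1 + (?k \<gamma> * \<delta> L.a ^ n + ?k \<delta>) *\<^sub>E EE)"
    by (simp add: distrib_left distrib_right sm_add sm_add_left mult.assoc EE_EE)
  finally show "cc (\<gamma> \<otimes>\<^bsub>Gam D\<^esub> \<delta>) = cc \<gamma> * cc \<delta>"
    by (simp only: cc_def T k)
next
  show "cc \<one>\<^bsub>Gam D\<^esub> = 1"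
    using L.co_one R.co_one by (simp add: cc_def del: characters_simps) (simp add: characters_simps)
next
  have "X2 * (X1 * p2) = \<rho> *\<^sub>E ((X1 * p2) * X2)"
    using mult12[of X1 X2 1 p2] R.X_goa by (simp add: mult.assoc)
  then have "XX ^ n = (X1 * p2) ^ n + X2 ^ n"
    unfolding XX_def by (rule L.q_binomial_n)
  also have "(X1 * p2) ^ n = X1 ^ n * p2 ^ n"
    using swap[of X1 p2] by (intro pow_mult_comm) simp
  also have "\<dots> + X2 ^ n = scal D *\<^sub>E (p1 ^ n * p2 ^ n - 1)"
    by (simp add: L.X_pow R.X_pow left_diff_distrib sm_diff)
  also have "p1 ^ n * p2 ^ n = gg L.a ^ n"
    unfolding gg_def using swap[of p1 p2] by (intro pow_mult_comm[symmetric]) simp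
  finally show "XX ^ n = scal D *\<^sub>E (gg L.a ^ n - 1)" .
next
  fix g assume g: "g \<in> carrier L.G"
  have "X1 * p2 * gg g = L.\<chi> g *\<^sub>E (gg g * (X1 * p2))"
    unfolding gg_def using mult12[of "g1 g" p2 X1 "g2 g"] mult12[of X1 "g2 g" "g1 g" p2] g
    by (simp add: L.X_go R.go_comm[of L.a g])
  moreover have "X2 * gg g = L.\<chi> g *\<^sub>E (gg g * X2)"
    unfolding gg_def using mult12[of "g1 g" X2 1 "g2 g"] g by (simp add: R.X_go mult.assoc)
  ultimately show "XX * gg g = L.\<chi> g *\<^sub>E (gg g * XX)"
    by (simp add: XX_def distrib_left distrib_right sm_add)
next
  show "YY ^ n = 0" by (rule YY_n)
next
  fix \<gamma> assume g: "\<gamma> \<in> carrier (Gam D)"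
  let ?E = "1 + (\<gamma> L.a ^ n - 1) *\<^sub>E EE"
  have "YY * ?E = ?E * YY" by (simp add: distrib_left distrib_right YY_EE)
  moreover have "YY * cc \<gamma> = YY * (c1 \<gamma> * c2 \<gamma>) * ?E" by (simp add: cc_def mult.assoc)
  ultimately show "YY * cc \<gamma> = \<gamma> L.a *\<^sub>E (cc \<gamma> * YY)"
    by (simp add: YY_T[OF g] cc_def mult.assoc)
next
  fix g \<gamma> assume g: "g \<in> carrier L.G" and c: "\<gamma> \<in> carrier (Gam D)"
  have "EE * gg g = gg g * EE"
  proof (cases L.nilp)
    case False
    \<comment> \<open>Moving g past \<open>EE\<close> costs \<chi>(g)^(-n), which is 1 in this
      type.\<close>
    then show ?thesis
      using EE_scal_comm[of "g1 g" "g2 g" "inverse (L.\<chi> g)"] g L.go_co[OF g L.\<chi>_in] L.nonnilp_chi[OF False g]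
      by (simp add: gg_def L.Y_go R.Y_go power_inverse)
  qed (simp add: EE_def)
  moreover have "gg g * (c1 \<gamma> * c2 \<gamma>) = c1 \<gamma> * c2 \<gamma> * gg g"
    unfolding gg_def using mult12[of "c1 \<gamma>" "g2 g" "g1 g" "c2 \<gamma>"] mult12[of "g1 g" "c2 \<gamma>" "c1 \<gamma>" "g2 g"] g c
    by (simp add: L.go_co R.go_co)
  ultimately show "gg g * cc \<gamma> = cc \<gamma> * gg g"
    unfolding cc_def by (simp add: distrib_left distrib_right flip: mult.assoc) (simp add: mult.assoc)
next
  fix g assume g: "g \<in> carrier L.G"
  have "Y1 * gg g = inverse (L.\<chi> g) *\<^sub>E (gg g * Y1)"
    unfolding gg_def using comm3[OF L.Y_go[OF g], of "g2 g"] swap[of Y1 "g2 g"] g by (simp add: mult.assoc)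
  moreover have "u * Y2 * gg g = inverse (L.\<chi> g) *\<^sub>E (gg g * (u * Y2))"
    unfolding gg_def
    using mult12[of "g1 g" Y2 u "g2 g"] mult12[of u "g2 g" "g1 g" Y2] L.go_co[OF g L.\<chi>_in] g
    by (simp add: R.Y_go)
  ultimately show "YY * gg g = inverse (L.\<chi> g) *\<^sub>E (gg g * YY)"
    by (simp add: YY_def distrib_left distrib_right sm_add)
next
  have "X1 * p2 * Y1 - Y1 * (X1 * p2) = (X1 * Y1 - Y1 * X1) * p2"
    using swap[of Y1 p2] by (simp add: left_diff_distrib mult.assoc)
  moreover have "X1 * p2 * (u * Y2) = u * Y2 * (X1 * p2)"
    using mult12[of u p2 X1 Y2] mult12[of X1 Y2 u p2] L.X_cochi R.Y_goa by simp
  moreover have "X2 * Y1 = Y1 * X2" using swap[of Y1 X2] by simp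
  moreover have "X2 * (u * Y2) - u * Y2 * X2 = u * (X2 * Y2 - Y2 * X2)"
    using swap[of u X2] comm3'[of X2 u Y2] by (simp add: right_diff_distrib mult.assoc)
  moreover have "XX * YY - YY * XX = (X1 * p2 * Y1 - Y1 * (X1 * p2))
      + (X1 * p2 * (u * Y2) - u * Y2 * (X1 * p2)) + (X2 * Y1 - Y1 * X2) + (X2 * (u * Y2) - u * Y2 * X2)"
    by (simp add: XX_def YY_def distrib_left distrib_right)
  ultimately have "XX * YY - YY * XX = (X1 * Y1 - Y1 * X1) * p2 + u * (X2 * Y2 - Y2 * X2)"
    by simp
  also have "\<dots> = p1 * p2 - u * v"
    by (simp add: L.XY R.XY left_diff_distrib right_diff_distrib)
  finally show "XX * YY - YY * XX = gg L.a - cc L.\<chi>" by (simp add: gg_def cc_chi)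
next
  fix \<gamma> assume g: "\<gamma> \<in> carrier (Gam D)"
  let ?k = "\<gamma> L.a ^ n - 1" and ?T = "c1 \<gamma> * c2 \<gamma>"
  show "\<gamma> L.a *\<^sub>E (XX * cc \<gamma>) = cc \<gamma> * XX +
        (if L.nilp then 0 else (?k / qfact \<rho> (n - 1)) *\<^sub>E
           (cc \<gamma> * (\<rho> *\<^sub>E gg L.a - cc L.\<chi>) * YY ^ (n - 1)))"
  proof (cases L.nilp)
    case True
    then show ?thesis using XX_T_nilp[OF g True] by (simp add: cc_def EE_def)
  next
    case False
    have "\<gamma> L.a *\<^sub>E (XX * cc \<gamma>) = (\<gamma> L.a *\<^sub>E (XX * ?T)) * (1 + ?k *\<^sub>E EE)"
      by (simp add: cc_def mult.assoc)
    also have "\<dots> = ?T * ((XX + ?k *\<^sub>E Z') * (1 + ?k *\<^sub>E EE))"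
      by (simp only: XX_T[OF g False] mult.assoc)
    also have "(XX + ?k *\<^sub>E Z') * (1 + ?k *\<^sub>E EE) = XX + ?k *\<^sub>E (XX * EE) + ?k *\<^sub>E Z'"
      by (simp add: distrib_left distrib_right Z'_EE)
    also have "\<dots> = XX + ?k *\<^sub>E (EE * XX + ZZ)"
      by (simp add: XX_EE[OF False, symmetric] sm_add sm_diff)
    also have "\<dots> = (1 + ?k *\<^sub>E EE) * (XX + ?k *\<^sub>E ZZ)"
      by (simp add: distrib_left distrib_right EE_ZZ sm_add)
    also have "?T * ((1 + ?k *\<^sub>E EE) * (XX + ?k *\<^sub>E ZZ)) = cc \<gamma> * XX + ?k *\<^sub>E (cc \<gamma> * ZZ)"
      by (simp add: cc_def mult.assoc distrib_left distrib_right sm_add)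
    finally show ?thesis
      using False by (simp add: ZZ_def gg_def cc_chi mult.assoc)
  qed
qed

end


section \<open>Kronecker products and the tensor square of the free algebra\<close>

lemma sum_div_mod:
  fixes f :: "nat \<Rightarrow> nat \<Rightarrow> 'a::comm_monoid_add"
  shows "(\<Sum>k<m * d. f (k div d) (k mod d)) = (\<Sum>a<m. \<Sum>b<d. f a b)"
proof -
  have "(\<Sum>k<m * d. f (k div d) (k mod d)) = (\<Sum>ab\<in>{..<m} \<times> {..<d}. f (fst ab) (snd ab))"
  proof (rule sum.reindex_bij_witness[of _ "\<lambda>ab. fst ab * d + snd ab" "\<lambda>k. (k div d, k mod d)"])
    fix ab assume ab: "ab \<in> {..<m} \<times> {..<d}"
    have "fst ab * d + snd ab < fst ab * d + d" using ab by auto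
    also have "\<dots> = Suc (fst ab) * d" by simp
    also have "\<dots> \<le> m * d" using ab by (intro mult_right_mono) auto
    finally show "fst ab * d + snd ab \<in> {..<m * d}" by simp
    show "((fst ab * d + snd ab) div d, (fst ab * d + snd ab) mod d) = ab" using ab by auto
  next
    fix k assume k: "k \<in> {..<m * d}"
    then have "d > 0" by (cases d) auto
    with k show "(k div d, k mod d) \<in> {..<m} \<times> {..<d}"
      by (auto simp: less_mult_imp_div_less)
  qed auto
  then show ?thesis by (simp add: sum.cartesian_product split_beta)
qed

lemma kron_carrier [simp]:
  "A \<in> carrier_mat d d \<Longrightarrow> B \<in> carrier_mat e e \<Longrightarrow> kron A B \<in> carrier_mat (d * e) (d * e)"
  by (auto simp: kron_def)

lemma kron_index:
  "A \<in> carrier_mat d d \<Longrightarrow> B \<in> carrier_mat e e \<Longrightarrow> i < d * e \<Longrightarrow> j < d * e \<Longrightarrow>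
    kron A B $$ (i, j) = A $$ (i div e, j div e) * B $$ (i mod e, j mod e)"
  by (auto simp: kron_def)

lemma div_mod_less: "i < d * (e::nat) \<Longrightarrow> i div e < d \<and> i mod e < e"
  by (cases "e = 0") (auto simp: less_mult_imp_div_less)

lemma kron_mult:
  assumes "A \<in> carrier_mat d d" "B \<in> carrier_mat e e" "A' \<in> carrier_mat d d" "B' \<in> carrier_mat e e"
  shows "kron A B * kron A' B' = kron (A * A') (B * B')"
proof (rule eq_matI)
  fix i j assume "i < dim_row (kron (A * A') (B * B'))" "j < dim_col (kron (A * A') (B * B'))"
  then have ij: "i < d * e" "j < d * e" using assms by (auto simp: kron_def)
  note dm = div_mod_less[OF ij(1)] div_mod_less[OF ij(2)]
  have "(kron A B * kron A' B') $$ (i, j) = (\<Sum>k<d * e. kron A B $$ (i, k) * kron A' B' $$ (k, j))"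
    using ij kron_carrier[OF assms(1,2)] kron_carrier[OF assms(3,4)]
    by (simp add: scalar_prod_def atLeast0LessThan)
  also have "\<dots> = (\<Sum>k<d * e. (A $$ (i div e, k div e) * A' $$ (k div e, j div e))
      * (B $$ (i mod e, k mod e) * B' $$ (k mod e, j mod e)))"
    using ij by (intro sum.cong) (simp_all add: kron_index[OF assms(1,2)] kron_index[OF assms(3,4)])
  also have "\<dots> = (\<Sum>k<d. \<Sum>k'<e. (A $$ (i div e, k) * A' $$ (k, j div e))
      * (B $$ (i mod e, k') * B' $$ (k', j mod e)))"
    by (rule sum_div_mod)
  also have "\<dots> = (A * A') $$ (i div e, j div e) * (B * B') $$ (i mod e, j mod e)"
    using dm assms by (simp add: scalar_prod_def atLeast0LessThan sum_product)
  also have "\<dots> = kron (A * A') (B * B') $$ (i, j)"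
    using kron_index[of "A * A'" d "B * B'" e i j] assms ij by simp
  finally show "(kron A B * kron A' B') $$ (i, j) = kron (A * A') (B * B') $$ (i, j)" .
qed (use assms in \<open>auto simp: kron_def\<close>)

lemma kron_one: "kron (1\<^sub>m d) (1\<^sub>m e) = (1\<^sub>m (d * e) :: 'k::field mat)"
proof (rule eq_matI)
  fix i j assume "i < dim_row (1\<^sub>m (d * e) :: 'k mat)" "j < dim_col (1\<^sub>m (d * e) :: 'k mat)"
  then have ij: "i < d * e" "j < d * e" by auto
  note dm = div_mod_less[OF ij(1)] div_mod_less[OF ij(2)]
  have "i = j \<longleftrightarrow> i div e = j div e \<and> i mod e = j mod e" by (metis div_mult_mod_eq)
  with ij dm show "kron (1\<^sub>m d) (1\<^sub>m e) $$ (i, j) = (1\<^sub>m (d * e) :: 'k mat) $$ (i, j)"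
    by (auto simp: kron_def)
qed (auto simp: kron_def)

text \<open>With \<open>kr\<close> below, the two tensor factors acting by commuting algebra maps on
  the product space.\<close>

definition kl :: "nat \<Rightarrow> nat \<Rightarrow> 'k::field mat \<Rightarrow> 'k endo" where
  "kl d e A = emb (d * e) (kron A (1\<^sub>m e))"

definition kr :: "nat \<Rightarrow> nat \<Rightarrow> 'k::field mat \<Rightarrow> 'k endo" where
  "kr d e B = emb (d * e) (kron (1\<^sub>m d) B)"

lemma kron_bilinear:
  assumes "A \<in> carrier_mat d d" "B \<in> carrier_mat e e" "A' \<in> carrier_mat d d" "B' \<in> carrier_mat e e"
  shows "kron (A + A') B = kron A B + kron A' B" "kron A (B + B') = kron A B + kron A B'"
    "kron (c \<cdot>\<^sub>m A) B = c \<cdot>\<^sub>m kron A B" "kron A (c \<cdot>\<^sub>m B) = c \<cdot>\<^sub>m kron A B"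
  by (rule eq_matI; use assms in \<open>auto simp: kron_def algebra_simps less_mult_imp_div_less dest: div_mod_less\<close>)+

context
  fixes d e :: nat
  assumes d: "d > 0" and e: "e > 0"
begin

lemma kron_one_mult:
  "A \<in> carrier_mat d d \<Longrightarrow> B \<in> carrier_mat d d \<Longrightarrow> kron (A * B) (1\<^sub>m e) = kron A (1\<^sub>m e) * kron B (1\<^sub>m e)"
  "A \<in> carrier_mat e e \<Longrightarrow> B \<in> carrier_mat e e \<Longrightarrow> kron (1\<^sub>m d) (A * B) = kron (1\<^sub>m d) A * kron (1\<^sub>m d) B"
  "A \<in> carrier_mat d d \<Longrightarrow> B \<in> carrier_mat e e \<Longrightarrow> kron A (1\<^sub>m e) * kron (1\<^sub>m d) B = kron A B"
  "A \<in> carrier_mat d d \<Longrightarrow> B \<in> carrier_mat e e \<Longrightarrow> kron (1\<^sub>m d) B * kron A (1\<^sub>m e) = kron A B"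
  using kron_mult[of A d "1\<^sub>m e" e B "1\<^sub>m e"] kron_mult[of "1\<^sub>m d" d A e "1\<^sub>m d" B]
    kron_mult[of A d "1\<^sub>m e" e "1\<^sub>m d" B] kron_mult[of "1\<^sub>m d" d B e A "1\<^sub>m e"]
  by simp_all

lemma mhom_kl: "mhom d (kl d e)"
  using d e
  by (auto simp: mhom_def kl_def kron_one_mult kron_one emb_one
      kron_bilinear(1)[OF _ one_carrier_mat _ one_carrier_mat]
      kron_bilinear(3)[OF _ one_carrier_mat _ one_carrier_mat] emb_mult emb_add emb_smult)

lemma mhom_kr: "mhom e (kr d e)"
  using d e
  by (auto simp: mhom_def kr_def kron_one_mult kron_one emb_one
      kron_bilinear(2)[OF one_carrier_mat _ one_carrier_mat]
      kron_bilinear(4)[OF one_carrier_mat _ one_carrier_mat] emb_mult emb_add emb_smult)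

lemma emb_kron:
  assumes "A \<in> carrier_mat d d" "B \<in> carrier_mat e e"
  shows "emb (d * e) (kron A B) = kl d e A * kr d e B" "kr d e B * kl d e A = kl d e A * kr d e B"
  using assms d e by (simp_all add: kl_def kr_def kron_one_mult flip: emb_mult)

end

lemma emb_lin_ext:
  assumes d: "d > 0" and f: "\<And>w. w \<in> Poly_Mapping.keys p \<Longrightarrow> emb d (f w) = h w"
  shows "emb d (lin_ext d f p) = Ev h p"
proof (rule endo_eqI, rule fvec_eqI)
  fix v :: "'b fvec" and i
  let ?c = "Poly_Mapping.lookup p" and ?w = "\<lambda>j. ent v (d * (i div d) + j)"
  have "ent (app (emb d (lin_ext d f p)) v) i =
      (\<Sum>j<d. \<Sum>w\<in>Poly_Mapping.keys p. ?c w * f w $$ (i mod d, j) * ?w j)"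
    using d by (simp add: app_emb lin_ext_def sum_distrib_right)
  also have "\<dots> = (\<Sum>w\<in>Poly_Mapping.keys p. \<Sum>j<d. ?c w * f w $$ (i mod d, j) * ?w j)"
    by (rule sum.swap)
  also have "\<dots> = (\<Sum>w\<in>Poly_Mapping.keys p. ent (app (?c w *\<^sub>E emb d (f w)) v) i)"
    by (simp add: app_emb sum_distrib_left mult.assoc)
  also have "\<dots> = ent (app (Ev h p) v) i"
    by (simp add: Ev_def app_esum ent_sum f)
  finally show "ent (app (emb d (lin_ext d f p)) v) i = ent (app (Ev h p) v) i" .
qed

lemma lin_ext_carrier [simp]: "lin_ext d f p \<in> carrier_mat d d"
  by (simp add: lin_ext_def)

text \<open>The action of a module is known only for words over \<open>S\<close>, so the words
  occurring in a coproduct have to be tracked.\<close>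

definition FA2 :: "'s set \<Rightarrow> ('s word \<times> 's word \<Rightarrow>\<^sub>0 'k::field) set" where
  "FA2 S = {t. \<forall>uw\<in>Poly_Mapping.keys t. set (letters (fst uw)) \<subseteq> S \<and> set (letters (snd uw)) \<subseteq> S}"

lemma FA2_single: "set (letters u) \<subseteq> S \<Longrightarrow> set (letters w) \<subseteq> S \<Longrightarrow> Poly_Mapping.single (u, w) c \<in> FA2 S"
  by (auto simp: FA2_def split: if_splits)

lemma FA2_zero [simp]: "0 \<in> FA2 S"
  by (simp add: FA2_def)

lemma FA2_add [simp]: "s \<in> FA2 S \<Longrightarrow> t \<in> FA2 S \<Longrightarrow> s + t \<in> FA2 S"
  unfolding FA2_def using keys_add[of s t] by blast

lemma FA2_mult [simp]: "s \<in> FA2 S \<Longrightarrow> t \<in> FA2 S \<Longrightarrow> s * t \<in> FA2 S"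
  unfolding FA2_def using keys_mult[of s t] by (fastforce simp: plus_word_def)

lemma FA2_sum: "(\<And>i. i \<in> I \<Longrightarrow> f i \<in> FA2 S) \<Longrightarrow> (\<Sum>i\<in>I. f i) \<in> FA2 S"
  by (induction I rule: infinite_finite_induct) simp_all

lemma FA2_const [simp]: "const c \<in> FA2 S"
  by (simp add: zero_prod_def zero_word_def FA2_single)

lemma FA2_prod_list: "(\<And>t. t \<in> set ts \<Longrightarrow> t \<in> FA2 S) \<Longrightarrow> prod_list ts \<in> FA2 S"
proof (induction ts)
  case Nil
  show ?case using FA2_const[of 1] by simp
next
  case (Cons t ts)
  then show ?case by (simp del: FA2_mult add: FA2_mult[of t S "prod_list ts"])
qed

lemma FA2_tens [simp]: "p \<in> FA S \<Longrightarrow> q \<in> FA S \<Longrightarrow> p \<otimes>\<^sub>F q \<in> FA2 S"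
  unfolding tens_def by (intro FA2_sum FA2_single) (auto simp: FA_iff)

lemma Ev_cong:
  assumes "p \<in> FA S" "\<And>s. s \<in> S \<Longrightarrow> r s = r' s"
  shows "Ev (wev r) p = Ev (wev r') p"
  using assms(1)
proof (induction rule: free_algebra_induct)
  case (gen s)
  then show ?case using assms(2) by simp
qed (simp_all add: Ev_simps del: Ev_single)

definition wev2 :: "('s \<Rightarrow> 'k::field endo) \<Rightarrow> ('s \<Rightarrow> 'k endo) \<Rightarrow> 's word \<times> 's word \<Rightarrow> 'k endo" where
  "wev2 r r' uw = wev r (fst uw) * wev r' (snd uw)"

lemma wev_commute:
  assumes "\<And>s. F * r s = r s * F"
  shows "F * wev r w = wev r w * F"
proof -
  have "F * prod_list (map r xs) = prod_list (map r xs) * F" for xs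
    by (induction xs) (simp_all add: mult.assoc comm3'[OF assms])
  then show ?thesis by (simp add: wev_def)
qed

lemma multiplicative_wev2:
  assumes "\<And>s s'. r' s' * r s = r s * r' s'"
  shows "multiplicative (wev2 r r')"
proof -
  have "r' s * wev r u = wev r u * r' s" for s u by (rule wev_commute) (rule assms)
  then have c: "wev r u * wev r' w = wev r' w * wev r u" for u w
    by (intro wev_commute) simp
  have m: "wev r (u + w) = wev r u * wev r w" for r :: "'a \<Rightarrow> 'b endo" and u w
    using multiplicative_wev[of r] by (simp add: multiplicative_def)
  show ?thesis
    unfolding multiplicative_def wev2_def
    by (auto simp: zero_prod_def m mult.assoc) (metis c mult.assoc)
qed

lemma Ev_tens: "Ev (wev2 r r') (p \<otimes>\<^sub>F q) = Ev (wev r) p * Ev (wev r') q"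
  by (simp add: tens_def Ev_sum wev2_def Ev_def[of "wev _"] sum_product mult.commute)

lemma Ev_prod_list: "multiplicative f \<Longrightarrow> Ev f (prod_list ts) = prod_list (map (Ev f) ts)"
  by (induction ts) (simp_all add: Ev_one Ev_mult)

text \<open>The locale constrains \<open>go\<close> and \<open>co\<close> on the carriers only, so
  their values elsewhere may be changed at will.\<close>

lemma double_ops_cong:
  assumes "double_ops D go co X Y"
    and go: "\<And>g. g \<in> carrier (grp D) \<Longrightarrow> go' g = go g"
    and co: "\<And>\<gamma>. \<gamma> \<in> carrier (Gam D) \<Longrightarrow> co' \<gamma> = co \<gamma>"
  shows "double_ops D go' co' X Y"
proof -
  interpret double_ops D go co X Y by fact
  show ?thesis
    by unfold_locales
      (simp_all add: go co go_mult go_one co_mult co_one X_pow X_go Y_pow Y_co go_co Y_go XY X_co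
        \<Gamma>.m_closed \<Gamma>.one_closed del: characters_simps)
qed

section \<open>Modules over the double from generators, and their tensor products\<close>

context gdatum
begin

definition opM :: "(('g, 'k) dfree set, 'k) fdmod \<Rightarrow> ('g, 'k) dgen \<Rightarrow> 'k endo" where
  "opM M s = emb (mdim M) (mact M (cl (gen s)))"

lemma ops_opM: "fd_module Alg M \<Longrightarrow> mdim M > 0 \<Longrightarrow> ops (opM M)"
  using mhom_rel[OF _ mhom_emb, of M] rels_iff[of "opM M"] by (simp add: opM_def[abs_def])

lemma module_of_gens:
  assumes d: "d > 0" and r: "\<And>s. r s \<in> carrier_mat d d" and rel: "ops (\<lambda>s. emb d (r s))"
  shows "fd_module Alg (module_of_gens d r)"
    "s \<in> dgens D \<Longrightarrow> opM (module_of_gens d r) s = emb d (r s)"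
proof -
  let ?M = "module_of_gens d r"
  have w: "emb d (word_mat d r w) = wev (\<lambda>s. emb d (r s)) w" for w
  proof -
    have "emb d (foldr (\<lambda>s A. r s * A) xs (1\<^sub>m d)) = prod_list (map (\<lambda>s. emb d (r s)) xs) \<and>
        foldr (\<lambda>s A. r s * A) xs (1\<^sub>m d) \<in> carrier_mat d d" for xs
      by (induction xs) (simp_all add: emb_one[OF d] emb_mult[OF d] r mult_carrier_mat[OF r])
    then show ?thesis by (simp add: word_mat_def wev_def)
  qed
  have m: "mdim ?M = d" by (simp add: module_of_gens_def)
  note * = fd_module_of_operators[of ?M "\<lambda>s. emb d (r s)", unfolded m, OF d]
  have 1: "Ev (wev (\<lambda>s. emb d (r s))) r' = 0" if "r' \<in> drels D" for r'
    using that rel rels_iff by blast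
  have 2: "emb d (mact ?M X) = Ev (wev (\<lambda>s. emb d (r s))) (SOME p. p \<in> X)" for X
    by (simp add: module_of_gens_def emb_lin_ext[OF d w])
  have 3: "mact ?M X \<in> carrier_mat d d" for X by (simp add: module_of_gens_def)
  show "fd_module Alg ?M" by (rule *(1)) (use 1 2 3 in auto)
  show "s \<in> dgens D \<Longrightarrow> opM ?M s = emb d (r s)"
    using *(2)[of "gen s"] 1 2 3 by (auto simp: opM_def m)
qed

text \<open>The evaluated comultiplication satisfies the relations by
  \<open>double_ops_tensor\<close>. For a general \<gamma> only the shape of the coproduct is
  retained: every term of the correction ends in a positive power of \<xi> on the right factor, so
  it disappears on vectors that this \<xi> kills.\<close>

lemma tensor_module:
  assumes M: "fd_module Alg M" "mdim M > 0" and N: "fd_module Alg N" "mdim N > 0"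
  defines "l \<equiv> \<lambda>s. kl (mdim M) (mdim N) (mact M (cl (gen s)))"
    and "r \<equiv> \<lambda>s. kr (mdim M) (mdim N) (mact N (cl (gen s)))"
  shows "fd_module Alg (tensor_module D M N)"
    and "g \<in> carrier G \<Longrightarrow> opM (tensor_module D M N) (GrpGen g) = l (GrpGen g) * r (GrpGen g)"
    and "opM (tensor_module D M N) XGen = l XGen * r (GrpGen a) + r XGen"
    and "opM (tensor_module D M N) XiGen = l XiGen + l (ChrGen \<chi>) * r XiGen"
    and "opM (tensor_module D M N) (ChrGen \<chi>) = l (ChrGen \<chi>) * r (ChrGen \<chi>)"
    and "\<gamma> \<in> carrier (Gam D) \<Longrightarrow>
      \<exists>H. opM (tensor_module D M N) (ChrGen \<gamma>) = l (ChrGen \<gamma>) * r (ChrGen \<gamma>) + H * r XiGen"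
proof -
  let ?d = "mdim M" and ?e = "mdim N" and ?S = "dgens D" and ?T = "tensor_module D M N"
  have de: "?d * ?e > 0" using M N by simp
  \<comment> \<open>Outside the generators the operators are replaced by 1, so that all left ones
    commute with all right ones, as \<open>multiplicative_wev2\<close> requires.\<close>
  define l' where "l' s = (if s \<in> ?S then l s else 1)" for s
  define r' where "r' s = (if s \<in> ?S then r s else 1)" for s
  have c: "r' s' * l' s = l' s * r' s'" for s s'
    unfolding l'_def r'_def l_def r_def
    using emb_kron(2)[OF M(2) N(2) rep_hom(1)[OF M(1), of "gen s" "gen s"]
      rep_hom(1)[OF N(1), of "gen s'" "gen s'"]] by auto
  let ?f = "wev2 l' r'"
  have mf: "multiplicative ?f" by (rule multiplicative_wev2) (rule c)
  have ol: "ops l" using mhom_rel[OF M(1) mhom_kl[OF M(2) N(2)], folded l_def] rels_iff[of l] by blast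
  have orr: "ops r" using mhom_rel[OF N(1) mhom_kr[OF M(2) N(2)], folded r_def] rels_iff[of r] by blast
  have ll: "l' s = l s" if "s \<in> ?S" for s using that by (simp add: l'_def)
  have rr: "r' s = r s" if "s \<in> ?S" for s using that by (simp add: r'_def)
  have ol': "ops l'" by (rule double_ops_cong[of D "\<lambda>g. l (GrpGen g)" "\<lambda>\<gamma>. l (ChrGen \<gamma>)"]) (use ol in \<open>simp_all add: ll\<close>)
  have orr': "ops r'" by (rule double_ops_cong[of D "\<lambda>g. r (GrpGen g)" "\<lambda>\<gamma>. r (ChrGen \<gamma>)"]) (use orr in \<open>simp_all add: rr\<close>)
  interpret O: tensor_ops D "\<lambda>g. l' (GrpGen g)" "\<lambda>\<gamma>. l' (ChrGen \<gamma>)" "l' XGen" "l' XiGen"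
      "\<lambda>g. r' (GrpGen g)" "\<lambda>\<gamma>. r' (ChrGen \<gamma>)" "r' XGen" "r' XiGen"
    by (intro tensor_ops.intro ol' orr' tensor_ops_axioms.intro) (auto simp: c)
  define t where "t s = Ev ?f (comult_gen D s)" for s
  have tg: "t (GrpGen g) = O.gg g" for g by (simp add: t_def Ev_tens O.gg_def)
  have tX: "t XGen = O.XX" by (simp add: t_def Ev_add Ev_tens Ev_one O.XX_def)
  have tY: "t XiGen = O.YY" by (simp add: t_def Ev_add Ev_tens Ev_one O.YY_def)
  have tc: "t (ChrGen \<gamma>) = O.cc \<gamma>" if g: "\<gamma> \<in> carrier (Gam D)" for \<gamma>
  proof (cases nilp)
    case True
    then show ?thesis by (simp add: t_def Ev_add Ev_tens O.cc_def O.EE_def)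
  next
    case False
    let ?P = "{(p, r). p + r = n \<and> p \<ge> 1 \<and> r \<ge> 1}"
    let ?F = "\<lambda>p r. (1 / (qfact \<rho> p * qfact \<rho> r)) *\<^sub>E
        ((l' (ChrGen \<gamma>) * l' (ChrGen \<chi>) ^ p * l' XiGen ^ r) * (r' (ChrGen \<gamma>) * r' XiGen ^ p))"
    have "t (ChrGen \<gamma>) = l' (ChrGen \<gamma>) * r' (ChrGen \<gamma>) + (\<gamma> a ^ n - 1) *\<^sub>E (\<Sum>pr\<in>?P. ?F (fst pr) (snd pr))"
      using False
      by (simp add: t_def Ev_add Ev_tens Ev_mult[OF mf] Ev_sum split_beta Ev_mult Ev_power char_pow
          Ev_const[OF mf] del: Ev_single)
    also have "(\<Sum>pr\<in>?P. ?F (fst pr) (snd pr)) = (\<Sum>p\<in>{1..<n}. ?F p (n - p))"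
    proof (rule sum.reindex_bij_witness[of _ "\<lambda>p. (p, n - p)" fst])
      fix pr assume "pr \<in> ?P"
      then have "n - fst pr = snd pr" by auto
      then show "?F (fst pr) (n - fst pr) = ?F (fst pr) (snd pr)" by simp
    qed auto
    also have "\<dots> = (\<Sum>p\<in>{1..<n}. (l' (ChrGen \<gamma>) * r' (ChrGen \<gamma>)) * (O.e p *\<^sub>E O.K p))"
    proof (rule sum.cong)
      fix p
      have "(l' (ChrGen \<gamma>) * (l' (ChrGen \<chi>) ^ p * l' XiGen ^ (n - p))) * (r' (ChrGen \<gamma>) * r' XiGen ^ p)
         = (l' (ChrGen \<gamma>) * r' (ChrGen \<gamma>)) * O.K p"
        unfolding O.K_def by (rule O.mult12[symmetric]) (use g in simp_all)
      then show "?F p (n - p) = (l' (ChrGen \<gamma>) * r' (ChrGen \<gamma>)) * (O.e p *\<^sub>E O.K p)"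
        by (simp add: O.e_def mult.assoc)
    qed simp
    finally show ?thesis
      using False by (simp add: O.cc_def O.EE_def distrib_left sum_distrib_left)
  qed
  have ot: "ops t"
    unfolding tX tY
    by (rule double_ops_cong[OF O.double_ops_tensor]) (simp_all add: tg tc)
  have g2: "comult_gen D s \<in> FA2 ?S" if s: "s \<in> ?S" for s
  proof (cases s)
    case (ChrGen \<gamma>)
    with s show ?thesis
      by (cases nilp) (auto intro!: FA2_add FA2_mult FA2_sum FA2_tens FA_mult FA_power FA2_const
          simp del: characters_simps)
  qed (use s in \<open>auto intro!: FA2_add FA2_tens\<close>)
  have c2: "comult D p \<in> FA2 ?S" if "p \<in> FA ?S" for p
    unfolding comult_def
    by (intro FA2_sum FA2_mult FA2_const FA2_prod_list) (use g2 that in \<open>auto simp: FA_iff\<close>)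
  have tp: "Ev ?f (comult D p) = Ev (wev t) p" for p
  proof -
    have "Ev ?f (comult D p) =
        (\<Sum>w\<in>Poly_Mapping.keys p. Poly_Mapping.lookup p w *\<^sub>E prod_list (map t (letters w)))"
      by (simp add: comult_def Ev_sum Ev_mult[OF mf] Ev_const[OF mf] Ev_prod_list[OF mf] t_def[abs_def]
          comp_def del: Ev_single)
    then show ?thesis by (simp add: Ev_def wev_def)
  qed
  have single: "Poly_Mapping.single w 1 \<in> FA ?S" if "set (letters w) \<subseteq> ?S" for w
    using that by (simp add: FA_iff)
  have kron: "emb (?d * ?e) (kron (mact M (cl (Poly_Mapping.single u 1))) (mact N (cl (Poly_Mapping.single w 1))))
      = ?f (u, w)" if uw: "set (letters u) \<subseteq> ?S" "set (letters w) \<subseteq> ?S" for u w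
  proof -
    note u = single[OF uw(1)] and w = single[OF uw(2)]
    have "kl ?d ?e (mact M (cl (Poly_Mapping.single u 1))) = Ev (wev l') (Poly_Mapping.single u 1)"
      using mhom_rep[OF M(1) mhom_kl[OF M(2) N(2)] u, folded l_def] Ev_cong[OF u ll] by simp
    moreover have "kr ?d ?e (mact N (cl (Poly_Mapping.single w 1))) = Ev (wev r') (Poly_Mapping.single w 1)"
      using mhom_rep[OF N(1) mhom_kr[OF M(2) N(2)] w, folded r_def] Ev_cong[OF w rr] by simp
    ultimately show ?thesis
      using emb_kron(1)[OF M(2) N(2) rep_hom(1)[OF M(1) u u] rep_hom(1)[OF N(1) w w]]
      by (simp add: wev2_def)
  qed
  have dim: "mdim ?T = ?d * ?e" by (simp add: tensor_module_def Let_def)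
  have act: "emb (?d * ?e) (mact ?T X) = Ev (wev t) (SOME p. p \<in> X)" if X: "X \<in> carrier Alg" for X
  proof -
    let ?p = "SOME p. p \<in> X"
    have "comult D ?p \<in> FA2 ?S" by (rule c2) (rule some_rep[OF X])
    then have "emb (?d * ?e) (mact ?T X) = Ev ?f (comult D ?p)"
      unfolding tensor_module_def Let_def fdmod.simps
      by (intro emb_lin_ext de) (auto simp: kron FA2_def)
    then show ?thesis by (simp add: tp)
  qed
  have car: "mact ?T X \<in> carrier_mat (?d * ?e) (?d * ?e)" for X
    by (simp add: tensor_module_def Let_def)
  note * = fd_module_of_operators[of ?T t, unfolded dim, OF de _ car act]
  have rel: "Ev (wev t) q = 0" if "q \<in> drels D" for q using that ot rels_iff by blast
  show "fd_module Alg ?T" by (rule *(1)) (use rel in auto)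
  have opT: "opM ?T s = t s" if "s \<in> ?S" for s
    using *(2)[of "gen s"] rel that by (auto simp: opM_def dim)
  have oX: "opM ?T XGen = O.XX" and oY: "opM ?T XiGen = O.YY"
    using opT[of XGen] opT[of XiGen] tX tY by simp_all
  have og: "opM ?T (GrpGen g) = O.gg g" if "g \<in> carrier G" for g
    using opT[of "GrpGen g"] tg that by simp
  have oc: "opM ?T (ChrGen \<gamma>) = O.cc \<gamma>" if "\<gamma> \<in> carrier (Gam D)" for \<gamma>
    using opT[of "ChrGen \<gamma>"] tc[OF that] that by simp
  show "opM ?T (GrpGen g) = l (GrpGen g) * r (GrpGen g)" if "g \<in> carrier G"
    unfolding og[OF that] O.gg_def using that by (simp add: ll rr)
  show "opM ?T XGen = l XGen * r (GrpGen a) + r XGen"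
    unfolding oX O.XX_def by (simp add: ll rr)
  show "opM ?T XiGen = l XiGen + l (ChrGen \<chi>) * r XiGen"
    unfolding oY O.YY_def by (simp add: ll rr)
  show "opM ?T (ChrGen \<chi>) = l (ChrGen \<chi>) * r (ChrGen \<chi>)"
    unfolding oc[OF \<chi>_in] O.cc_chi by (simp add: ll rr)
  show "\<exists>H. opM ?T (ChrGen \<gamma>) = l (ChrGen \<gamma>) * r (ChrGen \<gamma>) + H * r XiGen"
    if g: "\<gamma> \<in> carrier (Gam D)"
  proof -
    let ?H = "\<lambda>p. O.e p *\<^sub>E ((l' (ChrGen \<chi>) ^ p * l' XiGen ^ (n - p)) * r' XiGen ^ (p - 1))"
    have K: "O.e p *\<^sub>E O.K p = ?H p * r' XiGen" if "p \<in> {1..<n}" for p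
    proof -
      have "r' XiGen ^ p = r' XiGen ^ (p - 1) * r' XiGen"
        using that power_Suc2[of "r' XiGen" "p - 1"] by simp
      then show ?thesis unfolding O.K_def by (simp only: sm_simps mult.assoc)
    qed
    have "O.EE = (if nilp then 0 else \<Sum>p\<in>{1..<n}. ?H p) * r' XiGen"
      unfolding O.EE_def by (cases nilp) (simp_all only: if_True if_False mult_zero_left sum_distrib_right K cong: sum.cong)
    then have "\<exists>H. O.EE = H * r' XiGen" by (rule exI)
    then obtain H where H: "O.EE = H * r' XiGen" by blast
    have "opM ?T (ChrGen \<gamma>) = l (ChrGen \<gamma>) * r (ChrGen \<gamma>) * (1 + (\<gamma> a ^ n - 1) *\<^sub>E (H * r XiGen))"
      unfolding oc[OF g] O.cc_def H using g by (simp only: ll rr dgens_simps)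
    then have "opM ?T (ChrGen \<gamma>) = l (ChrGen \<gamma>) * r (ChrGen \<gamma>) +
        ((\<gamma> a ^ n - 1) *\<^sub>E (l (ChrGen \<gamma>) * r (ChrGen \<gamma>) * H)) * r XiGen"
      by (simp only: distrib_left sm_simps mult.assoc mult_1_right)
    then show ?thesis by blast
  qed
qed

end


section \<open>Comparing embedded matrices on basis vectors\<close>

definition ER :: "nat \<Rightarrow> 'k::field endo set" where
  "ER d = emb d ` carrier_mat d d"

lemma ER_emb [simp]: "A \<in> carrier_mat d d \<Longrightarrow> emb d A \<in> ER d"
  by (simp add: ER_def)

lemma ER_ops:
  fixes F H :: "'k::field endo"
  assumes d: "d > 0" and "F \<in> ER d" "H \<in> ER d"
  shows "F * H \<in> ER d" "F + H \<in> ER d" "c *\<^sub>E F \<in> ER d" "F - H \<in> ER d" "(1 :: 'k endo) \<in> ER d" "(0 :: 'k endo) \<in> ER d" "F ^ i \<in> ER d"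
proof -
  from assms obtain A B where A: "A \<in> carrier_mat d d" "F = emb d A" and B: "B \<in> carrier_mat d d" "H = emb d B"
    by (auto simp: ER_def)
  show "F * H \<in> ER d" using A B by (simp add: mult_carrier_mat flip: emb_mult[OF d])
  show "F + H \<in> ER d" using A B by (simp flip: emb_add[OF d])
  show "c *\<^sub>E F \<in> ER d" using A by (simp flip: emb_smult[OF d])
  have "F - H = F + (-1) *\<^sub>E H" by (simp add: sm_minus_left)
  also have "\<dots> = emb d (A + (-1) \<cdot>\<^sub>m B)" using A B by (simp add: emb_add[OF d] emb_smult[OF d])
  finally show "F - H \<in> ER d" using A B by simp
  show one: "(1 :: 'k endo) \<in> ER d" by (simp flip: emb_one[OF d])
  show "(0 :: 'k endo) \<in> ER d" by (simp flip: emb_zero[OF d])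
  have "\<exists>C\<in>carrier_mat d d. F ^ i = emb d C"
  proof (induction i)
    case 0
    show ?case using one by (auto simp: ER_def)
  next
    case (Suc i)
    then obtain C where "C \<in> carrier_mat d d" "F ^ i = emb d C" by blast
    with A show ?case by (intro bexI[of _ "A * C"]) (simp_all add: emb_mult[OF d] mult_carrier_mat)
  qed
  then show "F ^ i \<in> ER d" by (auto simp: ER_def)
qed

text \<open>Relations between the operators of an explicit module become statements about finitely
  many vectors.\<close>

lemma ER_eqI:
  assumes "d > 0" "F \<in> ER d" "H \<in> ER d" "\<And>j. j < d \<Longrightarrow> app F (bv j) = app H (bv j)"
  shows "F = H"
  using assms emb_inject[of d] by (auto simp: ER_def)

lemma app_emb_bv:
  assumes A: "A \<in> carrier_mat d d" and j: "j < d"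
    and c: "\<And>i. i < d \<Longrightarrow> A $$ (i, j) = (if i = i' then c else 0)" and i': "i' < d"
  shows "app (emb d A) (bv j) = c *\<^sub>F bv i'"
proof (rule fvec_eqI)
  fix i
  have "app (emb d A) (bv j) = lin A (bv j)" using A j by (simp add: app_emb_W)
  moreover have "ent (lin A (bv j)) i = (if i < d then A $$ (i, j) else 0)"
    using A j lin_bv[of i A j] by (auto simp: lin_def)
  ultimately show "ent (app (emb d A) (bv j)) i = ent (c *\<^sub>F bv i') i"
    using c i' by (auto simp: bv_def)
qed

declare characters_simps [simp del]

section \<open>Weights and the scalars \<alpha>_i\<close>

context gdatum
begin

lemma Gam_apply: "g \<in> carrier G \<Longrightarrow> (\<gamma> \<otimes>\<^bsub>Gam D\<^esub> \<delta>) g = \<gamma> g * \<delta> g" "g \<in> carrier G \<Longrightarrow> \<one>\<^bsub>Gam D\<^esub> g = 1"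
  by (simp_all add: characters_simps)

abbreviation m1 :: "('g \<times> ('g \<Rightarrow> 'k) \<Rightarrow> 'k) \<Rightarrow> 'g \<Rightarrow> 'k" where
  "m1 \<mu> g \<equiv> \<mu> (g, \<one>\<^bsub>Gam D\<^esub>)"

abbreviation m2 :: "('g \<times> ('g \<Rightarrow> 'k) \<Rightarrow> 'k) \<Rightarrow> ('g \<Rightarrow> 'k) \<Rightarrow> 'k" where
  "m2 \<mu> \<gamma> \<equiv> \<mu> (\<one>\<^bsub>G\<^esub>, \<gamma>)"

lemma GG_mem: "(g, \<gamma>) \<in> carrier (G \<times>\<times> Gam D) \<longleftrightarrow> g \<in> carrier G \<and> \<gamma> \<in> carrier (Gam D)"
  by (simp add: DirProd_def)

lemma Lam_split:
  assumes "\<mu> \<in> carrier (Lam D)" "g \<in> carrier G" "\<gamma> \<in> carrier (Gam D)"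
  shows "\<mu> (g, \<gamma>) = m1 \<mu> g * m2 \<mu> \<gamma>"
  using characters_mult[OF assms(1), of "(g, \<one>\<^bsub>Gam D\<^esub>)" "(\<one>\<^bsub>G\<^esub>, \<gamma>)"] assms(2,3)
  by (simp add: GG_mem \<Gamma>.one_closed \<Gamma>.l_one)

lemma Lam_m1_mult:
  assumes "\<mu> \<in> carrier (Lam D)" "g \<in> carrier G" "h \<in> carrier G"
  shows "m1 \<mu> (g \<otimes>\<^bsub>G\<^esub> h) = m1 \<mu> g * m1 \<mu> h"
  using characters_mult[OF assms(1), of "(g, \<one>\<^bsub>Gam D\<^esub>)" "(h, \<one>\<^bsub>Gam D\<^esub>)"] assms(2,3)
  by (simp add: GG_mem \<Gamma>.one_closed \<Gamma>.l_one)

lemma Lam_m2_mult: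
  assumes "\<mu> \<in> carrier (Lam D)" "\<gamma> \<in> carrier (Gam D)" "\<delta> \<in> carrier (Gam D)"
  shows "m2 \<mu> (\<gamma> \<otimes>\<^bsub>Gam D\<^esub> \<delta>) = m2 \<mu> \<gamma> * m2 \<mu> \<delta>"
  using characters_mult[OF assms(1), of "(\<one>\<^bsub>G\<^esub>, \<gamma>)" "(\<one>\<^bsub>G\<^esub>, \<delta>)"] assms(2,3)
  by (simp add: GG_mem)

lemma Lam_one: "\<mu> \<in> carrier (Lam D) \<Longrightarrow> m1 \<mu> \<one>\<^bsub>G\<^esub> = 1"
  using characters_one[OF GG.is_group, of \<mu>] by simp

lemma Lam_nz:
  assumes "\<mu> \<in> carrier (Lam D)"
  shows "g \<in> carrier G \<Longrightarrow> m1 \<mu> g \<noteq> 0" "\<gamma> \<in> carrier (Gam D) \<Longrightarrow> m2 \<mu> \<gamma> \<noteq> 0"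
  using characters_nonzero[OF assms] by (simp_all add: GG_mem \<Gamma>.one_closed)

lemma Lam_m1_pow: "\<mu> \<in> carrier (Lam D) \<Longrightarrow> g \<in> carrier G \<Longrightarrow> m1 \<mu> (g [^]\<^bsub>G\<^esub> (i::nat)) = m1 \<mu> g ^ i"
  by (induction i) (simp_all add: Lam_one Lam_m1_mult mult.commute)

lemma Lam_m2_pow:
  assumes "\<mu> \<in> carrier (Lam D)" "\<gamma> \<in> carrier (Gam D)"
  shows "m2 \<mu> (\<gamma> [^]\<^bsub>Gam D\<^esub> (i::nat)) = m2 \<mu> \<gamma> ^ i"
  by (induction i)
    (simp_all add: assms Lam_one Lam_m2_mult mult.commute)

lemma Lam_a_inv_chi:
  assumes "\<mu> \<in> carrier (Lam D)"
  shows "\<mu> (a, inv\<^bsub>Gam D\<^esub> \<chi>) = m1 \<mu> a / m2 \<mu> \<chi>"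
proof -
  have "m2 \<mu> (inv\<^bsub>Gam D\<^esub> \<chi>) * m2 \<mu> \<chi> = 1"
    using Lam_m2_mult[OF assms, of "inv\<^bsub>Gam D\<^esub> \<chi>" \<chi>] Lam_one[OF assms]
    by (simp add: \<Gamma>.l_inv)
  then have "m2 \<mu> (inv\<^bsub>Gam D\<^esub> \<chi>) = inverse (m2 \<mu> \<chi>)"
    using inverse_unique by (metis mult.commute)
  then show ?thesis
    using Lam_split[OF assms a_in, of "inv\<^bsub>Gam D\<^esub> \<chi>"] by (simp add: divide_inverse)
qed

lemma Lam_mult_apply:
  "g \<in> carrier G \<Longrightarrow> \<gamma> \<in> carrier (Gam D) \<Longrightarrow> (\<mu> \<otimes>\<^bsub>Lam D\<^esub> \<nu>) (g, \<gamma>) = \<mu> (g, \<gamma>) * \<nu> (g, \<gamma>)"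
  by (simp add: GG_mem characters_simps)

lemma phi_apply: "g \<in> carrier G \<Longrightarrow> \<gamma> \<in> carrier (Gam D) \<Longrightarrow> phi D (g, \<gamma>) = inverse (\<chi> g) * \<gamma> a"
  by (simp add: phi_def GG_mem inv_chi)

lemma phi_in [simp]: "phi D \<in> carrier (Lam D)"
proof (rule characters_memI)
  show "phi D \<in> extensional (carrier (G \<times>\<times> Gam D))" by (simp add: phi_def)
  fix x y assume x: "x \<in> carrier (G \<times>\<times> Gam D)" and y: "y \<in> carrier (G \<times>\<times> Gam D)"
  obtain g \<gamma> h \<delta> where xy: "x = (g, \<gamma>)" "y = (h, \<delta>)" by (cases x; cases y)
  show "phi D x \<noteq> 0" using x by (simp add: xy GG_mem phi_apply char_nz)
  have "phi D (g \<otimes>\<^bsub>G\<^esub> h, \<gamma> \<otimes>\<^bsub>Gam D\<^esub> \<delta>) = inverse (\<chi> (g \<otimes>\<^bsub>G\<^esub> h)) * (\<gamma> \<otimes>\<^bsub>Gam D\<^esub> \<delta>) a"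
    by (rule phi_apply) (use x y in \<open>auto simp: xy GG_mem intro: \<Gamma>.m_closed\<close>)
  then show "phi D (x \<otimes>\<^bsub>G \<times>\<times> Gam D\<^esub> y) = phi D x * phi D y"
    using x y by (simp add: xy GG_mem phi_apply char_mult Gam_apply)
qed

lemma phi_pow_apply:
  assumes "\<mu> \<in> carrier (Lam D)"
  shows "g \<in> carrier G \<Longrightarrow> m1 (phi D [^]\<^bsub>Lam D\<^esub> (i::nat) \<otimes>\<^bsub>Lam D\<^esub> \<mu>) g = inverse (\<chi> g) ^ i * m1 \<mu> g"
    "\<gamma> \<in> carrier (Gam D) \<Longrightarrow> m2 (phi D [^]\<^bsub>Lam D\<^esub> i \<otimes>\<^bsub>Lam D\<^esub> \<mu>) \<gamma> = \<gamma> a ^ i * m2 \<mu> \<gamma>"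
proof -
  show "m1 (phi D [^]\<^bsub>Lam D\<^esub> i \<otimes>\<^bsub>Lam D\<^esub> \<mu>) g = inverse (\<chi> g) ^ i * m1 \<mu> g" if g: "g \<in> carrier G"
  proof -
    have x: "(g, \<one>\<^bsub>Gam D\<^esub>) \<in> carrier (G \<times>\<times> Gam D)" using g \<Gamma>.one_closed by (simp add: GG_mem)
    show ?thesis
      unfolding Lam_mult_apply[OF g \<Gamma>.one_closed] characters_pow[OF x] phi_apply[OF g \<Gamma>.one_closed]
      by (simp add: Gam_apply)
  qed
  show "m2 (phi D [^]\<^bsub>Lam D\<^esub> i \<otimes>\<^bsub>Lam D\<^esub> \<mu>) \<gamma> = \<gamma> a ^ i * m2 \<mu> \<gamma>" if g: "\<gamma> \<in> carrier (Gam D)"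
  proof -
    have x: "(\<one>\<^bsub>G\<^esub>, \<gamma>) \<in> carrier (G \<times>\<times> Gam D)" using g by (simp add: GG_mem)
    show ?thesis
      unfolding Lam_mult_apply[OF G.one_closed g] characters_pow[OF x] phi_apply[OF G.one_closed g]
      by (simp add: char_one)
  qed
qed

text \<open>\<open>alph\<close> sees a weight only through its values s at a and t at \<chi>; in
  this form it also applies to vectors for which just these two eigenvalues are known. The case
  distinction replaces the integer exponent 1 - i.\<close>

definition al :: "'k \<Rightarrow> 'k \<Rightarrow> nat \<Rightarrow> 'k" where
  "al s t i = qint \<rho> i * (t - s * (if i = 0 then \<rho> else inverse \<rho> ^ (i - 1)))"

lemma al_0 [simp]: "al s t 0 = 0"
  by (simp add: al_def)

text \<open>The added terms are what the commutator \<chi> - a contributes when \<xi> passes one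
  more x.\<close>

lemma al_Suc: "al s t (Suc i) = al s t i + t * \<rho> ^ i - s * inverse \<rho> ^ i"
proof (cases i)
  case (Suc j)
  have e: "qint \<rho> (Suc i) * inverse \<rho> ^ i = qint \<rho> i * inverse \<rho> ^ j + inverse \<rho> ^ i"
    unfolding qint_Suc'[of _ i] by (simp add: Suc field_simps)
  have "al s t (Suc i) = t * qint \<rho> (Suc i) - s * (qint \<rho> (Suc i) * inverse \<rho> ^ i)"
    by (simp add: al_def algebra_simps)
  also have "\<dots> = t * qint \<rho> i + t * \<rho> ^ i - s * (qint \<rho> i * inverse \<rho> ^ j) - s * inverse \<rho> ^ i"
    unfolding e by (simp add: qint_Suc algebra_simps)
  also have "\<dots> = al s t i + t * \<rho> ^ i - s * inverse \<rho> ^ i"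
    by (simp add: al_def Suc algebra_simps)
  finally show ?thesis .
qed (simp add: al_def)

lemma alph_eq: "alph D \<mu> i = al (m1 \<mu> a) (m2 \<mu> \<chi>) i"
proof (cases i)
  case (Suc j)
  have "\<rho> powi (1 - int i) = inverse \<rho> ^ j"
    by (simp add: Suc power_int_def)
  then show ?thesis by (simp add: alph_def al_def Suc)
qed (simp add: alph_def al_def)

text \<open>As polynomials in s both sides are monic of degree n and share the n distinct roots
  \<rho>^k t, if t is not 0; their difference has degree below n.\<close>

lemma prod_roots: "(\<Prod>k<n. s - \<rho> ^ k * t) = s ^ n - t ^ n" for s t :: 'k
proof (cases "t = 0")
  case False
  define P where "P = (\<Prod>k<n. [:- (\<rho> ^ k * t), 1:])"
  define Q where "Q = Polynomial.monom 1 n - [:t ^ n:]"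
  have n0: "n > 0" using n_ge2 by simp
  have dP: "Polynomial.degree P = n" unfolding P_def by (subst degree_prod_eq_sum_degree) auto
  have lP: "lead_coeff P = 1" unfolding P_def by (simp add: lead_coeff_prod)
  have dQ: "Polynomial.degree Q \<le> n"
    unfolding Q_def by (rule degree_diff_le) (auto simp: Polynomial.degree_monom_le)
  have lQ: "Polynomial.coeff Q n = 1" using n0 by (cases n) (auto simp: Q_def)
  have dd: "Polynomial.degree (P - Q) < n"
  proof (rule ccontr)
    assume "\<not> ?thesis"
    moreover have "Polynomial.degree (P - Q) \<le> n" using dP dQ by (intro degree_diff_le) auto
    ultimately have "Polynomial.degree (P - Q) = n" by simp
    moreover from this have "lead_coeff (P - Q) = 0" using lP lQ dP by simp
    then have "P - Q = 0" by (simp only: leading_coeff_0_iff)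
    ultimately show False using n0 by (metis Polynomial.degree_0 less_numeral_extra(3))
  qed
  have root: "poly (P - Q) (\<rho> ^ k * t) = 0" if "k < n" for k
  proof -
    have "(\<rho> ^ k) ^ n = 1" by (simp add: rho_pow_eq_1 flip: power_mult)
    moreover have "poly P (\<rho> ^ k * t) = 0" using that by (auto simp: P_def poly_prod)
    ultimately show ?thesis by (simp add: Q_def Polynomial.poly_monom power_mult_distrib)
  qed
  have inj: "inj_on (\<lambda>k. \<rho> ^ k * t) {..<n}"
  proof (rule linorder_inj_onI)
    fix i j assume "i < j" "i \<in> {..<n}" "j \<in> {..<n}"
    then have "\<rho> ^ (j - i) \<noteq> 1" by (intro rho_pow_neq) auto
    moreover have "\<rho> ^ j = \<rho> ^ (j - i) * \<rho> ^ i" using \<open>i < j\<close> by (simp flip: power_add)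
    ultimately show "\<rho> ^ i * t \<noteq> \<rho> ^ j * t" using False by simp
  qed auto
  have "P - Q = 0"
  proof (rule ccontr)
    assume nz: "P - Q \<noteq> 0"
    have "n = card ((\<lambda>k. \<rho> ^ k * t) ` {..<n})" using inj by (simp add: card_image)
    also have "\<dots> \<le> card {x. poly (P - Q) x = 0}"
      by (rule card_mono) (use poly_roots_finite[OF nz] root in auto)
    also have "\<dots> \<le> Polynomial.degree (P - Q)" by (rule card_poly_roots_bound[OF nz])
    finally show False using dd by simp
  qed
  then have "poly P s = poly Q s" by simp
  then show ?thesis by (simp add: P_def Q_def poly_prod Polynomial.poly_monom)
qed (use n_ge2 in \<open>simp add: power_0_left\<close>)

text \<open>The product of the \<alpha>_i runs over all but one of the factors t - s \<rho>^(-i);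
  since \<rho>^(-(n-1)) = \<rho>, the factor in front is the missing one up to sign. This evaluates
  \<xi>^(n-1) on the last basis vector of V(n, \<lambda>).\<close>

lemma prod_al:
  "(\<rho> * s - t) * (\<Prod>i<n - 1. al s t (Suc i)) = qfact \<rho> (n - 1) * (s ^ n - t ^ n)"
proof -
  have n: "Suc (n - 1) = n" "0 < n" using n_ge2 by auto
  have q: "(\<Prod>i<m. al s t (Suc i)) = qfact \<rho> m * (\<Prod>i<m. t - s * inverse \<rho> ^ i)" for m
    by (induction m) (simp_all add: al_def qfact_Suc mult_ac)
  have ir: "inverse \<rho> ^ i = \<rho> ^ (n - i)" if "i \<le> n" for i
  proof -
    have "\<rho> ^ i * \<rho> ^ (n - i) = 1" using that by (simp flip: power_add)
    then show ?thesis by (simp add: power_inverse inverse_unique)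
  qed
  have "(\<Prod>i<n - 1. t - s * inverse \<rho> ^ i) * (t - s * \<rho>) = (\<Prod>i<n. t - s * inverse \<rho> ^ i)"
    using prod.lessThan_Suc[of "\<lambda>i. t - s * inverse \<rho> ^ i" "n - 1"] ir[of "n - 1"] n by simp
  also have "\<dots> = (\<Prod>k<n. t - \<rho> ^ k * s)"
  \<comment> \<open>Negation of exponents modulo n; reducing modulo n matters only for k =
    0.\<close>
  proof (rule prod.reindex_bij_witness[of _ "\<lambda>k. (n - k) mod n" "\<lambda>k. (n - k) mod n"])
    fix k assume k: "k \<in> {..<n}"
    then show "(n - (n - k) mod n) mod n = k" by (cases k) auto
    then show "(n - (n - k) mod n) mod n = k" .
    show "(n - k) mod n \<in> {..<n}" "(n - k) mod n \<in> {..<n}" using n by auto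
    have "inverse \<rho> ^ k = \<rho> ^ ((n - k) mod n)" using ir[of k] k by (cases k) auto
    then show "t - \<rho> ^ ((n - k) mod n) * s = t - s * inverse \<rho> ^ k" by simp
  qed
  also have "\<dots> = t ^ n - s ^ n" by (rule prod_roots)
  finally have "(\<rho> * s - t) * (\<Prod>i<n - 1. t - s * inverse \<rho> ^ i) = s ^ n - t ^ n"
    by (simp add: algebra_simps)
  then show ?thesis by (simp add: q mult.left_commute)
qed

section \<open>The simple modules satisfy the relations\<close>

context
  fixes l :: nat and \<mu> :: "'g \<times> ('g \<Rightarrow> 'k) \<Rightarrow> 'k"
  assumes \<mu>: "\<mu> \<in> carrier (Lam D)" and l: "1 \<le> l" "l \<le> n"
    and \<mu>l: "l < n \<Longrightarrow> \<mu> \<in> Il D l"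
begin

abbreviation sg :: "('g, 'k) dgen \<Rightarrow> 'k endo" where
  "sg s \<equiv> emb l (simple_gen D l \<mu> s)"

text \<open>The factor with which x returns from the last basis vector to the first; it treats the
  cases l < n, nilpotent and non-nilpotent alike.\<close>

definition wrap :: 'k where
  "wrap = (if l = n \<and> \<not> nilp then m1 \<mu> a ^ n - 1 else 0)"

lemma simple_gen_carrier: "simple_gen D l \<mu> s \<in> carrier_mat l l"
  by (cases s) simp_all

lemma sg_go: "g \<in> carrier G \<Longrightarrow> j < l \<Longrightarrow> app (sg (GrpGen g)) (bv j) = (inverse (\<chi> g) ^ j * m1 \<mu> g) *\<^sub>F bv j"
  by (rule app_emb_bv[OF simple_gen_carrier])
    (simp_all add: phi_pow_apply[OF \<mu>])

lemma sg_co: "\<gamma> \<in> carrier (Gam D) \<Longrightarrow> j < l \<Longrightarrow> app (sg (ChrGen \<gamma>)) (bv j) = (\<gamma> a ^ j * m2 \<mu> \<gamma>) *\<^sub>F bv j"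
  by (rule app_emb_bv[OF simple_gen_carrier])
    (simp_all add: phi_pow_apply[OF \<mu>])

lemma sg_X: "Suc j < l \<Longrightarrow> app (sg XGen) (bv j) = bv (Suc j)"
  by (subst app_emb_bv[OF simple_gen_carrier, where i' = "Suc j" and c = 1]) auto

lemma sg_X_top: "app (sg XGen) (bv (l - 1)) = wrap *\<^sub>F bv 0"
    "app (sg XGen) (bv (l - Suc 0)) = wrap *\<^sub>F bv 0"
  by (rule app_emb_bv[OF simple_gen_carrier]; use l in \<open>auto simp: wrap_def\<close>)+

lemma sg_Y_0: "app (sg XiGen) (bv 0) = 0"
  using app_emb_bv[OF simple_gen_carrier, of 0 "XiGen" 0 0] l by auto

lemma sg_Y: "Suc j < l \<Longrightarrow> app (sg XiGen) (bv (Suc j)) = al (m1 \<mu> a) (m2 \<mu> \<chi>) (Suc j) *\<^sub>F bv j"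
  by (rule app_emb_bv[OF simple_gen_carrier]) (auto simp: alph_eq)

declare simple_gen.simps [simp del]

lemma sg_X_pow: "j + k < l \<Longrightarrow> app (sg XGen ^ k) (bv j) = bv (j + k)"
  by (induction k) (simp_all add: sg_X)

lemma sg_Y_pow_0: "j < k \<Longrightarrow> j < l \<Longrightarrow> app (sg XiGen ^ k) (bv j) = 0"
proof (induction k arbitrary: j)
  case (Suc k)
  show ?case
  proof (cases j)
    case 0
    then show ?thesis by (simp add: app_pow_Suc2 sg_Y_0 del: power_Suc)
  next
    case (Suc i)
    then show ?thesis using Suc.IH[of i] Suc.prems by (simp add: app_pow_Suc2 sg_Y del: power_Suc)
  qed
qed simp

lemma sg_Y_pow: "k < l \<Longrightarrow> app (sg XiGen ^ k) (bv k) = (\<Prod>i<k. al (m1 \<mu> a) (m2 \<mu> \<chi>) (Suc i)) *\<^sub>F bv 0"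
  by (induction k) (simp_all add: app_pow_Suc2 sg_Y mult.commute del: power_Suc)

lemma m2_chi_n: "\<not> nilp \<Longrightarrow> m2 \<mu> \<chi> ^ n = 1"
  using Lam_m2_pow[OF \<mu> \<chi>_in, of n] Lam_one[OF \<mu>] by (simp add: nonnilp_chi_pow)

lemma m1_a_eq: "l < n \<Longrightarrow> m1 \<mu> a = m2 \<mu> \<chi> * \<rho> ^ (l - 1)"
  using \<mu>l Lam_a_inv_chi[OF \<mu>] Lam_nz(2)[OF \<mu> \<chi>_in] by (simp add: Il_def field_simps)

text \<open>For l < n this is the condition defining I_l; for l = n the q-integer (n) is 0. It makes
  the commutator of x and \<xi> correct on the last basis vector.\<close>

lemma al_l: "al (m1 \<mu> a) (m2 \<mu> \<chi>) l = 0"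
proof (cases "l < n")
  case True
  have "\<rho> ^ (l - 1) * inverse \<rho> ^ (l - 1) = 1" by (simp flip: power_mult_distrib)
  then show ?thesis using l True by (simp add: al_def m1_a_eq)
next
  case False
  then have "l = n" using l by simp
  then show ?thesis by (simp add: al_def)
qed

text \<open>In the nilpotent type both sides vanish. Otherwise, if l < n, then \<lambda>(a) =
  \<lambda>(\<chi>) \<rho>^(l-1) is an n-th root of unity, because \<chi>^n = 1.\<close>

lemma sg_wrap_scal: "scal D * (m1 \<mu> a ^ n - 1) = wrap"
proof (cases nilp)
  case True
  then consider "scal D = 0" | "a [^]\<^bsub>G\<^esub> n = \<one>\<^bsub>G\<^esub>" by (auto simp: nilpotent_type_def)
  then show ?thesis
    using Lam_m1_pow[OF \<mu> a_in, of n] Lam_one[OF \<mu>] True by cases (auto simp: wrap_def)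
next
  case False
  show ?thesis
  proof (cases "l < n")
    case True
    have "(\<rho> ^ (l - 1)) ^ n = 1" by (simp add: rho_pow_eq_1 flip: power_mult)
    then have "m1 \<mu> a ^ n = 1" using m2_chi_n[OF False] True by (simp add: m1_a_eq power_mult_distrib)
    then show ?thesis using True by (simp add: wrap_def)
  qed (use False l in \<open>unfold wrap_def, simp add: nonnilp_scal\<close>)
qed

text \<open>The relations are compared on the basis vectors. Only the last one is delicate: x leaves
  the chain there, and the correction between x and \<gamma> can be nonzero there.\<close>

lemma sg_ops: "ops sg"
proof -
  have d: "0 < l" using l by simp
  note sgE = ER_emb[OF simple_gen_carrier]
  have eqI: "F = H" if "F \<in> ER l" "H \<in> ER l" "\<And>j. j < l \<Longrightarrow> app F (bv j) = app H (bv j)" for F H :: "'k endo"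
    using ER_eqI[OF d that] .
  note E = ER_ops(1)[OF d] ER_ops(2)[OF d] ER_ops(3)[OF d _ sgE] ER_ops(4)[OF d] ER_ops(5-6)[OF d sgE sgE]
    ER_ops(7)[OF d _ sgE] sgE ER_ops(3)[OF d]
  have jl: "j = l - 1 \<or> Suc j < l" if "j < l" for j using that by auto
  have an: "inverse (\<chi> a) ^ j = inverse \<rho> ^ j" for j by (simp add: rho_eq)
  have Xn: "app (sg XGen ^ n) (bv j) = wrap *\<^sub>F bv j" if j: "j < l" for j
  proof -
    \<comment> \<open>x^n climbs from v_j to the top, crosses with factor \<open>wrap\<close> and
      returns to v_j. Further steps remain only if l < n, and then \<open>wrap\<close> is 0.\<close>
    have "n = (n - l) + (j + (Suc (l - 1 - j)))" using l j by auto
    then have "app (sg XGen ^ n) (bv j) = app (sg XGen ^ (n - l)) (app (sg XGen ^ j) (app (sg XGen) (app (sg XGen ^ (l - 1 - j)) (bv j))))"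
      by (metis app_pow_add app_pow_Suc)
    also have "app (sg XGen ^ (l - 1 - j)) (bv j) = bv (l - 1)"
      using sg_X_pow[of j "l - 1 - j"] j by simp
    also have "app (sg XGen ^ (n - l)) (app (sg XGen ^ j) (app (sg XGen) (bv (l - 1)))) =
        wrap *\<^sub>F app (sg XGen ^ (n - l)) (bv j)"
      using sg_X_pow[of 0 j] j unfolding sg_X_top by simp
    also have "\<dots> = wrap *\<^sub>F bv j"
      by (cases "l = n") (auto simp: wrap_def)
    finally show ?thesis .
  qed
  show ?thesis
  proof
    fix g h assume g: "g \<in> carrier G" and h: "h \<in> carrier G"
    show "sg (GrpGen (g \<otimes>\<^bsub>G\<^esub> h)) = sg (GrpGen g) * sg (GrpGen h)"
      by (rule eqI[OF sgE E(1)[OF sgE sgE]])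
        (simp add: sg_go g h char_mult Lam_m1_mult[OF \<mu>] power_mult_distrib mult_ac)
  next
    show "sg (GrpGen \<one>\<^bsub>G\<^esub>) = 1"
      by (rule eqI[OF sgE E(5)])
        (simp add: sg_go char_one Lam_one[OF \<mu>])
  next
    fix \<gamma> \<delta> assume g: "\<gamma> \<in> carrier (Gam D)" and h: "\<delta> \<in> carrier (Gam D)"
    have e: "(\<gamma> \<otimes>\<^bsub>Gam D\<^esub> \<delta>) a = \<gamma> a * \<delta> a" by (simp add: Gam_apply)
    show "sg (ChrGen (\<gamma> \<otimes>\<^bsub>Gam D\<^esub> \<delta>)) = sg (ChrGen \<gamma>) * sg (ChrGen \<delta>)"
      by (rule eqI[OF sgE E(1)[OF sgE sgE]])
        (simp add: sg_co g h \<Gamma>.m_closed e Lam_m2_mult[OF \<mu>] power_mult_distrib mult_ac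
         )
  next
    have e: "\<one>\<^bsub>Gam D\<^esub> a = 1" by (simp add: Gam_apply)
    show "sg (ChrGen \<one>\<^bsub>Gam D\<^esub>) = 1"
      by (rule eqI[OF sgE E(5)])
        (simp add: sg_co \<Gamma>.one_closed e Lam_one[OF \<mu>])
  next
    have ga: "app (sg (GrpGen a) ^ k) (bv j) = (inverse (\<chi> a) ^ j * m1 \<mu> a) ^ k *\<^sub>F bv j" if "j < l" for j k
      by (induction k) (simp_all add: sg_go that mult.commute)
    have an': "(inverse (\<chi> a) ^ j * m1 \<mu> a) ^ n = m1 \<mu> a ^ n" for j
    proof -
      have "(inverse \<rho> ^ j) ^ n = (inverse \<rho> ^ n) ^ j" by (simp add: mult.commute flip: power_mult)
      then show ?thesis by (simp add: rho_eq power_mult_distrib power_inverse)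
    qed
    have "sg (GrpGen a) ^ n - 1 \<in> ER l" by (rule E(4)) (use E in auto)
    then show "sg XGen ^ n = scal D *\<^sub>E (sg (GrpGen a) ^ n - 1)"
    proof (intro eqI)
      show "sg XGen ^ n \<in> ER l" by (rule E(7)[OF sgE])
      assume "sg (GrpGen a) ^ n - 1 \<in> ER l"
      then show "scal D *\<^sub>E (sg (GrpGen a) ^ n - 1) \<in> ER l" by (rule E(9)[OF _ sgE])
      fix j assume j: "j < l"
      have "app (sg (GrpGen a) ^ n) (bv j) = m1 \<mu> a ^ n *\<^sub>F bv j"
        using ga[OF j, of n] unfolding an' .
      then show "app (sg XGen ^ n) (bv j) = app (scal D *\<^sub>E (sg (GrpGen a) ^ n - 1)) (bv j)"
        using j by (simp add: Xn sg_wrap_scal[symmetric] right_diff_distrib sc_diff_left)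
    qed
  next
    fix g assume g: "g \<in> carrier G"
    show "sg XGen * sg (GrpGen g) = \<chi> g *\<^sub>E (sg (GrpGen g) * sg XGen)"
    proof (rule eqI[OF E(1)[OF sgE sgE] E(9)[OF E(1)[OF sgE sgE] sgE]])
      fix j assume j: "j < l"
      from jl[OF j] show "app (sg XGen * sg (GrpGen g)) (bv j) = app (\<chi> g *\<^sub>E (sg (GrpGen g) * sg XGen)) (bv j)"
      proof
        assume jj: "j = l - 1"
        \<comment> \<open>A nonzero \<open>wrap\<close> means l = n and non-nilpotent type, where
          \<chi>(g)^n = 1.\<close>
        have w: "wrap = wrap * \<chi> g ^ l"
        proof (cases "l = n \<and> \<not> nilp")
          case True
          then show ?thesis using nonnilp_chi[OF _ g] by simp
        qed (auto simp: wrap_def)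
        have "\<chi> g * \<chi> g ^ (l - 1) = \<chi> g ^ l" using l by (metis One_nat_def Suc_pred d power_Suc)
        moreover have "\<chi> g \<noteq> 0" using char_nz[OF \<chi>_in g] .
        ultimately have w2: "inverse (\<chi> g) ^ (l - 1) * wrap = \<chi> g * wrap"
          by (subst w) (simp add: field_simps power_inverse)
        have "app (sg XGen * sg (GrpGen g)) (bv j) = (inverse (\<chi> g) ^ (l - 1) * wrap * m1 \<mu> g) *\<^sub>F bv 0"
          using j g unfolding jj by (simp add: sg_X_top sg_go mult_ac)
        also have "\<dots> = app (\<chi> g *\<^sub>E (sg (GrpGen g) * sg XGen)) (bv j)"
          using d g unfolding w2 jj by (simp add: sg_X_top sg_go mult_ac)
        finally show ?thesis .
      next
        assume jl: "Suc j < l"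
        have c: "\<chi> g * (inverse (\<chi> g) * x) = x" for x using char_nz[OF \<chi>_in g] by simp
        show ?thesis using g jl by (simp add: sg_X sg_go mult.assoc c)
      qed
    qed
  next
    show "sg XiGen ^ n = 0"
      by (rule eqI[OF E(7)[OF sgE] E(6)]) (use l in \<open>simp add: sg_Y_pow_0\<close>)
  next
    fix \<gamma> assume g: "\<gamma> \<in> carrier (Gam D)"
    show "sg XiGen * sg (ChrGen \<gamma>) = \<gamma> a *\<^sub>E (sg (ChrGen \<gamma>) * sg XiGen)"
    proof (rule eqI[OF E(1)[OF sgE sgE] E(9)[OF E(1)[OF sgE sgE] sgE]])
      fix j assume j: "j < l"
      then show "app (sg XiGen * sg (ChrGen \<gamma>)) (bv j) = app (\<gamma> a *\<^sub>E (sg (ChrGen \<gamma>) * sg XiGen)) (bv j)"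
        using g by (cases j) (simp_all add: sg_Y sg_Y_0 sg_co mult_ac)
    qed
  next
    fix g \<gamma> assume g: "g \<in> carrier G" "\<gamma> \<in> carrier (Gam D)"
    show "sg (GrpGen g) * sg (ChrGen \<gamma>) = sg (ChrGen \<gamma>) * sg (GrpGen g)"
      by (rule eqI[OF E(1)[OF sgE sgE] E(1)[OF sgE sgE]])
        (simp add: sg_go sg_co g mult_ac)
  next
    fix g assume g: "g \<in> carrier G"
    show "sg XiGen * sg (GrpGen g) = inverse (\<chi> g) *\<^sub>E (sg (GrpGen g) * sg XiGen)"
    proof (rule eqI[OF E(1)[OF sgE sgE] E(9)[OF E(1)[OF sgE sgE] sgE]])
      fix j assume j: "j < l"
      then show "app (sg XiGen * sg (GrpGen g)) (bv j) = app (inverse (\<chi> g) *\<^sub>E (sg (GrpGen g) * sg XiGen)) (bv j)"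
        using g by (cases j) (simp_all add: sg_Y sg_Y_0 sg_go mult_ac)
    qed
  next
    show "sg XGen * sg XiGen - sg XiGen * sg XGen = sg (GrpGen a) - sg (ChrGen \<chi>)"
    proof (rule eqI[OF E(4)[OF E(1)[OF sgE sgE] E(1)[OF sgE sgE]] E(4)[OF sgE sgE]])
      fix j assume j: "j < l"
      let ?al = "al (m1 \<mu> a) (m2 \<mu> \<chi>)"
      have 1: "app (sg XGen * sg XiGen) (bv j) = ?al j *\<^sub>F bv j"
        using j by (cases j) (simp_all add: sg_Y_0 sg_Y sg_X)
      have 2: "app (sg XiGen * sg XGen) (bv j) = ?al (Suc j) *\<^sub>F bv j"
        using jl[OF j]
      proof
        assume "j = l - 1"
        then show ?thesis using al_l d by (simp add: sg_X_top sg_Y_0)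
      qed (simp add: sg_X sg_Y)
      show "app (sg XGen * sg XiGen - sg XiGen * sg XGen) (bv j) = app (sg (GrpGen a) - sg (ChrGen \<chi>)) (bv j)"
        using j
        by (simp only: app_ops(4) 1 2)
          (simp add: sg_go sg_co rho_eq al_Suc mult_ac flip: sc_diff_left)
    qed
  next
    fix \<gamma> assume g: "\<gamma> \<in> carrier (Gam D)"
    let ?Z = "(sg (ChrGen \<gamma>) * (\<rho> *\<^sub>E sg (GrpGen a) - sg (ChrGen \<chi>))) * sg XiGen ^ (n - 1)"
    have Z: "?Z \<in> ER l"
      by (rule E(1)[OF E(1)[OF sgE E(4)[OF E(3)[OF sgE] sgE]] E(7)[OF sgE]])
    show "\<gamma> a *\<^sub>E (sg XGen * sg (ChrGen \<gamma>)) = sg (ChrGen \<gamma>) * sg XGen +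
        (if nilp then 0 else ((\<gamma> a ^ n - 1) / qfact \<rho> (n - 1)) *\<^sub>E ?Z)"
    proof (rule eqI[OF E(9)[OF E(1)[OF sgE sgE] sgE] E(2)[OF E(1)[OF sgE sgE]]])
      show "(if nilp then 0 else ((\<gamma> a ^ n - 1) / qfact \<rho> (n - 1)) *\<^sub>E ?Z) \<in> ER l"
        using E(6) E(9)[OF Z sgE] by simp
      fix j assume j: "j < l"
      show "app (\<gamma> a *\<^sub>E (sg XGen * sg (ChrGen \<gamma>))) (bv j) = app (sg (ChrGen \<gamma>) * sg XGen +
        (if nilp then 0 else ((\<gamma> a ^ n - 1) / qfact \<rho> (n - 1)) *\<^sub>E ?Z)) (bv j)"
      \<comment> \<open>\<xi>^(n-1) kills every v_j except possibly v_(n-1), which exists only for l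
        = n.\<close>
      proof (cases "Suc j < n")
        case True
        then have "app (sg XiGen ^ (n - 1)) (bv j) = 0" using j by (intro sg_Y_pow_0) auto
        moreover have "l \<noteq> n" if "j = l - 1" using True that d by auto
        ultimately show ?thesis
          using jl[OF j] g j
          by (auto simp: sg_X sg_X_top sg_co wrap_def mult_ac)
      next
        case False
        then have ln: "l = n" and nj: "n - 1 = j" and jl: "j = l - 1" using j l by auto
        have Xj: "app (sg XGen) (bv j) = wrap *\<^sub>F bv 0" unfolding jl by (rule sg_X_top)
        have XC: "app (\<gamma> a *\<^sub>E (sg XGen * sg (ChrGen \<gamma>))) (bv j) = (\<gamma> a * \<gamma> a ^ j * m2 \<mu> \<gamma> * wrap) *\<^sub>F bv 0"
          and CX: "app (sg (ChrGen \<gamma>) * sg XGen) (bv j) = (wrap * m2 \<mu> \<gamma>) *\<^sub>F bv 0"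
          using j d g by (simp_all add: sg_co Xj mult.assoc)
        show ?thesis
        proof (cases nilp)
          case True
          then have "wrap = 0" by (simp add: wrap_def)
          with True show ?thesis by (simp only: XC CX if_True app_ops(1,3)) simp
        next
          case False
          let ?s = "m1 \<mu> a" and ?t = "m2 \<mu> \<chi>"
          have w: "wrap = ?s ^ n - 1" unfolding wrap_def using ln False by simp
          have q: "qfact \<rho> (n - 1) \<noteq> 0" using n_ge2 by (intro qfact_nz) simp
          have gn: "\<gamma> a * \<gamma> a ^ j = \<gamma> a ^ n"
            using n_ge2 unfolding nj[symmetric] by (metis One_nat_def Suc_pred less_le_trans pos2 power_Suc)
          have "app ?Z (bv j) = (\<Prod>i<j. al ?s ?t (Suc i)) *\<^sub>F app (sg (ChrGen \<gamma>)) ((\<rho> * ?s) *\<^sub>F bv 0 - ?t *\<^sub>F bv 0)"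
            unfolding nj using sg_Y_pow[OF j] d g by (simp add: sg_go sg_co)
          also have "\<dots> = ((\<rho> * ?s - ?t) * (\<Prod>i<n - 1. al ?s ?t (Suc i)) * m2 \<mu> \<gamma>) *\<^sub>F bv 0"
            unfolding nj using d g by (simp add: sg_co mult_ac flip: sc_diff_left)
          \<comment> \<open>By \<open>prod_al\<close> the scalar contains s^n - t^n, and t^n = 1
            because \<chi>^n = 1; so s^n - t^n is \<open>wrap\<close>.\<close>
          also have "\<dots> = (qfact \<rho> (n - 1) * wrap * m2 \<mu> \<gamma>) *\<^sub>F bv 0"
            by (simp only: prod_al m2_chi_n[OF False] w)
          finally have "app (((\<gamma> a ^ n - 1) / qfact \<rho> (n - 1)) *\<^sub>E ?Z) (bv j) =
              (((\<gamma> a ^ n - 1) / qfact \<rho> (n - 1)) * (qfact \<rho> (n - 1) * wrap * m2 \<mu> \<gamma>)) *\<^sub>F bv 0"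
            by (simp only: app_sm sc_simps)
          also have "((\<gamma> a ^ n - 1) / qfact \<rho> (n - 1)) * (qfact \<rho> (n - 1) * wrap * m2 \<mu> \<gamma>) =
              (\<gamma> a ^ n - 1) * wrap * m2 \<mu> \<gamma>"
            using q by simp
          finally have Z: "app (((\<gamma> a ^ n - 1) / qfact \<rho> (n - 1)) *\<^sub>E ?Z) (bv j) =
              ((\<gamma> a ^ n - 1) * wrap * m2 \<mu> \<gamma>) *\<^sub>F bv 0" .
          have "\<gamma> a * \<gamma> a ^ j * m2 \<mu> \<gamma> * wrap = wrap * m2 \<mu> \<gamma> + (\<gamma> a ^ n - 1) * wrap * m2 \<mu> \<gamma>"
            unfolding gn by (simp add: algebra_simps)
          then show ?thesis
            using False by (simp only: XC CX Z if_False app_ops(3) flip: sc_add_left)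
        qed
      qed
    qed
  qed
qed

lemma simple_module: "fd_module Alg (simple_module D l \<mu>)"
  and simple_module_op: "s \<in> dgens D \<Longrightarrow> opM (simple_module D l \<mu>) s = sg s"
  using module_of_gens[of l "simple_gen D l \<mu>", OF _ simple_gen_carrier sg_ops] l
  by (simp_all add: simple_module_def)

end

lemma mdim_simple [simp]: "mdim (simple_module D l \<mu>) = l"
  by (simp add: simple_module_def module_of_gens_def)

end


section \<open>Weight vectors and the passage of \<xi> past powers of x\<close>

context double_ops
begin

definition wt :: "('g \<Rightarrow> 'k) \<Rightarrow> (('g \<Rightarrow> 'k) \<Rightarrow> 'k) \<Rightarrow> 'k fvec \<Rightarrow> bool" where
  "wt f h v \<longleftrightarrow> (\<forall>g\<in>carrier G. app (go g) v = f g *\<^sub>F v) \<and>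
     (\<forall>\<gamma>\<in>carrier (Gam D). app (co \<gamma>) v = h \<gamma> *\<^sub>F v)"

text \<open>These two eigenvalues survive all powers of x and \<xi> in both types, whereas x need
  not carry a full weight vector to a weight vector.\<close>

definition aw :: "'k \<Rightarrow> 'k \<Rightarrow> 'k fvec \<Rightarrow> bool" where
  "aw s t v \<longleftrightarrow> app (go a) v = s *\<^sub>F v \<and> app (co \<chi>) v = t *\<^sub>F v"

lemma wt_aw: "wt f h v \<Longrightarrow> aw (f a) (h \<chi>) v"
  by (simp add: wt_def aw_def)

lemma wt_cong: "wt f h v \<Longrightarrow> (\<And>g. g \<in> carrier G \<Longrightarrow> f' g = f g) \<Longrightarrow>
    (\<And>\<gamma>. \<gamma> \<in> carrier (Gam D) \<Longrightarrow> h' \<gamma> = h \<gamma>) \<Longrightarrow> wt f' h' v"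
  by (simp add: wt_def)

lemma wt_add: "wt f h u \<Longrightarrow> wt f h v \<Longrightarrow> wt f h (u + v)"
  and wt_diff: "wt f h u \<Longrightarrow> wt f h v \<Longrightarrow> wt f h (u - v)"
  and wt_sc: "wt f h u \<Longrightarrow> wt f h (c *\<^sub>F u)"
  and wt_zero: "wt f h 0"
  by (simp_all add: wt_def mult.commute)

lemma app_rel: "F * H = c *\<^sub>E (H * F) \<Longrightarrow> app F (app H v) = c *\<^sub>F app H (app F v)"
  by (metis app_ops(6) app_sm)

lemma go_Y_app: "g \<in> carrier G \<Longrightarrow> app (go g) (app Y v) = \<chi> g *\<^sub>F app Y (app (go g) v)"
  using app_rel[OF Y_go, of g v] char_nz[OF \<chi>_in, of g] by simp

lemma go_X_app: "g \<in> carrier G \<Longrightarrow> app (go g) (app X v) = inverse (\<chi> g) *\<^sub>F app X (app (go g) v)"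
  using app_rel[OF X_go, of g v] char_nz[OF \<chi>_in, of g] by simp

lemma co_Y_app: "\<gamma> \<in> carrier (Gam D) \<Longrightarrow> app (co \<gamma>) (app Y v) = inverse (\<gamma> a) *\<^sub>F app Y (app (co \<gamma>) v)"
  using app_rel[OF Y_co, of \<gamma> v] char_nz[OF _ a_in, of \<gamma>] by simp

lemma cochi_X_app: "app (co \<chi>) (app X v) = \<rho> *\<^sub>F app X (app (co \<chi>) v)"
  using app_rel[OF X_cochi, of v] by simp

lemma XY_app: "app X (app Y v) = app Y (app X v) + (app (go a) v - app (co \<chi>) v)"
  using arg_cong[OF XY, of "\<lambda>F. app F v"] by (simp add: algebra_simps)

lemma co_X_app:
  assumes "\<gamma> \<in> carrier (Gam D)"
  shows "app (co \<gamma>) (app X v) = \<gamma> a *\<^sub>F app X (app (co \<gamma>) v) -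
    (if nilp then 0 else ((\<gamma> a ^ n - 1) / qfact \<rho> (n - 1)) *\<^sub>F
       app (co \<gamma>) (\<rho> *\<^sub>F app (go a) (app (Y ^ (n - 1)) v) - app (co \<chi>) (app (Y ^ (n - 1)) v)))"
  using arg_cong[OF X_co[OF assms], of "\<lambda>F. app F v"] by (simp split: if_splits)

lemma wt_Y: "wt f h v \<Longrightarrow> wt (\<lambda>g. \<chi> g * f g) (\<lambda>\<gamma>. inverse (\<gamma> a) * h \<gamma>) (app Y v)"
  by (simp add: wt_def go_Y_app co_Y_app)

lemma wt_Y_pow: "wt f h v \<Longrightarrow> wt (\<lambda>g. \<chi> g ^ i * f g) (\<lambda>\<gamma>. inverse (\<gamma> a) ^ i * h \<gamma>) (app (Y ^ i) v)"
proof (induction i)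
  case (Suc i)
  from wt_Y[OF Suc.IH[OF Suc.prems]] show ?case by (simp add: mult.assoc)
qed simp

lemma aw_Y: "aw s t v \<Longrightarrow> aw (\<rho> * s) (inverse \<rho> * t) (app Y v)"
  by (simp add: aw_def go_Y_app co_Y_app rho_eq)

lemma aw_X: "aw s t v \<Longrightarrow> aw (inverse \<rho> * s) (\<rho> * t) (app X v)"
  by (simp add: aw_def go_X_app cochi_X_app rho_eq)

lemma aw_Y_pow: "aw s t v \<Longrightarrow> aw (\<rho> ^ i * s) (inverse \<rho> ^ i * t) (app (Y ^ i) v)"
proof (induction i)
  case (Suc i)
  from aw_Y[OF Suc.IH[OF Suc.prems]] show ?case by (simp add: mult.assoc)
qed simp

lemma aw_X_pow: "aw s t v \<Longrightarrow> aw (inverse \<rho> ^ i * s) (\<rho> ^ i * t) (app (X ^ i) v)"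
proof (induction i)
  case (Suc i)
  from aw_X[OF Suc.IH[OF Suc.prems]] show ?case by (simp add: mult.assoc)
qed simp

text \<open>Each passage of \<xi> past an x costs \<chi> - a, which acts on x^i w by a known scalar;
  \<open>al_Suc\<close> sums these scalars. At i = 0 the truncated exponent is harmless because
  \<open>al s t 0 = 0\<close>.\<close>

lemma YX_pow:
  assumes "aw s t w"
  shows "app Y (app (X ^ i) w) = app (X ^ i) (app Y w) + al s t i *\<^sub>F app (X ^ (i - 1)) w"
proof (induction i)
  case (Suc i)
  have "app Y (app (X ^ Suc i) w) = app X (app Y (app (X ^ i) w)) -
      (app (go a) (app (X ^ i) w) - app (co \<chi>) (app (X ^ i) w))"
    using XY_app[of "app (X ^ i) w"] by simp
  also have "\<dots> = app X (app Y (app (X ^ i) w)) - (inverse \<rho> ^ i * s - \<rho> ^ i * t) *\<^sub>F app (X ^ i) w"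
    using aw_X_pow[OF assms, of i] by (simp add: aw_def sc_diff_left)
  also have "app X (app Y (app (X ^ i) w)) = app (X ^ Suc i) (app Y w) + al s t i *\<^sub>F app (X ^ i) w"
    unfolding Suc by (cases i) simp_all
  finally show ?case
    by (simp add: al_Suc sc_add_left sc_diff_left algebra_simps)
qed simp

lemma Y_pow_X_pow:
  assumes "aw s t w" "app Y w = 0"
  shows "app (Y ^ b) (app (X ^ (i + b)) w) = (\<Prod>k<b. al s t (i + Suc k)) *\<^sub>F app (X ^ i) w"
proof (induction b)
  case (Suc b)
  have "app (Y ^ Suc b) (app (X ^ (i + Suc b)) w) = app (Y ^ b) (app Y (app (X ^ Suc (i + b)) w))"
    by (simp only: app_pow_Suc2 add_Suc_right)
  also have "\<dots> = al s t (i + Suc b) *\<^sub>F app (Y ^ b) (app (X ^ (i + b)) w)"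
    unfolding YX_pow[OF assms(1)] by (simp add: assms(2))
  finally show ?case by (simp add: Suc mult.commute)
qed simp

lemma Y_pow_X_pow_0:
  assumes "aw s t w" "app Y w = 0" "i < b"
  shows "app (Y ^ b) (app (X ^ i) w) = 0"
proof -
  have "b = (b - Suc i) + Suc i" using assms(3) by simp
  then have "app (Y ^ b) (app (X ^ i) w) = app (Y ^ (b - Suc i)) (app Y (app (Y ^ i) (app (X ^ i) w)))"
    by (metis app_pow_add app_pow_Suc)
  then show ?thesis using Y_pow_X_pow[OF assms(1,2), of i 0] by (simp add: assms(2))
qed

lemma go_X_pow:
  assumes "wt f h w" "g \<in> carrier G"
  shows "app (go g) (app (X ^ i) w) = (inverse (\<chi> g) ^ i * f g) *\<^sub>F app (X ^ i) w"
  by (induction i) (use assms in \<open>simp_all add: wt_def go_X_app mult.commute mult.left_commute\<close>)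

text \<open>The correction between x and \<gamma> acts through \<xi>^(n-1), which kills x^i w as
  long as i < n - 1. Hence up to exponent n - 1 the powers of x do keep full weights here.\<close>

lemma wt_X_pow:
  assumes w: "wt f h w" "app Y w = 0" and i: "i < n"
  shows "wt (\<lambda>g. inverse (\<chi> g) ^ i * f g) (\<lambda>\<gamma>. \<gamma> a ^ i * h \<gamma>) (app (X ^ i) w)"
  unfolding wt_def
proof (intro conjI ballI)
  fix \<gamma> assume g: "\<gamma> \<in> carrier (Gam D)"
  show "app (co \<gamma>) (app (X ^ i) w) = (\<gamma> a ^ i * h \<gamma>) *\<^sub>F app (X ^ i) w"
    using i
  proof (induction i)
    case (Suc i)
    have "app (Y ^ (n - 1)) (app (X ^ i) w) = 0"
      by (rule Y_pow_X_pow_0[OF wt_aw[OF w(1)] w(2)]) (use Suc.prems in auto)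
    then show ?case using Suc by (simp add: co_X_app[OF g] mult.assoc)
  qed (use w g in \<open>simp add: wt_def\<close>)
qed (rule go_X_pow[OF w(1)])

lemma al_nz:
  assumes "0 < i" "i < n" "t * \<rho> ^ (i - 1) \<noteq> s"
  shows "al s t i \<noteq> 0"
proof -
  have "t - s * inverse \<rho> ^ (i - 1) \<noteq> 0" using assms(3) by (auto simp: field_simps)
  then show ?thesis using assms qint_nz[of i] by (simp add: al_def)
qed

lemma X_pow_app: "aw s t v \<Longrightarrow> app (X ^ n) v = (scal D * (s ^ n - 1)) *\<^sub>F v"
proof -
  assume "aw s t v"
  then have "app (go a ^ k) v = s ^ k *\<^sub>F v" for k
    by (induction k) (simp_all add: aw_def mult.commute)
  then show ?thesis by (simp add: X_pow sc_diff_left algebra_simps)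
qed

text \<open>A vector killed by a power of \<open>Y\<close> lies in the image of the complementary power, if its
  weight avoids the zeros of the \<open>\<alpha>\<^sub>i\<close>: modulo the vectors \<open>X\<^sup>k Y\<^sup>k p\<close> with larger \<open>k\<close>, the operator
  \<open>Y\<^sup>b X\<^sup>b\<^sup>+\<^sup>t\<close> acts on \<open>Y\<^sup>t p\<close> as a nonzero multiple of \<open>X\<^sup>t\<close>.\<close>

lemma Y_divisible:
  fixes S :: "'k fvec set"
  assumes aw: "aw s t p" and l: "l < n" and Yl: "app (Y ^ l) p = 0"
    and st: "s * \<rho> ^ l = t" "s \<noteq> 0"
    and S: "0 \<in> S" "\<And>u v. u \<in> S \<Longrightarrow> v \<in> S \<Longrightarrow> u + v \<in> S" "\<And>c v. v \<in> S \<Longrightarrow> c *\<^sub>F v \<in> S"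
    and img: "\<And>i j. app (Y ^ (n - l)) (app (X ^ i) (app (Y ^ j) p)) \<in> S"
  shows "p \<in> S"
proof -
  define \<alpha> where "\<alpha> k = al (\<rho> ^ k * s) (inverse \<rho> ^ k * t)" for k
  have diff: "u - v \<in> S" if "u \<in> S" "v \<in> S" for u v
    using S(2)[OF that(1) S(3)[OF that(2), of "-1"]] by (simp add: sc_minus_left)
  \<comment> \<open>Moving one \<xi> inward either raises both exponents, which leads into
    \<open>S\<close> by the induction hypothesis for k + 1, or leaves x^k \<xi>^k p with a factor
    \<alpha>.\<close>
  have cong: "\<exists>r\<in>S. app (Y ^ b) (app (X ^ (b + k)) (app (Y ^ k) p)) =
      (\<Prod>i<b. \<alpha> k (k + Suc i)) *\<^sub>F app (X ^ k) (app (Y ^ k) p) + r"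
    if "\<And>k'. k < k' \<Longrightarrow> app (X ^ k') (app (Y ^ k') p) \<in> S" for b k
    using that
  proof (induction b arbitrary: k)
    case 0
    show ?case using S(1) by (intro bexI[of _ 0]) auto
  next
    case (Suc b)
    let ?P = "\<lambda>k. \<Prod>i<b. \<alpha> k (k + Suc i)"
    obtain r where r: "r \<in> S" "app (Y ^ b) (app (X ^ (b + k)) (app (Y ^ k) p)) =
        ?P k *\<^sub>F app (X ^ k) (app (Y ^ k) p) + r"
      using Suc.IH[of k] Suc.prems by blast
    obtain r' where r': "r' \<in> S" "app (Y ^ b) (app (X ^ (b + Suc k)) (app (Y ^ Suc k) p)) =
        ?P (Suc k) *\<^sub>F app (X ^ Suc k) (app (Y ^ Suc k) p) + r'"
      using Suc.IH[of "Suc k"] Suc.prems by (metis Suc_lessD)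
    have "app (Y ^ Suc b) (app (X ^ (Suc b + k)) (app (Y ^ k) p)) =
        app (Y ^ b) (app Y (app (X ^ Suc (b + k)) (app (Y ^ k) p)))"
      by (simp only: app_pow_Suc2 add_Suc)
    also have "\<dots> = app (Y ^ b) (app (X ^ (b + Suc k)) (app (Y ^ Suc k) p)) +
        \<alpha> k (k + Suc b) *\<^sub>F app (Y ^ b) (app (X ^ (b + k)) (app (Y ^ k) p))"
      unfolding YX_pow[OF aw_Y_pow[OF aw]] \<alpha>_def by (simp add: add.commute)
    also have "\<dots> = (\<alpha> k (k + Suc b) * ?P k) *\<^sub>F app (X ^ k) (app (Y ^ k) p) +
        ((?P (Suc k) *\<^sub>F app (X ^ Suc k) (app (Y ^ Suc k) p) + r') + \<alpha> k (k + Suc b) *\<^sub>F r)"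
      unfolding r(2) r'(2) by (simp del: power_Suc)
    finally have "app (Y ^ Suc b) (app (X ^ (Suc b + k)) (app (Y ^ k) p)) =
        (\<alpha> k (k + Suc b) * ?P k) *\<^sub>F app (X ^ k) (app (Y ^ k) p) +
        ((?P (Suc k) *\<^sub>F app (X ^ Suc k) (app (Y ^ Suc k) p) + r') + \<alpha> k (k + Suc b) *\<^sub>F r)" .
    moreover have "(?P (Suc k) *\<^sub>F app (X ^ Suc k) (app (Y ^ Suc k) p) + r') + \<alpha> k (k + Suc b) *\<^sub>F r \<in> S"
      using Suc.prems[of "Suc k"] r r' S by (simp del: power_Suc)
    ultimately show ?case by (intro bexI) (simp_all add: mult.commute del: power_Suc)
  qed
  \<comment> \<open>Downward induction on the exponent l - d, starting from \<xi>^l p = 0.\<close>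
  have step: "app (X ^ (l - d)) (app (Y ^ (l - d)) p) \<in> S" if "d \<le> l" for d
    using that
  proof (induction d rule: less_induct)
    case (less d)
    show ?case
    proof (cases d)
      case 0
      then show ?thesis using Yl S(1) by simp
    next
      case (Suc d')
      define k where "k = l - d"
      have k: "k < l" using less.prems Suc by (simp add: k_def)
      have "app (X ^ k') (app (Y ^ k') p) \<in> S" if "k < k'" for k'
      proof (cases "k' < l")
        case True
        then show ?thesis using less.IH[of "l - k'"] that by (simp add: k_def)
      next
        case False
        then obtain j where "k' = j + l" by (metis add.commute le_Suc_ex not_less)
        then show ?thesis using Yl S(1) by (simp add: app_pow_add)
      qed
      from cong[of k "n - l", OF this] obtain r where r: "r \<in> S"
        "app (Y ^ (n - l)) (app (X ^ (n - l + k)) (app (Y ^ k) p)) =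
        (\<Prod>i<n - l. \<alpha> k (k + Suc i)) *\<^sub>F app (X ^ k) (app (Y ^ k) p) + r" by blast
      let ?c = "\<Prod>i<n - l. \<alpha> k (k + Suc i)"
      have "?c \<noteq> 0"
      proof -
        have "\<alpha> k (k + Suc i) \<noteq> 0" if i: "i < n - l" for i
          unfolding \<alpha>_def
        proof (rule al_nz)
          show "k + Suc i < n" using i k by simp
          \<comment> \<open>With t = s \<rho>^l a vanishing factor would mean \<rho>^(l-k+i) = 1,
            while 0 < l - k + i < n.\<close>
          have r1: "\<rho> ^ (l - k + i) \<noteq> 1" by (rule rho_pow_neq) (use i k in auto)
          have lhs: "inverse \<rho> ^ k * t * \<rho> ^ (k + Suc i - 1) = t * \<rho> ^ i"
            by (simp add: power_add field_simps)
          have t: "t = s * \<rho> ^ k * \<rho> ^ (l - k)" using st(1) k by (simp add: mult.assoc flip: power_add)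
          show "inverse \<rho> ^ k * t * \<rho> ^ (k + Suc i - 1) \<noteq> \<rho> ^ k * s"
          proof
            assume "inverse \<rho> ^ k * t * \<rho> ^ (k + Suc i - 1) = \<rho> ^ k * s"
            then have "t * \<rho> ^ i = \<rho> ^ k * s" unfolding lhs .
            then have "s * \<rho> ^ k * \<rho> ^ (l - k) * \<rho> ^ i = \<rho> ^ k * s" unfolding t .
            then have "s * \<rho> ^ k * \<rho> ^ (l - k + i) = s * \<rho> ^ k * 1"
              by (simp only: power_add mult_ac mult_1_left mult_1_right)
            then show False using r1 st(2) by simp
          qed
        qed simp
        then show ?thesis by simp
      qed
      moreover have "?c *\<^sub>F app (X ^ k) (app (Y ^ k) p) \<in> S"
        using diff[OF img[of "n - l + k" k] r(1)] r(2) by simp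
      ultimately show ?thesis
        using S(3)[of "?c *\<^sub>F app (X ^ k) (app (Y ^ k) p)" "inverse ?c"] by (simp add: k_def)
    qed
  qed
  from step[of l] show ?thesis by simp
qed

text \<open>The averaging projection onto a weight space of the two commuting finite groups; their
  orders are invertible in characteristic 0.\<close>

definition wproj :: "('g \<Rightarrow> 'k) \<Rightarrow> (('g \<Rightarrow> 'k) \<Rightarrow> 'k) \<Rightarrow> 'k fvec \<Rightarrow> 'k fvec" where
  "wproj f h v = (1 / of_nat (card (carrier G) * card (carrier (Gam D)))) *\<^sub>F
     (\<Sum>g\<in>carrier G. \<Sum>\<gamma>\<in>carrier (Gam D). (inverse (f g) * inverse (h \<gamma>)) *\<^sub>F app (go g) (app (co \<gamma>) v))"

lemma wproj_id:
  assumes "wt f h v" "\<And>g. g \<in> carrier G \<Longrightarrow> f g \<noteq> 0" "\<And>\<gamma>. \<gamma> \<in> carrier (Gam D) \<Longrightarrow> h \<gamma> \<noteq> 0"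
  shows "wproj f h v = v"
proof -
  have "card (carrier G) * card (carrier (Gam D)) \<noteq> 0"
    using finite_G finite_\<Gamma> G.one_closed \<Gamma>.one_closed by (auto simp: card_eq_0_iff)
  moreover have "(\<Sum>g\<in>carrier G. \<Sum>\<gamma>\<in>carrier (Gam D). (inverse (f g) * inverse (h \<gamma>)) *\<^sub>F app (go g) (app (co \<gamma>) v)) =
      (\<Sum>g\<in>carrier G. \<Sum>\<gamma>\<in>carrier (Gam D). v)"
  proof (intro sum.cong refl)
    fix g \<gamma> assume g: "g \<in> carrier G" "\<gamma> \<in> carrier (Gam D)"
    then have "inverse (f g) * inverse (h \<gamma>) * (h \<gamma> * f g) = 1" using assms(2,3) by (simp add: field_simps)
    with g assms(1) show "(inverse (f g) * inverse (h \<gamma>)) *\<^sub>F app (go g) (app (co \<gamma>) v) = v"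
      by (simp add: wt_def)
  qed
  moreover have "\<dots> = of_nat (card (carrier G) * card (carrier (Gam D))) *\<^sub>F v"
    by (rule fvec_eqI) (simp add: ent_sum mult.assoc)
  ultimately show ?thesis unfolding wproj_def by (simp del: of_nat_mult)
qed

lemma wt_wproj:
  assumes f: "\<And>g g'. g \<in> carrier G \<Longrightarrow> g' \<in> carrier G \<Longrightarrow> f (g \<otimes>\<^bsub>G\<^esub> g') = f g * f g'"
      "\<And>g. g \<in> carrier G \<Longrightarrow> f g \<noteq> 0"
    and h: "\<And>\<gamma> \<delta>. \<gamma> \<in> carrier (Gam D) \<Longrightarrow> \<delta> \<in> carrier (Gam D) \<Longrightarrow> h (\<gamma> \<otimes>\<^bsub>Gam D\<^esub> \<delta>) = h \<gamma> * h \<delta>"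
      "\<And>\<gamma>. \<gamma> \<in> carrier (Gam D) \<Longrightarrow> h \<gamma> \<noteq> 0"
  shows "wt f h (wproj f h v)"
  unfolding wt_def
proof (intro conjI ballI)
  let ?N = "1 / of_nat (card (carrier G) * card (carrier (Gam D))) :: 'k"
  let ?s = "\<lambda>g \<gamma>. (inverse (f g) * inverse (h \<gamma>)) *\<^sub>F app (go g) (app (co \<gamma>) v)"
  {
    fix g0 assume g0: "g0 \<in> carrier G"
    have t: "app (go g0) (?s g \<gamma>) = f g0 *\<^sub>F ?s (g0 \<otimes>\<^bsub>G\<^esub> g) \<gamma>" if "g \<in> carrier G" for g \<gamma>
      using f(2)[OF g0] by (simp add: f(1)[OF g0 that] go_mult[OF g0 that] field_simps)
    have "app (go g0) (wproj f h v) = ?N *\<^sub>F (\<Sum>g\<in>carrier G. \<Sum>\<gamma>\<in>carrier (Gam D). app (go g0) (?s g \<gamma>))"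
      by (simp add: wproj_def app_sum)
    also have "(\<Sum>g\<in>carrier G. \<Sum>\<gamma>\<in>carrier (Gam D). app (go g0) (?s g \<gamma>)) =
        (\<Sum>g\<in>carrier G. \<Sum>\<gamma>\<in>carrier (Gam D). f g0 *\<^sub>F ?s (g0 \<otimes>\<^bsub>G\<^esub> g) \<gamma>)"
      by (intro sum.cong refl t)
    also have "(\<Sum>g\<in>carrier G. \<Sum>\<gamma>\<in>carrier (Gam D). f g0 *\<^sub>F ?s (g0 \<otimes>\<^bsub>G\<^esub> g) \<gamma>) =
        (\<Sum>g\<in>carrier G. \<Sum>\<gamma>\<in>carrier (Gam D). f g0 *\<^sub>F ?s g \<gamma>)"
      by (rule sum.reindex_bij_witness[of _ "\<lambda>g. inv\<^bsub>G\<^esub> g0 \<otimes>\<^bsub>G\<^esub> g" "\<lambda>g. g0 \<otimes>\<^bsub>G\<^esub> g"])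
        (use g0 in \<open>simp_all add: G.m_assoc[symmetric]\<close>)
    finally show "app (go g0) (wproj f h v) = f g0 *\<^sub>F wproj f h v"
      by (simp add: wproj_def sc_sum mult.commute mult.left_commute)
  next
    fix \<gamma>0 assume g0: "\<gamma>0 \<in> carrier (Gam D)"
    have cg: "app (co \<gamma>0) (app (go g) (app (co \<gamma>) v)) = app (go g) (app (co (\<gamma>0 \<otimes>\<^bsub>Gam D\<^esub> \<gamma>)) v)"
      if "g \<in> carrier G" "\<gamma> \<in> carrier (Gam D)" for g \<gamma>
      using arg_cong[OF go_co[OF that(1) g0], of "\<lambda>F. app F (app (co \<gamma>) v)"] co_mult[OF g0 that(2)] by simp
    have t: "app (co \<gamma>0) (?s g \<gamma>) = h \<gamma>0 *\<^sub>F ?s g (\<gamma>0 \<otimes>\<^bsub>Gam D\<^esub> \<gamma>)"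
      if "g \<in> carrier G" "\<gamma> \<in> carrier (Gam D)" for g \<gamma>
      using h(2)[OF g0] by (simp add: h(1)[OF g0 that(2)] cg[OF that] field_simps)
    have "app (co \<gamma>0) (wproj f h v) = ?N *\<^sub>F (\<Sum>g\<in>carrier G. \<Sum>\<gamma>\<in>carrier (Gam D). app (co \<gamma>0) (?s g \<gamma>))"
      by (simp add: wproj_def app_sum)
    also have "(\<Sum>g\<in>carrier G. \<Sum>\<gamma>\<in>carrier (Gam D). app (co \<gamma>0) (?s g \<gamma>)) =
        (\<Sum>g\<in>carrier G. \<Sum>\<gamma>\<in>carrier (Gam D). h \<gamma>0 *\<^sub>F ?s g (\<gamma>0 \<otimes>\<^bsub>Gam D\<^esub> \<gamma>))"
      by (intro sum.cong refl t)
    also have "(\<Sum>g\<in>carrier G. \<Sum>\<gamma>\<in>carrier (Gam D). h \<gamma>0 *\<^sub>F ?s g (\<gamma>0 \<otimes>\<^bsub>Gam D\<^esub> \<gamma>)) =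
        (\<Sum>g\<in>carrier G. \<Sum>\<gamma>\<in>carrier (Gam D). h \<gamma>0 *\<^sub>F ?s g \<gamma>)"
      by (rule sum.cong[OF refl], rule sum.reindex_bij_witness[of _ "\<lambda>\<gamma>. inv\<^bsub>Gam D\<^esub> \<gamma>0 \<otimes>\<^bsub>Gam D\<^esub> \<gamma>" "\<lambda>\<gamma>. \<gamma>0 \<otimes>\<^bsub>Gam D\<^esub> \<gamma>"])
        (use g0 in \<open>simp_all add: \<Gamma>.m_closed \<Gamma>.inv_closed \<Gamma>.m_assoc[symmetric]\<close>)
    finally show "app (co \<gamma>0) (wproj f h v) = h \<gamma>0 *\<^sub>F wproj f h v"
      by (simp add: wproj_def sc_sum mult.commute mult.left_commute)
  }
qed

text \<open>\<xi> commutes with every g and every \<gamma> up to scalars, so the averages correspond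
  after a shift of weight. For x the correction would interfere.\<close>

lemma Y_wproj:
  shows "app Y (wproj f h v) = wproj (\<lambda>g. \<chi> g * f g) (\<lambda>\<gamma>. inverse (\<gamma> a) * h \<gamma>) (app Y v)"
proof -
  have "app Y (app (go g) (app (co \<gamma>) v)) = (inverse (\<chi> g) * \<gamma> a) *\<^sub>F app (go g) (app (co \<gamma>) (app Y v))"
    if "g \<in> carrier G" "\<gamma> \<in> carrier (Gam D)" for g \<gamma>
    using app_rel[OF Y_go[OF that(1)]] app_rel[OF Y_co[OF that(2)]] by simp
  then show ?thesis
    unfolding wproj_def by (simp add: app_sum mult_ac cong: sum.cong)
qed

lemma Y_pow_wproj_0:
  assumes "app (Y ^ i) v = 0"
  shows "app (Y ^ i) (wproj f h v) = 0"
proof -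
  have "app (Y ^ i) (app (go g) (app (co \<gamma>) v)) = 0" if "g \<in> carrier G" "\<gamma> \<in> carrier (Gam D)" for g \<gamma>
    using app_rel[OF comm_pow2[OF Y_go[OF that(1)]], of i] app_rel[OF comm_pow2[OF Y_co[OF that(2)]], of i] assms
    by simp
  then show ?thesis unfolding wproj_def by (simp add: app_sum)
qed

end


section \<open>Homomorphisms as linear maps, and projective covers\<close>

lemma mat_of_dims [simp]: "dim_row (mat_of m k t) = m" "dim_col (mat_of m k t) = k"
  by (simp_all add: mat_of_def)

lemma surj_mat_iff: "surj_mat (T :: 'a::field mat) \<longleftrightarrow> lin T ` W (dim_col T) = W (dim_row T)"
proof -
  have *: "fv ` ((\<lambda>v. T *\<^sub>v v) ` carrier_vec (dim_col T)) = lin T ` W (dim_col T)"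
    unfolding fv_image[symmetric] image_image by (rule image_cong) (auto simp: fv_mult)
  have inj: "inj_on fv (carrier_vec (dim_row T) :: 'a vec set)" by (rule inj_onI) (rule fv_inject)
  have sub: "(\<lambda>v. T *\<^sub>v v) ` carrier_vec (dim_col T) \<subseteq> carrier_vec (dim_row T)"
    using mult_mat_vec_carrier[of T "dim_row T" "dim_col T"] by auto
  show ?thesis
    using inj_on_image_eq_iff[OF inj sub subset_refl] unfolding * fv_image surj_mat_def by simp
qed

lemma islin_comp: "islin s \<Longrightarrow> islin t \<Longrightarrow> islin (\<lambda>v. s (t v))"
  by (simp add: islin_def)

lemma fd_act: "fd_module A M \<Longrightarrow> x \<in> carrier A \<Longrightarrow> mact M x \<in> carrier_mat (mdim M) (mdim M)"
  unfolding fd_module_def using ring_hom_closed[of "mact M" A] by (fastforce simp: ring_mat_simps)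

text \<open>Homomorphisms as functions on the common space: sums and composites need no matching of
  matrix sizes, and inclusions between the spaces \<open>W\<close> can be identities.\<close>

definition ehom :: "('k::field, 'a, 'm) module_scheme \<Rightarrow> ('a, 'k) fdmod \<Rightarrow> ('a, 'k) fdmod
    \<Rightarrow> ('k fvec \<Rightarrow> 'k fvec) \<Rightarrow> bool" where
  "ehom A M N t \<longleftrightarrow> islin t \<and> (\<forall>v\<in>W (mdim M). t v \<in> W (mdim N)) \<and>
     (\<forall>x\<in>carrier A. \<forall>v\<in>W (mdim M). t (lin (mact M x) v) = lin (mact N x) (t v))"

lemma ehom_W: "ehom A M N t \<Longrightarrow> v \<in> W (mdim M) \<Longrightarrow> t v \<in> W (mdim N)"
  by (simp add: ehom_def)

lemma ehom_islin: "ehom A M N t \<Longrightarrow> islin t"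
  by (simp add: ehom_def)

lemma ehom_act: "ehom A M N t \<Longrightarrow> x \<in> carrier A \<Longrightarrow> v \<in> W (mdim M) \<Longrightarrow>
    t (lin (mact M x) v) = lin (mact N x) (t v)"
  by (simp add: ehom_def)

lemma ehom_lin:
  assumes "fd_module A M" "fd_module A N" "T \<in> fd_hom A M N"
  shows "ehom A M N (lin T)"
proof -
  have "lin T (lin (mact M x) v) = lin (mact N x) (lin T v)" if "x \<in> carrier A" for x v
    using assms fd_act[OF assms(1) that] fd_act[OF assms(2) that] that
    by (auto simp: fd_hom_def simp flip: lin_mult)
  then show ?thesis using assms by (auto simp: ehom_def fd_hom_def)
qed

lemma lin_mat_of_ehom: "ehom A M N t \<Longrightarrow> v \<in> W (mdim M) \<Longrightarrow> lin (mat_of (mdim N) (mdim M) t) v = t v"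
  by (rule lin_mat_of) (auto simp: ehom_def)

lemma ehom_mat:
  assumes M: "fd_module A M" and N: "fd_module A N" and t: "ehom A M N t"
  shows "mat_of (mdim N) (mdim M) t \<in> fd_hom A M N"
proof -
  let ?T = "mat_of (mdim N) (mdim M) t"
  have "?T * mact M x = mact N x * ?T" if x: "x \<in> carrier A" for x
  proof (rule lin_inject)
    show "?T * mact M x \<in> carrier_mat (mdim N) (mdim M)" "mact N x * ?T \<in> carrier_mat (mdim N) (mdim M)"
      using fd_act[OF M x] fd_act[OF N x] by (auto simp: mat_of_def)
    fix j assume j: "j < mdim M"
    have "lin (mact M x) (bv j) \<in> W (mdim M)" using fd_act[OF M x] by auto
    then show "lin (?T * mact M x) (bv j) = lin (mact N x * ?T) (bv j)"
      using fd_act[OF M x] fd_act[OF N x] j ehom_act[OF t x, of "bv j"]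
      by (simp add: lin_mult lin_mat_of_ehom[OF t])
  qed
  then show ?thesis by (simp add: fd_hom_def)
qed

lemma ehom_comp: "ehom A N K s \<Longrightarrow> ehom A M N t \<Longrightarrow> ehom A M K (\<lambda>v. s (t v))"
  unfolding ehom_def by (auto intro: islin_comp)

lemma ehom_id: "fd_module A M \<Longrightarrow> ehom A M M (\<lambda>v. v)"
  by (auto simp: ehom_def islin_def)

lemma ehom_diff: "ehom A M N s \<Longrightarrow> ehom A M N t \<Longrightarrow> ehom A M N (\<lambda>v. s v - t v)"
  unfolding ehom_def
  by (auto simp: islin_def islin_diff[OF islin_lin] algebra_simps)

text \<open>\<open>T * S\<close> and \<open>S * T\<close> have the same trace, and in characteristic
  0 the trace of an identity matrix determines its size.\<close>

lemma mutual_inverse_dims: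
  fixes S T :: "'k::field_char_0 mat"
  assumes T: "T \<in> carrier_mat m k" and S: "S \<in> carrier_mat k m" and TS: "T * S = 1\<^sub>m m" and ST: "S * T = 1\<^sub>m k"
  shows "m = k"
proof -
  have 1: "(T * S) $$ (i, i) = (\<Sum>j<k. T $$ (i, j) * S $$ (j, i))" if "i < m" for i
    using that T S by (simp add: scalar_prod_def atLeast0LessThan)
  have 2: "(S * T) $$ (j, j) = (\<Sum>i<m. S $$ (j, i) * T $$ (i, j))" if "j < k" for j
    using that T S by (simp add: scalar_prod_def atLeast0LessThan)
  have "of_nat m = (\<Sum>i<m. (T * S) $$ (i, i))" by (simp add: TS)
  also have "\<dots> = (\<Sum>i<m. \<Sum>j<k. T $$ (i, j) * S $$ (j, i))" by (rule sum.cong) (simp_all add: 1)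
  also have "\<dots> = (\<Sum>j<k. \<Sum>i<m. S $$ (j, i) * T $$ (i, j))" by (subst sum.swap) (simp add: mult.commute)
  also have "\<dots> = (\<Sum>j<k. (S * T) $$ (j, j))" by (rule sum.cong) (simp_all add: 2)
  also have "\<dots> = (of_nat k :: 'k)" by (simp add: ST)
  finally show ?thesis by simp
qed

lemma fd_isoI:
  fixes A :: "('k::field_char_0, 'a, 'm) module_scheme"
  assumes M: "fd_module A M" and N: "fd_module A N" and t: "ehom A M N t" and s: "ehom A N M s"
    and st: "\<And>v. v \<in> W (mdim M) \<Longrightarrow> s (t v) = v" and ts: "\<And>v. v \<in> W (mdim N) \<Longrightarrow> t (s v) = v"
  shows "fd_iso A M N"
proof -
  let ?T = "mat_of (mdim N) (mdim M) t" and ?S = "mat_of (mdim M) (mdim N) s"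
  have c: "?T \<in> carrier_mat (mdim N) (mdim M)" "?S \<in> carrier_mat (mdim M) (mdim N)" by simp_all
  have 1: "?S * ?T = 1\<^sub>m (mdim M)"
    by (rule lin_inject[OF mult_carrier_mat[OF c(2,1)] one_carrier_mat])
      (use c in \<open>simp add: lin_mult lin_mat_of_ehom[OF t] lin_mat_of_ehom[OF s] ehom_W[OF t] st lin_one\<close>)
  have 2: "?T * ?S = 1\<^sub>m (mdim N)"
    by (rule lin_inject[OF mult_carrier_mat[OF c(1,2)] one_carrier_mat])
      (use c in \<open>simp add: lin_mult lin_mat_of_ehom[OF t] lin_mat_of_ehom[OF s] ehom_W[OF s] ts lin_one\<close>)
  have "mdim N = mdim M" by (rule mutual_inverse_dims[OF c 2 1])
  then have "invertible_mat ?T"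
    unfolding invertible_mat_def inverts_mat_def using c 1 2 by (metis carrier_matD square_mat.simps)
  with ehom_mat[OF M N t] M N show ?thesis by (auto simp: fd_iso_def)
qed

lemma fd_isoE:
  assumes "fd_iso A M N"
  obtains t s where "ehom A M N t" "ehom A N M s"
    "\<And>v. v \<in> W (mdim M) \<Longrightarrow> s (t v) = v" "\<And>v. v \<in> W (mdim N) \<Longrightarrow> t (s v) = v"
proof -
  from assms have M: "fd_module A M" and N: "fd_module A N" and "\<exists>T\<in>fd_hom A M N. invertible_mat T"
    by (simp_all add: fd_iso_def)
  then obtain T where T: "T \<in> fd_hom A M N" "invertible_mat T" by blast
  from T have d: "T \<in> carrier_mat (mdim N) (mdim M)" by (simp add: fd_hom_def)
  from T(2) have "\<exists>S. T * S = 1\<^sub>m (dim_row T) \<and> S * T = 1\<^sub>m (dim_row S)" and sq: "dim_row T = dim_col T"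
    by (simp_all only: invertible_mat_def inverts_mat_def square_mat.simps)
  then obtain S where S: "T * S = 1\<^sub>m (dim_row T)" "S * T = 1\<^sub>m (dim_row S)" by blast
  have dim: "mdim N = mdim M" using sq d by simp
  have "dim_col (S * T) = dim_row S" "dim_col (T * S) = dim_row T" by (simp_all only: S index_one_mat)
  then have Sc: "S \<in> carrier_mat (mdim M) (mdim N)" using d by auto
  have hS: "S \<in> fd_hom A N M"
  proof -
    have "S * mact N x = mact M x * S" if x: "x \<in> carrier A" for x
    proof -
      note a = fd_act[OF M x] fd_act[OF N x]
      have e: "T * mact M x = mact N x * T" using T(1) x by (simp add: fd_hom_def)
      have "S * mact N x * T = S * T * mact M x"
        using assoc_mult_mat[OF Sc a(2) d] assoc_mult_mat[OF Sc d a(1)] e by simp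
      also have "\<dots> = mact M x" using S(2) Sc a by simp
      finally have "S * mact N x * T * S = mact M x * S" by simp
      moreover have "S * mact N x * T * S = S * mact N x * (T * S)"
        by (rule assoc_mult_mat[OF mult_carrier_mat[OF Sc a(2)] d Sc])
      moreover have "S * mact N x * (T * S) = S * mact N x"
        using right_mult_one_mat[OF mult_carrier_mat[OF Sc a(2)]] S(1) d by simp
      ultimately show ?thesis by simp
    qed
    then show ?thesis using Sc by (simp add: fd_hom_def)
  qed
  show ?thesis
  proof
    show "ehom A M N (lin T)" by (rule ehom_lin[OF M N T(1)])
    show "ehom A N M (lin S)" by (rule ehom_lin[OF N M hS])
    show "v \<in> W (mdim M) \<Longrightarrow> lin S (lin T v) = v" for v
      using lin_mult[of S T v] S(2) Sc d lin_one[of v "mdim M"] by simp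
    show "v \<in> W (mdim N) \<Longrightarrow> lin T (lin S v) = v" for v
      using lin_mult[of T S v] S(1) Sc d lin_one[of v "mdim N"] by simp
  qed
qed

lemma fd_projectiveI:
  assumes P: "fd_module A P"
    and lift: "\<And>M N f g. fd_module A M \<Longrightarrow> fd_module A N \<Longrightarrow> ehom A M N f \<Longrightarrow> f ` W (mdim M) = W (mdim N)
      \<Longrightarrow> ehom A P N g \<Longrightarrow> \<exists>h. ehom A P M h \<and> (\<forall>v\<in>W (mdim P). f (h v) = g v)"
  shows "fd_projective A P"
  unfolding fd_projective_def
proof (intro conjI P allI impI)
  fix M N f g
  assume a: "fd_module A M \<and> fd_module A N \<and> f \<in> fd_hom A M N \<and> surj_mat f \<and> g \<in> fd_hom A P N"
  then have M: "fd_module A M" and N: "fd_module A N" and f: "f \<in> fd_hom A M N" and g: "g \<in> fd_hom A P N" by auto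
  have fc: "f \<in> carrier_mat (mdim N) (mdim M)" "g \<in> carrier_mat (mdim N) (mdim P)"
    using f g by (auto simp: fd_hom_def)
  from a have "lin f ` W (mdim M) = W (mdim N)" using fc by (simp add: surj_mat_iff)
  from lift[OF M N ehom_lin[OF M N f] this ehom_lin[OF P N g]]
  obtain h where h: "ehom A P M h" "\<And>v. v \<in> W (mdim P) \<Longrightarrow> lin f (h v) = lin g v" by blast
  let ?H = "mat_of (mdim M) (mdim P) h"
  have "f * ?H = g"
    by (rule lin_inject[OF mult_carrier_mat[OF fc(1)] fc(2)])
      (use fc carrier_matD[OF mat_of_carrier, of "mdim M" "mdim P" h] in
        \<open>simp_all add: lin_mult lin_mat_of_ehom[OF h(1)] h(2)\<close>)
  with ehom_mat[OF P M h(1)] show "\<exists>h\<in>fd_hom A P M. f * h = g" by blast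
qed

lemma fd_projectiveD:
  assumes P: "fd_projective A P" and M: "fd_module A M" and N: "fd_module A N"
    and f: "ehom A M N f" "f ` W (mdim M) = W (mdim N)" and g: "ehom A P N g"
  shows "\<exists>h. ehom A P M h \<and> (\<forall>v\<in>W (mdim P). f (h v) = g v)"
proof -
  have Pm: "fd_module A P" using P by (simp add: fd_projective_def)
  let ?F = "mat_of (mdim N) (mdim M) f" and ?G = "mat_of (mdim N) (mdim P) g"
  have d: "dim_row ?F = mdim N" "dim_col ?F = mdim M" by (simp_all add: mat_of_def)
  have "lin ?F ` W (mdim M) = f ` W (mdim M)"
    by (rule image_cong) (simp_all add: lin_mat_of_ehom[OF f(1)])
  then have "surj_mat ?F" by (simp add: surj_mat_iff d f(2))
  then obtain H where H: "H \<in> fd_hom A P M" "?F * H = ?G"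
    using P M N ehom_mat[OF M N f(1)] ehom_mat[OF Pm N g] unfolding fd_projective_def by blast
  have Hc: "H \<in> carrier_mat (mdim M) (mdim P)" using H(1) by (simp add: fd_hom_def)
  have hH: "ehom A P M (lin H)" by (rule ehom_lin[OF Pm M H(1)])
  have "f (lin H v) = g v" if v: "v \<in> W (mdim P)" for v
  proof -
    have "f (lin H v) = lin ?F (lin H v)" using lin_mat_of_ehom[OF f(1)] ehom_W[OF hH v] by simp
    also have "\<dots> = lin ?G v" using lin_mult[of ?F H v] H(2) Hc d by simp
    also have "\<dots> = g v" by (rule lin_mat_of_ehom[OF g v])
    finally show ?thesis .
  qed
  with hH show ?thesis by blast
qed

definition esub :: "('k::field, 'a, 'm) module_scheme \<Rightarrow> ('a, 'k) fdmod \<Rightarrow> 'k fvec set \<Rightarrow> bool" where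
  "esub A M U \<longleftrightarrow> U \<subseteq> W (mdim M) \<and> 0 \<in> U \<and> (\<forall>u\<in>U. \<forall>v\<in>U. u + v \<in> U) \<and> (\<forall>c. \<forall>u\<in>U. c *\<^sub>F u \<in> U) \<and>
     (\<forall>x\<in>carrier A. \<forall>u\<in>U. lin (mact M x) u \<in> U)"

lemma esub_iff:
  fixes A :: "('k::field, 'a, 'm) module_scheme"
  assumes M: "fd_module A M" and U: "U \<subseteq> carrier_vec (mdim M)"
  shows "fd_submodule A M U \<longleftrightarrow> esub A M (fv ` U)"
proof -
  let ?d = "mdim M"
  have m: "fv u \<in> fv ` U \<longleftrightarrow> u \<in> U" if "u \<in> carrier_vec ?d" for u
    using that U fv_inject[of u ?d] by blast
  have 0: "(0 :: 'k fvec) \<in> fv ` U \<longleftrightarrow> 0\<^sub>v ?d \<in> U"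
    using m[of "0\<^sub>v ?d"] fv_zero[of ?d, where ?'a = 'k] by simp
  have add: "fv u + fv v \<in> fv ` U \<longleftrightarrow> u + v \<in> U" if "u \<in> U" "v \<in> U" for u v
  proof -
    have c: "u \<in> carrier_vec ?d" "v \<in> carrier_vec ?d" using that U by auto
    show ?thesis using m[OF add_carrier_vec[OF c]] fv_add[OF c] by simp
  qed
  have sc: "c *\<^sub>F fv u \<in> fv ` U \<longleftrightarrow> c \<cdot>\<^sub>v u \<in> U" if "u \<in> U" for c u
  proof -
    have "u \<in> carrier_vec ?d" using that U by auto
    then have "c \<cdot>\<^sub>v u \<in> carrier_vec ?d" by simp
    from m[OF this] show ?thesis by (simp add: fv_smult)
  qed
  have act: "lin (mact M x) (fv u) \<in> fv ` U \<longleftrightarrow> mact M x *\<^sub>v u \<in> U" if "x \<in> carrier A" "u \<in> U" for x u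
  proof -
    have c: "mact M x \<in> carrier_mat ?d ?d" by (rule fd_act[OF M that(1)])
    have u: "u \<in> carrier_vec ?d" using that U by auto
    have "mact M x *\<^sub>v u \<in> carrier_vec ?d" using c u by simp
    from m[OF this] show ?thesis using fv_mult[of u "mact M x"] c u by simp
  qed
  have sub: "fv ` U \<subseteq> W ?d" using U by (auto simp: subset_iff)
  show ?thesis
    unfolding fd_submodule_def esub_def by (simp add: 0 add sc act sub U)
qed

lemma projective_cover_iff:
  fixes A :: "('k::field, 'a, 'm) module_scheme"
  shows "projective_cover A P M \<longleftrightarrow> fd_projective A P \<and> fd_module A M \<and>
    (\<exists>f. ehom A P M f \<and> f ` W (mdim P) = W (mdim M) \<and>
      (\<forall>U. esub A P U \<and> f ` U = W (mdim M) \<longrightarrow> U = W (mdim P)))"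
  (is "_ \<longleftrightarrow> _ \<and> _ \<and> (\<exists>f. ?Q f)")
proof (cases "fd_projective A P \<and> fd_module A M")
  case True
  then have P: "fd_module A P" and M: "fd_module A M" by (auto simp: fd_projective_def)
  let ?p = "mdim P" and ?m = "mdim M"
  have key: "{u + z | u z. u \<in> U \<and> z \<in> mat_kernel F} = carrier_vec ?p \<longleftrightarrow> lin F ` fv ` U = W ?m"
    if F: "F \<in> fd_hom A P M" "surj_mat F" and U: "U \<subseteq> carrier_vec ?p" for F U
  proof -
    have c: "F \<in> carrier_mat ?m ?p" using F by (simp add: fd_hom_def)
    have s: "lin F ` W ?p = W ?m" using F(2) c by (simp add: surj_mat_iff)
    show ?thesis
    proof
      assume e: "{u + z | u z. u \<in> U \<and> z \<in> mat_kernel F} = carrier_vec ?p"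
      show "lin F ` fv ` U = W ?m"
      proof
        show "lin F ` fv ` U \<subseteq> W ?m" using c by auto
        show "W ?m \<subseteq> lin F ` fv ` U"
        proof
          fix w :: "'k fvec" assume "w \<in> W ?m"
          then obtain v where v: "v \<in> W ?p" "w = lin F v" using s by blast
          then have "vec ?p (ent v) \<in> {u + z | u z. u \<in> U \<and> z \<in> mat_kernel F}" unfolding e by simp
          then obtain u z where uz: "vec ?p (ent v) = u + z" "u \<in> U" "z \<in> mat_kernel F" by blast
          have zc: "z \<in> carrier_vec ?p" "F *\<^sub>v z = 0\<^sub>v ?m" using uz(3) c by (auto simp: mat_kernel_def)
          have "v = fv u + fv z" using uz zc U fv_vec[OF v(1)] by (metis fv_add subsetD)
          moreover have "lin F (fv z) = 0" using fv_mult[of z F] zc c by (simp add: fv_zero)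
          ultimately show "w \<in> lin F ` fv ` U" using v uz by (auto simp: islin_add[OF islin_lin])
        qed
      qed
    next
      assume e: "lin F ` fv ` U = W ?m"
      have "v \<in> {u + z | u z. u \<in> U \<and> z \<in> mat_kernel F}" if v: "v \<in> carrier_vec ?p" for v
      proof -
        have "lin F (fv v) \<in> lin F ` fv ` U" unfolding e using c by simp
        then obtain u where u: "u \<in> U" "lin F (fv v) = lin F (fv u)" by auto
        have uc: "u \<in> carrier_vec ?p" using u U by auto
        have "F *\<^sub>v v = F *\<^sub>v u"
          by (rule fv_inject[of _ ?m]) (use c v uc u in \<open>simp_all add: fv_mult\<close>)
        then have "v - u \<in> mat_kernel F"
          using v uc c by (auto simp: mat_kernel_def mult_minus_distrib_mat_vec)
        moreover have "v = u + (v - u)" using v uc by (intro eq_vecI) auto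
        ultimately show ?thesis using u(1) by blast
      qed
      moreover have "u + z \<in> carrier_vec ?p" if "u \<in> U" "z \<in> mat_kernel F" for u z
        using that U c by (auto simp: mat_kernel_def)
      ultimately show "{u + z | u z. u \<in> U \<and> z \<in> mat_kernel F} = carrier_vec ?p" by blast
    qed
  qed
  show ?thesis
  proof
    assume "projective_cover A P M"
    then have "\<exists>F\<in>fd_hom A P M. surj_mat F \<and> (\<forall>U. fd_submodule A P U \<and>
        {u + z | u z. u \<in> U \<and> z \<in> mat_kernel F} = carrier_vec ?p \<longrightarrow> U = carrier_vec ?p)"
      unfolding projective_cover_def by (elim conjE)
    then obtain F where F: "F \<in> fd_hom A P M" "surj_mat F" and sup': "\<forall>U. fd_submodule A P U \<and>
        {u + z | u z. u \<in> U \<and> z \<in> mat_kernel F} = carrier_vec ?p \<longrightarrow> U = carrier_vec ?p"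
      by (elim bexE conjE) (rule that)
    note sup = sup'[rule_format, OF conjI]
    have c: "F \<in> carrier_mat ?m ?p" using F by (simp add: fd_hom_def)
    have "?Q (lin F)"
    proof (intro conjI allI impI)
      show "ehom A P M (lin F)" by (rule ehom_lin[OF P M F(1)])
      show "lin F ` W ?p = W ?m" using F(2) c by (simp add: surj_mat_iff)
      fix U assume U: "esub A P U \<and> lin F ` U = W ?m"
      define V where "V = {v \<in> carrier_vec ?p. fv v \<in> U}"
      have "U \<subseteq> W ?p" using U by (auto simp: esub_def)
      then have V: "fv ` V = U" unfolding V_def fv_image[symmetric] by auto
      have "V = carrier_vec ?p"
      proof (rule sup)
        have Vc: "V \<subseteq> carrier_vec ?p" by (auto simp: V_def)
        show "fd_submodule A P V" unfolding esub_iff[OF P Vc] V using U by simp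
        show "{u + z | u z. u \<in> V \<and> z \<in> mat_kernel F} = carrier_vec ?p" unfolding key[OF F Vc] V using U by simp
      qed
      then show "U = W ?p" unfolding V[symmetric] by (simp add: fv_image)
    qed
    with True show "fd_projective A P \<and> fd_module A M \<and> (\<exists>f. ?Q f)" by blast
  next
    assume "fd_projective A P \<and> fd_module A M \<and> (\<exists>f. ?Q f)"
    then obtain f where f: "?Q f" by blast
    let ?F = "mat_of ?m ?p f"
    have lf: "lin ?F v = f v" if "v \<in> W ?p" for v using lin_mat_of_ehom[of A P M f] f that by blast
    have F: "?F \<in> fd_hom A P M" using ehom_mat[OF P M] f by blast
    have "lin ?F ` W ?p = f ` W ?p" by (rule image_cong) (simp_all add: lf)
    then have s: "surj_mat ?F" using f by (simp add: surj_mat_iff mat_of_def)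
    have "U = carrier_vec ?p"
      if U: "fd_submodule A P U" "{u + z | u z. u \<in> U \<and> z \<in> mat_kernel ?F} = carrier_vec ?p" for U
    proof -
      have Uc: "U \<subseteq> carrier_vec ?p" using U(1) by (simp add: fd_submodule_def)
      have "lin ?F ` fv ` U = f ` fv ` U" by (rule image_cong) (use Uc lf in auto)
      moreover have "lin ?F ` fv ` U = W ?m" using U(2) unfolding key[OF F s Uc] .
      moreover have "esub A P (fv ` U)" using U(1) unfolding esub_iff[OF P Uc] .
      ultimately have "fv ` U = W ?p" using f by simp
      then have "fv ` U = fv ` carrier_vec ?p" by (simp add: fv_image)
      moreover have inj: "inj_on fv (carrier_vec ?p :: 'k vec set)" by (rule inj_onI) (rule fv_inject)
      ultimately show ?thesis using inj_on_image_eq_iff[OF inj Uc subset_refl] by simp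
    qed
    then show "projective_cover A P M"
      unfolding projective_cover_def using True by (intro conjI bexI[OF _ F] s allI impI) simp_all
  qed
next
  case False
  then show ?thesis
    by (cases "fd_projective A P") (simp_all only: projective_cover_def simp_thms)
qed

lemma projective_coverE:
  fixes A :: "('k::field, 'a, 'm) module_scheme"
  assumes "projective_cover A P M"
  obtains f where "fd_projective A P" "fd_module A P" "fd_module A M" "ehom A P M f"
    "f ` W (mdim P) = W (mdim M)" "\<And>U. esub A P U \<Longrightarrow> f ` U = W (mdim M) \<Longrightarrow> U = W (mdim P)"
proof -
  obtain f where P: "fd_projective A P" and M: "fd_module A M"
    and f: "ehom A P M f" "f ` W (mdim P) = W (mdim M)"
    and sup: "\<forall>U. esub A P U \<and> f ` U = W (mdim M) \<longrightarrow> U = W (mdim P)"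
    using assms unfolding projective_cover_iff by (elim exE conjE) (rule that)
  have "fd_module A P" using P by (simp add: fd_projective_def)
  then show thesis
    by (rule that[OF P _ M f]) (rule sup[rule_format, OF conjI])
qed

text \<open>Each covering map lifts through the other. Both composites of the lifts are compatible
  with a covering map, hence surjective, hence bijective.\<close>

lemma projective_cover_unique:
  fixes A :: "('k::field_char_0, 'a, 'm) module_scheme"
  assumes "projective_cover A P M" "projective_cover A P' M"
  shows "fd_iso A P P'"
proof -
  obtain f where pr1: "fd_projective A P" and mods1: "fd_module A P" "fd_module A M"
    and f: "ehom A P M f" "f ` W (mdim P) = W (mdim M)"
    and supf: "\<And>U. esub A P U \<Longrightarrow> f ` U = W (mdim M) \<Longrightarrow> U = W (mdim P)"
    by (rule projective_coverE[OF assms(1)]) (rule that, assumption+)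
  obtain f' where pr2: "fd_projective A P'" and mods2: "fd_module A P'" "fd_module A M"
    and f': "ehom A P' M f'" "f' ` W (mdim P') = W (mdim M)"
    and supf': "\<And>U. esub A P' U \<Longrightarrow> f' ` U = W (mdim M) \<Longrightarrow> U = W (mdim P')"
    by (rule projective_coverE[OF assms(2)]) (rule that, assumption+)
  note mods = mods1(1) mods2(1) and pr = pr1 pr2
  from fd_projectiveD[OF pr1 mods2 f' f(1)]
  obtain h where h: "ehom A P P' h" "\<And>v. v \<in> W (mdim P) \<Longrightarrow> f' (h v) = f v" by (elim exE conjE) (rule that, assumption, erule (1) bspec)
  from fd_projectiveD[OF pr2 mods1 f f'(1)]
  obtain k where k: "ehom A P' P k" "\<And>v. v \<in> W (mdim P') \<Longrightarrow> f (k v) = f' v" by (elim exE conjE) (rule that, assumption, erule (1) bspec)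
  have surj: "e ` W (mdim Q) = W (mdim Q)"
    if Q: "fd_module A Q" and e: "ehom A Q Q e" "\<And>v. v \<in> W (mdim Q) \<Longrightarrow> g (e v) = g v"
      and g: "g ` W (mdim Q) = W (mdim M)"
      and sup: "\<And>U. esub A Q U \<Longrightarrow> g ` U = W (mdim M) \<Longrightarrow> U = W (mdim Q)"
    for Q :: "('a, 'k) fdmod" and e and g :: "'k fvec \<Rightarrow> 'k fvec"
  proof (rule sup)
    note e_lin = ehom_islin[OF e(1)]
    have "lin (mact Q x) (e v) \<in> e ` W (mdim Q)" if "x \<in> carrier A" "v \<in> W (mdim Q)" for x v
      using ehom_act[OF e(1) that, symmetric] fd_act[OF Q that(1)] by auto
    moreover have "0 \<in> e ` W (mdim Q)" using islin_0[OF e_lin] by (intro image_eqI[of _ _ 0]) simp_all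
    moreover have "e u + e v \<in> e ` W (mdim Q)" if "u \<in> W (mdim Q)" "v \<in> W (mdim Q)" for u v
      using that islin_add[OF e_lin, of u v] by (intro image_eqI[of _ _ "u + v"]) simp_all
    moreover have "c *\<^sub>F e v \<in> e ` W (mdim Q)" if "v \<in> W (mdim Q)" for c v
      using that islin_sc[OF e_lin, of c v] by (intro image_eqI[of _ _ "c *\<^sub>F v"]) simp_all
    ultimately show "esub A Q (e ` W (mdim Q))"
      unfolding esub_def using ehom_W[OF e(1)] by (simp add: image_subset_iff)
    show "g ` e ` W (mdim Q) = W (mdim M)"
      unfolding image_image g[symmetric] by (rule image_cong) (simp_all add: e(2))
  qed
  \<comment> \<open>Projectivity splits the surjection, and for square matrices a one-sided inverse
    is two-sided.\<close>
  have bij: "\<exists>e'. ehom A Q Q e' \<and> (\<forall>v\<in>W (mdim Q). e (e' v) = v) \<and> (\<forall>v\<in>W (mdim Q). e' (e v) = v)"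
    if Q: "fd_projective A Q" and e: "ehom A Q Q e" "e ` W (mdim Q) = W (mdim Q)"
    for Q :: "('a, 'k) fdmod" and e
  proof -
    have Qm: "fd_module A Q" using Q by (simp add: fd_projective_def)
    obtain e' where e': "ehom A Q Q e'" "\<And>v. v \<in> W (mdim Q) \<Longrightarrow> e (e' v) = v"
      using fd_projectiveD[OF Q Qm Qm e ehom_id[OF Qm]] by blast
    let ?d = "mdim Q"
    let ?E = "mat_of ?d ?d e" and ?E' = "mat_of ?d ?d e'"
    have "?E * ?E' = 1\<^sub>m ?d"
      by (rule lin_inject[OF mult_carrier_mat[OF mat_of_carrier mat_of_carrier] one_carrier_mat])
        (simp_all add: lin_mult
          lin_mat_of_ehom[OF e(1)] lin_mat_of_ehom[OF e'(1)] ehom_W[OF e'(1)] e'(2) lin_one)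
    then have E: "?E' * ?E = 1\<^sub>m ?d"
      by (rule mat_mult_left_right_inverse[OF mat_of_carrier mat_of_carrier])
    have "e' (e v) = v" if v: "v \<in> W ?d" for v
      using lin_mult[of ?E' ?E v] v lin_mat_of_ehom[OF e(1) v] lin_mat_of_ehom[OF e'(1) ehom_W[OF e(1) v]] lin_one[OF v]
      unfolding E by simp
    with e' show ?thesis by blast
  qed
  have kh: "ehom A P P (\<lambda>v. k (h v))" by (rule ehom_comp[OF k(1) h(1)])
  have hk: "ehom A P' P' (\<lambda>v. h (k v))" by (rule ehom_comp[OF h(1) k(1)])
  have s1: "(\<lambda>v. k (h v)) ` W (mdim P) = W (mdim P)"
    by (rule surj[OF mods(1) kh _ f(2) supf]) (simp_all add: k(2) h(2) ehom_W[OF h(1)])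
  have s2: "(\<lambda>v. h (k v)) ` W (mdim P') = W (mdim P')"
    by (rule surj[OF mods(2) hk _ f'(2) supf']) (simp_all add: k(2) h(2) ehom_W[OF k(1)])
  obtain a where a: "ehom A P P a" "\<And>v. v \<in> W (mdim P) \<Longrightarrow> k (h (a v)) = v" "\<And>v. v \<in> W (mdim P) \<Longrightarrow> a (k (h v)) = v"
    using bij[OF pr(1) kh s1] by blast
  obtain b where b: "ehom A P' P' b" "\<And>v. v \<in> W (mdim P') \<Longrightarrow> h (k (b v)) = v" "\<And>v. v \<in> W (mdim P') \<Longrightarrow> b (h (k v)) = v"
    using bij[OF pr(2) hk s2] by blast
  show ?thesis
  proof (rule fd_isoI[OF mods h(1) ehom_comp[OF a(1) k(1)]])
    show "a (k (h v)) = v" if "v \<in> W (mdim P)" for v by (rule a(3)[OF that])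
    fix v :: "'k fvec" assume v: "v \<in> W (mdim P')"
    define u where "u = k (b v)"
    have u: "u \<in> W (mdim P)" unfolding u_def using ehom_W[OF k(1)] ehom_W[OF b(1)] v by blast
    have "h u = v" unfolding u_def by (rule b(2)[OF v])
    then show "h (a (k v)) = v" using a(3)[OF u] by simp
  qed
qed


text \<open>The matrix with columns \<open>e k\<close> has a right inverse made of the expansions of
  the unit vectors. Being square it is invertible, so d spanning vectors of a d-dimensional space
  have coordinate functions.\<close>

lemma linear_coordinates:
  fixes e :: "nat \<Rightarrow> 'k::field fvec"
  assumes e: "\<And>k. k < d \<Longrightarrow> e k \<in> W d" and span: "\<And>v. v \<in> W d \<Longrightarrow> \<exists>c. v = (\<Sum>k<d. c k *\<^sub>F e k)"
  shows "\<exists>\<kappa>. islin \<kappa> \<and> (\<forall>k<d. \<kappa> (e k) = bv k)"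
proof -
  define B where "B v = (\<Sum>k<d. ent v k *\<^sub>F e k)" for v
  have "\<forall>r. \<exists>c. r < d \<longrightarrow> bv r = (\<Sum>k<d. c k *\<^sub>F e k)" using span by auto
  then obtain c where c: "\<And>r. r < d \<Longrightarrow> bv r = (\<Sum>k<d. c r k *\<^sub>F e k)" by metis
  define C where "C v = (\<Sum>r<d. ent v r *\<^sub>F (\<Sum>k<d. c r k *\<^sub>F bv k))" for v
  have lB: "islin B" and lC: "islin C"
    by (simp_all add: islin_def B_def C_def sc_add_left sum.distrib sc_sum distrib_right mult.assoc)
  have BW: "B v \<in> W d" and CW: "C v \<in> W d" for v
    unfolding B_def C_def by (intro W_sum W_closed(4); simp add: e)+
  have Bbv: "B (bv k) = e k" if "k < d" for k
  proof -
    have "B (bv k) = (\<Sum>i<d. if i = k then e i else 0)"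
      unfolding B_def by (rule sum.cong) (auto simp: bv_def)
    with that show ?thesis by simp
  qed
  have Cbv: "C (bv r) = (\<Sum>k<d. c r k *\<^sub>F bv k)" if "r < d" for r
  proof -
    have "C (bv r) = (\<Sum>i<d. if i = r then (\<Sum>k<d. c i k *\<^sub>F bv k) else 0)"
      unfolding C_def by (rule sum.cong) (auto simp: bv_def)
    with that show ?thesis by simp
  qed
  let ?B = "mat_of d d B" and ?C = "mat_of d d C"
  note mB = lin_mat_of[OF lB BW] and mC = lin_mat_of[OF lC CW]
  have "?B * ?C = 1\<^sub>m d"
  proof (rule lin_inject[OF mult_carrier_mat[OF mat_of_carrier mat_of_carrier] one_carrier_mat])
    fix r assume r: "r < d"
    have "lin (?B * ?C) (bv r) = B (C (bv r))" using r by (simp add: lin_mult mB mC CW)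
    also have "\<dots> = (\<Sum>k<d. c r k *\<^sub>F e k)"
      using r by (simp add: Cbv islin_sum[OF lB] islin_sc[OF lB] Bbv)
    also have "\<dots> = bv r" by (rule c[OF r, symmetric])
    also have "\<dots> = lin (1\<^sub>m d) (bv r)" using r by (simp add: lin_one)
    finally show "lin (?B * ?C) (bv r) = lin (1\<^sub>m d) (bv r)" .
  qed
  then have CB: "?C * ?B = 1\<^sub>m d"
    by (rule mat_mult_left_right_inverse[OF mat_of_carrier mat_of_carrier])
  have "C (e k) = bv k" if k: "k < d" for k
  proof -
    have "lin (?C * ?B) (bv k) = C (B (bv k))" using k by (simp add: lin_mult mB mC BW)
    then show ?thesis using k unfolding CB by (simp add: Bbv lin_one)
  qed
  with lC show ?thesis by blast
qed

section \<open>The universal module on a generator killed by \<xi>^l\<close>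

context gdatum
begin

lemma cl_gen_in: "s \<in> dgens D \<Longrightarrow> cl (gen s) \<in> carrier Alg"
  by (auto simp: carrier_A)

context
  fixes M :: "(('g, 'k) dfree set, 'k) fdmod"
  assumes M: "fd_module Alg M"
begin

lemma opM_lin: "s \<in> dgens D \<Longrightarrow> v \<in> W (mdim M) \<Longrightarrow> app (opM M s) v = lin (mact M (cl (gen s))) v"
  unfolding opM_def by (rule app_emb_W[OF _ fd_act[OF M cl_gen_in]])

lemma opM_W: "s \<in> dgens D \<Longrightarrow> v \<in> W (mdim M) \<Longrightarrow> app (opM M s) v \<in> W (mdim M)"
  using fd_act[OF M cl_gen_in, of s] by (simp add: opM_lin)

lemma opM_pow_W: "s \<in> dgens D \<Longrightarrow> v \<in> W (mdim M) \<Longrightarrow> app (opM M s ^ i) v \<in> W (mdim M)"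
  by (induction i) (simp_all add: opM_W)

lemma esub_opM:
  assumes U: "esub Alg M U" and s: "s \<in> dgens D" and u: "u \<in> U"
  shows "app (opM M s ^ i) u \<in> U"
proof (induction i)
  case (Suc i)
  then show ?case using U opM_lin[OF s, of "app (opM M s ^ i) u"] cl_gen_in[OF s] by (auto simp: esub_def)
qed (use u in simp)

end

lemma ehom_opM:
  assumes "fd_module Alg M" "fd_module Alg N" "ehom Alg M N t" "s \<in> dgens D" "v \<in> W (mdim M)"
  shows "t (app (opM M s) v) = app (opM N s) (t v)"
  using assms by (simp add: opM_lin ehom_W ehom_act[OF _ cl_gen_in])

lemma ehom_opM_pow:
  assumes "fd_module Alg M" "fd_module Alg N" "ehom Alg M N t" "s \<in> dgens D" "v \<in> W (mdim M)"
  shows "t (app (opM M s ^ i) v) = app (opM N s ^ i) (t v)"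
  by (induction i) (simp_all add: assms ehom_opM[OF assms(1-4)] opM_pow_W)

lemma ehom_gens:
  assumes M: "fd_module Alg M" and N: "fd_module Alg N" and t: "islin t"
    and W: "\<And>v. v \<in> W (mdim M) \<Longrightarrow> t v \<in> W (mdim N)"
    and gens: "\<And>s v. s \<in> dgens D \<Longrightarrow> v \<in> W (mdim M) \<Longrightarrow> t (app (opM M s) v) = app (opM N s) (t v)"
  shows "ehom Alg M N t"
proof -
  let ?T = "mat_of (mdim N) (mdim M) t"
  note lT = lin_mat_of[OF t W]
  have "?T \<in> fd_hom Alg M N"
  proof (rule fd_hom_gens[OF M N mat_of_carrier])
    fix s assume s: "s \<in> dgens D"
    note a = fd_act[OF M cl_gen_in[OF s]] fd_act[OF N cl_gen_in[OF s]]
    show "?T * mact M (cl (gen s)) = mact N (cl (gen s)) * ?T"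
    proof (rule lin_inject[OF mult_carrier_mat[OF mat_of_carrier a(1)] mult_carrier_mat[OF a(2) mat_of_carrier]])
      fix j assume j: "j < mdim M"
      have "lin (?T * mact M (cl (gen s))) (bv j) = t (app (opM M s) (bv j))"
        using a j opM_W[OF M s, of "bv j"] by (simp add: lin_mult lT opM_lin[OF M s])
      also have "\<dots> = lin (mact N (cl (gen s)) * ?T) (bv j)"
        using a j W[of "bv j"] gens[OF s, of "bv j"] by (simp add: lin_mult lT opM_lin[OF N s])
      finally show "lin (?T * mact M (cl (gen s))) (bv j) = lin (mact N (cl (gen s)) * ?T) (bv j)" .
    qed
  qed
  from ehom_lin[OF M N this] have h: "ehom Alg M N (lin ?T)" .
  have "t (lin (mact M x) v) = lin (mact N x) (t v)" if x: "x \<in> carrier Alg" "v \<in> W (mdim M)" for x v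
  proof -
    have "lin (mact M x) v \<in> W (mdim M)" using fd_act[OF M x(1)] by auto
    then show ?thesis using ehom_act[OF h x] x by (simp add: lT)
  qed
  then show ?thesis using t W by (simp add: ehom_def)
qed

definition wtM :: "(('g, 'k) dfree set, 'k) fdmod \<Rightarrow> ('g \<times> ('g \<Rightarrow> 'k) \<Rightarrow> 'k) \<Rightarrow> 'k fvec \<Rightarrow> bool" where
  "wtM M \<nu> v \<longleftrightarrow> double_ops.wt D (\<lambda>g. opM M (GrpGen g)) (\<lambda>\<gamma>. opM M (ChrGen \<gamma>)) (m1 \<nu>) (m2 \<nu>) v"

definition XY :: "(('g, 'k) dfree set, 'k) fdmod \<Rightarrow> 'k fvec \<Rightarrow> nat \<Rightarrow> nat \<Rightarrow> 'k fvec" where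
  "XY M p i j = app (opM M XGen ^ i) (app (opM M XiGen ^ j) p)"

text \<open>The pairs (i, j) with i < n and j < l are numbered by i l + j, to match the numbering of
  coordinates in dimension n l.\<close>

definition spXY :: "(('g, 'k) dfree set, 'k) fdmod \<Rightarrow> nat \<Rightarrow> 'k fvec \<Rightarrow> 'k fvec set" where
  "spXY M l p = {v. \<exists>c. v = (\<Sum>k<n * l. c k *\<^sub>F XY M p (k div l) (k mod l))}"

text \<open>The module with generator \<open>p\<close> of weight \<open>\<nu>\<close> and the only further relation \<open>\<xi>\<^sup>l p = 0\<close>.\<close>

definition cyc :: "(('g, 'k) dfree set, 'k) fdmod \<Rightarrow> nat \<Rightarrow> ('g \<times> ('g \<Rightarrow> 'k) \<Rightarrow> 'k) \<Rightarrow> 'k fvec \<Rightarrow> bool" where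
  "cyc N l \<nu> p \<longleftrightarrow> fd_module Alg N \<and> 0 < l \<and> mdim N = n * l \<and> p \<in> W (mdim N) \<and>
     \<nu> \<in> carrier (Lam D) \<and> wtM N \<nu> p \<and> app (opM N XiGen ^ l) p = 0 \<and> W (mdim N) \<subseteq> spXY N l p"

lemma XY_W: "fd_module Alg M \<Longrightarrow> p \<in> W (mdim M) \<Longrightarrow> XY M p i j \<in> W (mdim M)"
  by (simp add: XY_def opM_pow_W)

context
  fixes M :: "(('g, 'k) dfree set, 'k) fdmod" and l :: nat and \<nu> :: "'g \<times> ('g \<Rightarrow> 'k) \<Rightarrow> 'k" and p :: "'k fvec"
  assumes M: "fd_module Alg M" "0 < mdim M" and l: "0 < l" and \<nu>: "wtM M \<nu> p"
    and Yl: "app (opM M XiGen ^ l) p = 0"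
begin

interpretation M: double_ops D "\<lambda>g. opM M (GrpGen g)" "\<lambda>\<gamma>. opM M (ChrGen \<gamma>)" "opM M XGen" "opM M XiGen"
  by (rule ops_opM[OF M])

lemma XY_aw: "M.aw (inverse \<rho> ^ i * (\<rho> ^ j * m1 \<nu> a)) (\<rho> ^ i * (inverse \<rho> ^ j * m2 \<nu> \<chi>)) (XY M p i j)"
  unfolding XY_def by (rule M.aw_X_pow, rule M.aw_Y_pow, rule M.wt_aw) (use \<nu> in \<open>simp add: wtM_def\<close>)

lemma XY_ge: "l \<le> j \<Longrightarrow> XY M p i j = 0"
proof -
  assume "l \<le> j"
  then obtain k where "j = k + l" by (metis add.commute le_Suc_ex)
  then show ?thesis by (simp add: XY_def app_pow_add Yl)
qed

lemma XY_X: "app (opM M XGen) (XY M p i j) = XY M p (Suc i) j"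
  by (simp add: XY_def)

text \<open>The eigenvalue of a on \<xi>^j p is \<rho>^j times that on p, and \<rho>^(jn) = 1, so
  x^n acts by the same scalar for every j.\<close>

lemma XY_n: "XY M p (i + n) j = (scal D * (m1 \<nu> a ^ n - 1)) *\<^sub>F XY M p i j"
proof -
  have "(\<rho> ^ j * m1 \<nu> a) ^ n = m1 \<nu> a ^ n"
  proof -
    have "(\<rho> ^ j) ^ n = 1" by (simp add: rho_pow_eq_1 flip: power_mult)
    then show ?thesis by (simp add: power_mult_distrib)
  qed
  then have "app (opM M XGen ^ n) (XY M p 0 j) = (scal D * (m1 \<nu> a ^ n - 1)) *\<^sub>F XY M p 0 j"
    using M.X_pow_app[OF XY_aw[of 0 j]] by simp
  then show ?thesis by (simp add: XY_def app_pow_add)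
qed

lemma XY_Y: "app (opM M XiGen) (XY M p i j) = XY M p i (Suc j) +
    al (\<rho> ^ j * m1 \<nu> a) (inverse \<rho> ^ j * m2 \<nu> \<chi>) i *\<^sub>F XY M p (i - 1) j"
  using M.YX_pow[OF XY_aw[of 0 j], of i] by (simp add: XY_def)

lemma sp_closed:
  "0 \<in> spXY M l p" "u \<in> spXY M l p \<Longrightarrow> v \<in> spXY M l p \<Longrightarrow> u + v \<in> spXY M l p"
  "v \<in> spXY M l p \<Longrightarrow> c *\<^sub>F v \<in> spXY M l p"
proof -
  show "0 \<in> spXY M l p" unfolding spXY_def by (auto intro!: exI[of _ "\<lambda>_. 0"])
  show "u \<in> spXY M l p \<Longrightarrow> v \<in> spXY M l p \<Longrightarrow> u + v \<in> spXY M l p"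
  proof -
    assume "u \<in> spXY M l p" "v \<in> spXY M l p"
    then obtain c c' where "u = (\<Sum>k<n * l. c k *\<^sub>F XY M p (k div l) (k mod l))"
      "v = (\<Sum>k<n * l. c' k *\<^sub>F XY M p (k div l) (k mod l))" by (auto simp: spXY_def)
    then show "u + v \<in> spXY M l p"
      unfolding spXY_def by (auto intro!: exI[of _ "\<lambda>k. c k + c' k"] simp: sc_add_left sum.distrib)
  qed
  show "v \<in> spXY M l p \<Longrightarrow> c *\<^sub>F v \<in> spXY M l p"
  proof -
    assume "v \<in> spXY M l p"
    then obtain c' where "v = (\<Sum>k<n * l. c' k *\<^sub>F XY M p (k div l) (k mod l))" by (auto simp: spXY_def)
    then show "c *\<^sub>F v \<in> spXY M l p"
      unfolding spXY_def by (auto intro!: exI[of _ "\<lambda>k. c * c' k"] simp: sc_sum)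
  qed
qed

text \<open>Exponents of x from n on are lowered by \<open>XY_n\<close>, and from j = l on the
  vector is 0.\<close>

lemma sp_XY: "XY M p i j \<in> spXY M l p"
proof (cases "j < l")
  case j: True
  show ?thesis
  proof (induction i rule: less_induct)
    case (less i)
    show ?case
    proof (cases "i < n")
      case True
      have "i * l + j < i * l + l" using j by simp
      also have "\<dots> = Suc i * l" by simp
      also have "\<dots> \<le> n * l" using True by (intro mult_right_mono) auto
      finally have k: "i * l + j < n * l" .
      have "(\<Sum>k<n * l. (if k = i * l + j then 1 else 0) *\<^sub>F XY M p (k div l) (k mod l)) =
          (\<Sum>k<n * l. if k = i * l + j then XY M p (k div l) (k mod l) else 0)"
        by (rule sum.cong) auto
      also have "\<dots> = XY M p i j" using k j by simp
      finally show ?thesis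
        unfolding spXY_def by (intro CollectI exI[of _ "\<lambda>k. if k = i * l + j then 1 else 0"]) (rule sym)
    next
      case False
      then have i: "i - n + n = i" "i - n < i" using n_ge2 by auto
      have "XY M p (i - n + n) j \<in> spXY M l p" unfolding XY_n by (rule sp_closed(3)[OF less.IH[OF i(2)]])
      then show ?thesis by (simp only: i(1))
    qed
  qed
qed (simp add: XY_ge sp_closed)

lemma sp_induct:
  assumes v: "v \<in> spXY M l p" and Q: "Q 0" "\<And>u v. Q u \<Longrightarrow> Q v \<Longrightarrow> Q (u + v)" "\<And>c v. Q v \<Longrightarrow> Q (c *\<^sub>F v)"
    and XY: "\<And>i j. Q (XY M p i j)"
  shows "Q v"
proof -
  obtain c where v: "v = (\<Sum>k<n * l. c k *\<^sub>F XY M p (k div l) (k mod l))" using v by (auto simp: spXY_def)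
  have "Q (\<Sum>k\<in>K. c k *\<^sub>F XY M p (k div l) (k mod l))" if "finite K" for K
    using that by (induction K) (simp_all add: Q XY)
  then show ?thesis by (simp add: v)
qed

lemma sp_X: "v \<in> spXY M l p \<Longrightarrow> app (opM M XGen) v \<in> spXY M l p"
  by (erule sp_induct) (simp_all add: sp_closed XY_X sp_XY)

lemma sp_Y: "v \<in> spXY M l p \<Longrightarrow> app (opM M XiGen) v \<in> spXY M l p"
  by (erule sp_induct) (simp_all add: sp_closed XY_Y sp_XY)

end

lemma cycD:
  assumes "cyc N l \<nu> p"
  shows "fd_module Alg N" "0 < mdim N" "0 < l" "wtM N \<nu> p" "app (opM N XiGen ^ l) p = 0"
    "p \<in> W (mdim N)" "\<nu> \<in> carrier (Lam D)" "W (mdim N) \<subseteq> spXY N l p" "mdim N = n * l"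
  using assms n_ge2 by (auto simp: cyc_def)

text \<open>The n l spanning vectors have coordinates, so a linear map with x^i \<xi>^j p going to
  x^i \<xi>^j m exists; \<open>XY_n\<close> extends this to all exponents. The actions of x, \<xi>
  and G on these vectors follow formulas with the same scalars on both sides. The action of \<Gamma>
  needs an induction.\<close>

lemma universal:
  assumes N: "cyc N l \<nu> p" and M: "fd_module Alg M" "0 < mdim M"
    and m: "m \<in> W (mdim M)" "wtM M \<nu> m" "app (opM M XiGen ^ l) m = 0"
  shows "\<exists>t. ehom Alg N M t \<and> t p = m"
proof -
  note Nc = cycD[OF N]
  note NX = XY_X[OF Nc(1-5)] and NY = XY_Y[OF Nc(1-5)] and Nn = XY_n[OF Nc(1-5)] and Ng = XY_ge[OF Nc(1-5)]
  note MX = XY_X[OF M Nc(3) m(2,3)] and MY = XY_Y[OF M Nc(3) m(2,3)] and Mn = XY_n[OF M Nc(3) m(2,3)] and Mg = XY_ge[OF M Nc(3) m(2,3)]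
  interpret N: double_ops D "\<lambda>g. opM N (GrpGen g)" "\<lambda>\<gamma>. opM N (ChrGen \<gamma>)" "opM N XGen" "opM N XiGen"
    by (rule ops_opM[OF Nc(1,2)])
  interpret M: double_ops D "\<lambda>g. opM M (GrpGen g)" "\<lambda>\<gamma>. opM M (ChrGen \<gamma>)" "opM M XGen" "opM M XiGen"
    by (rule ops_opM[OF M])
  let ?e = "\<lambda>k. XY N p (k div l) (k mod l)"
  have "\<exists>\<kappa>. islin \<kappa> \<and> (\<forall>k<n * l. \<kappa> (?e k) = bv k)"
  proof (rule linear_coordinates)
    show "?e k \<in> W (n * l)" for k using XY_W[OF Nc(1) Nc(6)] by (simp add: Nc(9))
    fix v :: "'k fvec" assume "v \<in> W (n * l)"
    then have "v \<in> spXY N l p" using Nc(8) by (auto simp: Nc(9))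
    then show "\<exists>c. v = (\<Sum>k<n * l. c k *\<^sub>F ?e k)" by (simp add: spXY_def)
  qed
  then obtain \<kappa> where \<kappa>: "islin \<kappa>" "\<And>k. k < n * l \<Longrightarrow> \<kappa> (?e k) = bv k" by blast
  define t where "t v = (\<Sum>k<n * l. ent (\<kappa> v) k *\<^sub>F XY M m (k div l) (k mod l))" for v
  have lt: "islin t"
    unfolding t_def islin_def by (simp add: islin_add[OF \<kappa>(1)] islin_sc[OF \<kappa>(1)] sc_add_left sum.distrib sc_sum)
  have tW: "t v \<in> W (mdim M)" for v
    unfolding t_def by (intro W_sum W_closed(4) XY_W M m)
  have te: "t (?e k) = XY M m (k div l) (k mod l)" if k: "k < n * l" for k
  proof -
    have "t (?e k) = (\<Sum>i<n * l. if i = k then XY M m (i div l) (i mod l) else 0)"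
      unfolding t_def \<kappa>(2)[OF k] by (rule sum.cong) (auto simp: bv_def)
    with k show ?thesis by simp
  qed
  have tXY: "t (XY N p i j) = XY M m i j" for i j
  proof (cases "j < l")
    case j: True
    show ?thesis
    proof (induction i rule: less_induct)
      case (less i)
      show ?case
      proof (cases "i < n")
        case True
        have "i * l + j < i * l + l" using j by simp
        also have "\<dots> = Suc i * l" by simp
        also have "\<dots> \<le> n * l" using True by (intro mult_right_mono) auto
        finally show ?thesis using te[of "i * l + j"] j by simp
      next
        case False
        then have i: "i - n + n = i" "i - n < i" using n_ge2 by auto
        have "t (XY N p ((i - n) + n) j) = XY M m ((i - n) + n) j"
          unfolding Nn Mn using less.IH[OF i(2)] by (simp add: islin_sc[OF lt])
        then show ?thesis by (simp only: i(1))
      qed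
    qed
  qed (simp add: Ng Mg islin_0[OF lt])
  have ext: "Q v" if "v \<in> W (mdim N)" "Q 0" "\<And>u v. Q u \<Longrightarrow> Q v \<Longrightarrow> Q (u + v)" "\<And>c v. Q v \<Longrightarrow> Q (c *\<^sub>F v)"
    "\<And>i j. Q (XY N p i j)" for Q v
  proof -
    have "v \<in> spXY N l p" using that(1) Nc(8) by blast
    then show ?thesis by (rule sp_induct[OF Nc(1-5)]) (simp_all add: that(2-5))
  qed
  note ls = islin_add[OF lt] islin_sc[OF lt] islin_0[OF lt] islin_diff[OF lt]
  have X: "t (app (opM N XGen) v) = app (opM M XGen) (t v)" if "v \<in> W (mdim N)" for v
    using that by (rule ext) (simp_all add: ls NX MX tXY)
  have Y: "t (app (opM N XiGen) v) = app (opM M XiGen) (t v)" if "v \<in> W (mdim N)" for v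
    using that by (rule ext) (simp_all add: ls NY MY tXY)
  have wN: "N.wt (m1 \<nu>) (m2 \<nu>) p" and wM: "M.wt (m1 \<nu>) (m2 \<nu>) m" using Nc(4) m(2) by (simp_all add: wtM_def)
  have g: "t (app (opM N (GrpGen g)) v) = app (opM M (GrpGen g)) (t v)" if "v \<in> W (mdim N)" "g \<in> carrier G" for v g
    using that(1)
  proof (rule ext)
    fix i j
    show "t (app (opM N (GrpGen g)) (XY N p i j)) = app (opM M (GrpGen g)) (t (XY N p i j))"
      unfolding tXY unfolding XY_def
      using N.go_X_pow[OF N.wt_Y_pow[OF wN, of j] that(2), of i] M.go_X_pow[OF M.wt_Y_pow[OF wM, of j] that(2), of i]
        tXY[of i j] by (simp add: ls XY_def)
  qed (simp_all add: ls)
  \<comment> \<open>No closed formula is available for \<gamma> on x^i \<xi>^j p, since each x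
    brings in a correction with \<xi>^(n-1). Compatibility with \<gamma> is proved instead by
    induction on the exponent of x.\<close>
  have co: "t (app (opM N (ChrGen \<gamma>)) v) = app (opM M (ChrGen \<gamma>)) (t v)"
    if v: "v \<in> W (mdim N)" and c: "\<gamma> \<in> carrier (Gam D)" for v \<gamma>
  proof -
    define Q where "Q v \<longleftrightarrow> v \<in> W (mdim N) \<and> t (app (opM N (ChrGen \<gamma>)) v) = app (opM M (ChrGen \<gamma>)) (t v)" for v
    have Q: "Q 0" "\<And>u v. Q u \<Longrightarrow> Q v \<Longrightarrow> Q (u + v)" "\<And>c v. Q v \<Longrightarrow> Q (c *\<^sub>F v)"
      by (simp_all add: Q_def ls)
    have QXY: "Q (XY N p i j)" for i j
    proof (induction i arbitrary: j rule: less_induct)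
      case (less i)
      show ?case
      proof (cases i)
        case 0
        show ?thesis
          using N.wt_Y_pow[OF wN, of j] M.wt_Y_pow[OF wM, of j] c tXY[of 0 j] XY_W[OF Nc(1,6), of 0 j]
          unfolding Q_def 0 by (simp add: XY_def N.wt_def M.wt_def ls)
      next
        case (Suc k)
        \<comment> \<open>\<xi> never raises the exponent of x, so applying its powers stays within
          the vectors covered by the induction hypothesis.\<close>
        have YQ: "Q (app (opM N XiGen ^ b) (XY N p i' j'))" if "i' \<le> k" for b i' j'
          using that
        proof (induction b arbitrary: i' j')
          case 0
          then show ?case using less.IH Suc by simp
        next
          case (Suc b)
          have "app (opM N XiGen ^ Suc b) (XY N p i' j') = app (opM N XiGen ^ b) (XY N p i' (Suc j')) +
              al (\<rho> ^ j' * m1 \<nu> a) (inverse \<rho> ^ j' * m2 \<nu> \<chi>) i' *\<^sub>F app (opM N XiGen ^ b) (XY N p (i' - 1) j')"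
            by (simp add: app_pow_Suc2 NY del: power_Suc)
          moreover have "Q (app (opM N XiGen ^ b) (XY N p i' (Suc j')))" by (rule Suc.IH[OF Suc.prems])
          moreover have "Q (app (opM N XiGen ^ b) (XY N p (i' - 1) j'))" by (rule Suc.IH) (use Suc.prems in simp)
          ultimately show ?case using Q(2)[OF _ Q(3)] by (simp only:)
        qed
        let ?v = "XY N p k j" and ?v' = "XY M m k j"
        let ?u = "app (opM N XiGen ^ (n - 1)) ?v" and ?u' = "app (opM M XiGen ^ (n - 1)) ?v'"
        have vW: "?v \<in> W (mdim N)" by (rule XY_W[OF Nc(1,6)])
        have uW: "?u \<in> W (mdim N)" using opM_pow_W[OF Nc(1) _ vW] by simp
        have tu: "t ?u = ?u'"
        proof -
          have "t (app (opM N XiGen ^ b) ?v) = app (opM M XiGen ^ b) ?v'" for b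
            using opM_pow_W[OF Nc(1) _ vW, of XiGen] by (induction b) (simp_all add: tXY Y)
          then show ?thesis .
        qed
        \<comment> \<open>The correction involves a and \<chi> only through their eigenvalues on
          this vector, which are the same in both modules.\<close>
        obtain s1 s2 where aw: "N.aw s1 s2 ?u" "M.aw s1 s2 ?u'"
          using N.aw_Y_pow[OF XY_aw[OF Nc(1-5)]] M.aw_Y_pow[OF XY_aw[OF M Nc(3) m(2,3)]] by blast
        have tc: "t (app (opM N (ChrGen \<gamma>)) ?u) = app (opM M (ChrGen \<gamma>)) ?u'"
          using YQ[of k "n - 1" j] tu by (simp add: Q_def)
        have tv: "t (app (opM N (ChrGen \<gamma>)) ?v) = app (opM M (ChrGen \<gamma>)) ?v'"
          using less.IH[of k j] Suc by (simp add: Q_def tXY)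
        have "t (app (opM N (ChrGen \<gamma>)) (app (opM N XGen) ?v)) = app (opM M (ChrGen \<gamma>)) (app (opM M XGen) ?v')"
          unfolding N.co_X_app[OF c] M.co_X_app[OF c]
          using aw tc vW opM_W[OF Nc(1) _ vW, of "ChrGen \<gamma>"] c
          by (simp add: N.aw_def M.aw_def ls X tv)
        then show ?thesis unfolding Q_def Suc using XY_W[OF Nc(1,6)] by (simp add: NX MX tXY)
      qed
    qed
    have "Q v" using v by (rule ext) (use Q QXY in auto)
    then show ?thesis by (simp add: Q_def)
  qed
  have "ehom Alg N M t"
  proof (rule ehom_gens[OF Nc(1) M(1) lt tW])
    fix s and v :: "'k fvec" assume "s \<in> dgens D" "v \<in> W (mdim N)"
    then show "t (app (opM N s) v) = app (opM M s) (t v)"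
      by (cases s) (simp_all add: X Y g co)
  qed
  moreover have "t p = m" using tXY[of 0 0] by (simp add: XY_def)
  ultimately show ?thesis by blast
qed

lemma hom_unique:
  assumes N: "cyc N l \<nu> p" and M: "fd_module Alg M"
    and t: "ehom Alg N M t" "ehom Alg N M t'" "t p = t' p" and v: "v \<in> W (mdim N)"
  shows "t v = t' v"
proof -
  note Nc = cycD[OF N]
  have XY: "t (XY N p i j) = XY M (t p) i j" if "ehom Alg N M t" for t i j
    unfolding XY_def using ehom_opM_pow[OF Nc(1) M that] opM_pow_W[OF Nc(1)] Nc(6) by simp
  have "v \<in> spXY N l p" using Nc(8) v by blast
  then show ?thesis
    by (rule sp_induct[OF Nc(1-5), where Q = "\<lambda>v. t v = t' v"])
      (simp_all add: islin_add[OF ehom_islin[OF t(1)]] islin_add[OF ehom_islin[OF t(2)]]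
        islin_sc[OF ehom_islin[OF t(1)]] islin_sc[OF ehom_islin[OF t(2)]]
        islin_0[OF ehom_islin[OF t(1)]] islin_0[OF ehom_islin[OF t(2)]] XY t)
qed

lemma wtM_ehom:
  assumes "fd_module Alg M" "fd_module Alg N" "0 < mdim M" "0 < mdim N" "ehom Alg M N t" "v \<in> W (mdim M)" "wtM M \<nu> v"
  shows "wtM N \<nu> (t v)"
proof -
  interpret M: double_ops D "\<lambda>g. opM M (GrpGen g)" "\<lambda>\<gamma>. opM M (ChrGen \<gamma>)" "opM M XGen" "opM M XiGen"
    by (rule ops_opM[OF assms(1,3)])
  interpret N: double_ops D "\<lambda>g. opM N (GrpGen g)" "\<lambda>\<gamma>. opM N (ChrGen \<gamma>)" "opM N XGen" "opM N XiGen"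
    by (rule ops_opM[OF assms(2,4)])
  show ?thesis
    unfolding wtM_def N.wt_def
  proof (intro conjI ballI)
    fix g assume g: "g \<in> carrier G"
    have "app (opM N (GrpGen g)) (t v) = t (app (opM M (GrpGen g)) v)"
      using ehom_opM[OF assms(1,2,5) _ assms(6), of "GrpGen g"] g by simp
    also have "\<dots> = m1 \<nu> g *\<^sub>F t v"
      using assms(7) g by (simp add: wtM_def M.wt_def islin_sc[OF ehom_islin[OF assms(5)]])
    finally show "app (opM N (GrpGen g)) (t v) = m1 \<nu> g *\<^sub>F t v" .
  next
    fix \<gamma> assume g: "\<gamma> \<in> carrier (Gam D)"
    have "app (opM N (ChrGen \<gamma>)) (t v) = t (app (opM M (ChrGen \<gamma>)) v)"
      using ehom_opM[OF assms(1,2,5) _ assms(6), of "ChrGen \<gamma>"] g by simp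
    also have "\<dots> = m2 \<nu> \<gamma> *\<^sub>F t v"
      using assms(7) g by (simp add: wtM_def M.wt_def islin_sc[OF ehom_islin[OF assms(5)]])
    finally show "app (opM N (ChrGen \<gamma>)) (t v) = m2 \<nu> \<gamma> *\<^sub>F t v" .
  qed
qed

lemma wproj_W:
  assumes M: "fd_module Alg M" "0 < mdim M" "v \<in> W (mdim M)"
  shows "double_ops.wproj D (\<lambda>g. opM M (GrpGen g)) (\<lambda>\<gamma>. opM M (ChrGen \<gamma>)) f h v \<in> W (mdim M)"
proof -
  interpret M: double_ops D "\<lambda>g. opM M (GrpGen g)" "\<lambda>\<gamma>. opM M (ChrGen \<gamma>)" "opM M XGen" "opM M XiGen"
    by (rule ops_opM[OF M(1,2)])
  show ?thesis
    unfolding M.wproj_def by (intro W_sum W_closed(4) opM_W M) simp_all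
qed

text \<open>By \<open>Y_divisible\<close> the image of p in the target is \<xi>^(n-l) of some
  vector. Lifting that vector and applying \<xi>^(n-l) gives a lift killed by \<xi>^l, because
  \<xi>^n = 0. Averaging restores the weight, and universality gives the homomorphism.\<close>

lemma cyc_projective:
  assumes N: "cyc N l \<nu> p" and l: "l < n" and \<nu>l: "m1 \<nu> a * \<rho> ^ l = m2 \<nu> \<chi>"
  shows "fd_projective Alg N"
proof (rule fd_projectiveI)
  note Nc = cycD[OF N]
  show "fd_module Alg N" by (rule Nc)
  fix M M' f g
  assume M: "fd_module Alg M" and M': "fd_module Alg M'" and f: "ehom Alg M M' f" "f ` W (mdim M) = W (mdim M')"
    and g: "ehom Alg N M' g"
  note lf = ehom_islin[OF f(1)]
  show "\<exists>h. ehom Alg N M h \<and> (\<forall>v\<in>W (mdim N). f (h v) = g v)"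
  \<comment> \<open>The operators on infinitely many copies satisfy the relations only in positive
    dimension, so zero modules are treated apart.\<close>
  proof (cases "mdim M' = 0")
    case True
    have z: "v = 0" if "v \<in> W (mdim M')" for v
      using that True by (auto simp: W_def fvec_eq_iff)
    have "ehom Alg N M (\<lambda>_. 0)" by (auto simp: ehom_def islin_def islin_0[OF islin_lin])
    then show ?thesis using z[OF ehom_W[OF g]] islin_0[OF lf] by (intro exI[of _ "\<lambda>_. 0"]) simp
  next
    case False
    then have M'0: "0 < mdim M'" by simp
    have M0: "0 < mdim M"
    proof (rule ccontr)
      assume "\<not> 0 < mdim M"
      then have "W (mdim M) = {0 :: 'k fvec}" by (auto simp: W_def fvec_eq_iff)
      then have "W (mdim M') = {0 :: 'k fvec}" using f(2) islin_0[OF lf] by auto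
      moreover have "bv 0 \<in> W (mdim M')" using M'0 by simp
      ultimately have "(bv 0 :: 'k fvec) = 0" by blast
      then have "ent (bv 0) 0 = (0::'k)" by simp
      then show False by (simp add: bv_def)
    qed
    interpret M: double_ops D "\<lambda>g. opM M (GrpGen g)" "\<lambda>\<gamma>. opM M (ChrGen \<gamma>)" "opM M XGen" "opM M XiGen"
      by (rule ops_opM[OF M M0])
    interpret M': double_ops D "\<lambda>g. opM M' (GrpGen g)" "\<lambda>\<gamma>. opM M' (ChrGen \<gamma>)" "opM M' XGen" "opM M' XiGen"
      by (rule ops_opM[OF M' M'0])
    let ?n = "g p" and ?Y = "opM M XiGen" and ?Y' = "opM M' XiGen"
    have n: "?n \<in> W (mdim M')" by (rule ehom_W[OF g Nc(6)])
    have wn: "wtM M' \<nu> ?n" by (rule wtM_ehom[OF Nc(1) M' Nc(2) M'0 g Nc(6,4)])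
    have Yn: "app (?Y' ^ l) ?n = 0"
      using ehom_opM_pow[OF Nc(1) M' g _ Nc(6), of XiGen l] Nc(5) islin_0[OF ehom_islin[OF g]] by simp
    have "?n \<in> {app (?Y' ^ (n - l)) v | v. v \<in> W (mdim M')}"
    proof (rule M'.Y_divisible[OF _ l Yn \<nu>l])
      show "M'.aw (m1 \<nu> a) (m2 \<nu> \<chi>) ?n" by (rule M'.wt_aw) (use wn in \<open>simp add: wtM_def\<close>)
      show "m1 \<nu> a \<noteq> 0" by (rule Lam_nz(1)[OF Nc(7) a_in])
      show "0 \<in> {app (?Y' ^ (n - l)) v | v. v \<in> W (mdim M')}" by (auto intro!: exI[of _ 0])
      show "u + v \<in> {app (?Y' ^ (n - l)) v | v. v \<in> W (mdim M')}"
        if "u \<in> {app (?Y' ^ (n - l)) v | v. v \<in> W (mdim M')}" "v \<in> {app (?Y' ^ (n - l)) v | v. v \<in> W (mdim M')}" for u v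
      proof -
        from that obtain u' v' where "u' \<in> W (mdim M')" "u = app (?Y' ^ (n - l)) u'" "v' \<in> W (mdim M')" "v = app (?Y' ^ (n - l)) v'"
          by (elim CollectE exE conjE)
        then show ?thesis by (intro CollectI exI[of _ "u' + v'"]) simp
      qed
      show "c *\<^sub>F v \<in> {app (?Y' ^ (n - l)) v | v. v \<in> W (mdim M')}"
        if "v \<in> {app (?Y' ^ (n - l)) v | v. v \<in> W (mdim M')}" for c v
      proof -
        from that obtain v' where "v' \<in> W (mdim M')" "v = app (?Y' ^ (n - l)) v'"
          by (elim CollectE exE conjE)
        then show ?thesis by (intro CollectI exI[of _ "c *\<^sub>F v'"]) simp
      qed
      show "app (?Y' ^ (n - l)) (app (opM M' XGen ^ i) (app (?Y' ^ j) ?n)) \<in> {app (?Y' ^ (n - l)) v | v. v \<in> W (mdim M')}" for i j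
        by (intro CollectI exI conjI, rule refl) (intro opM_pow_W[OF M'] n; simp)
    qed
    then obtain n1 where n1: "n1 \<in> W (mdim M')" "?n = app (?Y' ^ (n - l)) n1" by blast
    then obtain m1' where m1': "m1' \<in> W (mdim M)" "n1 = f m1'" using f(2) by blast
    define m0 where "m0 = app (?Y ^ (n - l)) m1'"
    define m where "m = M.wproj (m1 \<nu>) (m2 \<nu>) m0"
    have m0: "m0 \<in> W (mdim M)" unfolding m0_def using opM_pow_W[OF M] m1' by simp
    have fm0: "f m0 = ?n" unfolding m0_def using ehom_opM_pow[OF M M' f(1) _ m1'(1)] m1' n1 by simp
    have Ym0: "app (?Y ^ l) m0 = 0"
      using app_pow_add[of ?Y l "n - l" m1'] l M.Y_pow by (simp add: m0_def)
    have mW: "m \<in> W (mdim M)" unfolding m_def by (rule wproj_W[OF M M0 m0])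
    have Ym: "app (?Y ^ l) m = 0" unfolding m_def by (rule M.Y_pow_wproj_0[OF Ym0])
    have wm: "wtM M \<nu> m"
      unfolding wtM_def m_def by (rule M.wt_wproj) (simp_all add: Lam_m1_mult[OF Nc(7)] Lam_m2_mult[OF Nc(7)] Lam_nz[OF Nc(7)])
    \<comment> \<open>Averaging commutes with f, and the image of p already has the weight in
      question.\<close>
    have "f m = M'.wproj (m1 \<nu>) (m2 \<nu>) (f m0)"
    proof -
      have "f (app (opM M (GrpGen g)) (app (opM M (ChrGen \<gamma>)) m0)) = app (opM M' (GrpGen g)) (app (opM M' (ChrGen \<gamma>)) (f m0))"
        if "g \<in> carrier G" "\<gamma> \<in> carrier (Gam D)" for g \<gamma>
        using that m0 opM_W[OF M, of "ChrGen \<gamma>" m0] by (simp add: ehom_opM[OF M M' f(1)])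
      then show ?thesis
        unfolding m_def M.wproj_def M'.wproj_def by (simp add: islin_sc[OF lf] islin_sum[OF lf] cong: sum.cong)
    qed
    also have "\<dots> = ?n"
      unfolding fm0 by (rule M'.wproj_id) (use wn Lam_nz[OF Nc(7)] in \<open>simp_all add: wtM_def\<close>)
    finally have fm: "f m = ?n" .
    obtain h where h: "ehom Alg N M h" "h p = m" using universal[OF N M M0 mW wm Ym] by blast
    have "f (h v) = g v" if "v \<in> W (mdim N)" for v
      by (rule hom_unique[OF N M' ehom_comp[OF f(1) h(1)] g _ that]) (simp add: h fm)
    with h show ?thesis by blast
  qed
qed

lemma app_kl:
  assumes A: "A \<in> carrier_mat d d" and ki: "k < d" "i < e" "k' < d"
    and c: "app (emb d A) (bv k) = c *\<^sub>F bv k'"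
  shows "app (kl d e A) (bv (k * e + i)) = c *\<^sub>F bv (k' * e + i)"
proof -
  have en: "A $$ (r, k) = (if r = k' then c else 0)" if "r < d" for r
  proof -
    have "lin A (bv k) = c *\<^sub>F bv k'" using c A ki by (simp add: app_emb_W)
    then have "ent (lin A (bv k)) r = ent (c *\<^sub>F bv k') r" by simp
    then show ?thesis using A ki that lin_bv[of r A k] by (auto simp: bv_def)
  qed
  have lt: "r * e + i < d * e" if "r < d" for r
  proof -
    have "r * e + i < Suc r * e" using ki by simp
    also have "\<dots> \<le> d * e" using that by (intro mult_right_mono) auto
    finally show ?thesis .
  qed
  show ?thesis
    unfolding kl_def
  proof (rule app_emb_bv[OF kron_carrier[OF A one_carrier_mat] lt[OF ki(1)] _ lt[OF ki(3)]])
    fix r assume r: "r < d * e"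
    note dm = div_mod_less[OF r]
    have "r = k' * e + i \<longleftrightarrow> r div e = k' \<and> r mod e = i"
    proof
      assume "r div e = k' \<and> r mod e = i"
      then show "r = k' * e + i" using div_mult_mod_eq[of r e] by simp
    qed (use ki in simp)
    then show "kron A (1\<^sub>m e) $$ (r, k * e + i) = (if r = k' * e + i then c else 0)"
      using kron_index[OF A one_carrier_mat r lt[OF ki(1)]] dm ki en[of "r div e"] by auto
  qed
qed

lemma app_kr:
  assumes A: "A \<in> carrier_mat e e" and ki: "k < d" "i < e" "i' < e"
    and c: "app (emb e A) (bv i) = c *\<^sub>F bv i'"
  shows "app (kr d e A) (bv (k * e + i)) = c *\<^sub>F bv (k * e + i')"
proof -
  have en: "A $$ (r, i) = (if r = i' then c else 0)" if "r < e" for r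
  proof -
    have "lin A (bv i) = c *\<^sub>F bv i'" using c A ki by (simp add: app_emb_W)
    then have "ent (lin A (bv i)) r = ent (c *\<^sub>F bv i') r" by simp
    then show ?thesis using A ki that lin_bv[of r A i] by (auto simp: bv_def)
  qed
  have lt: "k * e + j < d * e" if "j < e" for j
  proof -
    have "k * e + j < Suc k * e" using that by simp
    also have "\<dots> \<le> d * e" using ki by (intro mult_right_mono) auto
    finally show ?thesis .
  qed
  show ?thesis
    unfolding kr_def
  proof (rule app_emb_bv[OF kron_carrier[OF one_carrier_mat A] lt[OF ki(2)] _ lt[OF ki(3)]])
    fix r assume r: "r < d * e"
    note dm = div_mod_less[OF r]
    have "r = k * e + i' \<longleftrightarrow> r div e = k \<and> r mod e = i'"
    proof
      assume "r div e = k \<and> r mod e = i'"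
      then show "r = k * e + i'" using div_mult_mod_eq[of r e] by simp
    qed (use ki in simp)
    then show "kron (1\<^sub>m d) A $$ (r, k * e + i) = (if r = k * e + i' then c else 0)"
      using kron_index[OF one_carrier_mat A r lt[OF ki(2)]] dm ki en[of "r mod e"] by auto
  qed
qed

end


section \<open>Direct sums and direct summands in coordinates\<close>

definition Lo :: "nat \<Rightarrow> 'k::field fvec \<Rightarrow> 'k fvec" where
  "Lo m v = Fvec (\<lambda>i. if i < m then ent v i else 0)"

definition Hi :: "nat \<Rightarrow> 'k::field fvec \<Rightarrow> 'k fvec" where
  "Hi m v = Fvec (\<lambda>i. ent v (m + i))"

text \<open>The inclusion of the second block of a direct sum. The first block is included by the
  identity, as \<open>W m\<close> lies in \<open>W (m + k)\<close>.\<close>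

definition Up :: "nat \<Rightarrow> 'k::field fvec \<Rightarrow> 'k fvec" where
  "Up m v = Fvec (\<lambda>i. if i < m then 0 else ent v (i - m))"

lemma ent_blocks [simp]: "ent (Lo m v) i = (if i < m then ent v i else 0)" "ent (Hi m v) i = ent v (m + i)"
  "ent (Up m v) i = (if i < m then 0 else ent v (i - m))"
  by (simp_all add: Lo_def Hi_def Up_def)

lemma islin_blocks [simp]: "islin (Lo m)" "islin (Hi m)" "islin (Up m)"
  by (auto simp: islin_def fvec_eq_iff)

lemma blocks_W [simp]: "Lo m v \<in> W m" "v \<in> W (m + k) \<Longrightarrow> Hi m v \<in> W k" "v \<in> W k \<Longrightarrow> Up m v \<in> W (m + k)"
  by (auto simp: W_def)

lemma W_add [simp]: "v \<in> W m \<Longrightarrow> v \<in> W (m + k)"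
  by (simp add: W_def)

lemma blocks_simps [simp]:
  "Lo m (Up m v) = 0" "Hi m (Up m v) = v" "v \<in> W m \<Longrightarrow> Lo m v = v" "v \<in> W m \<Longrightarrow> Hi m v = 0"
  by (auto simp: fvec_eq_iff W_def)

lemma Lo_Hi: "Lo m v + Up m (Hi m v) = v"
  by (auto simp: fvec_eq_iff)

abbreviation block_diag :: "'k::field mat \<Rightarrow> 'k mat \<Rightarrow> 'k mat" where
  "block_diag A B \<equiv> four_block_mat A (0\<^sub>m (dim_row A) (dim_col B)) (0\<^sub>m (dim_row B) (dim_col A)) B"

lemma sum_lessThan_add: "(\<Sum>k<m + (d::nat). f k) = (\<Sum>k<m. f k) + (\<Sum>k<d. f (m + k))"
  for f :: "nat \<Rightarrow> 'a::comm_monoid_add"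
  by (induction d) (simp_all add: add.assoc)

lemma lin_block_diag:
  assumes "A \<in> carrier_mat m m" "B \<in> carrier_mat k k"
  shows "lin (block_diag A B) v = lin A (Lo m v) + Up m (lin B (Hi m v))"
  by (rule fvec_eqI) (use assms in \<open>auto simp: lin_def sum_lessThan_add\<close>)

definition dsum2 :: "('a, 'k::field) fdmod \<Rightarrow> ('a, 'k) fdmod \<Rightarrow> ('a, 'k) fdmod" where
  "dsum2 M N = \<lparr>mdim = mdim M + mdim N, mact = (\<lambda>x. block_diag (mact M x) (mact N x))\<rparr>"

text \<open>Splitting the last summand off the list matches the inductions below, which add the
  summand with the largest s at the end.\<close>

lemma fd_direct_sum_append: "fd_direct_sum (Ms @ [M]) = dsum2 (fd_direct_sum Ms) M"
  by (simp add: fd_direct_sum_def dsum2_def diag_block_mat_append Let_def del: diag_block_mat.simps)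

lemma fd_direct_sum_single: "fd_direct_sum [M] = M"
  by (simp add: fd_direct_sum_def del: diag_block_mat.simps)

lemma fd_moduleD:
  assumes "fd_module A M" "x \<in> carrier A"
  shows "y \<in> carrier A \<Longrightarrow> mact M (x \<otimes>\<^bsub>A\<^esub> y) = mact M x * mact M y"
    and "y \<in> carrier A \<Longrightarrow> mact M (x \<oplus>\<^bsub>A\<^esub> y) = mact M x + mact M y"
    and "mact M (c \<odot>\<^bsub>A\<^esub> x) = c \<cdot>\<^sub>m mact M x"
    and "mact M \<one>\<^bsub>A\<^esub> = 1\<^sub>m (mdim M)"
  using assms by (auto simp: fd_module_def ring_mat_simps Ring.ring_hom_def)

lemma fd_moduleI:
  assumes "\<And>x. x \<in> carrier A \<Longrightarrow> mact M x \<in> carrier_mat (mdim M) (mdim M)"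
    and "\<And>x y. x \<in> carrier A \<Longrightarrow> y \<in> carrier A \<Longrightarrow> mact M (x \<otimes>\<^bsub>A\<^esub> y) = mact M x * mact M y"
    and "\<And>x y. x \<in> carrier A \<Longrightarrow> y \<in> carrier A \<Longrightarrow> mact M (x \<oplus>\<^bsub>A\<^esub> y) = mact M x + mact M y"
    and "\<And>c x. x \<in> carrier A \<Longrightarrow> mact M (c \<odot>\<^bsub>A\<^esub> x) = c \<cdot>\<^sub>m mact M x"
    and "mact M \<one>\<^bsub>A\<^esub> = 1\<^sub>m (mdim M)"
  shows "fd_module A M"
  using assms by (auto simp: fd_module_def ring_mat_simps Ring.ring_hom_def)

lemma dsum2_module:
  assumes M: "fd_module A M" and N: "fd_module A N"
  shows "fd_module A (dsum2 M N)"
proof (rule fd_moduleI)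
  fix x y c assume x: "x \<in> carrier A"
  note cx = fd_act[OF M x] fd_act[OF N x]
  show "mact (dsum2 M N) x \<in> carrier_mat (mdim (dsum2 M N)) (mdim (dsum2 M N))"
    using cx by (simp add: dsum2_def)
  show "mact (dsum2 M N) (c \<odot>\<^bsub>A\<^esub> x) = c \<cdot>\<^sub>m mact (dsum2 M N) x"
    using cx by (simp add: dsum2_def fd_moduleD[OF M x] fd_moduleD[OF N x]) (rule eq_matI; auto)
  assume y: "y \<in> carrier A"
  note cy = fd_act[OF M y] fd_act[OF N y]
  show "mact (dsum2 M N) (x \<oplus>\<^bsub>A\<^esub> y) = mact (dsum2 M N) x + mact (dsum2 M N) y"
    using cx cy y by (simp add: dsum2_def fd_moduleD[OF M x] fd_moduleD[OF N x]) (rule eq_matI; auto)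
  show "mact (dsum2 M N) (x \<otimes>\<^bsub>A\<^esub> y) = mact (dsum2 M N) x * mact (dsum2 M N) y"
  proof (rule lin_inject)
    show "mact (dsum2 M N) (x \<otimes>\<^bsub>A\<^esub> y) \<in> carrier_mat (mdim M + mdim N) (mdim M + mdim N)"
      "mact (dsum2 M N) x * mact (dsum2 M N) y \<in> carrier_mat (mdim M + mdim N) (mdim M + mdim N)"
      using cx cy y by (auto simp: dsum2_def fd_moduleD[OF M x] fd_moduleD[OF N x])
    fix j
    have l: "lin (mact (dsum2 M N) z) v = lin (mact M z) (Lo (mdim M) v) + Up (mdim M) (lin (mact N z) (Hi (mdim M) v))"
      if "mact M z \<in> carrier_mat (mdim M) (mdim M)" "mact N z \<in> carrier_mat (mdim N) (mdim N)" for z v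
      using lin_block_diag[OF that] by (simp add: dsum2_def)
    have xy: "mact M (x \<otimes>\<^bsub>A\<^esub> y) \<in> carrier_mat (mdim M) (mdim M)" "mact N (x \<otimes>\<^bsub>A\<^esub> y) \<in> carrier_mat (mdim N) (mdim N)"
      using cx cy y by (simp_all add: fd_moduleD[OF M x] fd_moduleD[OF N x] mult_carrier_mat)
    have lW: "lin (mact M y) v \<in> W (mdim M)" "lin (mact N y) v \<in> W (mdim N)" for v using cy by auto
    have lm: "lin (mact M x * mact M y) v = lin (mact M x) (lin (mact M y) v)"
      "lin (mact N x * mact N y) v = lin (mact N x) (lin (mact N y) v)" for v
      using cx cy by (simp_all add: lin_mult)
    have "lin (mact (dsum2 M N) x * mact (dsum2 M N) y) (bv j) =
        lin (mact (dsum2 M N) x) (lin (mact (dsum2 M N) y) (bv j))"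
      by (rule lin_mult) (use cx cy in \<open>simp add: dsum2_def\<close>)
    then show "lin (mact (dsum2 M N) (x \<otimes>\<^bsub>A\<^esub> y)) (bv j) = lin (mact (dsum2 M N) x * mact (dsum2 M N) y) (bv j)"
      by (simp add: l[OF cx] l[OF cy] l[OF xy] fd_moduleD[OF M x] fd_moduleD[OF N x] y lm lW
          islin_add[OF islin_blocks(1)] islin_add[OF islin_blocks(2)])
  qed
next
  show "mact (dsum2 M N) \<one>\<^bsub>A\<^esub> = 1\<^sub>m (mdim (dsum2 M N))"
    using assms by (auto simp: dsum2_def fd_module_def ring_mat_simps Ring.ring_hom_def)
qed

lemma ehom_add: "ehom A M N s \<Longrightarrow> ehom A M N t \<Longrightarrow> ehom A M N (\<lambda>v. s v + t v)"
  unfolding ehom_def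
  by (auto simp: islin_def islin_add[OF islin_lin] algebra_simps)

lemma dsum2_ehoms:
  assumes M: "fd_module A M" and N: "fd_module A N"
  shows "ehom A M (dsum2 M N) (\<lambda>v. v)" "ehom A N (dsum2 M N) (Up (mdim M))"
    "ehom A (dsum2 M N) M (Lo (mdim M))" "ehom A (dsum2 M N) N (Hi (mdim M))"
proof -
  have l: "lin (mact (dsum2 M N) x) v = lin (mact M x) (Lo (mdim M) v) + Up (mdim M) (lin (mact N x) (Hi (mdim M) v))"
    "lin (mact M x) u \<in> W (mdim M)"
    if "x \<in> carrier A" for x u v
    using lin_block_diag[OF fd_act[OF M that] fd_act[OF N that], of v] fd_act[OF M that] by (auto simp: dsum2_def)
  have d: "mdim (dsum2 M N) = mdim M + mdim N" by (simp add: dsum2_def)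
  note s = islin_0[OF islin_lin] islin_0[OF islin_blocks(3)] islin_add[OF islin_blocks(1)] islin_add[OF islin_blocks(2)]
  show "ehom A M (dsum2 M N) (\<lambda>v. v)" "ehom A N (dsum2 M N) (Up (mdim M))"
    "ehom A (dsum2 M N) M (Lo (mdim M))" "ehom A (dsum2 M N) N (Hi (mdim M))"
    by (simp_all add: ehom_def d l s) (simp add: islin_def)
qed

lemma fd_iso_dsum2:
  fixes A :: "('k::field_char_0, 'a, 'm) module_scheme"
  assumes N: "fd_module A N"
    and j: "ehom A N1 N j" and r: "ehom A N N1 r" and i: "ehom A N2 N i" and p: "ehom A N N2 p"
    and rj: "\<And>v. v \<in> W (mdim N1) \<Longrightarrow> r (j v) = v" and pi: "\<And>v. v \<in> W (mdim N2) \<Longrightarrow> p (i v) = v"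
    and ri: "\<And>v. v \<in> W (mdim N2) \<Longrightarrow> r (i v) = 0" and pj: "\<And>v. v \<in> W (mdim N1) \<Longrightarrow> p (j v) = 0"
    and id: "\<And>v. v \<in> W (mdim N) \<Longrightarrow> j (r v) + i (p v) = v"
    and iso: "fd_iso A N1 M1" "fd_iso A N2 M2"
  shows "fd_iso A N (dsum2 M1 M2)"
proof -
  from iso have M: "fd_module A M1" "fd_module A M2" by (auto simp: fd_iso_def)
  obtain t1 s1 where 1: "ehom A N1 M1 t1" "ehom A M1 N1 s1" "\<And>v. v \<in> W (mdim N1) \<Longrightarrow> s1 (t1 v) = v"
      "\<And>v. v \<in> W (mdim M1) \<Longrightarrow> t1 (s1 v) = v" using fd_isoE[OF iso(1)] by blast
  obtain t2 s2 where 2: "ehom A N2 M2 t2" "ehom A M2 N2 s2" "\<And>v. v \<in> W (mdim N2) \<Longrightarrow> s2 (t2 v) = v"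
      "\<And>v. v \<in> W (mdim M2) \<Longrightarrow> t2 (s2 v) = v" using fd_isoE[OF iso(2)] by blast
  note d = dsum2_ehoms[OF M]
  note lins = ehom_islin[OF j] ehom_islin[OF r] ehom_islin[OF i] ehom_islin[OF p]
    ehom_islin[OF 1(1)] ehom_islin[OF 1(2)] ehom_islin[OF 2(1)] ehom_islin[OF 2(2)]
  note Ws = ehom_W[OF j] ehom_W[OF r] ehom_W[OF i] ehom_W[OF p]
    ehom_W[OF 1(1)] ehom_W[OF 1(2)] ehom_W[OF 2(1)] ehom_W[OF 2(2)]
  let ?t = "\<lambda>v. t1 (r v) + Up (mdim M1) (t2 (p v))"
  let ?s = "\<lambda>w. j (s1 (Lo (mdim M1) w)) + i (s2 (Hi (mdim M1) w))"
  note bl = islin_add[OF islin_blocks(1)] islin_add[OF islin_blocks(2)]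
  show ?thesis
  proof (rule fd_isoI[OF N dsum2_module[OF M], of ?t ?s])
    show "ehom A N (dsum2 M1 M2) ?t"
      by (rule ehom_add[OF ehom_comp[OF d(1) ehom_comp[OF 1(1) r]] ehom_comp[OF d(2) ehom_comp[OF 2(1) p]]])
    show "ehom A (dsum2 M1 M2) N ?s"
      by (rule ehom_add[OF ehom_comp[OF j ehom_comp[OF 1(2) d(3)]] ehom_comp[OF i ehom_comp[OF 2(2) d(4)]]])
    show "?s (?t v) = v" if "v \<in> W (mdim N)" for v
      using that by (simp add: bl Ws 1(3) 2(3) id)
    show "?t (?s w) = w" if "w \<in> W (mdim (dsum2 M1 M2))" for w
    proof -
      have "Hi (mdim M1) w \<in> W (mdim M2)" using that by (simp add: dsum2_def)
      then show ?thesis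
        by (simp add: Ws rj pi ri pj 1(4) 2(4) Lo_Hi islin_add[OF lins(2)] islin_add[OF lins(4)])
    qed
  qed
qed

lemma fd_iso_mdim:
  fixes A :: "('k::field, 'a, 'm) module_scheme"
  shows "fd_iso A M N \<Longrightarrow> mdim M = mdim N"
  by (auto simp: fd_iso_def fd_hom_def invertible_mat_def)

lemma fd_iso_refl:
  fixes A :: "('k::field_char_0, 'a, 'm) module_scheme"
  shows "fd_module A M \<Longrightarrow> fd_iso A M M"
  by (rule fd_isoI[of A M M "\<lambda>v. v" "\<lambda>v. v"]) (simp_all add: ehom_id)

text \<open>If U is not contained in \<open>W d\<close>, a vector u of U with last coordinate 1
  serves as the new last basis vector, and subtracting multiples of u leads back to
  \<open>W d\<close>.\<close>

lemma subspace_coordinates: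
  fixes U :: "'k::field fvec set"
  assumes "U \<subseteq> W d" "0 \<in> U" "\<And>u v. u \<in> U \<Longrightarrow> v \<in> U \<Longrightarrow> u + v \<in> U" "\<And>c u. u \<in> U \<Longrightarrow> c *\<^sub>F u \<in> U"
  shows "\<exists>m i p. islin i \<and> islin p \<and> (\<forall>w\<in>W m. i w \<in> U \<and> p (i w) = w) \<and> (\<forall>v. p v \<in> W m) \<and> (\<forall>u\<in>U. i (p u) = u)"
  using assms
proof (induction d arbitrary: U)
  case 0
  have z: "u = 0" if "u \<in> U" for u
    using that 0(1) by (auto simp: W_def fvec_eq_iff)
  show ?case
    by (rule exI[of _ 0], rule exI[of _ "\<lambda>_. 0"], rule exI[of _ "\<lambda>_. 0"])
      (use z 0(2) in \<open>auto simp: islin_def W_def fvec_eq_iff\<close>)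
next
  case (Suc d)
  have "\<exists>m i p. islin i \<and> islin p \<and> (\<forall>w\<in>W m. i w \<in> U \<inter> W d \<and> p (i w) = w) \<and> (\<forall>v. p v \<in> W m) \<and> (\<forall>u\<in>U \<inter> W d. i (p u) = u)"
    by (rule Suc.IH) (use Suc.prems in auto)
  then obtain m i p where ip: "islin i" "islin p" "\<And>w. w \<in> W m \<Longrightarrow> i w \<in> U" "\<And>w. w \<in> W m \<Longrightarrow> i w \<in> W d"
      "\<And>w. w \<in> W m \<Longrightarrow> p (i w) = w" "\<And>v. p v \<in> W m" "\<And>u. u \<in> U \<Longrightarrow> u \<in> W d \<Longrightarrow> i (p u) = u" by blast
  show ?case
  proof (cases "U \<subseteq> W d")
    case True
    then show ?thesis using ip by blast
  next
    case False
    then obtain u' where u': "u' \<in> U" "u' \<notin> W d" by blast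
    have "ent u' i = 0" if "d < i" for i using u'(1) Suc.prems(1) that by (auto simp: W_def)
    then have nz: "ent u' d \<noteq> 0" using u'(2) unfolding W_def by (auto simp: le_less)
    define u where "u = inverse (ent u' d) *\<^sub>F u'"
    have u: "u \<in> U" "ent u d = 1" using u' nz Suc.prems(4) by (simp_all add: u_def)
    let ?i = "\<lambda>w. i (Lo m w) + ent w m *\<^sub>F u" and ?p = "\<lambda>v. p (v - ent v d *\<^sub>F u) + ent v d *\<^sub>F bv m"
    have sub: "v - ent v d *\<^sub>F u \<in> U \<and> v - ent v d *\<^sub>F u \<in> W d" if v: "v \<in> U" for v
    proof
      have "v + (- ent v d) *\<^sub>F u \<in> U" by (rule Suc.prems(3)[OF v Suc.prems(4)[OF u(1)]])
      then show m: "v - ent v d *\<^sub>F u \<in> U" by (simp add: sc_minus_left)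
      then have Wd: "v - ent v d *\<^sub>F u \<in> W (Suc d)" using Suc.prems(1) by blast
      have "ent (v - ent v d *\<^sub>F u) k = 0" if "d \<le> k" for k
      proof (cases "k = d")
        case False
        then have "Suc d \<le> k" using that by simp
        then show ?thesis using Wd unfolding W_def by blast
      qed (simp add: u(2))
      then show "v - ent v d *\<^sub>F u \<in> W d" unfolding W_def by blast
    qed
    show ?thesis
    proof (rule exI[of _ "Suc m"], rule exI[of _ ?i], rule exI[of _ ?p], intro conjI ballI allI)
      show "islin ?i"
        by (rule islinI) (simp_all add: islin_add[OF ip(1)] islin_sc[OF ip(1)] islin_add[OF islin_blocks(1)]
          islin_sc[OF islin_blocks(1)] sc_add_left)
      have "u1 + u2 - ent (u1 + u2) d *\<^sub>F u = (u1 - ent u1 d *\<^sub>F u) + (u2 - ent u2 d *\<^sub>F u)"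
        "c *\<^sub>F u1 - ent (c *\<^sub>F u1) d *\<^sub>F u = c *\<^sub>F (u1 - ent u1 d *\<^sub>F u)" for u1 u2 c
        by (simp_all add: fvec_eq_iff algebra_simps)
      note c = this
      show "islin ?p"
      proof (rule islinI)
        show "?p (v1 + v2) = ?p v1 + ?p v2" for v1 v2
          unfolding c(1) islin_add[OF ip(2)] by (simp add: sc_add_left)
        show "?p (b *\<^sub>F v1) = b *\<^sub>F ?p v1" for b v1
          unfolding c(2) islin_sc[OF ip(2)] by simp
      qed
      fix w :: "'k fvec" assume w: "w \<in> W (Suc m)"
      show "?i w \<in> U" using ip(3)[of "Lo m w"] Suc.prems(3,4) u(1) by simp
      have "ent (i (Lo m w)) d = 0" using ip(4)[of "Lo m w"] by (simp add: W_def)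
      then have "?p (?i w) = Lo m w + ent w m *\<^sub>F bv m" using ip(5)[of "Lo m w"] u(2) by simp
      also have "\<dots> = w"
      proof (rule fvec_eqI)
        fix k
        have "ent w k = 0" if "m < k" using w that by (simp add: W_def)
        then show "ent (Lo m w + ent w m *\<^sub>F bv m) k = ent w k"
          by (cases k m rule: linorder_cases) (simp_all add: bv_def)
      qed
      finally show "?p (?i w) = w" .
    next
      fix v :: "'k fvec"
      show "?p v \<in> W (Suc m)" using ip(6)[of "v - ent v d *\<^sub>F u"] by (simp add: W_def bv_def)
    next
      fix v assume v: "v \<in> U"
      let ?v = "v - ent v d *\<^sub>F u"
      have "Lo m (?p v) = p ?v" "ent (?p v) m = ent v d"
        using ip(6)[of ?v] by (auto simp: fvec_eq_iff W_def bv_def)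
      then show "?i (?p v) = v" using ip(7)[of ?v] sub[OF v] by simp
    qed
  qed
qed

text \<open>A submodule is a set of vectors, while a module lives on some \<open>W m\<close>;
  coordinates transport the action from one to the other.\<close>

lemma esub_module:
  fixes A :: "('k::field, 'a, 'm) module_scheme"
  assumes N: "fd_module A N" and U: "esub A N U"
  shows "\<exists>P i p. fd_module A P \<and> ehom A P N i \<and> islin p \<and> (\<forall>w\<in>W (mdim P). i w \<in> U \<and> p (i w) = w) \<and>
    (\<forall>v. p v \<in> W (mdim P)) \<and> (\<forall>u\<in>U. i (p u) = u) \<and>
    (\<forall>x\<in>carrier A. \<forall>u\<in>U. p (lin (mact N x) u) = lin (mact P x) (p u))"
proof -
  from U have "\<exists>m i p. islin i \<and> islin p \<and> (\<forall>w\<in>W m. i w \<in> U \<and> p (i w) = w) \<and> (\<forall>v. p v \<in> W m) \<and> (\<forall>u\<in>U. i (p u) = u)"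
    by (intro subspace_coordinates) (auto simp: esub_def)
  then obtain m i p where ip: "islin i" "islin p" "\<And>w. w \<in> W m \<Longrightarrow> i w \<in> U" "\<And>w. w \<in> W m \<Longrightarrow> p (i w) = w"
      "\<And>v. p v \<in> W m" "\<And>u. u \<in> U \<Longrightarrow> i (p u) = u" by blast
  define P where "P = \<lparr>mdim = m, mact = (\<lambda>x. mat_of m m (\<lambda>w. p (lin (mact N x) (i w))))\<rparr>"
  have l: "lin (mact P x) w = p (lin (mact N x) (i w))" if "w \<in> W m" for x w
    unfolding P_def using that
    by (simp add: lin_mat_of islin_comp[OF ip(2)] islin_comp[OF islin_lin] ip)
  have xU: "lin (mact N x) u \<in> U" if "x \<in> carrier A" "u \<in> U" for x u using U that by (simp add: esub_def)
  have UN: "u \<in> W (mdim N)" if "u \<in> U" for u using U that by (auto simp: esub_def)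
  have iW: "i w \<in> W (mdim N)" if "w \<in> W m" for w using UN ip(3) that by blast
  have c: "mact P x \<in> carrier_mat m m" for x by (simp add: P_def)
  have P: "fd_module A P"
  proof (rule fd_moduleI)
    show "mact P x \<in> carrier_mat (mdim P) (mdim P)" for x by (simp add: P_def)
    show "mact P (k \<odot>\<^bsub>A\<^esub> x) = k \<cdot>\<^sub>m mact P x" if x: "x \<in> carrier A" for k x
    proof (rule lin_inject[OF c smult_carrier_mat[OF c]])
      fix j assume j: "j < m"
      have "lin (k \<cdot>\<^sub>m T) v = k *\<^sub>F lin T v" for T :: "'k mat" and v
        by (auto simp: fvec_eq_iff lin_def sum_distrib_left mult.assoc)
      then show "lin (mact P (k \<odot>\<^bsub>A\<^esub> x)) (bv j) = lin (k \<cdot>\<^sub>m mact P x) (bv j)"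
        using j by (simp add: l fd_moduleD[OF N x] islin_sc[OF ip(2)])
    qed
    show "mact P (x \<oplus>\<^bsub>A\<^esub> y) = mact P x + mact P y" if x: "x \<in> carrier A" and y: "y \<in> carrier A" for x y
    proof (rule lin_inject[OF c add_carrier_mat[OF c]])
      fix j assume j: "j < m"
      have add: "lin (S + T) v = lin S v + lin T v" if "S \<in> carrier_mat q q" "T \<in> carrier_mat q q" for S T :: "'k mat" and v q
        using that by (auto simp: fvec_eq_iff lin_def sum.distrib distrib_right)
      show "lin (mact P (x \<oplus>\<^bsub>A\<^esub> y)) (bv j) = lin (mact P x + mact P y) (bv j)"
        using j by (simp add: l fd_moduleD[OF N x] y islin_add[OF ip(2)] add[OF c c] add[OF fd_act[OF N x] fd_act[OF N y]])
    qed
    show "mact P (x \<otimes>\<^bsub>A\<^esub> y) = mact P x * mact P y" if x: "x \<in> carrier A" and y: "y \<in> carrier A" for x y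
    proof (rule lin_inject[OF c mult_carrier_mat[OF c c]])
      fix j assume j: "j < m"
      have "lin (mact P x * mact P y) (bv j) = lin (mact P x) (lin (mact P y) (bv j))"
        by (rule lin_mult) (simp add: P_def)
      then show "lin (mact P (x \<otimes>\<^bsub>A\<^esub> y)) (bv j) = lin (mact P x * mact P y) (bv j)"
        using j fd_act[OF N x] fd_act[OF N y] xU[OF y ip(3), of "bv j"]
        by (simp add: l ip(5,6) fd_moduleD[OF N x] y lin_mult)
    qed
    show "mact P \<one>\<^bsub>A\<^esub> = 1\<^sub>m (mdim P)"
    proof (rule lin_inject[OF c])
      show "1\<^sub>m (mdim P) \<in> carrier_mat m m" by (simp add: P_def)
      have one: "mact N \<one>\<^bsub>A\<^esub> = 1\<^sub>m (mdim N)" using N by (simp add: fd_module_def ring_mat_simps Ring.ring_hom_def)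
      show "j < m \<Longrightarrow> lin (mact P \<one>\<^bsub>A\<^esub>) (bv j) = lin (1\<^sub>m (mdim P)) (bv j)" for j
        using iW[of "bv j"] ip(4)[of "bv j"] by (simp add: l one lin_one) (simp add: P_def lin_one)
    qed
  qed
  have Pm: "mdim P = m" by (simp add: P_def)
  have e: "ehom A P N i"
    unfolding ehom_def Pm using ip(1) iW by (auto simp: l ip(6) xU ip(3))
  have q: "\<forall>x\<in>carrier A. \<forall>u\<in>U. p (lin (mact N x) u) = lin (mact P x) (p u)"
    by (simp add: l ip(5,6))
  show ?thesis
    by (rule exI[of _ P], rule exI[of _ i], rule exI[of _ p]) (intro conjI P e q, simp_all add: Pm ip)
qed

text \<open>The complement is the image of the idempotent 1 - j r, described as its set of fixed
  vectors and then put in coordinates.\<close>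

lemma split_summand:
  fixes A :: "('k::field_char_0, 'a, 'm) module_scheme"
  assumes N: "fd_module A N" and N': "fd_module A N'" and j: "ehom A N' N j" and r: "ehom A N N' r"
    and rj: "\<And>v. v \<in> W (mdim N') \<Longrightarrow> r (j v) = v"
  obtains P i p where "fd_module A P" "ehom A P N i" "ehom A N P p"
    "\<And>w. w \<in> W (mdim P) \<Longrightarrow> p (i w) = w" "\<And>v. v \<in> W (mdim N) \<Longrightarrow> i (p v) = v - j (r v)"
    "\<And>v. v \<in> W (mdim N') \<Longrightarrow> p (j v) = 0" "mdim N = mdim N' + mdim P"
    "\<And>M1 M2. fd_iso A N' M1 \<Longrightarrow> fd_iso A P M2 \<Longrightarrow> fd_iso A N (dsum2 M1 M2)"
proof -
  define e where "e v = v - j (r v)" for v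
  have e: "ehom A N N e" unfolding e_def by (rule ehom_diff[OF ehom_id[OF N] ehom_comp[OF j r]])
  note le = ehom_islin[OF e] and lr = ehom_islin[OF r] and lj = ehom_islin[OF j]
  have re: "r (e v) = 0" if "v \<in> W (mdim N)" for v
    using that by (simp add: e_def islin_diff[OF lr] rj ehom_W[OF r])
  have ee: "e (e v) = e v" if "v \<in> W (mdim N)" for v
    using re[OF that] by (simp add: e_def[of "e v"] islin_0[OF lj])
  have ej: "e (j v) = 0" if "v \<in> W (mdim N')" for v using that by (simp add: e_def rj)
  let ?U = "{u \<in> W (mdim N). e u = u}"
  have "esub A N ?U"
  proof -
    have "lin (mact N x) u \<in> W (mdim N)" if "x \<in> carrier A" for x u using fd_act[OF N that] by auto
    then show ?thesis
      unfolding esub_def using ehom_act[OF e] by (auto simp: islin_add[OF le] islin_sc[OF le] islin_0[OF le])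
  qed
  from esub_module[OF N this] obtain P i p where P: "fd_module A P" "ehom A P N i" "islin p"
      "\<And>w. w \<in> W (mdim P) \<Longrightarrow> i w \<in> ?U" "\<And>w. w \<in> W (mdim P) \<Longrightarrow> p (i w) = w" "\<And>v. p v \<in> W (mdim P)"
      "\<And>u. u \<in> ?U \<Longrightarrow> i (p u) = u"
      "\<And>x u. x \<in> carrier A \<Longrightarrow> u \<in> ?U \<Longrightarrow> p (lin (mact N x) u) = lin (mact P x) (p u)" by blast
  have eU: "e v \<in> ?U" if "v \<in> W (mdim N)" for v using that ee ehom_W[OF e] by simp
  have pe: "ehom A N P (\<lambda>v. p (e v))"
    unfolding ehom_def using islin_comp[OF P(3) le] P(6) P(8)[OF _ eU] by (simp add: ehom_act[OF e])
  have pi: "p (e (i w)) = w" if "w \<in> W (mdim P)" for w using P(4,5)[OF that] by simp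
  have ip: "i (p (e v)) = v - j (r v)" if "v \<in> W (mdim N)" for v using P(7)[OF eU[OF that]] by (simp add: e_def)
  have pj: "p (e (j v)) = 0" if "v \<in> W (mdim N')" for v using ej[OF that] islin_0[OF P(3)] by simp
  have ri: "r (i w) = 0" if "w \<in> W (mdim P)" for w using P(4)[OF that] re[of "i w"] by simp
  have iso: "fd_iso A N (dsum2 M1 M2)" if "fd_iso A N' M1" "fd_iso A P M2" for M1 M2
    by (rule fd_iso_dsum2[OF N j r P(2) pe rj pi ri pj _ that]) (simp_all add: ip)
  have "mdim N = mdim N' + mdim P"
    using fd_iso_mdim[OF iso[OF fd_iso_refl[OF N'] fd_iso_refl[OF P(1)]]] by (simp add: dsum2_def)
  then show thesis using that[OF P(1,2) pe pi ip pj _ iso] by blast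
qed

lemma fd_projective_summand:
  fixes A :: "('k::field, 'a, 'm) module_scheme"
  assumes N: "fd_projective A N" and P: "fd_module A P" and i: "ehom A P N i" and p: "ehom A N P p"
    and pi: "\<And>w. w \<in> W (mdim P) \<Longrightarrow> p (i w) = w"
  shows "fd_projective A P"
proof (rule fd_projectiveI[OF P])
  fix M M' f g
  assume M: "fd_module A M" "fd_module A M'" and f: "ehom A M M' f" "f ` W (mdim M) = W (mdim M')" and g: "ehom A P M' g"
  obtain h where h: "ehom A N M h" "\<forall>v\<in>W (mdim N). f (h v) = g (p v)"
    using fd_projectiveD[OF N M f ehom_comp[OF g p]] by blast
  have "f (h (i w)) = g w" if "w \<in> W (mdim P)" for w using h(2) ehom_W[OF i that] pi[OF that] by simp
  with ehom_comp[OF h(1) i] show "\<exists>h. ehom A P M h \<and> (\<forall>v\<in>W (mdim P). f (h v) = g v)" by blast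
qed


declare simple_gen.simps [simp del]

section \<open>Tensor products are universal modules\<close>

context gdatum
begin

text \<open>At length n the assumption of the lemmas on simple modules that speaks of l < n becomes
  vacuous; these rules remove it.\<close>

lemmas top = less_irrefl False_implies_equals True_implies_equals

lemma rho_diff_neq: "i < j \<Longrightarrow> j < n \<Longrightarrow> \<rho> ^ (j - i) \<noteq> 1"
  by (rule rho_pow_neq) linarith+

lemma wtM_iff:
  assumes "fd_module Alg M" "0 < mdim M"
  shows "wtM M \<nu> v \<longleftrightarrow> (\<forall>g\<in>carrier G. app (opM M (GrpGen g)) v = m1 \<nu> g *\<^sub>F v) \<and>
    (\<forall>\<gamma>\<in>carrier (Gam D). app (opM M (ChrGen \<gamma>)) v = m2 \<nu> \<gamma> *\<^sub>F v)"
  unfolding wtM_def by (rule double_ops.wt_def[OF ops_opM[OF assms]])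

lemma sp_induct_reduced:
  assumes v: "v \<in> spXY M l p" and Q: "Q 0" "\<And>u v. Q u \<Longrightarrow> Q v \<Longrightarrow> Q (u + v)" "\<And>c v. Q v \<Longrightarrow> Q (c *\<^sub>F v)"
    and XY: "\<And>i j. i < n \<Longrightarrow> j < l \<Longrightarrow> Q (XY M p i j)" and l: "0 < l"
  shows "Q v"
proof -
  obtain c where v: "v = (\<Sum>k<n * l. c k *\<^sub>F XY M p (k div l) (k mod l))" using v by (auto simp: spXY_def)
  have "Q (\<Sum>k\<in>K. c k *\<^sub>F XY M p (k div l) (k mod l))" if "finite K" "K \<subseteq> {..<n * l}" for K
    using that by (induction K) (simp_all add: Q XY l less_mult_imp_div_less)
  then show ?thesis by (simp add: v)
qed

lemma sp_sum:
  assumes M: "fd_module Alg M" "0 < mdim M" "0 < l" "wtM M \<nu> p" "app (opM M XiGen ^ l) p = 0"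
    and bv: "\<And>j. j < mdim M \<Longrightarrow> bv j \<in> spXY M l p"
  shows "W (mdim M) \<subseteq> spXY M l p"
proof
  fix v :: "'k fvec" assume v: "v \<in> W (mdim M)"
  have "(\<Sum>j\<in>J. ent v j *\<^sub>F bv j) \<in> spXY M l p" if "finite J" "J \<subseteq> {..<mdim M}" for J
    using that by (induction J) (simp_all add: sp_closed[OF M] bv)
  from this[of "{..<mdim M}"] show "v \<in> spXY M l p" using W_expand[OF v] by simp
qed

lemma cyc_iso:
  assumes N: "cyc N l \<nu> p" and M: "cyc M l \<nu> q"
  shows "fd_iso Alg N M"
proof -
  note Nc = cycD[OF N] and Mc = cycD[OF M]
  obtain t where t: "ehom Alg N M t" "t p = q" using universal[OF N Mc(1,2,6,4,5)] by blast
  obtain s where s: "ehom Alg M N s" "s q = p" using universal[OF M Nc(1,2,6,4,5)] by blast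
  show ?thesis
  proof (rule fd_isoI[OF Nc(1) Mc(1) t(1) s(1)])
    show "v \<in> W (mdim N) \<Longrightarrow> s (t v) = v" for v
      by (rule hom_unique[OF N Nc(1) ehom_comp[OF s(1) t(1)] ehom_id[OF Nc(1)]]) (simp_all add: t s)
    show "v \<in> W (mdim M) \<Longrightarrow> t (s v) = v" for v
      by (rule hom_unique[OF M Mc(1) ehom_comp[OF t(1) s(1)] ehom_id[OF Mc(1)]]) (simp_all add: t s)
  qed
qed

lemma ehom_XY:
  assumes "fd_module Alg N" "fd_module Alg M" "ehom Alg N M t" "p \<in> W (mdim N)"
  shows "t (XY N p i j) = XY M (t p) i j"
  unfolding XY_def using ehom_opM_pow[OF assms(1-3)] opM_pow_W[OF assms(1)] assms(4) by simp

lemma ehom_generator: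
  assumes N: "cyc N l \<nu> p" and M: "fd_module Alg M" "0 < mdim M" and t: "ehom Alg N M t"
  shows "t p \<in> W (mdim M)" "wtM M \<nu> (t p)" "app (opM M XiGen ^ l) (t p) = 0"
    and "(\<And>w. w \<in> W (mdim M) \<Longrightarrow> \<exists>v\<in>W (mdim N). t v = w) \<Longrightarrow> W (mdim M) \<subseteq> spXY M l (t p)"
proof -
  note Nc = cycD[OF N]
  show "t p \<in> W (mdim M)" by (rule ehom_W[OF t Nc(6)])
  show w: "wtM M \<nu> (t p)" by (rule wtM_ehom[OF Nc(1) M(1) Nc(2) M(2) t Nc(6,4)])
  show Y: "app (opM M XiGen ^ l) (t p) = 0"
    using ehom_opM_pow[OF Nc(1) M(1) t _ Nc(6), of XiGen l] Nc(5) islin_0[OF ehom_islin[OF t]] by simp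
  assume s: "\<And>w. w \<in> W (mdim M) \<Longrightarrow> \<exists>v\<in>W (mdim N). t v = w"
  note sp = sp_closed[OF M Nc(3) w Y] sp_XY[OF M Nc(3) w Y]
  have "t v \<in> spXY M l (t p)" if "v \<in> W (mdim N)" for v
  proof -
    have "v \<in> spXY N l p" using Nc(8) that by blast
    then show ?thesis
      by (rule sp_induct[OF Nc(1-5)])
        (simp_all add: islin_simps[OF ehom_islin[OF t]] sp ehom_XY[OF Nc(1) M(1) t Nc(6)])
  qed
  then show "W (mdim M) \<subseteq> spXY M l (t p)" using s by blast
qed

text \<open>In length 1 the relation is \<xi> v_0 = 0, and v_i = x^i v_0 for i < n.\<close>

lemma cyc_simple:
  assumes \<nu>: "\<nu> \<in> carrier (Lam D)"
  shows "cyc (simple_module D n \<nu>) 1 \<nu> (bv 0)"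
proof -
  let ?V = "simple_module D n \<nu>"
  have c: "1 \<le> n" "n \<le> n" using n_ge2 by auto
  note V = simple_module[OF \<nu> c, simplified top] and op = simple_module_op[OF \<nu> c, simplified top]
  have d: "0 < mdim ?V" using c by simp
  have w: "wtM ?V \<nu> (bv 0)"
    unfolding wtM_iff[OF V d] using c by (auto simp: op sg_go[OF \<nu> c, simplified top] sg_co[OF \<nu> c, simplified top])
  have Y: "app (opM ?V XiGen ^ 1) (bv 0) = 0" by (simp add: op sg_Y_0[OF \<nu> c, simplified top])
  have "W (mdim ?V) \<subseteq> spXY ?V 1 (bv 0)"
  proof (rule sp_sum[OF V d _ w Y])
    fix j assume "j < mdim ?V"
    then have "XY ?V (bv 0) j 0 = bv j" using sg_X_pow[OF \<nu> c, simplified top, of 0 j] by (simp add: XY_def op)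
    then show "bv j \<in> spXY ?V 1 (bv 0)" using sp_XY[OF V d _ w Y, of j 0] by simp
  qed simp
  then show ?thesis using V \<nu> w Y d c by (simp add: cyc_def)
qed

text \<open>Since \<xi> w_0 = 0, on v_k \<otimes> w_0 the element \<xi> acts through the left factor
  and the correction in \<Delta>(\<gamma>) vanishes. For the span, \<xi> leads from the generator to
  every v_k \<otimes> w_0 with nonzero scalars, and x then raises the index of w_i modulo vectors
  with larger k.\<close>

lemma cyc_tensor:
  assumes l: "1 \<le> l" "l < n" and \<mu>: "\<mu> \<in> Il D l" and \<mu>': "\<mu>' \<in> carrier (Lam D)"
  shows "cyc (tensor_module D (simple_module D l \<mu>) (simple_module D n \<mu>')) l
    (phi D [^]\<^bsub>Lam D\<^esub> (l - 1) \<otimes>\<^bsub>Lam D\<^esub> \<mu> \<otimes>\<^bsub>Lam D\<^esub> \<mu>') (bv ((l - 1) * n))"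
proof -
  let ?M = "simple_module D l \<mu>" and ?K = "simple_module D n \<mu>'"
  let ?T = "tensor_module D ?M ?K" and ?\<nu> = "phi D [^]\<^bsub>Lam D\<^esub> (l - 1) \<otimes>\<^bsub>Lam D\<^esub> \<mu> \<otimes>\<^bsub>Lam D\<^esub> \<mu>'"
  let ?p = "bv ((l - 1) * n)"
  have \<mu>L: "\<mu> \<in> carrier (Lam D)" using \<mu> by (simp add: Il_def)
  have cM: "1 \<le> l" "l \<le> n" "\<mu> \<in> Il D l" using l \<mu> by auto
  have cK: "1 \<le> n" "n \<le> n" using n_ge2 by auto
  note M = simple_module[OF \<mu>L cM] and Mop = simple_module_op[OF \<mu>L cM]
  note K = simple_module[OF \<mu>' cK, simplified top] and Kop = simple_module_op[OF \<mu>' cK, simplified top]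
  define L where "L s = kl l n (mact ?M (cl (gen s)))" for s
  define R where "R s = kr l n (mact ?K (cl (gen s)))" for s
  have L: "app (L s) (bv (k * n + i)) = c *\<^sub>F bv (k' * n + i)"
    if "s \<in> dgens D" "app (emb l (simple_gen D l \<mu> s)) (bv k) = c *\<^sub>F bv k'" "k < l" "i < n" "k' < l" for s k i c k'
    unfolding L_def
    by (rule app_kl) (use that fd_act[OF M cl_gen_in[OF that(1)]] Mop[OF that(1)] in \<open>auto simp: opM_def\<close>)
  have R: "app (R s) (bv (k * n + i)) = c *\<^sub>F bv (k * n + i')"
    if "s \<in> dgens D" "app (emb n (simple_gen D n \<mu>' s)) (bv i) = c *\<^sub>F bv i'" "k < l" "i < n" "i' < n" for s k i c i'
    unfolding R_def
    by (rule app_kr) (use that fd_act[OF K cl_gen_in[OF that(1)]] Kop[OF that(1)] in \<open>auto simp: opM_def\<close>)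
  have d: "0 < mdim ?M" "0 < mdim ?K" using l by simp_all
  note T0 = tensor_module[OF M d(1) K d(2)]
  have T: "fd_module Alg ?T" and Tg: "\<And>g. g \<in> carrier G \<Longrightarrow> opM ?T (GrpGen g) = L (GrpGen g) * R (GrpGen g)"
    and TX: "opM ?T XGen = L XGen * R (GrpGen a) + R XGen"
    and TY: "opM ?T XiGen = L XiGen + L (ChrGen \<chi>) * R XiGen"
    and Tc: "\<And>\<gamma>. \<gamma> \<in> carrier (Gam D) \<Longrightarrow> \<exists>H. opM ?T (ChrGen \<gamma>) = L (ChrGen \<gamma>) * R (ChrGen \<gamma>) + H * R XiGen"
    unfolding L_def R_def using T0(1,2,3,4,6) by simp_all
  have Td: "mdim ?T = l * n" by (simp add: tensor_module_def Let_def)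
  have d0: "0 < mdim ?T" using l by (simp add: Td)
  have RY0: "app (R XiGen) (bv (k * n)) = 0" if "k < l" for k
    using R[of XiGen 0 0 0 k] that l sg_Y_0[OF \<mu>' cK, simplified top] by simp
  have Y0: "app (opM ?T XiGen) (bv 0) = 0"
    using L[of XiGen 0 0 0 0] RY0[of 0] l sg_Y_0[OF \<mu>L cM] by (simp add: TY)
  have YS: "app (opM ?T XiGen) (bv (Suc k * n)) = al (m1 \<mu> a) (m2 \<mu> \<chi>) (Suc k) *\<^sub>F bv (k * n)" if "Suc k < l" for k
    using L[OF _ sg_Y[OF \<mu>L cM that], of 0] RY0[OF that] that l by (simp add: TY)
  have Yk: "app (opM ?T XiGen ^ Suc k) (bv (k * n)) = 0" if "k < l" for k
    using that
  proof (induction k)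
    case (Suc k)
    have "app (opM ?T XiGen ^ Suc (Suc k)) (bv (Suc k * n)) =
        al (m1 \<mu> a) (m2 \<mu> \<chi>) (Suc k) *\<^sub>F app (opM ?T XiGen ^ Suc k) (bv (k * n))"
      unfolding app_pow_Suc2[of _ "Suc k"] YS[OF Suc.prems] by (rule app_simps)
    then show ?case using Suc by simp
  qed (simp add: Y0)
  have Yl: "app (opM ?T XiGen ^ l) ?p = 0" using Yk[of "l - 1"] l by (simp del: power_Suc)
  have pL: "phi D [^]\<^bsub>Lam D\<^esub> (l - 1) \<otimes>\<^bsub>Lam D\<^esub> \<mu> \<in> carrier (Lam D)" using \<mu>L by simp
  have w: "wtM ?T ?\<nu> ?p"
    unfolding wtM_iff[OF T d0]
  proof (intro conjI ballI)
    fix g assume g: "g \<in> carrier G"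
    have "app (R (GrpGen g)) ?p = m1 \<mu>' g *\<^sub>F ?p"
      using R[of "GrpGen g" 0 "m1 \<mu>' g" 0 "l - 1"] g l sg_go[OF \<mu>' cK, simplified top, of g 0] by simp
    moreover have "app (L (GrpGen g)) ?p = (inverse (\<chi> g) ^ (l - 1) * m1 \<mu> g) *\<^sub>F ?p"
      using L[of "GrpGen g" "l - 1" "inverse (\<chi> g) ^ (l - 1) * m1 \<mu> g" "l - 1" 0] g l sg_go[OF \<mu>L cM, of g "l - 1"] by simp
    moreover have "m1 ?\<nu> g = inverse (\<chi> g) ^ (l - 1) * m1 \<mu> g * m1 \<mu>' g"
      by (simp only: phi_pow_apply(1)[OF \<mu>L g] Lam_mult_apply[OF g \<Gamma>.one_closed, of "phi D [^]\<^bsub>Lam D\<^esub> (l - 1) \<otimes>\<^bsub>Lam D\<^esub> \<mu>"])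
    ultimately show "app (opM ?T (GrpGen g)) ?p = m1 ?\<nu> g *\<^sub>F ?p"
      by (simp only: Tg[OF g] app_ops app_simps sc_simps ac_simps)
  next
    fix \<gamma> assume g: "\<gamma> \<in> carrier (Gam D)"
    obtain H where H: "opM ?T (ChrGen \<gamma>) = L (ChrGen \<gamma>) * R (ChrGen \<gamma>) + H * R XiGen" using Tc[OF g] by blast
    have "app (R (ChrGen \<gamma>)) ?p = m2 \<mu>' \<gamma> *\<^sub>F ?p"
      using R[of "ChrGen \<gamma>" 0 "m2 \<mu>' \<gamma>" 0 "l - 1"] g l sg_co[OF \<mu>' cK, simplified top, of \<gamma> 0] by simp
    moreover have "app (L (ChrGen \<gamma>)) ?p = (\<gamma> a ^ (l - 1) * m2 \<mu> \<gamma>) *\<^sub>F ?p"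
      using L[of "ChrGen \<gamma>" "l - 1" "\<gamma> a ^ (l - 1) * m2 \<mu> \<gamma>" "l - 1" 0] g l sg_co[OF \<mu>L cM, of \<gamma> "l - 1"] by simp
    moreover have "m2 ?\<nu> \<gamma> = \<gamma> a ^ (l - 1) * m2 \<mu> \<gamma> * m2 \<mu>' \<gamma>"
      by (simp only: phi_pow_apply(2)[OF \<mu>L g] Lam_mult_apply[OF G.one_closed g, of "phi D [^]\<^bsub>Lam D\<^esub> (l - 1) \<otimes>\<^bsub>Lam D\<^esub> \<mu>"])
    moreover have "app (R XiGen) ?p = 0" by (rule RY0) (use l in simp)
    ultimately show "app (opM ?T (ChrGen \<gamma>)) ?p = m2 ?\<nu> \<gamma> *\<^sub>F ?p"
      by (simp only: H app_ops app_simps sc_simps ac_simps add_0_right add_0_left)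
  qed
  have l0: "0 < l" using l by simp
  note sp = sp_closed[OF T d0 l0 w Yl] sp_X[OF T d0 l0 w Yl] sp_Y[OF T d0 l0 w Yl]
  have diff: "u - v \<in> spXY ?T l ?p" if "u \<in> spXY ?T l ?p" "v \<in> spXY ?T l ?p" for u v
    using sp(2)[OF that(1) sp(3)[OF that(2), of "-1"]] by (simp add: sc_minus_left)
  \<comment> \<open>The term from x \<otimes> a goes to v_(k+1) \<otimes> w_i. At k = l - 1 it is
    absent, because l < n makes \<open>wrap\<close> vanish.\<close>
  have XL: "\<exists>c k'. app (opM ?T XGen) (bv (k * n + i)) = c *\<^sub>F bv (k' * n + i) + bv (k * n + Suc i) \<and> (c \<noteq> 0 \<longrightarrow> k' = Suc k \<and> k' < l)"
    if ki: "k < l" "Suc i < n" for k i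
  proof -
    have "app (R XGen) (bv (k * n + i)) = bv (k * n + Suc i)"
      using R[of XGen i 1 "Suc i" k] ki sg_X[OF \<mu>' cK, simplified top, of i] by simp
    moreover have "app (R (GrpGen a)) (bv (k * n + i)) = (inverse (\<chi> a) ^ i * m1 \<mu>' a) *\<^sub>F bv (k * n + i)"
      using R[of "GrpGen a" i "inverse (\<chi> a) ^ i * m1 \<mu>' a" i k] ki sg_go[OF \<mu>' cK, simplified top, of a i] by simp
    moreover obtain c k' where "app (L XGen) (bv (k * n + i)) = c *\<^sub>F bv (k' * n + i)" "c \<noteq> 0 \<longrightarrow> k' = Suc k \<and> k' < l"
    proof -
      have "\<exists>c k'. app (L XGen) (bv (k * n + i)) = c *\<^sub>F bv (k' * n + i) \<and> (c \<noteq> 0 \<longrightarrow> k' = Suc k \<and> k' < l)"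
    proof (cases "Suc k < l")
      case True
      then show ?thesis
        using L[of XGen k 1 "Suc k" i] ki sg_X[OF \<mu>L cM, of k] by (intro exI[of _ "1::'k"] exI[of _ "Suc k"]) simp
    next
      case False
      then have k: "k = l - 1" using ki by simp
      have "wrap l \<mu> = 0" using wrap_def[OF \<mu>L cM] l by simp
      then show ?thesis
        using L[of XGen k 0 0 i] ki l sg_X_top(1)[OF \<mu>L cM] k by (intro exI[of _ "0::'k"] exI[of _ "0::nat"]) simp
    qed
      then show thesis using that by (elim exE conjE)
    qed
    ultimately show ?thesis
      by (intro exI[of _ "inverse (\<chi> a) ^ i * m1 \<mu>' a * c"] exI[of _ k']) (auto simp: TX)
  qed
  \<comment> \<open>Downward induction on k = l - 1 - e, and for each k upward induction on
    i.\<close>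
  have "\<forall>i<n. bv ((l - 1 - e) * n + i) \<in> spXY ?T l ?p" if "e \<le> l - 1" for e
    using that
  proof (induction e)
    case 0
    have "bv ((l - 1) * n + i) \<in> spXY ?T l ?p" if "i < n" for i
      using that
    proof (induction i)
      case 0
      show ?case using sp_XY[OF T d0 l0 w Yl, of 0 0] by (simp add: XY_def)
    next
      case (Suc i)
      obtain c k' where c: "app (opM ?T XGen) (bv ((l - 1) * n + i)) = c *\<^sub>F bv (k' * n + i) + bv ((l - 1) * n + Suc i)"
          "c \<noteq> 0 \<longrightarrow> k' = Suc (l - 1) \<and> k' < l"
        using XL[of "l - 1" i] Suc.prems l by auto
      then have "c = 0" by auto
      then show ?case using sp(4)[OF Suc.IH] Suc.prems c by simp
    qed
    then show ?case by simp
  next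
    case (Suc e)
    define k where "k = l - 1 - Suc e"
    have k: "l - 1 - e = Suc k" "Suc k < l" using Suc.prems by (auto simp: k_def)
    have IH: "bv (Suc k * n + i) \<in> spXY ?T l ?p" if "i < n" for i using Suc that k by simp
    have "bv (k * n + i) \<in> spXY ?T l ?p" if "i < n" for i
      using that
    proof (induction i)
      case 0
      let ?c = "al (m1 \<mu> a) (m2 \<mu> \<chi>) (Suc k)"
      have "?c \<noteq> 0"
      proof (rule double_ops.al_nz[OF ops_opM[OF T d0]])
        show "m2 \<mu> \<chi> * \<rho> ^ (Suc k - 1) \<noteq> m1 \<mu> a"
        proof
          assume "m2 \<mu> \<chi> * \<rho> ^ (Suc k - 1) = m1 \<mu> a"
          then have "\<rho> ^ k = \<rho> ^ (l - 1)"
            using m1_a_eq[OF \<mu>L cM l(2)] Lam_nz(2)[OF \<mu>L \<chi>_in] by simp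
          moreover have "\<rho> ^ (l - 1) = \<rho> ^ k * \<rho> ^ (l - 1 - k)" using k by (simp flip: power_add)
          ultimately have "\<rho> ^ (l - 1 - k) = 1" by simp
          moreover have "k < l - 1" "l - 1 < n" using k l by linarith+
          ultimately show False using rho_diff_neq by blast
        qed
      qed (use k l in auto)
      moreover have "?c *\<^sub>F bv (k * n) \<in> spXY ?T l ?p" using sp(5)[OF IH[of 0]] YS[OF k(2)] l by simp
      ultimately show ?case using sp(3)[of "?c *\<^sub>F bv (k * n)" "inverse ?c"] by simp
    next
      case (Suc i)
      obtain c k' where c: "app (opM ?T XGen) (bv (k * n + i)) = c *\<^sub>F bv (k' * n + i) + bv (k * n + Suc i)"
          "c \<noteq> 0 \<longrightarrow> k' = Suc k \<and> k' < l"
        using XL[of k i] Suc.prems k by auto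
      have "c *\<^sub>F bv (k' * n + i) \<in> spXY ?T l ?p"
        using IH[of i] Suc.prems c(2) sp(1) sp(3) by (cases "c = 0") auto
      then have "app (opM ?T XGen) (bv (k * n + i)) - c *\<^sub>F bv (k' * n + i) \<in> spXY ?T l ?p"
        using sp(4)[OF Suc.IH] Suc.prems by (intro diff) simp_all
      then show ?case unfolding c(1) by simp
    qed
    then show ?case by (simp add: k_def)
  qed
  then have all: "bv (k * n + i) \<in> spXY ?T l ?p" if "k < l" "i < n" for k i
    using that by (metis One_nat_def Suc_leI Suc_pred diff_diff_cancel diff_le_self l0 less_Suc_eq_le)
  have "W (mdim ?T) \<subseteq> spXY ?T l ?p"
  proof (rule sp_sum[OF T d0 l0 w Yl])
    fix j assume "j < mdim ?T"
    then show "bv j \<in> spXY ?T l ?p"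
      using all[of "j div n" "j mod n"] div_mod_less[of j l n] by (simp add: Td)
  qed
  moreover have "(l - 1) * n < l * n" using l by simp
  ultimately show ?thesis
    using T w Yl pL \<mu>' l by (simp add: cyc_def Td mult.commute[of n l])
qed

text \<open>The first factor is taken with the weight \<mu> that is trivial on G and sends \<gamma>
  to \<gamma>(a)^(-(l-1)); its value at a \<chi>^(-1) is \<rho>^(l-1), as I_l demands. The second
  factor then takes the weight \<mu>^(-1) \<tau>.\<close>

lemma cyc_exists:
  assumes l: "1 \<le> l" "l < n" and \<tau>: "\<tau> \<in> carrier (Lam D)"
  shows "\<exists>N p. cyc N l (phi D [^]\<^bsub>Lam D\<^esub> (l - 1) \<otimes>\<^bsub>Lam D\<^esub> \<tau>) p"
proof -
  define \<mu> where "\<mu> = (\<lambda>(g, \<gamma>) \<in> carrier (G \<times>\<times> Gam D). inverse (\<gamma> a) ^ (l - 1))"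
  have ap: "\<mu> (g, \<gamma>) = inverse (\<gamma> a) ^ (l - 1)" if "g \<in> carrier G" "\<gamma> \<in> carrier (Gam D)" for g \<gamma>
    using that by (simp add: \<mu>_def GG_mem)
  have \<mu>: "\<mu> \<in> carrier (Lam D)"
  proof (rule characters_memI)
    show "\<mu> \<in> extensional (carrier (G \<times>\<times> Gam D))" by (simp add: \<mu>_def)
    fix x y assume x: "x \<in> carrier (G \<times>\<times> Gam D)" and y: "y \<in> carrier (G \<times>\<times> Gam D)"
    obtain g \<gamma> h \<delta> where xy: "x = (g, \<gamma>)" "y = (h, \<delta>)" by (cases x; cases y)
    show "\<mu> x \<noteq> 0" using x by (simp add: xy GG_mem ap char_nz)
    have "\<mu> (g \<otimes>\<^bsub>G\<^esub> h, \<gamma> \<otimes>\<^bsub>Gam D\<^esub> \<delta>) = inverse ((\<gamma> \<otimes>\<^bsub>Gam D\<^esub> \<delta>) a) ^ (l - 1)"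
      by (rule ap) (use x y in \<open>auto simp: xy GG_mem intro: \<Gamma>.m_closed\<close>)
    then show "\<mu> (x \<otimes>\<^bsub>G \<times>\<times> Gam D\<^esub> y) = \<mu> x * \<mu> y"
      using x y by (simp add: xy GG_mem ap Gam_apply power_mult_distrib)
  qed
  have "\<mu> (a, inv\<^bsub>Gam D\<^esub> \<chi>) = \<rho> ^ (l - 1)"
    using ap[of a "inv\<^bsub>Gam D\<^esub> \<chi>"] \<Gamma>.inv_closed[OF \<chi>_in] by (simp add: inv_chi rho_eq)
  with \<mu> have "\<mu> \<in> Il D l" by (simp add: Il_def)
  from cyc_tensor[OF l this, of "inv\<^bsub>Lam D\<^esub> \<mu> \<otimes>\<^bsub>Lam D\<^esub> \<tau>"] \<mu> \<tau>
  show ?thesis by (auto simp: \<Lambda>.m_assoc \<Lambda>.r_inv simp flip: \<Lambda>.m_assoc[of \<mu> "inv\<^bsub>Lam D\<^esub> \<mu>" \<tau>])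
qed

lemma phi_mult_apply:
  shows "g \<in> carrier G \<Longrightarrow> m1 (phi D \<otimes>\<^bsub>Lam D\<^esub> \<kappa>) g = inverse (\<chi> g) * m1 \<kappa> g"
    and "\<gamma> \<in> carrier (Gam D) \<Longrightarrow> m2 (phi D \<otimes>\<^bsub>Lam D\<^esub> \<kappa>) \<gamma> = \<gamma> a * m2 \<kappa> \<gamma>"
  using phi_apply[OF _ \<Gamma>.one_closed, of g] phi_apply[OF G.one_closed, of \<gamma>]
  by (simp_all add: Lam_mult_apply[OF _ \<Gamma>.one_closed] Lam_mult_apply[OF G.one_closed] Gam_apply char_one)

lemma wtM_Y:
  assumes M: "fd_module Alg M" "0 < mdim M" and w: "wtM M (phi D \<otimes>\<^bsub>Lam D\<^esub> \<kappa>) v"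
  shows "wtM M \<kappa> (app (opM M XiGen) v)"
proof -
  interpret M: double_ops D "\<lambda>g. opM M (GrpGen g)" "\<lambda>\<gamma>. opM M (ChrGen \<gamma>)" "opM M XGen" "opM M XiGen"
    by (rule ops_opM[OF M])
  from w have "M.wt (m1 (phi D \<otimes>\<^bsub>Lam D\<^esub> \<kappa>)) (m2 (phi D \<otimes>\<^bsub>Lam D\<^esub> \<kappa>)) v" by (simp add: wtM_def)
  from M.wt_cong[OF M.wt_Y[OF this], of "m1 \<kappa>" "m2 \<kappa>"] show ?thesis
    by (simp add: wtM_def phi_mult_apply char_nz)
qed

text \<open>\<xi> x^(k+1) \<xi>^k p equals x^(k+1) \<xi>^(k+1) p plus a nonzero multiple of x^k
  \<xi>^k p. Descending from \<xi>^l p = 0, all x^k \<xi>^k p and finally p lie in the image of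
  \<xi>. Averaging makes the preimage a weight vector.\<close>

lemma Y_preimage:
  assumes M: "fd_module Alg M" "0 < mdim M" and \<kappa>: "\<kappa> \<in> carrier (Lam D)"
    and p: "p \<in> W (mdim M)" "wtM M \<kappa> p" "app (opM M XiGen ^ l) p = 0" and l: "l < n"
    and c: "\<And>k. k < l \<Longrightarrow> m2 \<kappa> \<chi> \<noteq> \<rho> ^ k * m1 \<kappa> a"
  shows "\<exists>r\<in>W (mdim M). wtM M (phi D \<otimes>\<^bsub>Lam D\<^esub> \<kappa>) r \<and> app (opM M XiGen) r = p"
proof -
  interpret M: double_ops D "\<lambda>g. opM M (GrpGen g)" "\<lambda>\<gamma>. opM M (ChrGen \<gamma>)" "opM M XGen" "opM M XiGen"
    by (rule ops_opM[OF M])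
  let ?Y = "opM M XiGen"
  \<comment> \<open>The lemmas on \<open>XY\<close> require a positive length, while l may be 0
    here.\<close>
  have Yl: "app (?Y ^ Suc l) p = 0" using p(3) by simp
  have "\<exists>v\<in>W (mdim M). XY M p (l - d) (l - d) = app ?Y v" if "d \<le> l" for d
    using that
  proof (induction d)
    case 0
    show ?case by (rule bexI[of _ 0]) (simp_all add: XY_def p(3))
  next
    case (Suc d)
    define k where "k = l - Suc d"
    have k: "l - d = Suc k" "k < l" using Suc.prems by (auto simp: k_def)
    obtain v where v: "v \<in> W (mdim M)" "XY M p (Suc k) (Suc k) = app ?Y v" using Suc k by auto
    let ?c = "al (\<rho> ^ k * m1 \<kappa> a) (inverse \<rho> ^ k * m2 \<kappa> \<chi>) (Suc k)"
    have nz: "?c \<noteq> 0"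
    proof (rule M.al_nz)
      show "inverse \<rho> ^ k * m2 \<kappa> \<chi> * \<rho> ^ (Suc k - 1) \<noteq> \<rho> ^ k * m1 \<kappa> a"
        using c[OF k(2)] by (simp add: field_simps)
    qed (use k l in auto)
    have "app ?Y (XY M p (Suc k) k) = app ?Y v + ?c *\<^sub>F XY M p k k"
      using XY_Y[OF M _ p(2) Yl, of "Suc k" k] v by simp
    then have "app ?Y (inverse ?c *\<^sub>F (XY M p (Suc k) k - v)) = XY M p k k"
      using nz by simp
    moreover have "inverse ?c *\<^sub>F (XY M p (Suc k) k - v) \<in> W (mdim M)" using XY_W[OF M(1) p(1)] v by simp
    ultimately show ?case unfolding k_def[symmetric] by (metis (no_types))
  qed
  from this[of l] obtain r1 where r1: "r1 \<in> W (mdim M)" "p = app ?Y r1" by (auto simp: XY_def)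
  let ?\<nu> = "phi D \<otimes>\<^bsub>Lam D\<^esub> \<kappa>"
  have \<nu>: "?\<nu> \<in> carrier (Lam D)" using \<kappa> by simp
  define r where "r = M.wproj (m1 ?\<nu>) (m2 ?\<nu>) r1"
  have "app ?Y r = M.wproj (\<lambda>g. \<chi> g * m1 ?\<nu> g) (\<lambda>\<gamma>. inverse (\<gamma> a) * m2 ?\<nu> \<gamma>) p"
    unfolding r_def M.Y_wproj r1(2) ..
  also have "\<dots> = p"
  proof (rule M.wproj_id)
    have "M.wt (m1 \<kappa>) (m2 \<kappa>) p" using p(2) by (simp add: wtM_def)
    from M.wt_cong[OF this] show "M.wt (\<lambda>g. \<chi> g * m1 ?\<nu> g) (\<lambda>\<gamma>. inverse (\<gamma> a) * m2 ?\<nu> \<gamma>) p"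
      by (simp add: phi_mult_apply char_nz)
  qed (simp_all add: Lam_nz[OF \<nu>] char_nz)
  finally have "app ?Y r = p" .
  moreover have "wtM M ?\<nu> r"
    unfolding wtM_def r_def by (rule M.wt_wproj) (simp_all add: Lam_m1_mult[OF \<nu>] Lam_m2_mult[OF \<nu>] Lam_nz[OF \<nu>])
  moreover have "r \<in> W (mdim M)" unfolding r_def by (rule wproj_W[OF M r1(1)])
  ultimately show ?thesis by blast
qed

end


section \<open>Splitting off a shorter universal module\<close>

context gdatum
begin

text \<open>Universality of \<open>N'\<close> gives an inclusion with image generated by q, and
  universality of \<open>N\<close> a map sending p to a \<xi>-preimage of the generator of
  \<open>N'\<close>. By \<open>rq\<close> this map sends q to that generator, so it is a retraction.
  The last conclusion carries maps that kill q over to the complement.\<close>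

lemma split_cyc:
  assumes N: "cyc N l \<nu> p" and N': "cyc N' l' \<kappa> p'" and \<nu>: "\<nu> = phi D \<otimes>\<^bsub>Lam D\<^esub> \<kappa>" and l: "l' < l" "l' < n"
    and q: "q \<in> W (mdim N)" "wtM N \<kappa> q" "app (opM N XiGen ^ l') q = 0"
    and c: "\<And>k. k < l' \<Longrightarrow> m2 \<kappa> \<chi> \<noteq> \<rho> ^ k * m1 \<kappa> a"
    and rq: "\<And>t. ehom Alg N N' t \<Longrightarrow> app (opM N' XiGen) (t p) = p' \<Longrightarrow> t q = p'"
  obtains P i \<pi> where "fd_module Alg P" "ehom Alg P N i" "ehom Alg N P \<pi>"
    "\<And>w. w \<in> W (mdim P) \<Longrightarrow> \<pi> (i w) = w" "\<pi> q = 0" "mdim N = mdim N' + mdim P"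
    "\<And>M1 M2. fd_iso Alg N' M1 \<Longrightarrow> fd_iso Alg P M2 \<Longrightarrow> fd_iso Alg N (dsum2 M1 M2)"
    "\<And>K f. fd_module Alg K \<Longrightarrow> ehom Alg N K f \<Longrightarrow> f q = 0 \<Longrightarrow> f (i (\<pi> p)) = f p"
proof -
  note Nc = cycD[OF N] and Nc' = cycD[OF N']
  obtain r0 where r0: "r0 \<in> W (mdim N')" "wtM N' \<nu> r0" "app (opM N' XiGen) r0 = p'"
    using Y_preimage[OF Nc'(1,2,7,6,4,5) l(2) c] unfolding \<nu> by blast
  have "app (opM N' XiGen ^ Suc l') r0 = 0" unfolding app_pow_Suc2 r0(3) by (rule Nc'(5))
  moreover have "l = (l - Suc l') + Suc l'" using l by simp
  ultimately have "app (opM N' XiGen ^ l) r0 = 0" by (metis app_pow_add app_simps(3))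
  then obtain r where r: "ehom Alg N N' r" "r p = r0" using universal[OF N Nc'(1,2) r0(1,2)] by blast
  obtain j where j: "ehom Alg N' N j" "j p' = q" using universal[OF N' Nc(1,2) q] by blast
  have "r (j p') = p'" using rq[OF r(1)] by (simp add: r j r0)
  then have rj: "r (j v) = v" if "v \<in> W (mdim N')" for v
    using hom_unique[OF N' Nc'(1) ehom_comp[OF r(1) j(1)] ehom_id[OF Nc'(1)] _ that] by simp
  obtain P i \<pi> where P: "fd_module Alg P" "ehom Alg P N i" "ehom Alg N P \<pi>"
    "\<And>w. w \<in> W (mdim P) \<Longrightarrow> \<pi> (i w) = w" "\<And>v. v \<in> W (mdim N) \<Longrightarrow> i (\<pi> v) = v - j (r v)"
    "\<And>v. v \<in> W (mdim N') \<Longrightarrow> \<pi> (j v) = 0" "mdim N = mdim N' + mdim P"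
    "\<And>M1 M2. fd_iso Alg N' M1 \<Longrightarrow> fd_iso Alg P M2 \<Longrightarrow> fd_iso Alg N (dsum2 M1 M2)"
    by (rule split_summand[OF Nc(1) Nc'(1) j(1) r(1) rj]) (assumption | rule that)+
  have f: "f (i (\<pi> p)) = f p" if f: "fd_module Alg K" "ehom Alg N K f" "f q = 0" for K f
  proof -
    have "ehom Alg N' K (\<lambda>_. 0)" by (simp add: ehom_def islin_def islin_0[OF islin_lin])
    then have "f (j (r p)) = 0"
      using hom_unique[OF N' f(1) ehom_comp[OF f(2) j(1)], of "\<lambda>_. 0" "r p"] f(3) j(2) ehom_W[OF r(1) Nc(6)] by simp
    then show ?thesis using P(5)[OF Nc(6)] islin_diff[OF ehom_islin[OF f(2)]] by simp
  qed
  have pq: "\<pi> q = 0" using P(6)[OF Nc'(6)] j(2) by simp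
  show thesis
  proof (rule that[of P i \<pi>])
    show "fd_module Alg P" "ehom Alg P N i" "ehom Alg N P \<pi>" "\<pi> q = 0" "mdim N = mdim N' + mdim P"
      by (fact P(1) P(2) P(3) pq P(7))+
    show "\<pi> (i w) = w" if "w \<in> W (mdim P)" for w by (rule P(4)[OF that])
    show "fd_iso Alg N (dsum2 M1 M2)" if "fd_iso Alg N' M1" "fd_iso Alg P M2" for M1 M2 by (rule P(8)[OF that])
    show "f (i (\<pi> p)) = f p" if "fd_module Alg K" "ehom Alg N K f" "f q = 0" for K f by (rule f[OF that])
  qed
qed

text \<open>Here q = \<xi> p. In the complement \<xi> kills the image of the generator, so the span
  shrinks to length 1 and the complement, of dimension n, is V(n, \<nu>).\<close>

lemma step_simple:
  assumes N: "cyc N (Suc l) \<nu> p" and N': "cyc N' l \<kappa> p'" and \<nu>: "\<nu> = phi D \<otimes>\<^bsub>Lam D\<^esub> \<kappa>" and l: "l < n"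
    and c: "\<And>k. k < l \<Longrightarrow> m2 \<kappa> \<chi> \<noteq> \<rho> ^ k * m1 \<kappa> a" and iso: "fd_iso Alg N' M"
  shows "fd_iso Alg N (dsum2 M (simple_module D n \<nu>))"
proof -
  note Nc = cycD[OF N] and Nc' = cycD[OF N']
  let ?q = "app (opM N XiGen) p"
  have q: "?q \<in> W (mdim N)" "wtM N \<kappa> ?q" "app (opM N XiGen ^ l) ?q = 0"
  proof -
    show "?q \<in> W (mdim N)" by (rule opM_W[OF Nc(1) _ Nc(6)]) simp
    show "wtM N \<kappa> ?q" using wtM_Y[OF Nc(1,2), of \<kappa> p] Nc(4) unfolding \<nu> .
    show "app (opM N XiGen ^ l) ?q = 0" using Nc(5) unfolding app_pow_Suc2 .
  qed
  have rq: "t ?q = p'" if "ehom Alg N N' t" "app (opM N' XiGen) (t p) = p'" for t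
    using ehom_opM[OF Nc(1) Nc'(1) that(1) _ Nc(6), of XiGen] that(2) by simp
  obtain P i \<pi> where P: "fd_module Alg P" "ehom Alg P N i" "ehom Alg N P \<pi>"
    "\<And>w. w \<in> W (mdim P) \<Longrightarrow> \<pi> (i w) = w" "\<pi> ?q = 0" "mdim N = mdim N' + mdim P"
    "\<And>M1 M2. fd_iso Alg N' M1 \<Longrightarrow> fd_iso Alg P M2 \<Longrightarrow> fd_iso Alg N (dsum2 M1 M2)"
    by (rule split_cyc[where q = "app (opM N XiGen) p" and p = p, OF N N' \<nu> lessI l q]) (erule c, erule (1) rq, (assumption | rule that)+)
  have dP: "mdim P = n" using P(6) Nc(9) Nc'(9) by simp
  then have P0: "0 < mdim P" using n_ge2 by simp
  note g = ehom_generator[OF N P(1) P0 P(3)]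
  have Y: "app (opM P XiGen ^ 1) (\<pi> p) = 0"
    using ehom_opM[OF Nc(1) P(1,3) _ Nc(6), of XiGen] P(5) by simp
  have one: "0 < (1 :: nat)" by simp
  have sp0: "0 \<in> spXY P 1 (\<pi> p)" by (rule sp_closed(1)[OF P(1) P0 one g(2) Y])
  have sp1: "u + v \<in> spXY P 1 (\<pi> p)" if "u \<in> spXY P 1 (\<pi> p)" "v \<in> spXY P 1 (\<pi> p)" for u v
    by (rule sp_closed(2)[OF P(1) P0 one g(2) Y that])
  have sp2: "b *\<^sub>F v \<in> spXY P 1 (\<pi> p)" if "v \<in> spXY P 1 (\<pi> p)" for b v
    by (rule sp_closed(3)[OF P(1) P0 one g(2) Y that])
  have sp3: "XY P (\<pi> p) i j \<in> spXY P 1 (\<pi> p)" for i j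
    by (rule sp_XY[OF P(1) P0 one g(2) Y])
  have "w \<in> spXY P 1 (\<pi> p)" if w: "w \<in> W (mdim P)" for w
  proof -
    have "w \<in> spXY P (Suc l) (\<pi> p)" using g(4) P(4) ehom_W[OF P(2)] w by blast
    then show ?thesis by (rule sp_induct[OF P(1) P0 Nc(3) g(2,3)]) (simp_all only: sp0 sp1 sp2 sp3)
  qed
  then have "cyc P 1 \<nu> (\<pi> p)" using P(1) dP g(1,2) Y Nc(7) unfolding cyc_def by auto
  from P(7)[OF iso cyc_iso[OF this cyc_simple[OF Nc(7)]]] show ?thesis .
qed

text \<open>The projection \<open>E\<close> to the a-eigenspace of p has image spanned by p and
  x^(l-1) \<xi>^(l-1) p. A submodule U onto the simple module contains p + d x^(l-1) \<xi>^(l-1) p;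
  applying \<xi>^(l-1), which kills the second term, puts \<xi>^(l-1) p into U, and therefore
  p.\<close>

lemma projective_cover_simple:
  assumes P: "fd_projective Alg P" and P0: "0 < mdim P" and \<nu>: "\<nu> \<in> carrier (Lam D)"
    and p: "p \<in> W (mdim P)" "wtM P \<nu> p" "app (opM P XiGen ^ l) p = 0" and l: "2 \<le> l" "l < n"
    and \<nu>l: "m1 \<nu> a * \<rho> ^ l = m2 \<nu> \<chi>"
    and Yp: "app (opM P XiGen) p = c *\<^sub>F XY P p (l - 2) (l - 1)"
    and span: "W (mdim P) \<subseteq> spXY P l p"
    and f: "ehom Alg P (simple_module D (Suc (n - l)) \<nu>) f" "f p = bv 0"
  shows "projective_cover Alg P (simple_module D (Suc (n - l)) \<nu>)"
proof -
  let ?m = "Suc (n - l)" and ?s = "m1 \<nu> a" and ?Y = "opM P XiGen"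
  let ?V = "simple_module D ?m \<nu>"
  have Pm: "fd_module Alg P" using P by (simp add: fd_projective_def)
  have snz: "?s \<noteq> 0" by (rule Lam_nz(1)[OF \<nu> a_in])
  have "\<nu> \<in> Il D ?m"
  proof -
    have "m2 \<nu> \<chi> * \<rho> ^ (n - l) = ?s * \<rho> ^ n" using l by (simp flip: \<nu>l power_add add: mult.assoc)
    then have "?s / m2 \<nu> \<chi> = \<rho> ^ (n - l)" using Lam_nz(2)[OF \<nu> \<chi>_in] by (simp add: field_simps)
    then show ?thesis using \<nu> by (simp add: Il_def Lam_a_inv_chi)
  qed
  then have cV: "1 \<le> ?m" "?m \<le> n" "\<nu> \<in> Il D ?m" using l by auto
  note V = simple_module[OF \<nu> cV] and Vop = simple_module_op[OF \<nu> cV]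
  have V0: "0 < mdim ?V" by simp
  interpret P: double_ops D "\<lambda>g. opM P (GrpGen g)" "\<lambda>\<gamma>. opM P (ChrGen \<gamma>)" "opM P XGen" "opM P XiGen"
    by (rule ops_opM[OF Pm P0])
  have l0: "0 < l" using l by simp
  note aw = XY_aw[OF Pm P0 l0 p(2,3)] and lf = ehom_islin[OF f(1)]
  have fX: "f (XY P p j 0) = bv j" if "j < ?m" for j
    using ehom_XY[OF Pm V f(1) p(1), of j 0] sg_X_pow[OF \<nu> cV, of 0 j] that by (simp add: XY_def f(2) Vop)
  have surj: "f ` W (mdim P) = W (mdim ?V)"
  proof
    show "f ` W (mdim P) \<subseteq> W (mdim ?V)" using ehom_W[OF f(1)] by blast
    show "W (mdim ?V) \<subseteq> f ` W (mdim P)"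
    proof
      fix w :: "'k fvec" assume w: "w \<in> W (mdim ?V)"
      let ?v = "\<Sum>j<?m. ent w j *\<^sub>F XY P p j 0"
      have vW: "?v \<in> W (mdim P)" by (intro W_sum W_closed(4) XY_W[OF Pm p(1)])
      have f1: "f ?v = (\<Sum>j<?m. ent w j *\<^sub>F bv j)"
        unfolding islin_sum[OF lf] islin_sc[OF lf] by (rule sum.cong) (simp_all only: fX lessThan_iff)
      have f2: "(\<Sum>j<?m. ent w j *\<^sub>F bv j) = w" using W_expand[OF w] unfolding mdim_simple by (rule sym)
      show "w \<in> f ` W (mdim P)" by (rule image_eqI[OF _ vW]) (simp only: f1 f2)
    qed
  qed
  \<comment> \<open>On x^i \<xi>^j p the eigenvalue of a is \<rho>^(j-i) s, so the average of the
    powers of a / s keeps exactly the vectors with i = j when i, j < n.\<close>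
  define E where "E = (1 / of_nat n) *\<^sub>E (\<Sum>k<n. inverse ?s ^ k *\<^sub>E opM P (GrpGen a) ^ k)"
  have Eapp: "app E v = (1 / of_nat n) *\<^sub>F (\<Sum>k<n. inverse ?s ^ k *\<^sub>F app (opM P (GrpGen a) ^ k) v)" for v
    by (simp add: E_def app_esum)
  have EXY: "app E (XY P p i j) = (if i = j then XY P p i j else 0)" if "i < n" "j < n" for i j
  proof -
    let ?w = "inverse \<rho> ^ i * \<rho> ^ j"
    have "app (opM P (GrpGen a) ^ k) (XY P p i j) = (?w * ?s) ^ k *\<^sub>F XY P p i j" for k
      using aw[of i j] by (induction k) (simp_all add: P.aw_def mult_ac)
    then have "app E (XY P p i j) = (1 / of_nat n) *\<^sub>F (\<Sum>k<n. ?w ^ k) *\<^sub>F XY P p i j"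
      unfolding Eapp sc_sum_left using snz by (simp add: power_mult_distrib field_simps)
    moreover have "(\<Sum>k<n. ?w ^ k) = (if i = j then of_nat n else 0)"
    proof (cases "i = j")
      case True
      then have "?w = 1" by (simp add: power_inverse)
      then show ?thesis using True by simp
    next
      case False
      have "?w \<noteq> 1"
      proof
        assume "?w = 1"
        then have e: "\<rho> ^ j = \<rho> ^ i" by (simp add: field_simps power_inverse)
        consider "i < j" | "j < i" using False by linarith
        then show False
        proof cases
          case 1
          then have "\<rho> ^ j = \<rho> ^ i * \<rho> ^ (j - i)" by (simp flip: power_add)
          then show False using e rho_diff_neq[OF 1 that(2)] by simp
        next
          case 2
          then have "\<rho> ^ i = \<rho> ^ j * \<rho> ^ (i - j)" by (simp flip: power_add)
          then show False using e rho_diff_neq[OF 2 that(1)] by simp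
        qed
      qed
      moreover have "?w ^ n = 1"
      proof -
        have "(\<rho> ^ k) ^ n = 1" for k by (simp add: rho_pow_eq_1 flip: power_mult)
        then show ?thesis by (simp add: power_mult_distrib power_inverse)
      qed
      ultimately show ?thesis using False power_diff_1_eq[of ?w n] by simp
    qed
    ultimately show ?thesis using n_ge2 by simp
  qed
  \<comment> \<open>Applying \<xi> to a multiple of x^i \<xi>^(l-1) p only lowers i, because the
    other term contains \<xi>^l p = 0.\<close>
  have Yj: "\<exists>c'. app (?Y ^ Suc j) p = c' *\<^sub>F XY P p (l - 1 - Suc j) (l - 1)" if "Suc j \<le> l - 1" for j
    using that
  proof (induction j)
    case 0
    have "l - 1 - Suc 0 = l - 2" by simp
    then show ?case using Yp by auto
  next
    case (Suc j)
    then obtain c' where c': "app (?Y ^ Suc j) p = c' *\<^sub>F XY P p (l - 1 - Suc j) (l - 1)" by auto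
    have z: "XY P p (l - 1 - Suc j) (Suc (l - 1)) = 0"
      by (rule XY_ge[OF Pm P0 l0 p(2,3)]) (use l in simp)
    have "app (?Y ^ Suc (Suc j)) p = c' *\<^sub>F app ?Y (XY P p (l - 1 - Suc j) (l - 1))"
      unfolding app_pow_Suc[of _ "Suc j"] c' by simp
    also have "\<dots> = (c' * al (\<rho> ^ (l - 1) * ?s) (inverse \<rho> ^ (l - 1) * m2 \<nu> \<chi>) (l - 1 - Suc j)) *\<^sub>F
        XY P p (l - 1 - Suc (Suc j)) (l - 1)"
      unfolding XY_Y[OF Pm P0 l0 p(2,3)] z by simp
    finally show ?case by blast
  qed
  \<comment> \<open>Multiplying the formula for \<xi>^j p by x^j brings all these vectors onto one
    line.\<close>
  have XYjj: "\<exists>d. XY P p j j = d *\<^sub>F XY P p (l - 1) (l - 1)" if j: "0 < j" "j < l" for j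
  proof -
    obtain k where k: "j = Suc k" using j by (cases j) auto
    have "Suc k \<le> l - 1" using j k by linarith
    from Yj[OF this] obtain c' where "app (?Y ^ j) p = c' *\<^sub>F XY P p (l - 1 - j) (l - 1)" unfolding k by blast
    then have "XY P p j j = c' *\<^sub>F app (opM P XGen ^ j) (XY P p (l - 1 - j) (l - 1))" by (simp add: XY_def)
    also have "app (opM P XGen ^ j) (XY P p (l - 1 - j) (l - 1)) = XY P p (l - 1) (l - 1)"
    proof -
      have "j + (l - 1 - j) = l - 1" using j by simp
      then show ?thesis unfolding XY_def app_pow_add[symmetric] by simp
    qed
    finally show ?thesis by blast
  qed
  have E_range: "\<exists>\<alpha> d. app E v = \<alpha> *\<^sub>F p + d *\<^sub>F XY P p (l - 1) (l - 1)" if v: "v \<in> W (mdim P)" for v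
  proof -
    let ?Q = "\<lambda>v. \<exists>\<alpha> d. app E v = \<alpha> *\<^sub>F p + d *\<^sub>F XY P p (l - 1) (l - 1)"
    have "v \<in> spXY P l p" using span v by blast
    then show ?thesis
    proof (rule sp_induct_reduced[where Q = ?Q])
      show "?Q 0" by (intro exI[of _ 0]) simp
      show "?Q (u + v)" if "?Q u" "?Q v" for u v
      proof -
        from that obtain \<alpha> d \<alpha>' d' where "app E u = \<alpha> *\<^sub>F p + d *\<^sub>F XY P p (l - 1) (l - 1)"
          "app E v = \<alpha>' *\<^sub>F p + d' *\<^sub>F XY P p (l - 1) (l - 1)" by (elim exE)
        then have "app E (u + v) = (\<alpha> + \<alpha>') *\<^sub>F p + (d + d') *\<^sub>F XY P p (l - 1) (l - 1)"
          by (simp add: sc_add_left algebra_simps)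
        then show ?thesis by blast
      qed
      show "?Q (b *\<^sub>F v)" if "?Q v" for b v
      proof -
        from that obtain \<alpha> d where "app E v = \<alpha> *\<^sub>F p + d *\<^sub>F XY P p (l - 1) (l - 1)" by (elim exE)
        then have "app E (b *\<^sub>F v) = (b * \<alpha>) *\<^sub>F p + (b * d) *\<^sub>F XY P p (l - 1) (l - 1)" by simp
        then show ?thesis by blast
      qed
      show "?Q (XY P p i j)" if ij: "i < n" "j < l" for i j
      proof (cases "i = j")
        case False
        then have "app E (XY P p i j) = 0 *\<^sub>F p + 0 *\<^sub>F XY P p (l - 1) (l - 1)" using EXY[of i j] ij l by simp
        then show ?thesis by blast
      next
        case True
        then have e: "app E (XY P p i j) = XY P p j j" using EXY[of i j] ij by simp
        show ?thesis
        proof (cases "j = 0")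
          case True
          have "XY P p j j = p" unfolding True XY_def by simp
          then have "app E (XY P p i j) = 1 *\<^sub>F p + 0 *\<^sub>F XY P p (l - 1) (l - 1)" using e by (simp only: sc_simps add_0_right)
          then show ?thesis by blast
        next
          case False
          then obtain d where "XY P p j j = d *\<^sub>F XY P p (l - 1) (l - 1)" using XYjj[of j] ij by blast
          then have "app E (XY P p i j) = 0 *\<^sub>F p + d *\<^sub>F XY P p (l - 1) (l - 1)" unfolding e by simp
          then show ?thesis by blast
        qed
      qed
    qed (rule l0)
  qed
  have sup: "U = W (mdim P)" if U: "esub Alg P U" "f ` U = W (mdim ?V)" for U
  proof -
    have Ucl: "u + v \<in> U" "b *\<^sub>F u \<in> U" "0 \<in> U" if "u \<in> U" "v \<in> U" for u v b using U(1) that by (auto simp: esub_def)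
    have UW: "U \<subseteq> W (mdim P)" using U(1) by (simp add: esub_def)
    note Uop = esub_opM[OF Pm U(1)]
    have "bv 0 \<in> f ` U" unfolding U(2) by simp
    then obtain u where u: "u \<in> U" "f u = bv 0" by auto
    have uW: "u \<in> W (mdim P)" using u UW by blast
    have EU: "app E u \<in> U"
    proof -
      have "(\<Sum>k\<in>K. inverse ?s ^ k *\<^sub>F app (opM P (GrpGen a) ^ k) u) \<in> U" if "finite K" for K
        using that by (induction K) (simp_all add: Ucl u Ucl(3)[OF u(1) u(1)] Uop)
      then show ?thesis unfolding Eapp using Ucl(2)[OF _ u(1)] by blast
    qed
    have "f (app (opM P (GrpGen a) ^ k) u) = ?s ^ k *\<^sub>F bv 0" for k
    proof -
      have "app (opM ?V (GrpGen a) ^ k) (bv 0) = ?s ^ k *\<^sub>F bv 0"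
        by (induction k) (simp_all add: Vop sg_go[OF \<nu> cV] mult.commute)
      then show ?thesis using ehom_opM_pow[OF Pm V f(1) _ uW, of "GrpGen a" k] u(2) by simp
    qed
    moreover have "inverse ?s ^ k * ?s ^ k = 1" for k using snz by (simp flip: power_mult_distrib)
    ultimately have "f (app E u) = (1 / of_nat n) *\<^sub>F (\<Sum>k<n. bv 0)"
      unfolding Eapp islin_sc[OF lf] islin_sum[OF lf] by (simp only: sc_simps)
    moreover have "(\<Sum>k<n. bv 0) = of_nat n *\<^sub>F (bv 0 :: 'k fvec)" by (rule fvec_eqI) (simp add: ent_sum)
    moreover have "(of_nat n :: 'k) \<noteq> 0" using n_ge2 by simp
    ultimately have fE: "f (app E u) = bv 0" by simp
    obtain \<alpha> d where d: "app E u = \<alpha> *\<^sub>F p + d *\<^sub>F XY P p (l - 1) (l - 1)" using E_range[OF uW] by blast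
    let ?w = "app (?Y ^ (l - 1)) p"
    have YV: "app (opM ?V XiGen ^ (l - 1)) (bv 0) = 0"
    proof -
      obtain k where "l - 1 = Suc k" using l by (cases "l - 1") auto
      then show ?thesis using sg_Y_0[OF \<nu> cV] by (simp add: app_pow_Suc2 Vop del: power_Suc)
    qed
    have "f (XY P p (l - 1) (l - 1)) = 0"
    proof -
      have "f (XY P p (l - 1) (l - 1)) = XY ?V (f p) (l - 1) (l - 1)" by (rule ehom_XY[OF Pm V f(1) p(1)])
      also have "\<dots> = 0" unfolding f(2) XY_def YV by (rule app_simps(3))
      finally show ?thesis .
    qed
    then have "bv 0 = \<alpha> *\<^sub>F (bv 0 :: 'k fvec)" using fE unfolding d by (simp add: islin_add[OF lf] islin_sc[OF lf] f(2))
    then have "ent (bv 0 :: 'k fvec) 0 = ent (\<alpha> *\<^sub>F (bv 0 :: 'k fvec)) 0" by simp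
    then have \<alpha>: "\<alpha> = 1" by (simp add: bv_def)
    have Yw: "app ?Y ?w = 0"
    proof -
      have "Suc (l - 1) = l" using l by simp
      then show ?thesis using p(3) app_pow_Suc[of ?Y "l - 1" p] by simp
    qed
    have aww: "P.aw (\<rho> ^ (l - 1) * ?s) (inverse \<rho> ^ (l - 1) * m2 \<nu> \<chi>) ?w"
      using aw[of 0 "l - 1"] by (simp add: XY_def)
    \<comment> \<open>The last factor of the product below: with t = s \<rho>^l the two terms of its
      difference are both s \<rho>.\<close>
    have "al (\<rho> ^ (l - 1) * ?s) (inverse \<rho> ^ (l - 1) * m2 \<nu> \<chi>) (l - 1) = 0"
    proof -
      obtain k where k: "l = Suc (Suc k)" using l by (metis add_2_eq_Suc le_Suc_ex)
      show ?thesis unfolding al_def \<nu>l[symmetric] k by (simp add: field_simps power_inverse)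
    qed
    then have pz: "(\<Prod>k<l - 1. al (\<rho> ^ (l - 1) * ?s) (inverse \<rho> ^ (l - 1) * m2 \<nu> \<chi>) (0 + Suc k)) = 0"
      using l by (intro prod_zero bexI[of _ "l - 2"]) (auto simp: Suc_diff_Suc numeral_2_eq_2)
    have "app (?Y ^ (l - 1)) (app (opM P XGen ^ (l - 1)) ?w) = 0"
      using P.Y_pow_X_pow[OF aww Yw, of "l - 1" 0] unfolding pz by simp
    then have "app (?Y ^ (l - 1)) (app E u) = ?w" unfolding d \<alpha> by (simp add: XY_def)
    then have wU: "?w \<in> U" using Uop[OF _ EU, of XiGen "l - 1"] by simp
    have "app E u + (- d) *\<^sub>F app (opM P XGen ^ (l - 1)) ?w \<in> U"
      using Uop[OF _ wU, of XGen "l - 1"] Ucl EU by simp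
    then have pU: "p \<in> U" unfolding d \<alpha> by (simp add: XY_def sc_minus_left)
    have "v \<in> U" if "v \<in> W (mdim P)" for v
    proof -
      have "v \<in> spXY P l p" using span that by blast
      then show ?thesis
        by (rule sp_induct[OF Pm P0 l0 p(2,3)])
          (simp_all add: Ucl Ucl(3)[OF u(1) u(1)] Uop XY_def pU)
    qed
    then show ?thesis using UW by blast
  qed
  show ?thesis unfolding projective_cover_iff using P V f(1) surj sup by blast
qed

text \<open>The existence of one cover makes the choice in \<open>proj_module\<close> a cover as
  well, and covers are unique.\<close>

lemma projective_cover_proj_module:
  assumes "projective_cover Alg P (simple_module D m \<nu>)" "m \<noteq> n"
  shows "fd_iso Alg P (proj_module D m \<nu>)"
proof -
  have "projective_cover Alg (proj_module D m \<nu>) (simple_module D m \<nu>)"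
    using assms someI[of "\<lambda>P. projective_cover Alg P (simple_module D m \<nu>)" P] by (simp add: proj_module_def)
  then show ?thesis by (rule projective_cover_unique[OF assms(1)])
qed


section \<open>The two decompositions by induction on the length\<close>

lemma phi_shift:
  assumes "\<tau> \<in> carrier (Lam D)"
  shows "phi D \<otimes>\<^bsub>Lam D\<^esub> (phi D [^]\<^bsub>Lam D\<^esub> (k::nat) \<otimes>\<^bsub>Lam D\<^esub> \<tau>) = phi D [^]\<^bsub>Lam D\<^esub> Suc k \<otimes>\<^bsub>Lam D\<^esub> \<tau>"
    and "phi D [^]\<^bsub>Lam D\<^esub> (k::nat) \<otimes>\<^bsub>Lam D\<^esub> (phi D \<otimes>\<^bsub>Lam D\<^esub> \<tau>) = phi D [^]\<^bsub>Lam D\<^esub> Suc k \<otimes>\<^bsub>Lam D\<^esub> \<tau>"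
  using \<Lambda>.m_assoc[of "phi D [^]\<^bsub>Lam D\<^esub> k" "phi D" \<tau>] \<Lambda>.m_lcomm[of "phi D" "phi D [^]\<^bsub>Lam D\<^esub> k" \<tau>] assms
  by simp_all

lemma inverse_rho: "inverse \<rho> = \<rho> ^ (n - 1)"
proof -
  have "\<rho> * \<rho> ^ (n - 1) = 1" using rho_n n_ge2 by (metis One_nat_def Suc_pred less_le_trans pos2 power_Suc)
  then show ?thesis by (rule inverse_unique)
qed

text \<open>Hypothesis \<open>c\<close> keeps all scalars met by \<open>Y_preimage\<close> away from
  0 at every length, so each step removes one summand V(n, -) belonging to the current
  generator.\<close>

lemma tensor_decomposition':
  assumes \<tau>: "\<tau> \<in> carrier (Lam D)" and c: "\<And>k. m2 \<tau> \<chi> \<noteq> \<rho> ^ k * m1 \<tau> a"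
    and l: "0 < l" "l < n" and N: "cyc N l (phi D [^]\<^bsub>Lam D\<^esub> (l - 1) \<otimes>\<^bsub>Lam D\<^esub> \<tau>) p"
  shows "fd_iso Alg N (fd_direct_sum (map (\<lambda>s. simple_module D n (phi D [^]\<^bsub>Lam D\<^esub> s \<otimes>\<^bsub>Lam D\<^esub> \<tau>)) [0..<l]))"
  using l N
proof (induction l arbitrary: N p)
  case (Suc l)
  let ?\<tau> = "\<lambda>s::nat. phi D [^]\<^bsub>Lam D\<^esub> s \<otimes>\<^bsub>Lam D\<^esub> \<tau>"
  have \<tau>s: "?\<tau> s \<in> carrier (Lam D)" for s using \<tau> by simp
  have N: "cyc N (Suc l) (?\<tau> l) p" using Suc.prems(3) by simp
  show ?case
  proof (cases "l = 0")
    case True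
    have "fd_iso Alg N (simple_module D n (?\<tau> l))"
      by (rule cyc_iso[OF _ cyc_simple[OF \<tau>s]]) (use N True in simp)
    moreover have "[0..<Suc l] = [l]" by (simp add: True)
    ultimately show ?thesis by (simp only: list.map fd_direct_sum_single)
  next
    case False
    then have l: "0 < l" "1 \<le> l" "l < n" using Suc.prems by auto
    obtain N' p' where N': "cyc N' l (?\<tau> (l - 1)) p'" using cyc_exists[OF l(2,3) \<tau>] by blast
    obtain l1 where l1: "l = Suc l1" using l by (cases l) auto
    have e1: "?\<tau> l = phi D \<otimes>\<^bsub>Lam D\<^esub> ?\<tau> (l - 1)" unfolding l1 by (simp only: diff_Suc_1 phi_shift(1)[OF \<tau>])
    \<comment> \<open>Shifting by \<phi> changes the two values only by powers of \<rho>; inverses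
      of \<rho> are written as powers to fit \<open>c\<close>.\<close>
    have e2: "m2 (?\<tau> (l - 1)) \<chi> \<noteq> \<rho> ^ k * m1 (?\<tau> (l - 1)) a" for k
    proof
      let ?i = "l - 1"
      assume "m2 (?\<tau> ?i) \<chi> = \<rho> ^ k * m1 (?\<tau> ?i) a"
      then have "\<rho> ^ ?i * m2 \<tau> \<chi> = \<rho> ^ k * (inverse \<rho> ^ ?i * m1 \<tau> a)"
        unfolding phi_pow_apply(1)[OF \<tau> a_in] phi_pow_apply(2)[OF \<tau> \<chi>_in] rho_eq .
      then have "inverse \<rho> ^ ?i * (\<rho> ^ ?i * m2 \<tau> \<chi>) = inverse \<rho> ^ ?i * (\<rho> ^ k * (inverse \<rho> ^ ?i * m1 \<tau> a))" by simp
      moreover have "inverse \<rho> ^ ?i * (\<rho> ^ ?i * m2 \<tau> \<chi>) = m2 \<tau> \<chi>"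
        unfolding mult.assoc[symmetric] power_mult_distrib[symmetric] by simp
      ultimately have "m2 \<tau> \<chi> = \<rho> ^ ((n - 1) * ?i + k + (n - 1) * ?i) * m1 \<tau> a"
        unfolding inverse_rho by (simp only: power_add power_mult mult.assoc)
      then show False using c by blast
    qed
    have "fd_iso Alg N (dsum2 (fd_direct_sum (map (\<lambda>s. simple_module D n (?\<tau> s)) [0..<l])) (simple_module D n (?\<tau> l)))"
      by (rule step_simple[OF N N' e1 l(3) e2 Suc.IH[OF l(1,3) N']])
    then show ?thesis by (simp only: upt_Suc_append[OF le0] map_append list.map fd_direct_sum_append)
  qed
qed simp

text \<open>As \<rho>^(-l) = \<rho>^(n-l), the assumption on \<nu> places it in I_(n-l+1). The map
  obtained becomes the covering map of the complement.\<close>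

lemma hom_to_simple:
  assumes N: "cyc N l \<nu> p" and l: "2 \<le> l" "l < n" and \<nu>l: "m1 \<nu> a * \<rho> ^ l = m2 \<nu> \<chi>"
  shows "\<exists>f. ehom Alg N (simple_module D (Suc (n - l)) \<nu>) f \<and> f p = bv 0 \<and>
      app (opM (simple_module D (Suc (n - l)) \<nu>) XiGen) (bv 0) = 0 \<and> fd_module Alg (simple_module D (Suc (n - l)) \<nu>)"
proof -
  note \<nu>L = cycD(7)[OF N]
    let ?m = "Suc (n - l)"
    have "\<rho> ^ l * \<rho> ^ (n - l) = \<rho> ^ n" using l by (simp flip: power_add)
    then have "m2 \<nu> \<chi> * \<rho> ^ (n - l) = m1 \<nu> a"
      unfolding \<nu>l[symmetric] mult.assoc by (simp only: rho_n mult_1_right)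
    then have "m1 \<nu> a / m2 \<nu> \<chi> = \<rho> ^ (n - l)"
      using Lam_nz(2)[OF \<nu>L \<chi>_in] by (simp add: field_simps)
    then have "\<nu> \<in> Il D ?m" unfolding Il_def using \<nu>L Lam_a_inv_chi[OF \<nu>L] by simp
    then have cV: "1 \<le> ?m" "?m \<le> n" "\<nu> \<in> Il D ?m" using l by auto
    note V = simple_module[OF \<nu>L cV] and Vop = simple_module_op[OF \<nu>L cV]
    have V0: "0 < mdim (simple_module D ?m \<nu>)" by simp
    have w: "wtM (simple_module D ?m \<nu>) \<nu> (bv 0)"
      unfolding wtM_iff[OF V V0] by (simp add: Vop sg_go[OF \<nu>L cV] sg_co[OF \<nu>L cV])
    have Y: "app (opM (simple_module D ?m \<nu>) XiGen) (bv 0) = 0" by (simp add: Vop sg_Y_0[OF \<nu>L cV])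
    have "app (opM (simple_module D ?m \<nu>) XiGen ^ l) (bv 0) = 0"
      using l Y by (cases l) (simp_all add: app_pow_Suc2 del: power_Suc)
    then show ?thesis using universal[OF N V V0 _ w] Y V by auto
qed

lemma proj_module_iso:
  assumes N: "cyc N l \<nu> p" and l: "2 \<le> l" "l < n" and \<nu>l: "m1 \<nu> a * \<rho> ^ l = m2 \<nu> \<chi>"
    and P: "fd_projective Alg P" "0 < mdim P" and t: "ehom Alg N P t" and surj: "W (mdim P) \<subseteq> t ` W (mdim N)"
    and Yp: "app (opM P XiGen) (t p) = b *\<^sub>F XY P (t p) (l - 2) (l - 1)"
    and f: "ehom Alg P (simple_module D (Suc (n - l)) \<nu>) f" "f (t p) = bv 0"
  shows "fd_iso Alg P (proj_module D (Suc (n - l)) \<nu>)"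
proof (rule projective_cover_proj_module)
  have Pm: "fd_module Alg P" using P by (simp add: fd_projective_def)
  note g = ehom_generator[OF N Pm P(2) t]
  have "W (mdim P) \<subseteq> spXY P l (t p)" by (rule g(4)) (use surj in blast)
  then show "projective_cover Alg P (simple_module D (Suc (n - l)) \<nu>)"
    by (rule projective_cover_simple[OF P cycD(7)[OF N] g(1-3) l \<nu>l Yp _ f])
  show "Suc (n - l) \<noteq> n" using l by linarith
qed

text \<open>Passing from (l, \<tau>) to (l - 2, \<phi> \<tau>) preserves \<open>c\<close> and raises
  the index s of each summand by one, since n + (l - 2) - 1 - 2 s = n + l - 1 - 2 (s + 1). The
  induction ends at l = 1 with V(n, \<tau>), or at l = 2, where the whole module is the
  cover.\<close>

lemma tensor_decomposition'':
  assumes \<tau>: "\<tau> \<in> carrier (Lam D)" and c: "\<rho> * m1 \<tau> a = \<rho> ^ (l - 1) * m2 \<tau> \<chi>"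
    and l: "0 < l" "l < n" and N: "cyc N l (phi D [^]\<^bsub>Lam D\<^esub> (l - 1) \<otimes>\<^bsub>Lam D\<^esub> \<tau>) p"
  shows "fd_iso Alg N (fd_direct_sum
    (map (\<lambda>s. proj_module D (n + l - 1 - 2 * s) (phi D [^]\<^bsub>Lam D\<^esub> s \<otimes>\<^bsub>Lam D\<^esub> \<tau>)) [l div 2..<l]))"
  using \<tau> c l N
proof (induction l arbitrary: N p \<tau> rule: less_induct)
  case (less l)
  note \<tau> = less.prems(1) and l = less.prems(3,4)
  let ?\<tau> = "\<lambda>s::nat. phi D [^]\<^bsub>Lam D\<^esub> s \<otimes>\<^bsub>Lam D\<^esub> \<tau>"
  define \<nu> where "\<nu> = ?\<tau> (l - 1)"
  have N: "cyc N l \<nu> p" using less.prems(5) unfolding \<nu>_def .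
  note Nc = cycD[OF N]
  have \<tau>s: "?\<tau> s \<in> carrier (Lam D)" for s using \<tau> by simp
  have \<nu>L: "\<nu> \<in> carrier (Lam D)" unfolding \<nu>_def by (rule \<tau>s)
  have \<nu>l: "m1 \<nu> a * \<rho> ^ l = m2 \<nu> \<chi>"
  proof -
    have "inverse \<rho> ^ (l - 1) * \<rho> ^ l = inverse \<rho> ^ (l - 1) * \<rho> ^ (l - 1) * \<rho>"
      using l(1) by (cases l) (simp_all add: mult_ac)
    also have "\<dots> = \<rho>" by (simp flip: power_mult_distrib)
    finally have e: "inverse \<rho> ^ (l - 1) * \<rho> ^ l = \<rho>" .
    have "inverse \<rho> ^ (l - 1) * m1 \<tau> a * \<rho> ^ l = inverse \<rho> ^ (l - 1) * \<rho> ^ l * m1 \<tau> a" by (simp only: mult_ac)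
    also have "\<dots> = \<rho> ^ (l - 1) * m2 \<tau> \<chi>" unfolding e by (rule less.prems(2))
    finally show ?thesis
      unfolding \<nu>_def phi_pow_apply(1)[OF \<tau> a_in] phi_pow_apply(2)[OF \<tau> \<chi>_in] rho_eq .
  qed
  note toV = hom_to_simple[OF N _ l(2) \<nu>l]
  have proj: "fd_projective Alg N" by (rule cyc_projective[OF N l(2) \<nu>l])
  consider "l = 1" | "l = 2" | "3 \<le> l" using l by linarith
  then show ?case
  proof cases
    case 1
    have "fd_iso Alg N (simple_module D n (?\<tau> 0))"
      by (rule cyc_iso[OF _ cyc_simple[OF \<tau>s]]) (use less.prems(5) 1 in simp)
    moreover have "[l div 2..<l] = [0]" by (simp add: 1)
    ultimately show ?thesis unfolding 1 by (simp add: fd_direct_sum_single proj_module_def del: \<Lambda>.nat_pow_0)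
  next
    case 2
    obtain f where f: "ehom Alg N (simple_module D (Suc (n - l)) \<nu>) f" "f p = bv 0" using toV 2 by auto
    have yp: "app (opM N XiGen) p = 1 *\<^sub>F XY N p (l - 2) (l - 1)" by (simp add: 2 XY_def)
    have "fd_iso Alg N (proj_module D (Suc (n - l)) \<nu>)"
    proof -
      have "2 \<le> l" using 2 by simp
      moreover have "W (mdim N) \<subseteq> (\<lambda>v. v) ` W (mdim N)" by simp
      ultimately show ?thesis by (rule proj_module_iso[OF N _ l(2) \<nu>l proj Nc(2) ehom_id[OF Nc(1)] _ yp f])
    qed
    moreover have "[l div 2..<l] = [1]"
      by ((simp add: 2 upt_conv_Cons; fail) | (simp add: 2 numeral_2_eq_2; fail) | (simp add: 2 upt_eq_Cons_conv))
    moreover have "n + l - 1 - 2 * 1 = Suc (n - l)" "l - 1 = 1" using l by (simp_all add: 2)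
    ultimately show ?thesis by (simp only: \<nu>_def list.map fd_direct_sum_single)
  next
    case 3
    define m where "m = l - 2"
    have m: "l = Suc (Suc m)" "0 < m" "m < n" "1 \<le> m" using 3 l by (auto simp: m_def)
    let ?\<kappa> = "?\<tau> m"
    have \<nu>: "\<nu> = phi D \<otimes>\<^bsub>Lam D\<^esub> ?\<kappa>" unfolding \<nu>_def m(1) by (simp only: diff_Suc_1 phi_shift(1)[OF \<tau>])
    have \<tau>': "phi D \<otimes>\<^bsub>Lam D\<^esub> \<tau> \<in> carrier (Lam D)" using \<tau> by simp
    have sh: "phi D [^]\<^bsub>Lam D\<^esub> (m - 1) \<otimes>\<^bsub>Lam D\<^esub> (phi D \<otimes>\<^bsub>Lam D\<^esub> \<tau>) = ?\<kappa>"
    proof -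
      obtain k where k: "m = Suc k" using m by (cases m) auto
      show ?thesis unfolding k by (simp only: diff_Suc_1 phi_shift(2)[OF \<tau>])
    qed
    obtain N' p' where N'0: "cyc N' m (phi D [^]\<^bsub>Lam D\<^esub> (m - 1) \<otimes>\<^bsub>Lam D\<^esub> (phi D \<otimes>\<^bsub>Lam D\<^esub> \<tau>)) p'"
      using cyc_exists[OF m(4,3) \<tau>'] by blast
    then have N': "cyc N' m ?\<kappa> p'" unfolding sh .
    note Nc' = cycD[OF N']
    have c': "\<rho> * m1 (phi D \<otimes>\<^bsub>Lam D\<^esub> \<tau>) a = \<rho> ^ (m - 1) * m2 (phi D \<otimes>\<^bsub>Lam D\<^esub> \<tau>) \<chi>"
    proof -
      have "\<rho> * m1 (phi D \<otimes>\<^bsub>Lam D\<^esub> \<tau>) a = m1 \<tau> a" by (simp add: phi_mult_apply rho_eq)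
      moreover have "\<rho> ^ (m - 1) * m2 (phi D \<otimes>\<^bsub>Lam D\<^esub> \<tau>) \<chi> = \<rho> ^ m * m2 \<tau> \<chi>"
        using m(2) by (cases m) (simp_all add: phi_mult_apply rho_eq)
      moreover have "\<rho> * m1 \<tau> a = \<rho> * (\<rho> ^ m * m2 \<tau> \<chi>)" using less.prems(2) by (simp add: m(1) mult.assoc)
      ultimately show ?thesis by simp
    qed
    have iso: "fd_iso Alg N' (fd_direct_sum (map (\<lambda>s. proj_module D (n + m - 1 - 2 * s)
        (phi D [^]\<^bsub>Lam D\<^esub> s \<otimes>\<^bsub>Lam D\<^esub> (phi D \<otimes>\<^bsub>Lam D\<^esub> \<tau>))) [m div 2..<m]))" (is "fd_iso _ _ ?S")
      by (rule less.IH[OF _ \<tau>' c' m(2,3) N'0]) (simp add: m)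
    have S: "?S = fd_direct_sum (map (\<lambda>s. proj_module D (n + l - 1 - 2 * s) (?\<tau> s)) [l div 2..<l - 1])"
    proof -
      have "[l div 2..<l - 1] = map Suc [m div 2..<m]" unfolding m(1) map_Suc_upt by simp
      moreover have "n + m - 1 - 2 * s = n + l - 1 - 2 * Suc s" for s using m by simp
      ultimately show ?thesis by (simp only: map_map comp_def phi_shift(2)[OF \<tau>])
    qed
    interpret N: double_ops D "\<lambda>g. opM N (GrpGen g)" "\<lambda>\<gamma>. opM N (ChrGen \<gamma>)" "opM N XGen" "opM N XiGen"
      by (rule ops_opM[OF Nc(1,2)])
    let ?Y = "opM N XiGen" and ?w = "app (opM N XiGen ^ Suc m) p"
    let ?s = "m1 \<nu> a"
    have Yw: "app ?Y ?w = 0" using Nc(5) by (simp add: m)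
    have wN: "N.wt (m1 \<nu>) (m2 \<nu>) p" using Nc(4) by (simp add: wtM_def)
    note ww = N.wt_Y_pow[OF wN, of "Suc m"]
    \<comment> \<open>The scalar by which \<xi>^m x^m acts on w = \<xi>^(m+1) p.\<close>
    define b where "b = (\<Prod>k<m. al (\<rho> ^ Suc m * ?s) (inverse \<rho> ^ Suc m * m2 \<nu> \<chi>) (0 + Suc k))"
    have b: "b \<noteq> 0"
    proof -
      \<comment> \<open>Since \<nu>(\<chi>) = \<nu>(a) \<rho>^l, a zero would force \<rho>^(m-k) = 1
        with 0 < m - k < n.\<close>
      have "al (\<rho> ^ Suc m * ?s) (inverse \<rho> ^ Suc m * m2 \<nu> \<chi>) (0 + Suc k) \<noteq> 0" if k: "k < m" for k
      proof (rule N.al_nz)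
        have "\<rho> ^ l = \<rho> ^ Suc m * \<rho>" unfolding m(1) by (simp only: power_Suc2)
        then have "inverse \<rho> ^ Suc m * \<rho> ^ l = (inverse \<rho> * \<rho>) ^ Suc m * \<rho>"
          unfolding power_mult_distrib by (simp only: mult.assoc)
        also have "\<dots> = \<rho>" by simp
        finally have "inverse \<rho> ^ Suc m * m2 \<nu> \<chi> = ?s * \<rho>"
          unfolding \<nu>l[symmetric] by (simp add: mult.left_commute)
        note i = this
        have "Suc m = Suc k + (m - k)" using k by simp
        then have ii: "\<rho> ^ Suc m = \<rho> ^ Suc k * \<rho> ^ (m - k)" by (metis power_add)
        show "inverse \<rho> ^ Suc m * m2 \<nu> \<chi> * \<rho> ^ (0 + Suc k - 1) \<noteq> \<rho> ^ Suc m * ?s"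
        proof
          assume "inverse \<rho> ^ Suc m * m2 \<nu> \<chi> * \<rho> ^ (0 + Suc k - 1) = \<rho> ^ Suc m * ?s"
          then have "?s * \<rho> * \<rho> ^ k = \<rho> ^ Suc k * \<rho> ^ (m - k) * ?s" unfolding i ii by simp
          then have "(?s * \<rho> ^ Suc k) * 1 = (?s * \<rho> ^ Suc k) * \<rho> ^ (m - k)" by (simp add: mult_ac)
          moreover have "?s * \<rho> ^ Suc k \<noteq> 0" using Lam_nz(1)[OF \<nu>L a_in] by simp
          ultimately have "\<rho> ^ (m - k) = 1" using mult_left_cancel by metis
          then show False using rho_diff_neq[OF k m(3)] by simp
        qed
      qed (use k m in auto)
      then show ?thesis unfolding b_def by simp
    qed
    have YXw: "app (?Y ^ m) (app (opM N XGen ^ m) ?w) = b *\<^sub>F ?w"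
      using N.Y_pow_X_pow[OF N.wt_aw[OF ww] Yw, of m 0] unfolding b_def rho_eq by simp
    \<comment> \<open>\<xi> p itself is killed only by \<xi>^(m+1). Subtracting x^m w / b cancels
      \<xi>^m (\<xi> p) = w without changing the weight.\<close>
    define q where "q = app ?Y p - inverse b *\<^sub>F app (opM N XGen ^ m) ?w"
    have XW: "app (opM N XGen ^ m) ?w \<in> W (mdim N)" by (intro opM_pow_W[OF Nc(1)] Nc(6)) simp_all
    have q: "q \<in> W (mdim N)" "wtM N ?\<kappa> q" "app (?Y ^ m) q = 0"
    proof -
      show "q \<in> W (mdim N)" unfolding q_def using XW opM_W[OF Nc(1) _ Nc(6), of XiGen] by simp
      have "N.wt (m1 ?\<kappa>) (m2 ?\<kappa>) (app (opM N XGen ^ m) ?w)"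
      proof (rule N.wt_cong[OF N.wt_X_pow[OF ww Yw m(3)]])
        show "m1 ?\<kappa> g = inverse (\<chi> g) ^ m * (\<chi> g ^ Suc m * m1 \<nu> g)" if "g \<in> carrier G" for g
          unfolding \<nu> phi_mult_apply(1)[OF that] using char_nz[OF \<chi>_in that] by (simp add: field_simps power_inverse)
        show "m2 ?\<kappa> \<gamma> = \<gamma> a ^ m * (inverse (\<gamma> a) ^ Suc m * m2 \<nu> \<gamma>)" if "\<gamma> \<in> carrier (Gam D)" for \<gamma>
          unfolding \<nu> phi_mult_apply(2)[OF that] using char_nz[OF that a_in] by (simp add: field_simps power_inverse)
      qed
      moreover have "N.wt (m1 ?\<kappa>) (m2 ?\<kappa>) (app ?Y p)"
        using wtM_Y[OF Nc(1,2) Nc(4)[unfolded \<nu>]] by (simp add: wtM_def)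
      ultimately show "wtM N ?\<kappa> q" unfolding wtM_def q_def by (intro N.wt_diff N.wt_sc)
      show "app (?Y ^ m) q = 0"
        unfolding q_def app_simps YXw using b by (simp add: app_pow_Suc2 del: power_Suc)
    qed
    have cc: "m2 ?\<kappa> \<chi> \<noteq> \<rho> ^ k * m1 ?\<kappa> a" if k: "k < m" for k
    proof
      assume e: "m2 ?\<kappa> \<chi> = \<rho> ^ k * m1 ?\<kappa> a"
      have "inverse \<rho> * m1 ?\<kappa> a * \<rho> ^ l = \<rho> * m2 ?\<kappa> \<chi>"
        using \<nu>l unfolding \<nu> phi_mult_apply(1)[OF a_in] phi_mult_apply(2)[OF \<chi>_in] rho_eq .
      then have "m1 ?\<kappa> a * \<rho> ^ m = m2 ?\<kappa> \<chi>" by (simp add: m field_simps)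
      then have "\<rho> ^ m = \<rho> ^ k" using e Lam_nz(1)[OF \<tau>s a_in, of m] by (simp add: mult.commute)
      moreover have "\<rho> ^ m = \<rho> ^ k * \<rho> ^ (m - k)" using k by (simp flip: power_add)
      ultimately show False using rho_diff_neq[OF k m(3)] by simp
    qed
    have hq: "t q = app (opM K XiGen) (t p) - inverse b *\<^sub>F XY K (t p) m (Suc m)"
      if "fd_module Alg K" "ehom Alg N K t" for K t
      using ehom_XY[OF Nc(1) that Nc(6), of m "Suc m"] ehom_opM[OF Nc(1) that _ Nc(6), of XiGen]
      unfolding q_def XY_def by (simp add: islin_diff[OF ehom_islin[OF that(2)]] islin_sc[OF ehom_islin[OF that(2)]] del: power_Suc)
    \<comment> \<open>When \<xi> sends the image of p to p', it follows that \<xi>^(m+1) kills that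
      image, so the correction in q maps to 0.\<close>
    have rq: "t q = p'" if t: "ehom Alg N N' t" "app (opM N' XiGen) (t p) = p'" for t
    proof -
      have "XY N' (t p) m (Suc m) = 0" unfolding XY_def app_pow_Suc2 t(2) Nc'(5) by simp
      then show ?thesis unfolding hq[OF Nc'(1) t(1)] t(2) by simp
    qed
    have ml: "m < l" by (simp add: m)
    obtain P i \<pi> where P: "fd_module Alg P" "ehom Alg P N i" "ehom Alg N P \<pi>"
      "\<And>w. w \<in> W (mdim P) \<Longrightarrow> \<pi> (i w) = w" "\<pi> q = 0" "mdim N = mdim N' + mdim P"
      "\<And>M1 M2. fd_iso Alg N' M1 \<Longrightarrow> fd_iso Alg P M2 \<Longrightarrow> fd_iso Alg N (dsum2 M1 M2)"
      "\<And>K f. fd_module Alg K \<Longrightarrow> ehom Alg N K f \<Longrightarrow> f q = 0 \<Longrightarrow> f (i (\<pi> p)) = f p"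
      by (rule split_cyc[where q = q and p = p, OF N N' \<nu> ml m(3) q]) (erule cc, erule (1) rq, (assumption | rule that)+)
    have P0: "0 < mdim P" using P(6) Nc(9) Nc'(9) n_ge2 by (simp add: m)
    have Pp: "fd_projective Alg P" by (rule fd_projective_summand[OF proj P(1,2,3,4)])
    obtain f where f: "ehom Alg N (simple_module D (Suc (n - l)) \<nu>) f" "f p = bv 0"
      "app (opM (simple_module D (Suc (n - l)) \<nu>) XiGen) (bv 0) = 0" "fd_module Alg (simple_module D (Suc (n - l)) \<nu>)"
      using toV 3 by auto
    have "f q = 0"
      unfolding hq[OF f(4,1)] f(2,3) XY_def app_pow_Suc2 by simp
    then have fp: "f (i (\<pi> p)) = bv 0" using P(8)[OF f(4,1)] f(2) by simp
    \<comment> \<open>q becomes 0 in the complement, so its two parts agree there; this is the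
      relation needed for the projective cover.\<close>
    have yp: "app (opM P XiGen) (\<pi> p) = inverse b *\<^sub>F XY P (\<pi> p) (l - 2) (l - 1)"
      using hq[OF P(1,3)] P(5) by (simp add: m)
    have "fd_iso Alg P (proj_module D (Suc (n - l)) \<nu>)"
    proof -
      have "2 \<le> l" using 3 by simp
      moreover have "W (mdim P) \<subseteq> \<pi> ` W (mdim N)"
      proof
        fix w :: "'k fvec" assume w: "w \<in> W (mdim P)"
        show "w \<in> \<pi> ` W (mdim N)" by (rule image_eqI[of _ _ "i w"]) (rule P(4)[OF w, symmetric], rule ehom_W[OF P(2) w])
      qed
      ultimately show ?thesis by (rule proj_module_iso[OF N _ l(2) \<nu>l Pp P0 P(3) _ yp ehom_comp[OF f(1) P(2)] fp])
    qed
    from P(7)[OF iso this] have "fd_iso Alg N (fd_direct_sum (map (\<lambda>s. proj_module D (n + l - 1 - 2 * s) (?\<tau> s)) [l div 2..<l - 1]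
        @ [proj_module D (Suc (n - l)) \<nu>]))" unfolding S fd_direct_sum_append .
    moreover have "[l div 2..<l] = [l div 2..<l - 1] @ [l - 1]" using m by (simp add: upt_Suc_append)
    moreover have "Suc (n - l) = n + l - 1 - 2 * (l - 1)" using l 3 by simp
    ultimately show ?thesis by (simp only: \<nu>_def map_append list.map)
  qed
qed

end

theorem theorem5p7:
  fixes D :: "('g, 'k::{alg_closed_field, field_char_0}) datum"
    and l :: nat
    and \<mu> \<mu>' :: "'g \<times> ('g \<Rightarrow> 'k) \<Rightarrow> 'k"
  assumes "group_datum D"
    and "1 \<le> l" and "l \<le> ordn D - 1"
    and "\<mu> \<in> Il D l" and "\<mu>' \<in> In D"
  shows "(\<mu>' \<in> In' D \<longrightarrow>
           fd_iso (double D)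
             (tensor_module D (simple_module D l \<mu>) (simple_module D (ordn D) \<mu>'))
             (fd_direct_sum (map (\<lambda>s. simple_module D (ordn D)
                (phi D [^]\<^bsub>Lam D\<^esub> s \<otimes>\<^bsub>Lam D\<^esub> \<mu> \<otimes>\<^bsub>Lam D\<^esub> \<mu>')) [0..<l])))
       \<and> (\<mu>' \<in> In'' D \<longrightarrow>
           fd_iso (double D)
             (tensor_module D (simple_module D l \<mu>) (simple_module D (ordn D) \<mu>'))
             (fd_direct_sum (map (\<lambda>s. proj_module D (ordn D + l - 1 - 2 * s)
                (phi D [^]\<^bsub>Lam D\<^esub> s \<otimes>\<^bsub>Lam D\<^esub> \<mu> \<otimes>\<^bsub>Lam D\<^esub> \<mu>'))
                [nat (ceil_half (int l - 1))..<l])))"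
proof -
  interpret gdatum D by unfold_locales (rule assms(1))
  have l: "1 \<le> l" "l < ordn D" "0 < l" using assms(2,3) n_ge2 by auto
  have \<mu>: "\<mu> \<in> carrier (Lam D)" and \<mu>': "\<mu>' \<in> carrier (Lam D)"
    using assms(4,5) by (auto simp: Il_def In_def In'_def In''_def)
  define \<tau> where "\<tau> = \<mu> \<otimes>\<^bsub>Lam D\<^esub> \<mu>'"
  have \<tau>: "\<tau> \<in> carrier (Lam D)" using \<mu> \<mu>' by (simp add: \<tau>_def)
  have as: "phi D [^]\<^bsub>Lam D\<^esub> (s::nat) \<otimes>\<^bsub>Lam D\<^esub> \<mu> \<otimes>\<^bsub>Lam D\<^esub> \<mu>' = phi D [^]\<^bsub>Lam D\<^esub> s \<otimes>\<^bsub>Lam D\<^esub> \<tau>" for s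
    unfolding \<tau>_def by (rule \<Lambda>.m_assoc) (use \<mu> \<mu>' in simp_all)
  have \<tau>1: "m1 \<tau> (elt D) = m1 \<mu> (elt D) * m1 \<mu>' (elt D)" and \<tau>2: "m2 \<tau> (chi D) = m2 \<mu> (chi D) * m2 \<mu>' (chi D)"
    unfolding \<tau>_def by (simp_all add: Lam_mult_apply[OF a_in \<Gamma>.one_closed] Lam_mult_apply[OF G.one_closed \<chi>_in])
  note nz = Lam_nz(2)[OF \<mu> \<chi>_in] Lam_nz(2)[OF \<mu>' \<chi>_in]
  have \<mu>l: "m1 \<mu> (elt D) = m2 \<mu> (chi D) * rho D ^ (l - 1)"
    using assms(4) Lam_a_inv_chi[OF \<mu>] nz by (simp add: Il_def field_simps)
  note N = cyc_tensor[OF l(1,2) assms(4) \<mu>', unfolded as]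
  show ?thesis
    unfolding as
  proof (intro conjI impI)
    assume "\<mu>' \<in> In' D"
    then have ne: "m1 \<mu>' (elt D) / m2 \<mu>' (chi D) \<noteq> rho D ^ k" if "k \<le> ordn D - 1" for k
      using that Lam_a_inv_chi[OF \<mu>'] by (simp add: In'_def)
    \<comment> \<open>The weight \<mu> contributes only the factor \<rho>^(l-1), so equality would
      make the value of \<mu>' at a \<chi>^(-1) a power of \<rho>.\<close>
    have "m2 \<tau> (chi D) \<noteq> rho D ^ k * m1 \<tau> (elt D)" for k
    proof
      let ?e = "k + (l - 1)" and ?n = "ordn D"
      assume "m2 \<tau> (chi D) = rho D ^ k * m1 \<tau> (elt D)"
      then have "m2 \<mu> (chi D) * m2 \<mu>' (chi D) = m2 \<mu> (chi D) * (rho D ^ ?e * m1 \<mu>' (elt D))"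
        unfolding \<tau>1 \<tau>2 \<mu>l by (simp only: power_add mult_ac)
      then have "m2 \<mu>' (chi D) = rho D ^ ?e * m1 \<mu>' (elt D)" using nz by simp
      then have "m1 \<mu>' (elt D) / m2 \<mu>' (chi D) = inverse (rho D) ^ ?e"
        using Lam_nz(1)[OF \<mu>' a_in] by (simp add: field_simps power_inverse)
      also have "\<dots> = rho D ^ ((?n - 1) * ?e)" unfolding inverse_rho by (simp only: power_mult)
      \<comment> \<open>\<open>In'\<close> speaks of exponents up to n - 1 only, so the exponent is
        reduced modulo n.\<close>
      also have "\<dots> = rho D ^ (?n * ((?n - 1) * ?e div ?n) + (?n - 1) * ?e mod ?n)" by simp
      also have "\<dots> = rho D ^ ((?n - 1) * ?e mod ?n)" unfolding power_add power_mult by simp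
      finally have "m1 \<mu>' (elt D) / m2 \<mu>' (chi D) = rho D ^ ((?n - 1) * ?e mod ?n)" .
      moreover have "(?n - 1) * ?e mod ?n < ?n" using n_ge2 by simp
      ultimately show False using ne[of "(?n - 1) * ?e mod ?n"] by linarith
    qed
    then show "fd_iso (double D) (tensor_module D (simple_module D l \<mu>) (simple_module D (ordn D) \<mu>'))
        (fd_direct_sum (map (\<lambda>s. simple_module D (ordn D) (phi D [^]\<^bsub>Lam D\<^esub> s \<otimes>\<^bsub>Lam D\<^esub> \<tau>)) [0..<l]))"
      by (rule tensor_decomposition'[OF \<tau> _ l(3,2) N])
  next
    assume "\<mu>' \<in> In'' D"
    then have "m1 \<mu>' (elt D) = m2 \<mu>' (chi D) * rho D ^ (ordn D - 1)"
      using Lam_a_inv_chi[OF \<mu>'] nz by (simp add: In''_def field_simps)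
    then have "rho D * m1 \<tau> (elt D) = rho D ^ (l - 1) * m2 \<tau> (chi D) * (rho D * inverse (rho D))"
      unfolding \<tau>1 \<tau>2 \<mu>l inverse_rho by (simp only: mult_ac)
    then have "rho D * m1 \<tau> (elt D) = rho D ^ (l - 1) * m2 \<tau> (chi D)" by simp
    \<comment> \<open>The lower bound c(l - 1) of the sum is \<open>l div 2\<close>.\<close>
    from tensor_decomposition''[OF \<tau> this l(3,2) N]
    show "fd_iso (double D) (tensor_module D (simple_module D l \<mu>) (simple_module D (ordn D) \<mu>'))
        (fd_direct_sum (map (\<lambda>s. proj_module D (ordn D + l - 1 - 2 * s) (phi D [^]\<^bsub>Lam D\<^esub> s \<otimes>\<^bsub>Lam D\<^esub> \<tau>))
          [nat (ceil_half (int l - 1))..<l]))"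
      by (simp add: ceil_half_def nat_div_distrib)
  qed
qed

end
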